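(* Let $A\in\operatorname{Sect}(\omega)$ on a complex Banach space for some $\omega\in[0,\pi/2)$, and let $f\in\mathcal{E}$. Assume that either $A$ has dense range or $f$ is a Bernstein function. Then $f(A)\in\operatorname{Sect}(\omega)$. More precisely, when $\theta\in(0,\pi-\omega)$ and $$\max\left(\frac{\pi}{\pi-\theta},2\right)<q<\frac\pi\omega,$$ one has $$\|z(z+f(A))^{-1}\|\le\frac1{\sin(\pi/q)}+\frac{q\,\tilde M_{\omega,q,0}(A)}{\pi\cos^2(\pi/q)}\,\frac{\kappa_{\pi/q}(f)}{\cos^2((\pi/q+\theta)/2)},\qquad z\in\Sigma_\theta,$$ where $\kappa_{\pi/q}(f)$ is any constant such that $$\int_0^\infty\frac{|\operatorname{Im}f(te^{i\pi/q})|}{(r+f(t))^2t}\,dt\le\frac{\kappa_{\pi/q}(f)}{r},\qquad r>0,$$ and $$\tilde M_{\omega,q,0}(A)=M(A)+\frac{2M(A,\beta)}{\pi\cos(\beta/2)\cos(q\beta/2)},\qquad \beta=\frac{\omega+\pi/q}{2}.$$ If $f$ is a Bernstein function then we may take $\kappa_{\pi/q}(f)=\tan(\pi/q)$.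
   Context: $\mathbb{C}_+=\{\lambda\in\mathbb{C}:\operatorname{Re}\lambda>0\}$; $\Sigma_\theta=\{z\in\mathbb{C}: z\ne0,\ |\arg z|<\theta\}$ for $\theta\in(0,\pi]$ and $\Sigma_0=(0,\infty)$. For $\omega=0$, $\pi/\omega:=\infty$. $\mathcal{NP}_+$ is the set of holomorphic $f:\mathbb{C}_+\to\mathbb{C}_+$ with $f((0,\infty))\subset(0,\infty)$. $\mathcal{E}$ is the set of $f\in\mathcal{NP}_+$ such that for each $\theta\in(0,\pi/2)$ there is $\kappa_\theta(f)<\infty$ with $\int_0^\infty\frac{|\operatorname{Im}f(te^{i\theta})|}{(r+f(t))^2t}\,dt\le\frac{\kappa_\theta(f)}r$ for all $r>0$. A Bernstein function is a smooth $f:(0,\infty)\to(0,\infty)$ with $(-1)^{n-1}f^{(n)}\ge0$ for all $n\ge1$; equivalently $f(t)=a+bt+\int_{(0,\infty)}(1-e^{-ts})\,\mu(ds)$ (and $f\not\equiv0$) with $a,b\ge0$ and $\mu$ a positive measure with $\int\frac{s}{1+s}\mu(ds)<\infty$. It is identified with its holomorphic extension $\mathbb{C}_+\to\mathbb{C}_+$. All Bernstein functions belong to $\mathcal{E}$. $\operatorname{Sect}(\omega)$: closed, densely defined operators $A$ with $\sigma(A)\subset\overline{\Sigma}_\omega$ such that for every $\omega'\in(\omega,\pi)$ there is a finite constant $M(A,\omega')$ with $\|z(A+z)^{-1}\|\le M(A,\omega')$ for $z\in\Sigma_{\pi-\omega'}$. Also $M(A)=\sup_{s>0}\|s(A+s)^{-1}\|$.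 A sectorial operator with dense range is injective. Definition of $f(A)$. If $A$ is injective, put $\tau(z)=z/(1+z)^2$; for $\omega'\in(\omega,\pi/2)$ let $(f\tau^2)(A)=\frac1{2\pi i}\int_{\partial\Sigma_{\omega'}}f(\lambda)\tau(\lambda)^2(\lambda-A)^{-1}\,d\lambda\in\mathcal{L}(X)$ (positively oriented boundary; the integral converges for every $f\in\mathcal{NP}_+$) and $f(A):=(\tau^2(A))^{-1}(f\tau^2)(A)$ with its natural domain, where $\tau^2(A)=(A(1+A)^{-2})^2$ is injective. If $f$ is a Bernstein function, written as $f(t)=a+bt+\int_{(0,\infty)}(1-e^{-ts})\,\mu(ds)$ with $a,b\ge0$ and $\mu$ a positive measure on $(0,\infty)$ satisfying $\int\frac{s}{1+s}\mu(ds)<\infty$ (and $A$ not necessarily injective), $f(A)$ is the closure of the operator $x\mapsto ax+bAx+\int_{(0,\infty)}(x-T(t)x)\,\mu(dt)$ with domain $\operatorname{dom}(A)$, where $(T(t))_{t\ge0}$ is the bounded $C_0$-semigroup generated by $-A$. The two definitions agree when both apply. *)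

theory Defs
  imports "HOL-Analysis.Analysis"
begin

section \<open>Complex Banach spaces\<close>

class complex_banach = banach +
  fixes scaleC :: "complex \<Rightarrow> 'a \<Rightarrow> 'a" (infixr "*\<^sub>C" 75)
  assumes scaleC_add_right: "c *\<^sub>C (x + y) = c *\<^sub>C x + c *\<^sub>C y"
    and scaleC_add_left: "(c + d) *\<^sub>C x = c *\<^sub>C x + d *\<^sub>C x"
    and scaleC_scaleC: "c *\<^sub>C d *\<^sub>C x = (c * d) *\<^sub>C x"
    and scaleR_scaleC: "r *\<^sub>R x = complex_of_real r *\<^sub>C x"
    and norm_scaleC: "norm (c *\<^sub>C x) = cmod c * norm x"

instantiation complex :: complex_banach
begin
definition scaleC_complex :: "complex \<Rightarrow> complex \<Rightarrow> complex"
  where "scaleC_complex c x = c * x"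
instance
  by standard (auto simp: scaleC_complex_def algebra_simps norm_mult scaleR_conv_of_real)
end

section \<open>Unbounded operators\<close>

text \<open>An unbounded operator is represented by its graph. In particular its domain, range,
  inverse and closure are \<^const>\<open>Domain\<close>, \<^const>\<open>Range\<close>, \<^const>\<open>converse\<close> and (if the operator is
  closable) \<^const>\<open>closure\<close>, and it is a closed operator iff the graph is a closed set.\<close>

type_synonym 'a graph = "('a \<times> 'a) set"

definition linear_operator :: "'a::complex_banach graph \<Rightarrow> bool" where
  "linear_operator A \<longleftrightarrow> single_valued A \<and> (0, 0) \<in> A \<and>
     (\<forall>x y u v. (x, y) \<in> A \<longrightarrow> (u, v) \<in> A \<longrightarrow> (x + u, y + v) \<in> A) \<and>
     (\<forall>c x y. (x, y) \<in> A \<longrightarrow> (c *\<^sub>C x, c *\<^sub>C y) \<in> A)"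

definition injective_operator :: "'a::complex_banach graph \<Rightarrow> bool" where
  "injective_operator A \<longleftrightarrow> (\<forall>x. (x, 0) \<in> A \<longrightarrow> x = 0)"

definition op_apply :: "'a graph \<Rightarrow> 'a \<Rightarrow> 'a" where
  "op_apply A x = (THE y. (x, y) \<in> A)"

definition op_uminus :: "'a::complex_banach graph \<Rightarrow> 'a graph" where
  "op_uminus A = {(x, - y) |x y. (x, y) \<in> A}"

text \<open>The operators $A + z$ and $z - A$.\<close>

definition op_plus_scalar :: "'a::complex_banach graph \<Rightarrow> complex \<Rightarrow> 'a graph" where
  "op_plus_scalar A z = {(x, y + z *\<^sub>C x) |x y. (x, y) \<in> A}"

definition scalar_minus_op :: "complex \<Rightarrow> 'a::complex_banach graph \<Rightarrow> 'a graph" where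
  "scalar_minus_op z A = {(x, z *\<^sub>C x - y) |x y. (x, y) \<in> A}"

text \<open>The inverse is everywhere defined and bounded. If the graph of \<open>T\<close> is a complex subspace,
  then so is that of \<open>R\<close>; hence \<open>R\<close> is automatically complex linear.\<close>

definition boundedly_invertible :: "'a::complex_banach graph \<Rightarrow> bool" where
  "boundedly_invertible T \<longleftrightarrow> (\<exists>R. bounded_linear R \<and> T\<inverse> = {(x, R x) |x. True})"

definition op_spectrum :: "'a::complex_banach graph \<Rightarrow> complex set" where
  "op_spectrum A = {z. \<not> boundedly_invertible (scalar_minus_op z A)}"

section \<open>Sectorial operators\<close>

definition sector :: "real \<Rightarrow> complex set" where
  "sector \<theta> = (if \<theta> = 0 then complex_of_real ` {0<..} else {z. z \<noteq> 0 \<and> \<bar>Arg z\<bar> < \<theta>})"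

text \<open>The map $z(A+z)^{-1}$; it is only used for \<open>z\<close> such that $A + z$ is boundedly invertible.\<close>

definition scaled_resolvent :: "'a::complex_banach graph \<Rightarrow> complex \<Rightarrow> 'a \<Rightarrow> 'a" where
  "scaled_resolvent A z x = z *\<^sub>C op_apply ((op_plus_scalar A z)\<inverse>) x"

text \<open>\<open>C\<close> is an admissible value for the constant $M(A,\omega')$.\<close>

definition sect_bound :: "'a::complex_banach graph \<Rightarrow> real \<Rightarrow> real \<Rightarrow> bool" where
  "sect_bound A \<omega>' C \<longleftrightarrow> (\<forall>z\<in>sector (pi - \<omega>'). onorm (scaled_resolvent A z) \<le> C)"

definition Sect :: "real \<Rightarrow> 'a::complex_banach graph set" where
  "Sect \<omega> = {A. linear_operator A \<and> closed A \<and> closure (Domain A) = UNIV \<and>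
     op_spectrum A \<subseteq> closure (sector \<omega>) \<and> (\<forall>\<omega>'\<in>{\<omega><..<pi}. \<exists>C. sect_bound A \<omega>' C)}"

text \<open>The constant $M(A)$.\<close>

definition sect_const :: "'a::complex_banach graph \<Rightarrow> real" where
  "sect_const A = (SUP s\<in>{0<..}. onorm (scaled_resolvent A (complex_of_real s)))"

text \<open>The constant $\tilde M_{\omega,q,0}(A)$, where \<open>C\<close> is the value used for $M(A,\beta)$.\<close>

definition tilde_const :: "'a::complex_banach graph \<Rightarrow> real \<Rightarrow> real \<Rightarrow> real \<Rightarrow> real" where
  "tilde_const A q \<beta> C = sect_const A + 2 * C / (pi * cos (\<beta> / 2) * cos (q * \<beta> / 2))"

section \<open>Classes of functions\<close>

abbreviation right_half_plane :: "complex set" where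
  "right_half_plane \<equiv> {z. Re z > 0}"

definition NP_plus :: "(complex \<Rightarrow> complex) set" where
  "NP_plus = {f. f holomorphic_on right_half_plane \<and> f ` right_half_plane \<subseteq> right_half_plane \<and>
     f ` complex_of_real ` {0<..} \<subseteq> complex_of_real ` {0<..}}"

text \<open>\<open>\<kappa>\<close> is an admissible value for the constant $\kappa_\theta(f)$. For \<open>f\<close> in \<^const>\<open>NP_plus\<close>, $f(t)$ is
  real, so \<open>Re (f t)\<close> is just $f(t)$. Finiteness of the integral is part of the requirement.\<close>

definition kappa_bound :: "(complex \<Rightarrow> complex) \<Rightarrow> real \<Rightarrow> real \<Rightarrow> bool" where
  "kappa_bound f \<theta> \<kappa> \<longleftrightarrow> (\<forall>r>0.
     set_integrable lborel {0<..}
       (\<lambda>t. \<bar>Im (f (of_real t * cis \<theta>))\<bar> / ((r + Re (f (of_real t)))\<^sup>2 * t)) \<and>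
     (LINT t:{0<..}|lborel. \<bar>Im (f (of_real t * cis \<theta>))\<bar> / ((r + Re (f (of_real t)))\<^sup>2 * t))
       \<le> \<kappa> / r)"

definition class_E :: "(complex \<Rightarrow> complex) set" where
  "class_E = {f \<in> NP_plus. \<forall>\<theta>\<in>{0<..<pi/2}. \<exists>\<kappa>. kappa_bound f \<theta> \<kappa>}"

definition bernstein :: "(real \<Rightarrow> real) \<Rightarrow> bool" where
  "bernstein g \<longleftrightarrow>
     (\<forall>t>0. g t > 0) \<and>
     (\<forall>n. \<forall>t>0. ((deriv ^^ n) g) field_differentiable (at t)) \<and>
     (\<forall>n\<ge>1. \<forall>t>0. (-1) ^ (n - 1) * (deriv ^^ n) g t \<ge> 0)"

text \<open>The restriction to the positive axis of a function in \<^const>\<open>NP_plus\<close>. Holomorphic extensions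
  to the half-plane being unique, \<open>f \<in> NP_plus\<close> is (the extension of) a Bernstein function
  iff \<open>bernstein (pos_restrict f)\<close>.\<close>

definition pos_restrict :: "(complex \<Rightarrow> complex) \<Rightarrow> real \<Rightarrow> real" where
  "pos_restrict f t = Re (f (of_real t))"

text \<open>The representation $g(t) = a + bt + \int_{(0,\infty)} (1 - e^{-ts})\,\mu(ds)$.\<close>

definition bernstein_rep :: "(real \<Rightarrow> real) \<Rightarrow> real \<Rightarrow> real \<Rightarrow> real measure \<Rightarrow> bool" where
  "bernstein_rep g a b \<mu> \<longleftrightarrow> a \<ge> 0 \<and> b \<ge> 0 \<and> sets \<mu> = sets (restrict_space borel {0<..}) \<and>
     (\<integral>\<^sup>+ s. ennreal (s / (1 + s)) \<partial>\<mu>) < \<infinity> \<and>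
     (\<forall>t>0. g t = a + b * t + (LINT s|\<mu>. 1 - exp (- t * s)))"

section \<open>The operator $f(A)$ for injective $A$\<close>

definition tau :: "complex \<Rightarrow> complex" where
  "tau z = z / (1 + z)\<^sup>2"

text \<open>The operators $A(1+A)^{-2}$ and $\tau^2(A) = (A(1+A)^{-2})^2$.\<close>

definition tau_op :: "'a::complex_banach graph \<Rightarrow> 'a \<Rightarrow> 'a" where
  "tau_op A x = op_apply A (op_apply ((op_plus_scalar A 1)\<inverse>) (op_apply ((op_plus_scalar A 1)\<inverse>) x))"

definition tau2_op :: "'a::complex_banach graph \<Rightarrow> 'a \<Rightarrow> 'a" where
  "tau2_op A x = tau_op A (tau_op A x)"

text \<open>$\int f(\lambda)\tau(\lambda)^2(\lambda-A)^{-1}x\,d\lambda$ along the ray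
  $\{re^{i\alpha} : r > 0\}$, directed from $0$ to $\infty$. The integrals are absolutely convergent
  in operator norm, so they may be evaluated pointwise in \<open>x\<close>, and the Henstock--Kurzweil
  integral gives the usual value.\<close>

definition ray_integral :: "(complex \<Rightarrow> complex) \<Rightarrow> 'a::complex_banach graph \<Rightarrow> real \<Rightarrow> 'a \<Rightarrow> 'a" where
  "ray_integral f A \<alpha> x = integral {0<..} (\<lambda>r.
     let l = of_real r * cis \<alpha> in
       (f l * (tau l)\<^sup>2 * cis \<alpha>) *\<^sub>C op_apply ((scalar_minus_op l A)\<inverse>) x)"

text \<open>The operator $(f\tau^2)(A)$. The positively oriented boundary of the sector of half-angle
  \<open>\<omega>'\<close> comes in from infinity along the upper ray and goes out along the lower one.\<close>

definition ftau2_op :: "real \<Rightarrow> (complex \<Rightarrow> complex) \<Rightarrow> 'a::complex_banach graph \<Rightarrow> 'a \<Rightarrow> 'a" where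
  "ftau2_op \<omega>' f A x =
     (1 / (2 * of_real pi * \<i>)) *\<^sub>C (ray_integral f A (- \<omega>') x - ray_integral f A \<omega>' x)"

text \<open>$(\tau^2(A))^{-1}(f\tau^2)(A)$ with its natural domain.\<close>

definition regularised_calculus ::
    "real \<Rightarrow> (complex \<Rightarrow> complex) \<Rightarrow> 'a::complex_banach graph \<Rightarrow> 'a graph" where
  "regularised_calculus \<omega>' f A = {(x, y). tau2_op A y = ftau2_op \<omega>' f A x}"

section \<open>The operator $f(A)$ for a Bernstein function $f$\<close>

text \<open>The Bochner integral. This is the definition of \<^const>\<open>has_bochner_integral\<close>, whose type
  is restricted to second countable spaces, for arbitrary normed spaces.\<close>

definition has_bochner :: "'b measure \<Rightarrow> ('b \<Rightarrow> 'a::real_normed_vector) \<Rightarrow> 'a \<Rightarrow> bool" where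
  "has_bochner M f x \<longleftrightarrow> f \<in> borel_measurable M \<and>
     (\<exists>s. (\<forall>i. Bochner_Integration.simple_bochner_integrable M (s i)) \<and>
        (\<lambda>i. \<integral>\<^sup>+ t. ennreal (norm (f t - s i t)) \<partial>M) \<longlonglongrightarrow> 0 \<and>
        (\<lambda>i. Bochner_Integration.simple_bochner_integral M (s i)) \<longlonglongrightarrow> x)"

text \<open>Only the values \<open>T t\<close> for \<open>t \<ge> 0\<close> matter.\<close>

definition bounded_C0_semigroup :: "(real \<Rightarrow> 'a::complex_banach \<Rightarrow> 'a) \<Rightarrow> bool" where
  "bounded_C0_semigroup T \<longleftrightarrow>
     (\<forall>t\<ge>0. bounded_linear (T t) \<and> (\<forall>c x. T t (c *\<^sub>C x) = c *\<^sub>C T t x)) \<and>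
     (\<forall>x. T 0 x = x) \<and> (\<forall>s\<ge>0. \<forall>t\<ge>0. \<forall>x. T (s + t) x = T s (T t x)) \<and>
     (\<forall>x. ((\<lambda>t. T t x) \<longlongrightarrow> x) (at_right 0)) \<and>
     (\<exists>C. \<forall>t\<ge>0. onorm (T t) \<le> C)"

definition semigroup_generator :: "(real \<Rightarrow> 'a::complex_banach \<Rightarrow> 'a) \<Rightarrow> 'a graph" where
  "semigroup_generator T = {(x, y). ((\<lambda>h. (T h x - x) /\<^sub>R h) \<longlongrightarrow> y) (at_right 0)}"

definition bernstein_calculus ::
    "real \<Rightarrow> real \<Rightarrow> real measure \<Rightarrow> (real \<Rightarrow> 'a \<Rightarrow> 'a) \<Rightarrow> 'a::complex_banach graph \<Rightarrow> 'a graph" where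
  "bernstein_calculus a b \<mu> T A =
     closure {(x, a *\<^sub>R x + b *\<^sub>R y + v) |x y v. (x, y) \<in> A \<and> has_bochner \<mu> (\<lambda>t. x - T t x) v}"

section \<open>The operator $f(A)$\<close>

text \<open>\<open>B\<close> is the operator $f(A)$, for \<open>A \<in> Sect \<omega>\<close>, by either of the two definitions. Neither the
  choice of \<open>\<omega>'\<close>, nor that of the definition when both apply, affects $f(A)$. As $A$ is
  sectorial of angle less than $\pi/2$, the semigroup \<open>T\<close> generated by $-A$ exists; on $[0,\infty)$
  it is unique.\<close>

definition is_fun_calc ::
    "real \<Rightarrow> (complex \<Rightarrow> complex) \<Rightarrow> 'a::complex_banach graph \<Rightarrow> 'a graph \<Rightarrow> bool" where
  "is_fun_calc \<omega> f A B \<longleftrightarrow>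
     (injective_operator A \<and> (\<exists>\<omega>'\<in>{\<omega><..<pi/2}. B = regularised_calculus \<omega>' f A)) \<or>
     (bernstein (pos_restrict f) \<and>
       (\<exists>a b \<mu> T. bernstein_rep (pos_restrict f) a b \<mu> \<and>
          bounded_C0_semigroup T \<and> semigroup_generator T = op_uminus A \<and>
          B = bernstein_calculus a b \<mu> T A))"

end

(* Substituting l = e^w turns the rays bounding a sector into horizontal lines and r(w) = 1/(z + f(e^w)) into a
   bounded holomorphic function on a strip around the line Im w = 0. With q a = pi, the kernel
   psi(w) = 1/(1 + e^(q w)) represents r as a constant plus q/pi times the integral of J(y) psi(w - y) dy, where
   J(y) is the jump of r between the lines Im w = a and Im w = -a; the hypothesis on kappa bounds the L^1 norm of J,
   and the constant is controlled by Schwarz-Pick for f. Replacing psi(log A - y) by the uniformly bounded operator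
   e^(q y) (e^(q y) + A^q)^(-1) gives a bounded operator Rz with the asserted norm, and Fubini together with the
   multiplicativity of the contour integral identifies Rz with (z + f(A))^(-1). When A is not injective,
   the semigroup definition of f(A) agrees with the contour integral up to the kernel of A, and the part in the
   kernel is recovered by letting s tend to 0 in s(s + A)^(-1). *)
theory Submission
  imports Defs "HOL-Complex_Analysis.Complex_Analysis" "HOL-Real_Asymp.Real_Asymp"
begin

section \<open>Complex linear functionals\<close>

text \<open>The space may be nonseparable, so vector integrals are taken weakly: all bounded
  functionals together determine the value, and Cauchy's theorem, Fubini and analytic continuation
  are applied to scalar functions only. The choice \<open>q * a = pi\<close> makes the Cauchy kernel
  in the variable \<open>q * w\<close> equal on both edges of the strip, which is why only the jump
  of the resolvent function enters. The kernel \<open>psi q\<close> does not decay on the left; it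
  is therefore realised as \<open>psi 1\<close>, a plain resolvent bounded by M(A), plus the
  decaying \<open>phi_fun\<close>, whose contour integral at angle \<beta> gives the second summand
  of \<open>tilde_const\<close>. The half-angle cosines come from a single lower bound for |1 +
  e^v|, and cos^2(pi/q) from Re f >= cos(pi/q) f(t) on the ray, used for each of the two
  denominators in the jump. \<open>Rz\<close> is built before f(A) is looked at. Each definition of
  f(A) only has to satisfy that (x, y) is in the graph iff \<open>Rz\<close> maps y + z x to x;
  closedness, spectrum and norm bounds then follow in the same way for both. What remains is
  single-valuedness and density of the domain, the latter being where the dense range or the
  Bernstein property is used.\<close>

lemma scaleC_one [simp]: "1 *\<^sub>C (x::'a::complex_banach) = x"
 using scaleR_scaleC[of 1 x] by simp

interpretation scaleC: bounded_bilinear "scaleC :: complex => 'a => 'a::complex_banach"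
proof
 fix r :: real and a :: complex and b :: 'a
 show "(r *\<^sub>R a) *\<^sub>C b = r *\<^sub>R (a *\<^sub>C b)"
  by (simp add: scaleR_conv_of_real scaleR_scaleC[of r "a *\<^sub>C b"] scaleC_scaleC)
 show "a *\<^sub>C (r *\<^sub>R b) = r *\<^sub>R (a *\<^sub>C b)"
  by (simp add: scaleR_scaleC[of r b] scaleR_scaleC[of r "a *\<^sub>C b"] scaleC_scaleC mult.commute)
 show "EX K. ALL (a::complex) (b::'a). norm (a *\<^sub>C b) <= norm a * norm b * K"
  by (auto intro!: exI[of _ 1] simp: norm_scaleC)
qed (auto simp: scaleC_add_left scaleC_add_right)

lemmas scaleC_simps [simp] = scaleC.zero_left scaleC.zero_right scaleC.minus_left scaleC.minus_right
 scaleC_scaleC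

lemma continuous_on_scaleC [continuous_intros]:
 fixes g :: "'b::topological_space => 'a::complex_banach"
 shows "continuous_on S f ==> continuous_on S g ==> continuous_on S (%x. f x *\<^sub>C g x)"
 by (rule scaleC.continuous_on)

definition clinear_bounded :: "('a::complex_banach => 'b::complex_banach) => bool" where
 "clinear_bounded B \<longleftrightarrow> bounded_linear B \<and> (ALL c x. B (c *\<^sub>C x) = c *\<^sub>C B x)"

lemma clinear_boundedD:
 assumes "clinear_bounded B"
 shows "B (x + y) = B x + B y" "B (x - y) = B x - B y" "B (- x) = - B x" "B 0 = 0"
  "B (c *\<^sub>C x) = c *\<^sub>C B x" "B (r *\<^sub>R x) = r *\<^sub>R B x"
proof -
 interpret bounded_linear B using assms by (simp add: clinear_bounded_def)
 show "B (x + y) = B x + B y" "B (x - y) = B x - B y" "B (- x) = - B x" "B 0 = 0"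
  "B (r *\<^sub>R x) = r *\<^sub>R B x"
  by (simp_all add: add diff neg zero scaleR)
 show "B (c *\<^sub>C x) = c *\<^sub>C B x" using assms by (simp add: clinear_bounded_def)
qed

lemma clinear_bounded_imp_bounded_linear: "clinear_bounded B ==> bounded_linear B"
 by (simp add: clinear_bounded_def)

lemma clinear_bounded_continuous_on:
 "clinear_bounded B ==> continuous_on S g ==> continuous_on S (%x. B (g x))"
 by (rule bounded_linear.continuous_on[OF clinear_bounded_imp_bounded_linear])

lemma clinear_bounded_tendsto:
 "clinear_bounded B ==> (g \<longlongrightarrow> l) F ==> ((%x. B (g x)) \<longlongrightarrow> B l) F"
 by (rule bounded_linear.tendsto[OF clinear_bounded_imp_bounded_linear])

lemma clinear_bounded_bound:
 assumes "clinear_bounded B" shows "EX K>=0. ALL x. norm (B x) <= K * norm x"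
proof -
 obtain K where "0 <= K" "!!x. norm (B x) <= norm x * K"
  using bounded_linear.nonneg_bounded[OF clinear_bounded_imp_bounded_linear[OF assms]] by blast
 thus ?thesis by (auto simp: mult.commute)
qed

lemma clinear_boundedI:
 assumes "!!x y. B (x + y) = B x + B y" "!!c x. B (c *\<^sub>C x) = c *\<^sub>C B x"
  and "!!x. norm (B x) <= K * norm x"
 shows "clinear_bounded B"
 unfolding clinear_bounded_def
proof (intro conjI allI assms(2))
 show "bounded_linear B"
  by (rule bounded_linear_intro[where K = K])
   (use assms in \<open>auto simp: scaleR_scaleC mult.commute\<close>)
qed

lemma clinear_bounded_compose:
 assumes "clinear_bounded B" "clinear_bounded C" shows "clinear_bounded (%x. B (C x))"
 using assms bounded_linear_compose by (auto simp: clinear_bounded_def)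

lemma clinear_bounded_id: "clinear_bounded (%x. x)"
 by (simp add: clinear_bounded_def bounded_linear_ident)

lemma clinear_bounded_scaleC: "clinear_bounded B ==> clinear_bounded (%x. c *\<^sub>C B x)"
 by (auto simp: clinear_bounded_def mult.commute
    intro: bounded_linear_compose[OF scaleC.bounded_linear_right])

lemma clinear_bounded_diff:
 "clinear_bounded B ==> clinear_bounded C ==> clinear_bounded (%x. B x - C x)"
 by (auto simp: clinear_bounded_def scaleC.diff_right intro: bounded_linear_sub)

subsection \<open>Norming functionals\<close>

text \<open>The value \<open>a\<close> at \<open>x\<close> must lie above every b - |y - x| and
  below every |y' + x| - b'. The triangle inequality puts each lower candidate under each upper one,
  so the supremum of the lower ones works; scaling by |c| then reaches all multiples of
  \<open>x\<close>. Functionals are kept as graphs so that Zorn's lemma can be applied to plain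
  inclusion.\<close>

lemma hahn_banach_extension_step:
 fixes g :: "('a::real_normed_vector \<times> real) set"
 assumes g: "subspace g" and dom: "!!y b. (y, b) \<in> g ==> b <= norm y"
 shows "EX a. ALL y b c. (y, b) \<in> g --> b + c * a <= norm (y + c *\<^sub>R x)"
proof -
 have ineq: "b - norm (y - x) <= norm (y' + x) - b'" if "(y, b) \<in> g" "(y', b') \<in> g" for y b y' b'
 proof -
  have "(y + y', b + b') \<in> g" using subspace_add[OF g that] by simp
  hence "b + b' <= norm (y + y')" by (rule dom)
  also have "... <= norm (y - x) + norm (y' + x)"
   using norm_triangle_ineq[of "y - x" "y' + x"] by simp
  finally show ?thesis by simp
 qed
 have z: "(0, 0) \<in> g" using subspace_0[OF g] by (simp add: zero_prod_def)
 define L where "L = {b - norm (y - x) |y b. (y, b) \<in> g}"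
 define a where "a = Sup L"
 have bdd: "bdd_above L" using ineq[OF _ z] by (auto simp: L_def bdd_above_def)
 have lo: "b - norm (y - x) <= a" if "(y, b) \<in> g" for y b
  unfolding a_def by (rule cSup_upper[OF _ bdd]) (use that in \<open>auto simp: L_def\<close>)
 have up: "a <= norm (y' + x) - b'" if "(y', b') \<in> g" for y' b'
  unfolding a_def by (rule cSup_least) (use z ineq that in \<open>auto simp: L_def\<close>)
 have "b + c * a <= norm (y + c *\<^sub>R x)" if yb: "(y, b) \<in> g" for y b c
 proof (cases "c = 0")
  case True thus ?thesis using dom[OF yb] by simp
 next
  case False
  define d where "d = abs c"
  have d: "d > 0" using False by (simp add: d_def)
  have gd: "(y /\<^sub>R d, b / d) \<in> g"
   using subspace_scale[OF g yb, of "1/d"] by (simp add: divide_inverse mult.commute)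
  show ?thesis
  proof (cases "c > 0")
   case True
   hence "d = c" by (simp add: d_def)
   have "a <= norm (y /\<^sub>R d + x) - b / d" by (rule up[OF gd])
   hence "d * a <= d * norm (y /\<^sub>R d + x) - b" using d by (simp add: field_simps del: norm_scaleR)
   moreover have "d * norm (y /\<^sub>R d + x) = norm (d *\<^sub>R (y /\<^sub>R d + x))" using d by simp
   moreover have "d *\<^sub>R (y /\<^sub>R d + x) = y + c *\<^sub>R x"
    using d \<open>d = c\<close> by (simp add: scaleR_add_right)
   ultimately have "d * a <= norm (y + c *\<^sub>R x) - b" by metis
   thus ?thesis using \<open>d = c\<close> by simp
  next
   case nc: False
   hence "d = - c" using False by (simp add: d_def)
   have "b / d - norm (y /\<^sub>R d - x) <= a" by (rule lo[OF gd])
   hence "b - d * norm (y /\<^sub>R d - x) <= d * a" using d by (simp add: field_simps)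
   moreover have "d * norm (y /\<^sub>R d - x) = norm (d *\<^sub>R (y /\<^sub>R d - x))" using d by simp
   moreover have "d *\<^sub>R (y /\<^sub>R d - x) = y + c *\<^sub>R x"
    using d \<open>d = -c\<close> by (simp add: scaleR_diff_right)
   ultimately have "b - norm (y + c *\<^sub>R x) <= d * a" by metis
   thus ?thesis using \<open>d = - c\<close> by simp
  qed
 qed
 thus ?thesis by blast
qed

text \<open>A maximal dominated graph containing the span of (x0, |x0|) is total by the extension
  step. That it is single-valued comes from domination itself: applied to (0, c) and (0, -c) it
  forces c = 0.\<close>

theorem hahn_banach_norming:
 fixes x0 :: "'a::real_normed_vector"
 shows "EX u::'a => real. linear u \<and> (ALL x. u x <= norm x) \<and> u x0 = norm x0"
proof -
 define F where "F = {g. subspace g \<and> (ALL y b. (y, b) \<in> g --> b <= norm y) \<and>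
  (x0, norm x0) \<in> (g::('a \<times> real) set)}"
 define g0 where "g0 = range (%c. (c *\<^sub>R x0, c * norm x0))"
 have "subspace g0"
  unfolding subspace_def g0_def
  by (auto simp: zero_prod_def image_iff scaleR_add_left[symmetric] distrib_right[symmetric]
    intro: exI[of _ "0::real"])
 moreover have "c * norm x0 <= norm (c *\<^sub>R x0)" for c
  by (simp add: mult_right_mono)
 ultimately have g0F: "g0 \<in> F"
  unfolding F_def by (auto simp: g0_def image_iff intro: exI[of _ 1])
 have "\<exists>M\<in>F. \<forall>X\<in>F. M \<subseteq> X --> X = M"
 proof (rule subset_Zorn_nonempty)
  show "F ~= {}" using g0F by blast
  fix C assume C: "C ~= {}" "subset.chain F C"
  have CF: "C \<subseteq> F" and tot: "!!X Y. X \<in> C ==> Y \<in> C ==> X \<subseteq> Y \<or> Y \<subseteq> X"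
   using C(2) by (auto simp: subset_chain_def)
  have sub: "subspace (\<Union>C)"
   unfolding subspace_def
  proof (intro conjI ballI allI)
   show "0 \<in> \<Union>C" using C(1) CF by (auto simp: F_def subspace_def)
   fix p assume p: "p \<in> \<Union>C"
   show "c *\<^sub>R p \<in> \<Union>C" for c
    using p CF unfolding F_def by (auto intro!: subspace_scale)
   fix p' assume p': "p' \<in> \<Union>C"
   obtain X Y where "X \<in> C" "p \<in> X" "Y \<in> C" "p' \<in> Y" using p p' by blast
   then obtain Z where "Z \<in> C" "p \<in> Z" "p' \<in> Z" using tot[of X Y] by blast
   moreover have "subspace Z" using \<open>Z \<in> C\<close> CF by (auto simp: F_def)
   ultimately show "p + p' \<in> \<Union>C" using subspace_add[of Z p p'] by blast
  qed
  have "(ALL y b. (y, b) \<in> \<Union>C --> b <= norm y)" using CF unfolding F_def by blast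
  moreover have "(x0, norm x0) \<in> \<Union>C" using C(1) CF unfolding F_def by blast
  ultimately show "\<Union>C \<in> F" using sub by (simp add: F_def)
 qed
 then obtain g where gF: "g \<in> F" and max: "!!X. X \<in> F ==> g \<subseteq> X ==> X = g" by blast
 have g: "subspace g" and dom: "!!y b. (y, b) \<in> g ==> b <= norm y" and x0: "(x0, norm x0) \<in> g"
  using gF by (auto simp: F_def)
 have total: "EX b. (x, b) \<in> g" for x
 proof -
  obtain a where a: "!!y b c. (y, b) \<in> g ==> b + c * a <= norm (y + c *\<^sub>R x)"
   using hahn_banach_extension_step[OF g dom, of x] by blast
  define g' where "g' = {p + c *\<^sub>R (x, a) |p c. p \<in> g}"
  have "g' = {p + q |p q. p \<in> g \<and> q \<in> range (%c. c *\<^sub>R (x, a))}" unfolding g'_def by blast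
  moreover have "subspace (range (%c. c *\<^sub>R (x, a)))"
   by (rule real_vector.subspaceI)
    (auto simp: image_iff zero_prod_def scaleR_add_left[symmetric] distrib_right[symmetric])
  ultimately have "subspace g'" using subspace_sums[OF g] by simp
  moreover have "b <= norm y" if yb: "(y, b) \<in> g'" for y b
  proof -
   obtain y' b' c where "(y', b') \<in> g" "y = y' + c *\<^sub>R x" "b = b' + c * a"
    using yb by (auto simp: g'_def)
   thus ?thesis using a by simp
  qed
  moreover have gg': "g \<subseteq> g'"
  proof
   fix p assume "p \<in> g"
   hence "p + 0 *\<^sub>R (x, a) \<in> g'" unfolding g'_def by blast
   thus "p \<in> g'" by (simp add: zero_prod_def[symmetric])
  qed
  ultimately have "g' = g" using x0 by (intro max) (auto simp: F_def)
  have "0 + 1 *\<^sub>R (x, a) \<in> g'" unfolding g'_def using subspace_0[OF g] by blast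
  thus ?thesis using \<open>g' = g\<close> by auto
 qed
 have uniq: "b = b'" if "(x, b) \<in> g" "(x, b') \<in> g" for x b b'
 proof -
  have "(0, b - b') \<in> g" "(0, b' - b) \<in> g"
   using subspace_diff[OF g that] subspace_diff[OF g that(2) that(1)] by auto
  thus ?thesis using dom[of 0 "b - b'"] dom[of 0 "b' - b"] by auto
 qed
 define u where "u x = (THE b. (x, b) \<in> g)" for x
 have u: "(x, u x) \<in> g" for x
  unfolding u_def using total uniq theI'[of "%b. (x, b) \<in> g"] by blast
 have "linear u"
 proof (rule linearI)
  fix x y :: 'a and c :: real
  show "u (x + y) = u x + u y" using subspace_add[OF g u[of x] u[of y]] uniq[OF u] by simp
  show "u (c *\<^sub>R x) = c *\<^sub>R u x" using subspace_scale[OF g u[of x], of c] uniq[OF u] by simp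
 qed
 moreover have "u x0 = norm x0" using uniq[OF u x0] .
 ultimately show ?thesis using dom[OF u] by blast
qed

text \<open>A real functional u is the real part of the complex functional u(x) - i u(ix). The norm
  does not grow, because a unimodular factor makes any given value real and hence equal to a value
  of u.\<close>

lemma complex_norming_functional:
 fixes x0 :: "'a::complex_banach"
 shows "EX ph::'a => complex. clinear_bounded ph \<and> (ALL x. norm (ph x) <= norm x) \<and> ph x0 = of_real (norm x0)"
proof -
 obtain u :: "'a => real" where lin: "linear u" and le: "!!x. u x <= norm x" and x0: "u x0 = norm x0"
  using hahn_banach_norming by blast
 interpret linear u by fact
 define ph where "ph x = of_real (u x) - \<i> * of_real (u (\<i> *\<^sub>C x))" for x
 have ph_add: "ph (x + y) = ph x + ph y" for x y
  by (simp add: ph_def add scaleC_add_right algebra_simps)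
 have real: "u (of_real r *\<^sub>C x) = r * u x" for r x
  by (simp add: scaleR_scaleC[symmetric] scale)
 have im: "u (\<i> *\<^sub>C (c *\<^sub>C x)) = Re c * u (\<i> *\<^sub>C x) - Im c * u x" for c x
 proof -
  have "\<i> *\<^sub>C c *\<^sub>C x = of_real (Re c) *\<^sub>C (\<i> *\<^sub>C x) + of_real (- Im c) *\<^sub>C x"
   by (simp only: scaleC_scaleC scaleC_add_left[symmetric])
    (rule arg_cong[where f = "%c. c *\<^sub>C x"], simp add: complex_eq_iff)
  hence "u (\<i> *\<^sub>C (c *\<^sub>C x)) = Re c * u (\<i> *\<^sub>C x) + - Im c * u x"
   by (simp only: add real)
  thus ?thesis by (simp only: diff_conv_add_uminus minus_mult_left)
 qed
 have re: "u (c *\<^sub>C x) = Re c * u x + Im c * u (\<i> *\<^sub>C x)" for c x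
 proof -
  have "c *\<^sub>C x = of_real (Re c) *\<^sub>C x + of_real (Im c) *\<^sub>C (\<i> *\<^sub>C x)"
   by (simp only: scaleC_scaleC scaleC_add_left[symmetric])
    (rule arg_cong[where f = "%c. c *\<^sub>C x"], simp add: complex_eq_iff)
  thus ?thesis by (simp only: add real)
 qed
 have scale: "ph (c *\<^sub>C x) = c * ph x" for c x
  by (simp only: ph_def im re[of c x]) (simp add: complex_eq_iff)
 have bound: "norm (ph x) <= norm x" for x
 proof (cases "ph x = 0")
  case False
  define c where "c = cnj (ph x) / of_real (norm (ph x))"
  have nc: "norm c = 1" using False by (simp add: c_def norm_divide)
  have "ph (c *\<^sub>C x) = of_real (norm (ph x))"
   using False unfolding scale c_def
   by (simp add: complex_norm_square[symmetric] power2_eq_square mult.commute)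
  hence "norm (ph x) = Re (ph (c *\<^sub>C x))" by simp
  also have "... = u (c *\<^sub>C x)" by (simp add: ph_def)
  also have "... <= norm x" using le[of "c *\<^sub>C x"] nc by (simp add: norm_scaleC)
  finally show ?thesis .
 qed simp
 \<comment> \<open>The real part already exhausts the norm bound, so the imaginary part must
   vanish.\<close>
 have "ph x0 = of_real (norm x0)"
 proof -
  have r: "Re (ph x0) = norm x0" by (simp add: ph_def x0)
  have "(Re (ph x0))^2 + (Im (ph x0))^2 <= (norm x0)^2"
   using bound[of x0] by (simp add: cmod_power2[symmetric] power_mono)
  thus ?thesis using r by (simp add: complex_eq_iff)
 qed
 moreover have "clinear_bounded ph"
  by (rule clinear_boundedI[where K = 1])
   (use ph_add scale bound in \<open>auto simp: scaleC_complex_def\<close>)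
 ultimately show ?thesis using bound by blast
qed

lemma functional_eqI:
 fixes x y :: "'a::complex_banach"
 assumes "!!ph::'a => complex. clinear_bounded ph ==> ph x = ph y"
 shows "x = y"
proof -
 obtain ph :: "'a => complex" where "clinear_bounded ph" "ph (x - y) = of_real (norm (x - y))"
  using complex_norming_functional by blast
 thus ?thesis using assms[of ph] by (simp add: clinear_boundedD)
qed

lemma functional_scaleC: "clinear_bounded (ph::'a::complex_banach => complex) ==> ph (c *\<^sub>C x) = c * ph x"
 by (simp add: clinear_boundedD scaleC_complex_def)

section \<open>Weak integrals over the real line\<close>

text \<open>This is the Pettis integral. Estimates and identities for it reduce to scalar ones by
  norming functionals, without any separability of the range.\<close>

definition has_wint :: "(real => 'a::complex_banach) => 'a => bool" where
 "has_wint F v \<longleftrightarrow> (ALL ph::'a => complex. clinear_bounded ph -->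
  has_bochner_integral lborel (%s. ph (F s)) (ph v))"

definition wint :: "(real => 'a::complex_banach) => 'a" where
 "wint F = (THE v. has_wint F v)"

lemma has_wintD:
 assumes "has_wint F v" "clinear_bounded (ph::'a::complex_banach => complex)"
 shows "integrable lborel (%s. ph (F s))" "(LINT s|lborel. ph (F s)) = ph v"
 using assms by (auto simp: has_wint_def has_bochner_integral_iff)

lemma has_wint_unique:
 assumes "has_wint F v" "has_wint F w" shows "v = w"
proof (rule functional_eqI)
 fix ph :: "'a => complex" assume "clinear_bounded ph"
 thus "ph v = ph w" using has_wintD(2)[OF assms(1)] has_wintD(2)[OF assms(2)] by metis
qed

lemma wint_eqI: "has_wint F v ==> wint F = v"
 unfolding wint_def using has_wint_unique by blast

lemma has_wint_wint: "has_wint F v ==> has_wint F (wint F)"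
 by (simp add: wint_eqI)

lemma has_wint_compose:
 assumes "has_wint F v" "clinear_bounded B" shows "has_wint (%s. B (F s)) (B v)"
 using assms clinear_bounded_compose[OF _ assms(2)] by (auto simp: has_wint_def)

lemma has_wint_add:
 assumes "has_wint F v" "has_wint G w" shows "has_wint (%s. F s + G s) (v + w)"
 using assms has_bochner_integral_add by (fastforce simp: has_wint_def clinear_boundedD)

lemma has_wint_diff:
 assumes "has_wint F v" "has_wint G w" shows "has_wint (%s. F s - G s) (v - w)"
 using assms has_bochner_integral_diff by (fastforce simp: has_wint_def clinear_boundedD)

lemma has_wint_scaleC:
 assumes "has_wint F v" shows "has_wint (%s. c *\<^sub>C F s) (c *\<^sub>C v)"
 by (rule has_wint_compose[OF assms clinear_bounded_scaleC[OF clinear_bounded_id]])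

text \<open>A functional that norms \<open>v\<close> turns the claim into the scalar
  estimate.\<close>

lemma has_wint_norm_bound:
 assumes F: "has_wint F v" and le: "!!s. norm (F s) <= m s" and m: "integrable lborel m"
 shows "norm v <= (LINT s|lborel. m s)"
proof -
 obtain ph :: "'a => complex" where ph: "clinear_bounded ph" "!!x. norm (ph x) <= norm x"
  "ph v = of_real (norm v)"
  using complex_norming_functional by blast
 have "norm v = norm (LINT s|lborel. ph (F s))"
  using has_wintD(2)[OF F ph(1)] ph(3) by simp
 also have "... <= (LINT s|lborel. norm (ph (F s)))" by (rule integral_norm_bound)
 also have "... <= (LINT s|lborel. m s)"
  using has_wintD(1)[OF F ph(1)] m order_trans[OF ph(2) le]
  by (intro integral_mono) auto
 finally show ?thesis .
qed

section \<open>Existence of the weak integral of a dominated continuous function, and its relation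
  to integrals over (0, infinity)\<close>

lemma antiderivative_real_line:
 fixes F :: "real => 'a::banach"
 assumes F: "continuous_on UNIV F"
 shows "EX K. ALL s. (K has_vector_derivative F s) (at s)"
proof -
 define K where "K s = (if 0 <= s then integral {0..s} F else - integral {s..0} F)" for s
 have int: "F integrable_on {a..b}" for a b
  using F continuous_on_subset integrable_continuous_interval by blast
 have eq: "K s = integral {-n..s} F - integral {-n..0} F" if "- n <= s" "0 <= n" for s n
 proof (cases "0 <= s")
  case True
  thus ?thesis
   using Henstock_Kurzweil_Integration.integral_combine[of "-n" 0 s F] int that
   by (simp add: K_def algebra_simps)
 next
  case False
  thus ?thesis
   using Henstock_Kurzweil_Integration.integral_combine[of "-n" s 0 F] int that
   by (simp add: K_def algebra_simps)
 qed
 have "(K has_vector_derivative F s) (at s)" for s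
 proof -
  define n where "n = abs s + 1"
  have "((%u. integral {-n..u} F) has_vector_derivative F s) (at s within {-n..n})"
   using F by (intro integral_has_vector_derivative continuous_on_subset[OF F]) (auto simp: n_def)
  hence "((%u. integral {-n..u} F - integral {-n..0} F) has_vector_derivative F s)
    (at s within {-n..n})"
   by (auto intro!: derivative_eq_intros)
  hence "((%u. integral {-n..u} F - integral {-n..0} F) has_vector_derivative F s)
    (at s within {-n<..<n})"
   by (rule has_vector_derivative_within_subset) auto
  hence "((%u. integral {-n..u} F - integral {-n..0} F) has_vector_derivative F s) (at s)"
   by (subst (asm) at_within_open) (auto simp: n_def)
  moreover have "integral {-n..y} F - integral {-n..0} F = K y" if "y \<in> {-n<..<n}" for y
   by (rule eq[symmetric]) (use that in \<open>auto simp: n_def\<close>)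
  moreover have "s \<in> {-n<..<n}" by (auto simp: n_def)
  ultimately show ?thesis
   using has_vector_derivative_transform_within_open open_greaterThanLessThan by blast
 qed
 thus ?thesis by blast
qed

lemma integrable_tail_small:
 fixes m :: "real => real"
 assumes m: "integrable lborel m" and "e > 0"
 shows "EX N. (LINT s|lborel. indicator {s. N <= abs s} s * m s) < e"
proof -
 have "(%n::nat. LINT s|lborel. indicator {s. real n <= abs s} s * m s) \<longlonglongrightarrow> (LINT s|(lborel::real measure). (0::real))"
 proof (rule integral_dominated_convergence)
  show "integrable lborel (%s. norm (m s))" using m by simp
  show "AE s in lborel. (%n::nat. indicator {s. real n <= abs s} s * m s) \<longlonglongrightarrow> 0"
  proof (rule AE_I2, rule tendsto_eventually)
   fix s
   obtain N :: nat where "abs s < real N" using reals_Archimedean2 by blast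
   thus "\<forall>\<^sub>F n::nat in sequentially. indicator {s. real n <= abs s} s * m s = 0"
    by (intro eventually_sequentiallyI[of N]) (auto simp: indicator_def)
  qed
 qed (use m in \<open>auto simp: indicator_def\<close>)
 hence "\<forall>\<^sub>F n::nat in sequentially. (LINT s|lborel. indicator {s. real n <= abs s} s * m s) < e"
  using \<open>e > 0\<close> by (intro order_tendstoD) auto
 then obtain N :: nat where "ALL n>=N. (LINT s|lborel. indicator {s. real n <= abs s} s * m s) < e"
  by (auto simp: eventually_sequentially)
 thus ?thesis by blast
qed

lemma Cauchy_at_top_convergent:
 fixes K :: "real => 'a::complete_space"
 assumes "!!e. e > 0 ==> EX N. ALL a>=N. ALL b>=N. dist (K a) (K b) < e"
 shows "EX L. (K \<longlongrightarrow> L) at_top"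
proof -
 have "Cauchy (%n. K (real n))"
 proof (rule metric_CauchyI)
  fix e :: real assume "e > 0"
  then obtain N where N: "!!a b. a >= N ==> b >= N ==> dist (K a) (K b) < e" using assms by blast
  show "EX M. ALL m>=M. ALL n>=M. dist (K (real m)) (K (real n)) < e"
   by (rule exI[of _ "nat \<lceil>N\<rceil>"]) (auto intro!: N simp: nat_le_iff ceiling_le_iff)
 qed
 then obtain L where L: "(%n. K (real n)) \<longlonglongrightarrow> L"
  using Cauchy_convergent convergent_def by blast
 have "(K \<longlongrightarrow> L) at_top"
 proof (rule tendstoI)
  fix e :: real assume "e > 0"
  then obtain N where N: "!!a b. a >= N ==> b >= N ==> dist (K a) (K b) < e/2"
   using assms[of "e/2"] half_gt_zero by metis
  obtain M where M: "!!n. n >= M ==> dist (K (real n)) L < e/2"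
   using metric_LIMSEQ_D[OF L, of "e/2"] \<open>e > 0\<close> by auto
  define n where "n = max M (nat \<lceil>N\<rceil>)"
  have n: "real n >= N" "n >= M" unfolding n_def by linarith+
  have "dist (K a) L < e" if "a >= N" for a
   using dist_triangle[of "K a" L "K (real n)"] N[OF that n(1)] M[OF n(2)] by linarith
  thus "\<forall>\<^sub>F x in at_top. dist (K x) L < e"
   using eventually_ge_at_top[of N] by (rule eventually_mono[rotated])
 qed
 thus ?thesis by blast
qed

text \<open>The increments of K are dominated by tails of the integral of m, so K is Cauchy at both
  ends.\<close>

lemma antiderivative_limits:
 fixes F :: "real => 'a::banach"
 assumes F: "continuous_on UNIV F" and le: "!!s. norm (F s) <= m s" and m: "integrable lborel m"
  and K: "!!s. (K has_vector_derivative F s) (at s)"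
 shows "EX L. (K \<longlongrightarrow> L) at_top" "EX L. (K \<longlongrightarrow> L) at_bot"
proof -
 have tail: "EX N. ALL a b. a <= b --> (N <= a \<or> b <= - N) --> norm (K b - K a) < e" if "e > 0" for e
 proof -
  obtain N where N: "(LINT s|lborel. indicator {s. N <= abs s} s * m s) < e"
   using integrable_tail_small[OF m \<open>e > 0\<close>] by blast
  have "norm (K b - K a) < e" if ab: "a <= b" and N': "N <= a \<or> b <= - N" for a b
  proof -
   have si: "set_integrable lborel {a..b} m"
    using m unfolding set_integrable_def by (intro integrable_mult_indicator) auto
   have m_int: "m integrable_on {a..b}" "integral {a..b} m = (LINT s|lborel. indicator {a..b} s * m s)"
    using set_borel_integral_eq_integral[OF si] by (auto simp: set_lebesgue_integral_def)
   have "(F has_integral K b - K a) {a..b}"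
    using K ab by (intro fundamental_theorem_of_calculus)
     (auto intro: has_vector_derivative_at_within)
   hence "norm (K b - K a) = norm (integral {a..b} F)" by (simp add: integral_unique)
   also have "... <= integral {a..b} m"
    using continuous_on_subset[OF F] le m_int(1)
    by (intro integral_norm_bound_integral[OF integrable_continuous_interval]) auto
   also have "... <= (LINT s|lborel. indicator {s. N <= abs s} s * m s)"
   proof (subst m_int(2), rule integral_mono)
    show "integrable lborel (%s. indicator {a..b} s * m s)"
     using integrable_mult_indicator[OF _ m, of "{a..b}"] by simp
    show "integrable lborel (%s. indicator {s. N <= abs s} s * m s)"
     using integrable_mult_indicator[OF _ m, of "{s. N <= abs s}"] by simp
    have "0 <= m s" for s using order_trans[OF norm_ge_zero le] .
    thus "indicator {a..b} s * m s <= indicator {s. N <= abs s} s * m s" for s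
     using N' by (auto simp: indicator_def)
   qed
   finally show ?thesis using N by simp
  qed
  thus ?thesis by blast
 qed
 show "EX L. (K \<longlongrightarrow> L) at_top"
 proof (rule Cauchy_at_top_convergent)
  fix e :: real assume "e > 0"
  then obtain N where N: "!!a b. a <= b ==> N <= a ==> norm (K b - K a) < e"
   using tail by blast
  have "dist (K a) (K b) < e" if "a >= N" "b >= N" for a b
   using N[of a b] N[of b a] that by (cases "a <= b") (auto simp: dist_norm norm_minus_commute)
  thus "EX N. ALL a>=N. ALL b>=N. dist (K a) (K b) < e" by blast
 qed
 have "EX L. ((%s. K (- s)) \<longlongrightarrow> L) at_top"
 proof (rule Cauchy_at_top_convergent)
  fix e :: real assume "e > 0"
  then obtain N where N: "!!a b. a <= b ==> b <= - N ==> norm (K b - K a) < e"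
   using tail by blast
  have "dist (K (-a)) (K (-b)) < e" if "a >= N" "b >= N" for a b
   using N[of "-a" "-b"] N[of "-b" "-a"] that
   by (cases "a <= b") (auto simp: dist_norm norm_minus_commute)
  thus "EX N. ALL a>=N. ALL b>=N. dist (K (-a)) (K (-b)) < e" by blast
 qed
 thus "EX L. (K \<longlongrightarrow> L) at_bot" by (simp add: filterlim_at_bot_mirror)
qed

lemma integral_FTC_real_line:
 fixes F f :: "real => 'a::euclidean_space"
 assumes "!!s. (F has_vector_derivative f s) (at s)" "continuous_on UNIV f" "integrable lborel f"
  and "(F \<longlongrightarrow> A) at_bot" "(F \<longlongrightarrow> B) at_top"
 shows "(LINT s|lborel. f s) = B - A"
proof -
 have ei: "einterval (-\<infinity>) \<infinity> = (UNIV::real set)" by (auto simp: einterval_def)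
 have "(LBINT s=-\<infinity>..\<infinity>. f s) = B - A"
  by (rule interval_integral_FTC_integrable)
   (use assms in \<open>auto simp: ei set_integrable_def continuous_on_eq_continuous_at
    ereal_tendsto_simps\<close>)
 thus ?thesis by (simp add: interval_lebesgue_integral_def ei set_lebesgue_integral_def)
qed

lemma integrable_continuous_dominated:
 fixes f :: "real => 'a::{banach, second_countable_topology}"
 assumes "continuous_on UNIV f" "!!s. norm (f s) <= m s" "integrable lborel m"
 shows "integrable lborel f"
 by (rule Bochner_Integration.integrable_bound[OF assms(3)])
  (use assms in \<open>auto intro!: borel_measurable_continuous_onI order_trans[OF assms(2)]\<close>)

text \<open>Scalar integrability alone would only give an element of the bidual. Completeness
  provides the limits of the antiderivative in the space, and their difference is the integral
  because functionals commute with derivatives and limits.\<close>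

lemma wint_antiderivative:
 fixes F :: "real => 'a::complex_banach"
 assumes F: "continuous_on UNIV F" and le: "!!s. norm (F s) <= m s" and m: "integrable lborel m"
 shows "EX K A B. (ALL s. (K has_vector_derivative F s) (at s)) \<and> (K \<longlongrightarrow> A) at_bot \<and> (K \<longlongrightarrow> B) at_top \<and>
  has_wint F (B - A)"
proof -
 obtain K where K: "!!s. (K has_vector_derivative F s) (at s)"
  using antiderivative_real_line[OF F] by blast
 obtain A B where AB: "(K \<longlongrightarrow> A) at_bot" "(K \<longlongrightarrow> B) at_top"
  using antiderivative_limits[OF F le m K] by blast
 have "has_wint F (B - A)"
  unfolding has_wint_def has_bochner_integral_iff
 proof (intro allI impI conjI)
  fix ph :: "'a => complex" assume ph: "clinear_bounded ph"
  note bl = clinear_bounded_imp_bounded_linear[OF ph]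
  obtain C where C: "0 <= C" "!!x. norm (ph x) <= C * norm x" using clinear_bounded_bound[OF ph] by blast
  have cont: "continuous_on UNIV (%s. ph (F s))" by (rule clinear_bounded_continuous_on[OF ph F])
  have "norm (ph (F s)) <= C * m s" for s
   using C(2)[of "F s"] mult_left_mono[OF le C(1), of s] by linarith
  thus int: "integrable lborel (%s. ph (F s))"
   by (rule integrable_continuous_dominated[OF cont]) (use m in auto)
  have "(LINT s|lborel. ph (F s)) = ph B - ph A"
   by (rule integral_FTC_real_line[where F = "%s. ph (K s)"])
    (use bl K cont int AB in \<open>auto intro: bounded_linear.has_vector_derivative bounded_linear.tendsto\<close>)
  thus "(LINT s|lborel. ph (F s)) = ph (B - A)" by (simp add: clinear_boundedD ph)
 qed
 thus ?thesis using K AB by blast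
qed

lemma has_wint_wintI:
 fixes F :: "real => 'a::complex_banach"
 assumes "continuous_on UNIV F" "!!s. norm (F s) <= m s" "integrable lborel m"
 shows "has_wint F (wint F)"
 using wint_antiderivative[OF assms] has_wint_wint by blast

text \<open>Links the Henstock-Kurzweil integral in \<open>ray_integral\<close> with weak integrals
  in s = ln r. The antiderivative on the line, composed with ln and continued by its limit at
  -infinity, is continuous at 0, so the fundamental theorem applies on every [0, b].\<close>

lemma has_integral_half_line_log:
 fixes G :: "real => 'a::complex_banach"
 assumes F: "continuous_on UNIV (%s. exp s *\<^sub>R G (exp s))"
  and le: "!!s. norm (exp s *\<^sub>R G (exp s)) <= m s" and m: "integrable lborel m"
 shows "(G has_integral wint (%s. exp s *\<^sub>R G (exp s))) {0<..}"
proof -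
 define F where "F = (%s. exp s *\<^sub>R G (exp s))"
 obtain K A B where K: "!!s. (K has_vector_derivative F s) (at s)" and A: "(K \<longlongrightarrow> A) at_bot"
  and B: "(K \<longlongrightarrow> B) at_top" and w: "has_wint F (B - A)"
  using wint_antiderivative[OF assms] unfolding F_def by metis
 define W where "W r = (if r <= 0 then A else K (ln r))" for r
 have deriv: "(W has_vector_derivative G r) (at r)" if "r > 0" for r
 proof -
  have "((K \<circ> ln) has_vector_derivative inverse r *\<^sub>R F (ln r)) (at r)"
   by (rule vector_diff_chain_at)
    (use K DERIV_ln[OF that] has_real_derivative_iff_has_vector_derivative in auto)
  hence "((K \<circ> ln) has_vector_derivative G r) (at r)" using that by (simp add: F_def)
  thus ?thesis
   by (rule has_vector_derivative_transform_within_open[where S = "{0<..}"])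
    (use that in \<open>auto simp: W_def\<close>)
 qed
 have cont: "continuous_on {0..b} W" if "b > 0" for b
  unfolding continuous_on_eq_continuous_within
 proof
  fix r assume r: "r \<in> {0..b}"
  show "continuous (at r within {0..b}) W"
  proof (cases "r = 0")
   case False
   thus ?thesis using r deriv[of r]
    by (auto intro: continuous_at_imp_continuous_at_within has_vector_derivative_continuous)
  next
   case True
   have "((%r. K (ln r)) \<longlongrightarrow> A) (at_right 0)"
    by (rule filterlim_compose[OF A ln_at_0])
   hence "(W \<longlongrightarrow> A) (at_right 0)"
    by (rule Lim_transform_eventually) (auto simp: W_def eventually_at_right_less eventually_at_filter)
   hence "(W \<longlongrightarrow> W 0) (at 0 within {0..b})"
    using that by (simp add: W_def at_within_Icc_at_right)
   thus ?thesis using True by (simp add: continuous_within)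
  qed
 qed
 have Gb: "(G has_integral W b - A) {0..b}" if "b >= 0" for b
 proof (cases "b = 0")
  case True thus ?thesis using has_integral_refl(1)[of G "0::real"] by (simp add: W_def)
 next
  case False
  have "(G has_integral W b - W 0) {0..b}"
   using that False cont[of b] deriv by (intro fundamental_theorem_of_calculus_interior) auto
  thus ?thesis by (simp add: W_def)
 qed
 have box: "((%r. if r \<in> {0<..} then G r else 0) has_integral W b - A) {a..b}" if "a <= 0" "0 <= b" for a b
 proof -
  have "((%r. if r \<in> {0<..} then G r else 0) has_integral W b - A) {0..b}"
   by (rule has_integral_spike_finite[OF _ _ Gb[OF that(2)], of "{0}"]) auto
  moreover have "((%r. if r \<in> {0<..} then G r else 0) has_integral 0) {a..0}"
   by (rule has_integral_is_0) auto
  ultimately have "((%r. if r \<in> {0<..} then G r else 0) has_integral 0 + (W b - A)) {a..b}"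
   using that by (intro has_integral_combine[of a 0 b]) auto
  thus ?thesis by simp
 qed
 have "(G has_integral B - A) {0<..}"
  unfolding has_integral_alt'
 proof (intro conjI allI impI)
  let ?G = "%r. if r \<in> {0<..} then G r else 0"
  fix a b :: real
  have "?G integrable_on {min a 0..max b 0}" using box[of "min a 0" "max b 0"] by auto
  thus "?G integrable_on cbox a b"
   by (metis (no_types, lifting) box_real(2) integrable_on_subinterval atLeastatMost_subset_iff
     max.cobounded1 min.cobounded1)
 next
  let ?G = "%r. if r \<in> {0<..} then G r else 0"
  fix e :: real assume "e > 0"
  then obtain N where N: "!!s. s >= N ==> dist (K s) B < e"
   using tendstoD[OF B] by (auto simp: eventually_at_top_linorder)
  \<comment> \<open>Boxes containing the ball of radius e^N satisfy a <= 0 and b >= e^N; the part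
    left of 0 contributes nothing, so only the limit of K at +infinity is tested.\<close>
  have "norm (integral (cbox a b) ?G - (B - A)) < e" if ab: "ball 0 (exp N) \<subseteq> cbox a b" for a b
  proof -
   have "0 < exp N" by simp
   have sub: "x \<in> {a..b}" if "abs x < exp N" for x
    using ab that by (auto simp: subset_iff dist_norm)
   have a: "a <= 0" and b0: "0 <= b" using sub[of 0] by auto
   have b: "exp N <= b"
   proof (rule dense_le)
    fix x assume "x < exp N"
    thus "x <= b" using sub[of x] b0 by (cases "0 <= x") auto
   qed
   hence bp: "b > 0" by (smt (verit) exp_gt_zero)
   have "integral (cbox a b) ?G = W b - A" using box[OF a] bp by (simp add: integral_unique)
   moreover have "W b = K (ln b)" using bp by (simp add: W_def)
   moreover have "ln b >= N" using b bp by (metis ln_exp ln_le_cancel_iff exp_gt_zero)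
   ultimately show ?thesis using N[of "ln b"] by (simp add: dist_norm)
  qed
  thus "EX B'>0. ALL a b. ball 0 B' \<subseteq> cbox a b --> norm (integral (cbox a b) ?G - (B - A)) < e"
   by (intro exI[of _ "exp N"]) auto
 qed
 thus ?thesis using wint_eqI[OF w] by (simp add: F_def)
qed

section \<open>Cauchy's theorem in a strip\<close>

lemma Complex_eq_of_real: "Complex s t = of_real s + \<i> * of_real t"
 by (simp add: complex_eq_iff)

lemma continuous_on_Complex [continuous_intros]:
 "continuous_on S f ==> continuous_on S g ==> continuous_on S (%x. Complex (f x) (g x))"
 unfolding Complex_eq_of_real by (intro continuous_intros)

text \<open>Cauchy's theorem in differentiated form: for holomorphic H the s-derivative is 1/i times
  the t-derivative, so the vertical cross-section \<open>P\<close> changes at the rate of the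
  difference of the edge values. Integrating in s trades the two edges for the two limits of
  \<open>P\<close>, which are allowed to be nonzero.\<close>

theorem strip_integral:
 fixes H :: "complex => complex"
 assumes H: "H holomorphic_on U" and U: "open U" "!!w. p1 <= Im w ==> Im w <= p2 ==> w \<in> U"
  and p: "p1 <= p2"
 defines "P \<equiv> %s. integral {p1..p2} (%t. H (Complex s t))"
 shows strip_integral_derivative:
   "!!s. (P has_vector_derivative (H (Complex s p2) - H (Complex s p1)) / \<i>) (at s)"
  and strip_integral_limits:
   "(P \<longlongrightarrow> B) at_top ==> (P \<longlongrightarrow> A) at_bot ==>
   integrable lborel (%s. H (Complex s p2) - H (Complex s p1)) ==>
   (LINT s|lborel. H (Complex s p2) - H (Complex s p1)) = \<i> * (B - A)"
proof -
 have d: "(H has_field_derivative deriv H w) (at w)" if "p1 <= Im w" "Im w <= p2" for w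
  using holomorphic_derivI[OF H U(1)] U(2)[OF that] by blast
 have ds: "((%s. H (Complex s t)) has_vector_derivative deriv H (Complex s t)) (at s)"
  if "p1 <= t" "t <= p2" for s t
 proof -
  have "((%s. Complex s t) has_vector_derivative 1) (at s)"
   unfolding Complex_eq_of_real by (auto intro!: derivative_eq_intros)
  from field_vector_diff_chain_at[OF this d[of "Complex s t"]] that
  show ?thesis by (simp add: o_def)
 qed
 have dt: "((%t. H (Complex s t)) has_vector_derivative \<i> * deriv H (Complex s t)) (at t)"
  if "p1 <= t" "t <= p2" for s t
 proof -
  have "((%t. Complex s t) has_vector_derivative \<i>) (at t)"
   unfolding Complex_eq_of_real by (auto intro!: derivative_eq_intros)
  from field_vector_diff_chain_at[OF this d[of "Complex s t"]] that
  show ?thesis by (simp add: o_def)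
 qed
 have dH: "continuous_on U (deriv H)"
  using H U(1) holomorphic_deriv holomorphic_on_imp_continuous_on by blast
 have contH: "continuous_on U H" using H holomorphic_on_imp_continuous_on by blast
 have cont1: "continuous_on {p1..p2} (%t. H (Complex s t))" for s
  by (rule continuous_on_compose2[OF contH]) (auto intro!: continuous_intros U)
 have P': "(P has_vector_derivative (H (Complex s p2) - H (Complex s p1)) / \<i>) (at s)" for s
 proof -
  have "continuous_on (UNIV \<times> cbox p1 p2) (%x. deriv H (Complex (fst x) (snd x)))"
   by (rule continuous_on_compose2[OF dH]) (auto intro!: continuous_intros U)
  hence "((%s. integral (cbox p1 p2) (%t. H (Complex s t))) has_vector_derivative
    integral (cbox p1 p2) (%t. deriv H (Complex s t))) (at s within UNIV)"
   by (intro leibniz_rule_vector_derivative)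
    (use ds cont1 in \<open>auto simp: case_prod_beta intro!: integrable_continuous_interval
     has_vector_derivative_at_within\<close>)
  hence 1: "(P has_vector_derivative integral {p1..p2} (%t. deriv H (Complex s t))) (at s)"
   by (simp add: P_def)
  have "((%t. \<i> * deriv H (Complex s t)) has_integral H (Complex s p2) - H (Complex s p1)) {p1..p2}"
   by (rule fundamental_theorem_of_calculus[OF p])
    (use dt in \<open>auto intro: has_vector_derivative_at_within\<close>)
  hence "((%t. (1 / \<i>) * (\<i> * deriv H (Complex s t))) has_integral
    (1 / \<i>) * (H (Complex s p2) - H (Complex s p1))) {p1..p2}"
   by (rule has_integral_mult_right)
  hence "integral {p1..p2} (%t. deriv H (Complex s t)) = (H (Complex s p2) - H (Complex s p1)) / \<i>"
   by (simp add: integral_unique)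
  with 1 show ?thesis by simp
 qed
 thus "!!s. (P has_vector_derivative (H (Complex s p2) - H (Complex s p1)) / \<i>) (at s)" .
 assume lim: "(P \<longlongrightarrow> B) at_top" "(P \<longlongrightarrow> A) at_bot"
  and int: "integrable lborel (%s. H (Complex s p2) - H (Complex s p1))"
 have "continuous_on UNIV (%s. (H (Complex s p2) - H (Complex s p1)) / \<i>)"
  by (intro continuous_intros continuous_on_compose2[OF contH]) (use p in \<open>auto intro!: U\<close>)
 hence "(LINT s|lborel. (H (Complex s p2) - H (Complex s p1)) / \<i>) = B - A"
  by (intro integral_FTC_real_line[OF P'] lim integrable_divide int) auto
 hence "(LINT s|lborel. H (Complex s p2) - H (Complex s p1)) / \<i> = B - A"
  by (simp only: integral_divide_zero)
 thus "(LINT s|lborel. H (Complex s p2) - H (Complex s p1)) = \<i> * (B - A)"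
  by (simp add: field_simps)
qed

lemma cross_section_integral_tendsto:
 fixes H :: "complex => complex"
 assumes cont: "!!s. continuous_on {p1..p2} (%t. H (Complex s t))" and p: "p1 <= p2"
  and le: "\<forall>\<^sub>F s in F. \<forall>t\<in>{p1..p2}. norm (H (Complex s t) - L) <= e s" and e: "(e \<longlongrightarrow> 0) F"
 shows "((%s. integral {p1..p2} (%t. H (Complex s t))) \<longlongrightarrow> of_real (p2 - p1) * L) F"
proof (rule Lim_null_comparison[THEN Lim_null[THEN iffD2]])
 show "((%s. (p2 - p1) * e s) \<longlongrightarrow> 0) F" using tendsto_mult_left[OF e, of "p2 - p1"] by simp
 show "\<forall>\<^sub>F s in F. norm (integral {p1..p2} (%t. H (Complex s t)) - of_real (p2 - p1) * L) <= (p2 - p1) * e s"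
  using le
 proof eventually_elim
  case (elim s)
  have "integral {p1..p2} (%t. H (Complex s t)) - of_real (p2 - p1) * L =
    integral {p1..p2} (%t. H (Complex s t) - L)"
   by (subst Henstock_Kurzweil_Integration.integral_diff)
    (use cont p in \<open>auto intro: integrable_continuous_interval simp: scaleR_conv_of_real\<close>)
  also have "norm ... <= integral {p1..p2} (%t. e s)"
   by (rule integral_norm_bound_integral)
    (use elim cont in \<open>auto intro!: integrable_continuous_interval continuous_intros\<close>)
  finally show ?case using p by simp
 qed
qed

subsection \<open>Exponentially decaying functions\<close>

text \<open>With r = e^(Re v) and c = cos(Im v) the squares differ by (1 - c)/2 times (1 - r)^2.
  Every half-angle cosine in the final constant originates here.\<close>

lemma norm_one_plus_exp_ge:
 "abs (cos (Im v / 2)) * (1 + exp (Re v)) <= norm (1 + exp v)"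
proof (rule power2_le_imp_le)
 define r c where "r = exp (Re v)" and "c = cos (Im v)"
 have "(norm (1 + exp v))^2 = (1 + r * c)^2 + (r * sin (Im v))^2"
  by (simp add: cmod_power2 Re_exp Im_exp r_def c_def)
 also have "... = 1 + 2 * r * c + r^2 * (c^2 + (sin (Im v))^2)"
  by (simp add: power2_eq_square algebra_simps)
 also have "... = 1 + 2 * r * c + r^2" by (simp add: c_def)
 finally have 1: "(norm (1 + exp v))^2 = 1 + 2 * r * c + r^2" .
 have c: "c = 2 * (cos (Im v / 2))^2 - 1" using cos_double_cos[of "Im v / 2"] by (simp add: c_def)
 have "(abs (cos (Im v / 2)) * (1 + r))^2 = (1 + c) / 2 * (1 + r)^2"
  by (simp add: c power_mult_distrib)
 also have "... = 1 + 2 * r * c + r^2 - (1 - c) / 2 * (1 - r)^2"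
  by (simp add: power2_eq_square field_simps)
 also have "... <= 1 + 2 * r * c + r^2" by (simp add: c_def)
 finally show "(abs (cos (Im v / 2)) * (1 + exp (Re v)))^2 <= (norm (1 + exp v))^2"
  using 1 by (simp add: r_def)
qed simp

lemma norm_one_minus_exp_ge:
 "abs (sin (Im v / 2)) * (1 + exp (Re v)) <= norm (1 - exp v)"
proof -
 have "exp (v + \<i> * of_real pi) = - exp v" by (simp add: exp_add)
 hence "abs (cos (Im v / 2 + pi / 2)) * (1 + exp (Re v)) <= norm (1 - exp v)"
  using norm_one_plus_exp_ge[of "v + \<i> * of_real pi"] by (simp add: add_divide_distrib)
 thus ?thesis by (simp add: cos_add)
qed

lemma integrable_exp_neg_abs: "integrable lborel (%s::real. exp (- abs s))"
 and integral_exp_neg_abs: "(LINT s|lborel. exp (- abs s)) = (2::real)"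
proof -
 have "(\<integral>\<^sup>+ s. ennreal (exp (- s)) * indicator {0..} s \<partial>lborel) = ennreal (0 - (- exp (- 0)))"
 proof (rule nn_integral_FTC_atLeast)
  show "((%s::real. - exp (- s)) \<longlongrightarrow> 0) at_top"
   using tendsto_minus[OF filterlim_compose[OF exp_at_bot filterlim_uminus_at_bot_at_top]] by simp
 qed (auto intro!: derivative_eq_intros)
 hence pos: "(\<integral>\<^sup>+ s. ennreal (exp (- s)) * indicator {0..} s \<partial>lborel) = 1" by simp
 have "(\<integral>\<^sup>+ s. ennreal (exp s) * indicator {..0} s \<partial>lborel) =
   (\<integral>\<^sup>+ s. ennreal (exp (- s)) * indicator {0..} s \<partial>lborel)"
  by (subst nn_integral_real_affine[where c = "-1" and t = 0]) (auto simp: indicator_def)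
 hence neg: "(\<integral>\<^sup>+ s. ennreal (exp s) * indicator {..0} s \<partial>lborel) = 1" using pos by simp
 have "(\<integral>\<^sup>+ s. ennreal (exp (- abs s)) \<partial>lborel) =
   (\<integral>\<^sup>+ s. ennreal (exp s) * indicator {..0} s + ennreal (exp (- s)) * indicator {0..} s \<partial>(lborel::real measure))"
  by (rule nn_integral_cong_AE, rule AE_I[of _ _ "{0::real}"]) (auto simp: indicator_def)
 also have "... = 1 + 1" using pos neg by (subst nn_integral_add) auto
 finally have "has_bochner_integral lborel (%s::real. exp (- abs s)) 2"
  by (intro has_bochner_integral_nn_integral) auto
 thus "integrable lborel (%s::real. exp (- abs s))"
  "(LINT s|lborel. exp (- abs s)) = (2::real)"
  by (auto simp: has_bochner_integral_iff)
qed

lemma exp_neg_abs_tendsto_0: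
 "((%s::real. exp (- abs s)) \<longlongrightarrow> 0) at_top" "((%s::real. exp (- abs s)) \<longlongrightarrow> 0) at_bot"
proof -
 have "((%s::real. exp (- s)) \<longlongrightarrow> 0) at_top"
  using filterlim_compose[OF exp_at_bot filterlim_uminus_at_bot_at_top] by simp
 thus "((%s::real. exp (- abs s)) \<longlongrightarrow> 0) at_top"
  by (rule Lim_transform_eventually)
   (auto intro: eventually_mono[OF eventually_ge_at_top[of 0]])
 have "((%s::real. exp s) \<longlongrightarrow> 0) at_bot" by (rule exp_at_bot)
 thus "((%s::real. exp (- abs s)) \<longlongrightarrow> 0) at_bot"
  by (rule Lim_transform_eventually)
   (auto intro: eventually_mono[OF eventually_le_at_bot[of 0]])
qed

text \<open>In the variable l = e^w this is decay like min(|l|, 1/|l|). Holomorphy is asked for on a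
  slightly larger open strip, so that both edges are interior, while the bound concerns the closed
  strip only.\<close>

definition strip_decay :: "real => (complex => complex) => bool" where
 "strip_decay a h \<longleftrightarrow> (EX c>a. h holomorphic_on {w. abs (Im w) < c}) \<and>
  (EX C>=0. ALL w. abs (Im w) <= a --> norm (h w) <= C * exp (- abs (Re w)))"

lemma open_strip: "open {w. abs (Im w) < c}"
 by (intro open_Collect_less continuous_intros)

lemma strip_decay_mult:
 assumes h: "strip_decay a h" and g: "g holomorphic_on {w. abs (Im w) < c}" "a < c"
  and le: "!!w. abs (Im w) <= a ==> norm (g w) <= D"
 shows "strip_decay a (%w. h w * g w)"
proof -
 obtain c' C where c': "c' > a" "h holomorphic_on {w. abs (Im w) < c'}" and C: "C >= 0"
  "!!w. abs (Im w) <= a ==> norm (h w) <= C * exp (- abs (Re w))"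
  using h unfolding strip_decay_def by blast
 have "(%w. h w * g w) holomorphic_on {w. abs (Im w) < min c c'}"
  by (intro holomorphic_on_mult holomorphic_on_subset[OF c'(2)] holomorphic_on_subset[OF g(1)]) auto
 moreover have "norm (h w * g w) <= (C * abs D) * exp (- abs (Re w))" if "abs (Im w) <= a" for w
 proof -
  have "norm (h w) * norm (g w) <= (C * exp (- abs (Re w))) * abs D"
   by (intro mult_mono C that) (use le[OF that] C in auto)
  thus ?thesis by (simp add: norm_mult mult_ac)
 qed
 ultimately show ?thesis unfolding strip_decay_def using c'(1) g(2) C(1)
  by (intro conjI exI[of _ "min c c'"] exI[of _ "C * abs D"]) auto
qed

lemma strip_decay_continuous:
 assumes "strip_decay a h" "abs t <= a"
 shows "continuous_on UNIV (%s. h (Complex s t))"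
proof -
 obtain c where "c > a" "h holomorphic_on {w. abs (Im w) < c}"
  using assms unfolding strip_decay_def by blast
 thus ?thesis using assms(2)
  by (intro continuous_on_compose2[OF holomorphic_on_imp_continuous_on, of h "{w. abs (Im w) < c}"])
   (auto intro!: continuous_intros)
qed

lemma strip_decay_bound:
 assumes "strip_decay a h"
 obtains C where "C >= 0" "!!s t. abs t <= a ==> norm (h (Complex s t)) <= C * exp (- abs s)"
proof -
 obtain C where "C >= 0" "!!w. abs (Im w) <= a ==> norm (h w) <= C * exp (- abs (Re w))"
  using assms unfolding strip_decay_def by blast
 thus ?thesis using that[of C] by (metis complex.sel)
qed

lemma strip_decay_integrable:
 assumes "strip_decay a h" "abs t <= a"
 shows "integrable lborel (%s. h (Complex s t))"
proof -
 obtain C where C: "!!s t. abs t <= a ==> norm (h (Complex s t)) <= C * exp (- abs s)"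
  using strip_decay_bound[OF assms(1)] by metis
 show ?thesis
  by (rule integrable_continuous_dominated[OF strip_decay_continuous[OF assms] C[OF assms(2)]])
   (auto intro: integrable_exp_neg_abs)
qed

lemma strip_decay_mono: "strip_decay b h ==> a <= b ==> strip_decay a h"
 unfolding strip_decay_def by (meson order.strict_trans1 order_trans)

lemma cauchy_decaying:
 fixes H :: "complex => complex"
 assumes H: "H holomorphic_on U" and U: "open U" "!!w. p1 <= Im w ==> Im w <= p2 ==> w \<in> U"
  and p: "p1 <= p2"
  and le: "!!s t. p1 <= t ==> t <= p2 ==> norm (H (Complex s t)) <= C * exp (- abs s)"
 shows "(LINT s|lborel. H (Complex s p2) - H (Complex s p1)) = 0"
proof -
 have contH: "continuous_on U H" using H holomorphic_on_imp_continuous_on by blast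
 have cs: "continuous_on UNIV (%s. H (Complex s t))" if "p1 <= t" "t <= p2" for t
  by (rule continuous_on_compose2[OF contH]) (use that in \<open>auto intro!: continuous_intros U\<close>)
 have ct: "continuous_on {p1..p2} (%t. H (Complex s t))" for s
  by (rule continuous_on_compose2[OF contH]) (auto intro!: continuous_intros U)
 have int: "integrable lborel (%s. H (Complex s t))" if "p1 <= t" "t <= p2" for t
  by (rule integrable_continuous_dominated[OF cs[OF that] le[OF that]])
   (auto intro: integrable_exp_neg_abs)
 have "((%s. integral {p1..p2} (%t. H (Complex s t))) \<longlongrightarrow> of_real (p2 - p1) * 0) F"
  if "((%s::real. exp (- abs s)) \<longlongrightarrow> 0) F" for F
  by (rule cross_section_integral_tendsto[OF ct p, where e = "%s. C * exp (- abs s)"])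
   (use le tendsto_mult_left[OF that, of C] in auto)
 from this[OF exp_neg_abs_tendsto_0(1)] this[OF exp_neg_abs_tendsto_0(2)]
 show ?thesis
  using strip_integral_limits[OF H U p, of 0 0] int p by simp
qed

lemma strip_decay_cauchy:
 assumes h: "strip_decay a h" and a: "0 <= a"
 shows "(LINT s|lborel. h (Complex s a) - h (Complex s (- a))) = 0"
proof -
 obtain c where c: "c > a" "h holomorphic_on {w. abs (Im w) < c}" using h unfolding strip_decay_def by blast
 obtain C where C: "!!s t. abs t <= a ==> norm (h (Complex s t)) <= C * exp (- abs s)"
  using strip_decay_bound[OF h] by metis
 show ?thesis
  by (rule cauchy_decaying[OF c(2) open_strip, where C = C]) (use c a C in auto)
qed

lemma exp_ratio_le_exp_neg_abs: "exp x / (1 + exp x)^2 <= exp (- abs (x::real))"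
proof (cases "0 <= x")
 case True
 have "exp x * exp x <= (1 + exp x)^2" by (simp add: power2_eq_square algebra_simps)
 moreover have "0 < (1 + exp x)^2" by (intro zero_less_power add_pos_pos) auto
 ultimately have "exp x / (1 + exp x)^2 <= 1 / exp x"
  by (simp add: field_simps)
 thus ?thesis using True by (simp add: exp_minus divide_inverse)
next
 case False
 have "1 <= (1 + exp x)^2" by (rule one_le_power) simp
 moreover have "0 < (1 + exp x)^2" by (intro zero_less_power add_pos_pos) auto
 ultimately have "exp x / (1 + exp x)^2 <= exp x / 1"
  by (intro divide_left_mono) auto
 thus ?thesis using False by simp
qed

subsection \<open>The Cauchy kernel of a sector in logarithmic coordinates\<close>

text \<open>The form dl/(l - m) with l = e^w and m = e^z, written as a multiple of dw. It tends to 1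
  as Re w tends to +infinity and to 0 as Re w tends to -infinity.\<close>

definition cauchy_kernel :: "complex => complex => complex" where
 "cauchy_kernel z w = 1 / (1 - exp (z - w))"

lemma exp_eq_one_strip: "abs (Im v) < 2 * pi ==> exp v = 1 \<longleftrightarrow> v = 0"
proof
 assume v: "abs (Im v) < 2 * pi" "exp v = 1"
 then obtain n :: int where n: "Re v = 0" "Im v = of_int (2 * n) * pi" by (auto simp: exp_eq_1)
 hence "abs (real_of_int n) < 1" using v(1) by (simp add: abs_mult)
 hence "n = 0" by linarith
 thus "v = 0" using n by (simp add: complex_eq_iff)
qed auto

lemma cauchy_kernel_bound:
 assumes "0 < abs (Im (z - w))" "abs (Im (z - w)) < 2 * pi"
 shows "norm (cauchy_kernel z w) <= 1 / abs (sin (Im (z - w) / 2))"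
  "norm (cauchy_kernel z w - 1) <= 1 / abs (sin (Im (z - w) / 2))"
  "norm (cauchy_kernel z w) <= exp (Re (w - z)) / abs (sin (Im (z - w) / 2))"
  "norm (cauchy_kernel z w - 1) <= exp (Re (z - w)) / abs (sin (Im (z - w) / 2))"
proof -
 define v k where "v = z - w" and "k = abs (sin (Im v / 2))"
 have k: "k > 0"
 proof (cases "Im v > 0")
  case True thus ?thesis using assms sin_gt_zero[of "Im v / 2"] by (simp add: k_def v_def)
 next
  case False
  hence "sin (- (Im v / 2)) > 0" using assms by (intro sin_gt_zero) (auto simp: v_def field_simps)
  thus ?thesis by (simp add: k_def)
 qed
 have n: "norm (1 - exp v) >= k * (1 + exp (Re v))"
  using norm_one_minus_exp_ge[of v] by (simp add: k_def)
 have pos: "0 < k * (1 + exp (Re v))" using k by (simp add: add_pos_pos)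
 hence nz: "exp v ~= 1" using n by auto
 have 1: "norm (cauchy_kernel z w) <= 1 / (k * (1 + exp (Re v)))"
  using n pos by (simp add: cauchy_kernel_def v_def[symmetric] norm_divide frac_le)
 have eq: "cauchy_kernel z w - 1 = exp v / (1 - exp v)"
  using nz by (simp add: cauchy_kernel_def v_def[symmetric] field_simps)
 have 2: "norm (cauchy_kernel z w - 1) <= exp (Re v) / (k * (1 + exp (Re v)))"
  using n pos by (simp add: eq norm_divide frac_le)
 have le: "1 / (1 + exp (Re v)) <= 1" "1 / (1 + exp (Re v)) <= exp (- Re v)"
  "exp (Re v) / (1 + exp (Re v)) <= 1" "exp (Re v) / (1 + exp (Re v)) <= exp (Re v)"
  by (simp_all add: divide_le_eq add_pos_pos exp_minus field_simps)
 have eqs: "1 / (k * (1 + exp (Re v))) = 1 / (1 + exp (Re v)) / k"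
  "exp (Re v) / (k * (1 + exp (Re v))) = exp (Re v) / (1 + exp (Re v)) / k" by (simp_all add: mult.commute)
 have div: "x / k <= y / k" if "x <= y" for x y using that k by (simp add: divide_right_mono)
 note b = order_trans[OF 1[unfolded eqs] div] order_trans[OF 2[unfolded eqs] div]
 show "norm (cauchy_kernel z w) <= 1 / abs (sin (Im (z - w) / 2))"
  "norm (cauchy_kernel z w - 1) <= 1 / abs (sin (Im (z - w) / 2))"
  "norm (cauchy_kernel z w) <= exp (Re (w - z)) / abs (sin (Im (z - w) / 2))"
  "norm (cauchy_kernel z w - 1) <= exp (Re (z - w)) / abs (sin (Im (z - w) / 2))"
  using b(1)[OF le(1)] b(1)[OF le(2)] b(2)[OF le(3)] b(2)[OF le(4)] by (simp_all add: k_def v_def)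
qed

lemma cauchy_kernel_holomorphic:
 assumes "!!w. w \<in> U ==> exp (z - w) ~= 1" shows "cauchy_kernel z holomorphic_on U"
 unfolding cauchy_kernel_def using assms by (intro holomorphic_intros) auto

lemma cauchy_kernel_tendsto:
 "\<forall>\<^sub>F s in at_top. ALL t. norm (cauchy_kernel z (Complex s t) - 1) <= 2 * exp (Re z - s)"
 "\<forall>\<^sub>F s in at_bot. ALL t. norm (cauchy_kernel z (Complex s t)) <= 2 * exp (s - Re z)"
proof -
 have "norm (cauchy_kernel z (Complex s t) - 1) <= 2 * exp (Re z - s)" if s: "s >= Re z + 1" for s t
 proof -
  define v where "v = z - Complex s t"
  have r: "norm (exp v) <= 1 / 2"
  proof -
   have "exp (Re v) <= exp (-1)" using s by (simp add: v_def)
   also have "exp (-1) <= (1/2::real)" using exp_ge_add_one_self[of 1] by (simp add: exp_minus field_simps)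
   finally show ?thesis by simp
  qed
  have n: "norm (1 - exp v) >= 1 / 2" using norm_triangle_ineq2[of 1 "exp v"] r by simp
  hence "exp v ~= 1" by auto
  hence "cauchy_kernel z (Complex s t) - 1 = exp v / (1 - exp v)"
   by (simp add: cauchy_kernel_def v_def[symmetric] field_simps)
  also have "norm ... <= norm (exp v) / (1/2)"
   unfolding norm_divide by (rule divide_left_mono) (use n in auto)
  finally show ?thesis by (simp add: v_def)
 qed
 thus "\<forall>\<^sub>F s in at_top. ALL t. norm (cauchy_kernel z (Complex s t) - 1) <= 2 * exp (Re z - s)"
  by (intro eventually_mono[OF eventually_ge_at_top[of "Re z + 1"]]) blast
 have "norm (cauchy_kernel z (Complex s t)) <= 2 * exp (s - Re z)" if s: "s <= Re z - 1" for s t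
 proof -
  define v where "v = z - Complex s t"
  have "(2::real) <= exp 1" using exp_ge_add_one_self[of "1::real"] by simp
  also have "exp 1 <= exp (Re v)" using s by (simp add: v_def)
  finally have r: "norm (exp v) >= 2" by simp
  have n: "norm (1 - exp v) >= norm (exp v) / 2"
   using norm_triangle_ineq2[of "exp v" 1] r norm_minus_commute[of 1 "exp v"]
   unfolding norm_one by linarith
  have "norm (cauchy_kernel z (Complex s t)) <= 1 / (norm (exp v) / 2)"
   unfolding cauchy_kernel_def v_def[symmetric] norm_divide norm_one
   by (rule divide_left_mono) (use n r in \<open>auto intro!: mult_pos_pos\<close>)
  also have "... = 2 * exp (- Re v)" unfolding norm_exp_eq_Re exp_minus by (simp only: divide_simps) simp
  also have "- Re v = s - Re z" by (simp add: v_def)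
  finally show ?thesis .
 qed
 thus "\<forall>\<^sub>F s in at_bot. ALL t. norm (cauchy_kernel z (Complex s t)) <= 2 * exp (s - Re z)"
  by (intro eventually_mono[OF eventually_le_at_bot[of "Re z - 1"]]) blast
qed

lemma exp_shift_tendsto_0: "((%s::real. 2 * exp (c - s)) \<longlongrightarrow> 0) at_top" "((%s::real. 2 * exp (s - c)) \<longlongrightarrow> 0) at_bot"
proof -
 have "((%s. 2 * exp c * exp (- s)) \<longlongrightarrow> 2 * exp c * 0) at_top"
  by (intro tendsto_mult_left filterlim_compose[OF exp_at_bot filterlim_uminus_at_bot_at_top])
 thus "((%s::real. 2 * exp (c - s)) \<longlongrightarrow> 0) at_top" by (simp add: exp_diff exp_minus divide_inverse mult.assoc)
 have "((%s. 2 * exp (-c) * exp s) \<longlongrightarrow> 2 * exp (-c) * 0) at_bot"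
  by (intro tendsto_mult_left exp_at_bot)
 thus "((%s::real. 2 * exp (s - c)) \<longlongrightarrow> 0) at_bot"
  by (simp add: exp_diff exp_minus divide_inverse mult_ac)
qed

text \<open>The kernel has period 2 pi i, so the lower edge may be moved up to height 2 pi - b.
  Between b and 2 pi - b there is no pole, and the cross-sections tend to the width of that strip on
  the right and to 0 on the left.\<close>

lemma cauchy_kernel_difference_integral:
 assumes z: "abs (Im z) < b" and b: "b < pi"
 shows "integrable lborel (%s. cauchy_kernel z (Complex s (- b)) - cauchy_kernel z (Complex s b))"
  "(LINT s|lborel. cauchy_kernel z (Complex s (- b)) - cauchy_kernel z (Complex s b)) = \<i> * of_real (2 * pi - 2 * b)"
proof -
 define U where "U = {w. Im z < Im w \<and> Im w < Im z + 2 * pi}"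
 have U: "open U" unfolding U_def
  by (intro open_Collect_conj open_Collect_less continuous_intros)
 have nz: "exp (z - w) ~= 1" if "w \<in> U" for w
 proof -
  have "abs (Im (z - w)) < 2 * pi" "z - w ~= 0" using that by (auto simp: U_def)
  thus ?thesis using exp_eq_one_strip by blast
 qed
 have sub: "w \<in> U" if "b <= Im w" "Im w <= 2 * pi - b" for w
  using z b that by (auto simp: U_def)
 have per: "cauchy_kernel z (Complex s (2 * pi - b)) = cauchy_kernel z (Complex s (- b))" for s
 proof -
  have "z - Complex s (- b) = z - Complex s (2 * pi - b) + 2 * of_real pi * \<i>"
   by (simp add: complex_eq_iff)
  thus ?thesis unfolding cauchy_kernel_def by (simp only: exp_add exp_two_pi_i mult_1_right)
 qed
 have hol: "cauchy_kernel z holomorphic_on U" by (rule cauchy_kernel_holomorphic[OF nz])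
 have ck: "continuous_on U (cauchy_kernel z)" using hol holomorphic_on_imp_continuous_on by blast
 have cs: "continuous_on UNIV (%s. cauchy_kernel z (Complex s t))" if "b <= t" "t <= 2 * pi - b" for t
  by (rule continuous_on_compose2[OF ck]) (use that in \<open>auto intro!: continuous_intros sub\<close>)
 have ct: "continuous_on {b..2 * pi - b} (%t. cauchy_kernel z (Complex s t))" for s
  by (rule continuous_on_compose2[OF ck]) (auto intro!: continuous_intros sub)
 define k where "k t = 1 / abs (sin (Im (z - Complex 0 t) / 2))" for t
 let ?D = "%s. cauchy_kernel z (Complex s (2 * pi - b)) - cauchy_kernel z (Complex s b)"
 have le: "norm (?D s) <= (k (2 * pi - b) + k b) * exp (abs (Re z)) * exp (- abs s)" for s
 proof -
  have kp: "0 <= k t" for t by (simp add: k_def)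
  have i: "0 < abs (Im (z - Complex s t)) \<and> abs (Im (z - Complex s t)) < 2 * pi \<and> Im (z - Complex s t) = Im (z - Complex 0 t)"
   if "b <= t" "t <= 2 * pi - b" for t
   using z b that by auto
  have e1: "norm (cauchy_kernel z (Complex s t)) <= k t * exp (s - Re z)"
   "norm (cauchy_kernel z (Complex s t) - 1) <= k t * exp (Re z - s)" if "b <= t" "t <= 2 * pi - b" for t
   using cauchy_kernel_bound(3,4)[of z "Complex s t"] i[OF that] by (simp_all add: k_def)
  show ?thesis
  proof (cases "s <= 0")
   case True
   have "norm (?D s) <= k (2 * pi - b) * exp (s - Re z) + k b * exp (s - Re z)"
    using e1(1)[of "2 * pi - b"] e1(1)[of b] z b
    by (intro order_trans[OF norm_triangle_ineq4]) (auto intro!: add_mono)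
   also have "... = (k (2 * pi - b) + k b) * (exp (- Re z) * exp (- abs s))"
    using True by (simp add: distrib_right exp_add[symmetric])
   also have "... <= (k (2 * pi - b) + k b) * (exp (abs (Re z)) * exp (- abs s))"
    using kp by (intro mult_left_mono mult_right_mono) auto
   finally show ?thesis by simp
  next
   case False
   have "norm (?D s) = norm ((cauchy_kernel z (Complex s (2 * pi - b)) - 1) - (cauchy_kernel z (Complex s b) - 1))"
    by simp
   also have "... <= k (2 * pi - b) * exp (Re z - s) + k b * exp (Re z - s)"
    using e1(2)[of "2 * pi - b"] e1(2)[of b] z b
    by (intro order_trans[OF norm_triangle_ineq4]) (auto intro!: add_mono)
   also have "... = (k (2 * pi - b) + k b) * (exp (Re z) * exp (- abs s))"
    using False by (simp add: distrib_right exp_add[symmetric])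
   also have "... <= (k (2 * pi - b) + k b) * (exp (abs (Re z)) * exp (- abs s))"
    using kp by (intro mult_left_mono mult_right_mono) auto
   finally show ?thesis by simp
  qed
 qed
 have int: "integrable lborel ?D"
  by (rule integrable_continuous_dominated[OF _ le])
   (use cs z b in \<open>auto intro!: continuous_on_diff integrable_mult_right integrable_exp_neg_abs\<close>)
 thus "integrable lborel (%s. cauchy_kernel z (Complex s (- b)) - cauchy_kernel z (Complex s b))"
  by (simp add: per)
 have "(LINT s|lborel. ?D s) = \<i> * (of_real (2 * pi - b - b) * 1 - of_real (2 * pi - b - b) * 0)"
 proof (rule strip_integral_limits[OF hol U _ _ _ _ int])
  show "((%s. integral {b..2 * pi - b} (%t. cauchy_kernel z (Complex s t))) \<longlongrightarrow> of_real (2 * pi - b - b) * 1) at_top"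
   by (rule cross_section_integral_tendsto[OF ct _ eventually_mono[OF cauchy_kernel_tendsto(1)] exp_shift_tendsto_0(1)])
    (use b in auto)
  show "((%s. integral {b..2 * pi - b} (%t. cauchy_kernel z (Complex s t))) \<longlongrightarrow> of_real (2 * pi - b - b) * 0) at_bot"
   by (rule cross_section_integral_tendsto[OF ct _ eventually_mono[OF cauchy_kernel_tendsto(2)] exp_shift_tendsto_0(2)])
    (use b in auto)
 qed (use b sub in auto)
 thus "(LINT s|lborel. cauchy_kernel z (Complex s (- b)) - cauchy_kernel z (Complex s b)) = \<i> * of_real (2 * pi - 2 * b)"
  by (simp add: per)
qed

text \<open>Subtracting the constant h(z) removes the pole at the price of the contour integral of
  the kernel itself. The regular part contributes the height 2b of the strip, the kernel the
  remaining 2 pi - 2b.\<close>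

theorem strip_cauchy_formula:
 assumes h: "strip_decay b h" and z: "abs (Im z) < b" and b: "b < pi"
 shows "integrable lborel (%s. h (Complex s (- b)) * cauchy_kernel z (Complex s (- b)) -
   h (Complex s b) * cauchy_kernel z (Complex s b))"
  "(LINT s|lborel. h (Complex s (- b)) * cauchy_kernel z (Complex s (- b)) -
   h (Complex s b) * cauchy_kernel z (Complex s b)) = 2 * of_real pi * \<i> * h z"
proof -
 obtain c' where c': "c' > b" "h holomorphic_on {w. abs (Im w) < c'}" using h unfolding strip_decay_def by blast
 \<comment> \<open>The kernel also has poles at z + 2 pi i k with k nonzero; since |Im z| < b,
   height 2 pi - b stays clear of them.\<close>
 define c where "c = min c' (2 * pi - b)"
 have c: "c > b" "h holomorphic_on {w. abs (Im w) < c}"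
  using c'(1) b holomorphic_on_subset[OF c'(2), of "{w. abs (Im w) < c}"] by (auto simp: c_def)
 have nz: "exp (z - w) ~= 1" if "abs (Im w) < c" "w ~= z" for w
 proof -
  have "abs (Im (z - w)) < 2 * pi" using that z by (auto simp: c_def)
  moreover have "z - w ~= 0" using that by auto
  ultimately show ?thesis using exp_eq_one_strip by blast
 qed
 obtain C where C: "C >= 0" "!!s t. abs t <= b ==> norm (h (Complex s t)) <= C * exp (- abs s)"
  using strip_decay_bound[OF h] by metis
 let ?S = "{w. abs (Im w) < c}"
 have zS: "z \<in> ?S" using z c(1) by simp
 \<comment> \<open>Both quotients by w - z have removable singularities and D has no zero, so N / D
   is the holomorphic continuation of (h - h(z)) times the kernel.\<close>
 define N where "N w = (if w = z then deriv h z else (h w - h z) / (w - z))" for w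
 define E where "E w = 1 - exp (z - w)" for w
 define D where "D w = (if w = z then deriv E z else (E w - E z) / (w - z))" for w
 have holN: "N holomorphic_on ?S" unfolding N_def by (rule pole_lemma_open[OF c(2) open_strip])
 have holD: "D holomorphic_on ?S" unfolding D_def
  by (rule pole_lemma_open[OF _ open_strip]) (unfold E_def, intro holomorphic_intros)
 have "(E has_field_derivative 1) (at z)" unfolding E_def by (auto intro!: derivative_eq_intros)
 hence "deriv E z = 1" by (rule DERIV_imp_deriv)
 hence D0: "D w ~= 0" if "w \<in> ?S" for w
  using nz[of w] that by (auto simp: D_def E_def)
 define H where "H w = N w / D w" for w
 have holH: "H holomorphic_on ?S" unfolding H_def by (intro holomorphic_on_divide holN holD D0)
 have H: "H w = (h w - h z) * cauchy_kernel z w" if "w ~= z" for w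
  using that by (simp add: H_def N_def D_def E_def cauchy_kernel_def)
 have contH: "continuous_on ?S H" using holH holomorphic_on_imp_continuous_on by blast
 have ct: "continuous_on {-b..b} (%t. H (Complex s t))" for s
  by (rule continuous_on_compose2[OF contH]) (use c in \<open>auto intro!: continuous_intros\<close>)
 have Hb: "H (Complex s b) = (h (Complex s b) - h z) * cauchy_kernel z (Complex s b)"
  "H (Complex s (-b)) = (h (Complex s (-b)) - h z) * cauchy_kernel z (Complex s (-b))" for s
  using z by (intro H; auto)+
 have ub: "0 < abs (Im (z - Complex s t))" "abs (Im (z - Complex s t)) < 2 * pi" if "t = b \<or> t = - b" for s t
  using z b that by auto
 have inthk: "integrable lborel (%s. h (Complex s t) * cauchy_kernel z (Complex s t))" if t: "t = b \<or> t = - b" for t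
 proof (rule integrable_continuous_dominated)
  have "exp (z - Complex s t) ~= 1" for s
  proof (rule nz)
   show "Complex s t ~= z" using t z by auto
  qed (use t z c in auto)
  moreover have "abs t <= b" using t z by auto
  ultimately show "continuous_on UNIV (%s. h (Complex s t) * cauchy_kernel z (Complex s t))"
   unfolding cauchy_kernel_def
   by (intro continuous_intros strip_decay_continuous[OF h]) auto
  show "norm (h (Complex s t) * cauchy_kernel z (Complex s t)) <=
    (C * exp (- abs s)) * (1 / abs (sin (Im (z - Complex 0 t) / 2)))" for s
   unfolding norm_mult using cauchy_kernel_bound(1)[OF ub[OF t]] C t z
   by (intro mult_mono) auto
  show "integrable lborel (%s. (C * exp (- abs s)) * (1 / abs (sin (Im (z - Complex 0 t) / 2))))"
   by (intro integrable_mult_left integrable_mult_right integrable_exp_neg_abs)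
 qed
 let ?hk = "%s. h (Complex s (- b)) * cauchy_kernel z (Complex s (- b)) - h (Complex s b) * cauchy_kernel z (Complex s b)"
 let ?kk = "%s. cauchy_kernel z (Complex s (- b)) - cauchy_kernel z (Complex s b)"
 show int: "integrable lborel ?hk" using inthk[of b] inthk[of "-b"] by auto
 have eq: "H (Complex s b) - H (Complex s (-b)) = h z * ?kk s - ?hk s" for s
  unfolding Hb by (simp add: algebra_simps)
 note kk = cauchy_kernel_difference_integral[OF z b]
 have intH: "integrable lborel (%s. H (Complex s b) - H (Complex s (-b)))"
  unfolding eq by (rule Bochner_Integration.integrable_diff[OF integrable_mult_right[OF kk(1)] int])
 have "(LINT s|lborel. H (Complex s b) - H (Complex s (- b))) = \<i> * (of_real (b - - b) * (- h z) - of_real (b - - b) * 0)"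
 proof (rule strip_integral_limits[OF holH open_strip _ _ _ _ intH])
  have norms: "norm (h (Complex s t)) <= C * exp (- abs s)" if "t \<in> {-b..b}" for s t using C(2)[of t s] that by auto
  have neq: "\<forall>\<^sub>F s in at_top. ALL t. Complex s t ~= z" "\<forall>\<^sub>F s in at_bot. ALL t. Complex s t ~= z"
   by (auto intro: eventually_mono[OF eventually_gt_at_top[of "Re z"]]
      eventually_mono[OF eventually_gt_at_bot[of "Re z"]])
  show "((%s. integral {- b..b} (%t. H (Complex s t))) \<longlongrightarrow> of_real (b - - b) * (- h z)) at_top"
  proof (rule cross_section_integral_tendsto[OF ct])
   let ?e = "%s. (C + norm (h z)) * (2 * exp (Re z - s)) + C * exp (- abs s)"
   show "\<forall>\<^sub>F s in at_top. \<forall>t\<in>{- b..b}. norm (H (Complex s t) - - h z) <= ?e s"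
    using cauchy_kernel_tendsto(1)[of z] neq(1)
   proof eventually_elim
    case (elim s)
    show ?case
    proof
     fix t assume t: "t \<in> {-b..b}"
     define k where "k = cauchy_kernel z (Complex s t)"
     have "norm (h (Complex s t)) <= C * 1" using norms[OF t, of s] C(1)
      by (elim order_trans) (intro mult_left_mono; auto)
     hence "norm (h (Complex s t) - h z) <= C + norm (h z)"
      using norm_triangle_ineq4[of "h (Complex s t)" "h z"] by simp
     hence "norm ((h (Complex s t) - h z) * (k - 1)) <= (C + norm (h z)) * (2 * exp (Re z - s))"
      unfolding norm_mult using elim by (intro mult_mono) (auto simp: k_def C)
     moreover have "H (Complex s t) - - h z = (h (Complex s t) - h z) * (k - 1) + h (Complex s t)"
      using elim by (simp add: H k_def algebra_simps)
     ultimately show "norm (H (Complex s t) - - h z) <= ?e s"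
      using norm_triangle_ineq[of "(h (Complex s t) - h z) * (k - 1)" "h (Complex s t)"] norms[OF t, of s]
      by simp
    qed
   qed
   have "(?e \<longlongrightarrow> (C + norm (h z)) * 0 + C * 0) at_top"
    by (intro tendsto_add tendsto_mult_left exp_shift_tendsto_0 exp_neg_abs_tendsto_0)
   thus "(?e \<longlongrightarrow> 0) at_top" by simp
  qed (use z in auto)
  show "((%s. integral {- b..b} (%t. H (Complex s t))) \<longlongrightarrow> of_real (b - - b) * 0) at_bot"
  proof (rule cross_section_integral_tendsto[OF ct])
   let ?e = "%s. (C + norm (h z)) * (2 * exp (s - Re z))"
   show "\<forall>\<^sub>F s in at_bot. \<forall>t\<in>{- b..b}. norm (H (Complex s t) - 0) <= ?e s"
    using cauchy_kernel_tendsto(2)[of z] neq(2)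
   proof eventually_elim
    case (elim s)
    show ?case
    proof
     fix t assume t: "t \<in> {-b..b}"
     have "norm (h (Complex s t)) <= C * 1" using norms[OF t, of s] C(1)
      by (elim order_trans) (intro mult_left_mono; auto)
     hence "norm (h (Complex s t) - h z) <= C + norm (h z)"
      using norm_triangle_ineq4[of "h (Complex s t)" "h z"] by simp
     hence "norm ((h (Complex s t) - h z) * cauchy_kernel z (Complex s t)) <= ?e s"
      unfolding norm_mult using elim by (intro mult_mono) (auto simp: C)
     thus "norm (H (Complex s t) - 0) <= ?e s" using elim by (simp add: H)
    qed
   qed
   have "(?e \<longlongrightarrow> (C + norm (h z)) * 0) at_bot"
    by (intro tendsto_mult_left exp_shift_tendsto_0)
   thus "(?e \<longlongrightarrow> 0) at_bot" by simp
  qed (use z in auto)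
 qed (use z c in auto)
 hence "h z * (\<i> * of_real (2 * pi - 2 * b)) - (LINT s|lborel. ?hk s) = - \<i> * of_real (2 * b) * h z"
  unfolding eq Bochner_Integration.integral_diff[OF integrable_mult_right[OF kk(1)] int] integral_mult_right_zero kk(2)
  by simp
 thus "(LINT s|lborel. ?hk s) = 2 * of_real pi * \<i> * h z"
  by (simp add: algebra_simps)
qed

section \<open>Functions with positive real part\<close>

text \<open>The Cayley transform s of G maps the disc into itself and fixes 0. For even G its
  derivative at 0 vanishes too, so Schwarz's lemma applies once more to s / \<zeta> and a second
  power of |\<zeta>| is gained.\<close>

lemma half_plane_schwarz:
 assumes G: "G holomorphic_on ball 0 1" and re: "!!\<zeta>. norm \<zeta> < 1 ==> Re (G \<zeta>) > 0"
  and G0: "G 0 = 1" and \<zeta>: "norm \<zeta> < 1"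
 shows "norm ((G \<zeta> - 1) / (G \<zeta> + 1)) <= norm \<zeta>"
  and "(!!\<xi>. norm \<xi> < 1 ==> G (- \<xi>) = G \<xi>) ==> norm ((G \<zeta> - 1) / (G \<zeta> + 1)) <= (norm \<zeta>)^2"
proof -
 define s where "s \<xi> = (G \<xi> - 1) / (G \<xi> + 1)" for \<xi>
 have nz: "G \<xi> + 1 ~= 0" if "norm \<xi> < 1" for \<xi>
  using re[OF that] by (auto simp: complex_eq_iff)
 have hol: "s holomorphic_on ball 0 1" unfolding s_def
  by (intro holomorphic_intros G) (use nz in auto)
 have s0: "s 0 = 0" by (simp add: s_def G0)
 have lt: "norm (s \<xi>) < 1" if "norm \<xi> < 1" for \<xi>
 proof -
  have "(norm (G \<xi> - 1))^2 < (norm (G \<xi> + 1))^2"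
   using re[OF that] unfolding cmod_power2 by (simp add: power2_eq_square algebra_simps)
  hence "norm (G \<xi> - 1) < norm (G \<xi> + 1)" by (rule power2_less_imp_less) simp
  thus ?thesis using nz[OF that] by (simp add: s_def norm_divide)
 qed
 note schw = Schwarz_Lemma(1)[OF hol s0 lt]
 show "norm ((G \<zeta> - 1) / (G \<zeta> + 1)) <= norm \<zeta>" using schw[OF _ \<zeta>] by (simp add: s_def)
 assume even: "!!\<xi>. norm \<xi> < 1 ==> G (- \<xi>) = G \<xi>"
 define k where "k \<xi> = (if \<xi> = 0 then deriv s 0 else (s \<xi> - s 0) / (\<xi> - 0))" for \<xi>
 have holk: "k holomorphic_on ball 0 1" unfolding k_def by (rule pole_lemma_open[OF hol]) simp
 have "(s has_field_derivative deriv s 0) (at 0)"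
  using holomorphic_derivI[OF hol, of 0] by simp
 hence "((%\<xi>. s (- \<xi>)) has_field_derivative deriv s 0 * - 1) (at 0)"
  by (intro DERIV_chain2[of s _ uminus]) (auto intro!: derivative_eq_intros)
 hence s': "((%\<xi>. s (- \<xi>)) has_field_derivative - deriv s 0) (at 0)" by simp
 have "(s has_field_derivative - deriv s 0) (at 0)"
  by (rule has_field_derivative_transform_within_open[OF s', where S = "ball 0 1"])
   (auto simp: s_def even)
 with \<open>(s has_field_derivative deriv s 0) (at 0)\<close> have "deriv s 0 = - deriv s 0" by (rule DERIV_unique)
 hence d0: "deriv s 0 = 0" by simp
 have k1: "norm (k \<xi>) <= 1" if "norm \<xi> < 1" for \<xi>
  using schw[OF _ that] by (auto simp: k_def s0 d0 norm_divide divide_le_eq)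
 \<comment> \<open>Only |k| <= 1 is known, while Schwarz's lemma wants a strict inequality;
   multiplying by c < 1 and letting c tend to 1 bridges this.\<close>
 have "norm (k \<zeta>) <= norm \<zeta>"
 proof (rule field_le_mult_one_interval)
  fix c :: real assume c: "0 < c" "c < 1"
  have "norm (of_real c * k \<zeta>) <= norm \<zeta>"
  proof (rule Schwarz_Lemma(1)[OF _ _ _ \<zeta>])
   show "(%\<xi>. of_real c * k \<xi>) holomorphic_on ball 0 1" by (intro holomorphic_intros holk)
   show "of_real c * k 0 = 0" by (simp add: k_def d0)
   show "norm (of_real c * k \<xi>) < 1" if "norm \<xi> < 1" for \<xi>
   proof -
    have "c * norm (k \<xi>) <= c * 1" using c k1[OF that] by (intro mult_left_mono) auto
    hence "c * norm (k \<xi>) < 1" using c by linarith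
    thus ?thesis using c by (simp add: norm_mult)
   qed
  qed
  thus "c * norm (k \<zeta>) <= norm \<zeta>" using c by (simp add: norm_mult)
 qed
 hence "norm (k \<zeta>) * norm \<zeta> <= norm \<zeta> * norm \<zeta>" by (rule mult_right_mono) simp
 moreover have "s \<zeta> = k \<zeta> * \<zeta>" by (simp add: k_def s0)
 ultimately show "norm ((G \<zeta> - 1) / (G \<zeta> + 1)) <= (norm \<zeta>)^2"
  by (simp add: s_def[symmetric] norm_mult power2_eq_square)
qed

context
 fixes f :: "complex => complex"
 assumes f: "f \<in> NP_plus"
begin

lemma NP_plus_holomorphic: "f holomorphic_on right_half_plane"
 and NP_plus_Re_pos: "Re w > 0 ==> Re (f w) > 0"
 using f by (auto simp: NP_plus_def)

lemma NP_plus_real: "t > 0 ==> f (of_real t) = of_real (Re (f (of_real t)))"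
 and NP_plus_real_pos: "t > 0 ==> Re (f (of_real t)) > 0"
proof -
 assume "t > 0"
 hence "f (of_real t) \<in> complex_of_real ` {0<..}" using f by (auto simp: NP_plus_def)
 thus "f (of_real t) = of_real (Re (f (of_real t)))" "Re (f (of_real t)) > 0" by auto
qed

lemma open_right_half_plane: "open right_half_plane"
 by (rule open_halfspace_Re_gt)

lemma connected_right_half_plane: "connected right_half_plane"
 by (rule convex_connected) (rule convex_halfspace_Re_gt)

text \<open>Schwarz reflection: f and its reflection agree on the positive axis, hence everywhere by
  the identity theorem.\<close>

lemma NP_plus_cnj:
 assumes w: "Re w > 0" shows "f (cnj w) = cnj (f w)"
proof -
 have img: "cnj ` right_half_plane = right_half_plane"
  by (auto simp: image_iff intro!: exI[of _ "cnj _"])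
 have "(%w. f w - (cnj \<circ> f \<circ> cnj) w) holomorphic_on right_half_plane"
  using NP_plus_holomorphic
  by (intro holomorphic_on_diff holomorphic_on_compose_cnj_cnj) (auto simp: img open_right_half_plane)
 hence "f (cnj w) - (cnj \<circ> f \<circ> cnj) (cnj w) = 0"
 proof (rule analytic_continuation[OF _ open_right_half_plane connected_right_half_plane,
   where U = "of_real ` {0<..}" and \<xi> = 1])
  have "(1::real) islimpt {0<..}" by (simp add: interior_limit_point interior_open)
  hence "(of_real 1 ::complex) islimpt of_real ` {0<..}"
   by (intro islimpt_isCont_image) (auto simp: eventually_at_filter)
  thus "(1 ::complex) islimpt of_real ` {0<..}" by simp
  show "f v - (cnj \<circ> f \<circ> cnj) v = 0" if "v \<in> of_real ` {0<..}" for v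
   using that NP_plus_real by (metis (no_types, lifting) complex_cnj_complex_of_real comp_apply diff_self greaterThan_iff imageE)
 qed (use w in auto)
 thus ?thesis by simp
qed

text \<open>A Moebius map takes the half-plane to the disc and t to 0; dividing by f(t) then brings
  f into the normal form of the Schwarz estimates.\<close>

lemma NP_plus_disc:
 assumes t: "t > 0"
 defines "G \<equiv> %\<zeta>. f (of_real t * (1 + \<zeta>) / (1 - \<zeta>)) / f (of_real t)"
 shows "G holomorphic_on ball 0 1" "norm \<zeta> < 1 ==> Re (G \<zeta>) > 0" "G 0 = 1"
  and "Re w > 0 ==> norm ((w - of_real t) / (w + of_real t)) < 1"
  and "Re w > 0 ==> G ((w - of_real t) / (w + of_real t)) = f w / f (of_real t)"
proof -
 have ft: "f (of_real t) = of_real (Re (f (of_real t)))" "Re (f (of_real t)) > 0"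
  using NP_plus_real NP_plus_real_pos t by auto
 have re: "Re (of_real t * (1 + \<zeta>) / (1 - \<zeta>)) > 0" if "norm \<zeta> < 1" for \<zeta> :: complex
 proof -
  have ne: "1 - \<zeta> ~= 0" using that by auto
  have "of_real t * (1 + \<zeta>) / (1 - \<zeta>) = of_real t * ((1 + \<zeta>) * cnj (1 - \<zeta>)) / (of_real (norm (1 - \<zeta>)))^2"
   by (subst complex_div_cnj) (simp add: mult.assoc)
  also have "Re ... = t * (1 - (norm \<zeta>)^2) / (norm (1 - \<zeta>))^2"
  proof -
   have "(norm \<zeta>)^2 = Re \<zeta> * Re \<zeta> + Im \<zeta> * Im \<zeta>" using cmod_power2[of \<zeta>] by (simp only: power2_eq_square)
   thus ?thesis
    by (simp add: Re_divide_of_real algebra_simps flip: of_real_power)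
  qed
  also have "... > 0" using that t ne
   by (intro divide_pos_pos mult_pos_pos) (auto simp: abs_square_less_1)
  finally show ?thesis .
 qed
 show "G holomorphic_on ball 0 1"
  unfolding G_def
  by (intro holomorphic_on_divide holomorphic_on_compose[OF _ holomorphic_on_subset[OF NP_plus_holomorphic],
    unfolded o_def] holomorphic_intros) (use re ft in auto)
 show "norm \<zeta> < 1 ==> Re (G \<zeta>) > 0"
  unfolding G_def by (subst ft(1)) (simp add: Re_divide_of_real NP_plus_Re_pos re ft(2))
 have "f (of_real t) ~= 0" using ft(2) by auto
 thus "G 0 = 1" by (simp add: G_def)
 assume w: "Re w > 0"
 have nz: "w + of_real t ~= 0" using w t by (auto simp: complex_eq_iff)
 have "(norm (w - of_real t))^2 < (norm (w + of_real t))^2"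
  using w t unfolding cmod_power2 by (simp add: power2_eq_square algebra_simps)
 hence "norm (w - of_real t) < norm (w + of_real t)" by (rule power2_less_imp_less) simp
 thus "norm ((w - of_real t) / (w + of_real t)) < 1" using nz by (simp add: norm_divide)
 have "1 - (w - of_real t) / (w + of_real t) = 2 * of_real t / (w + of_real t)"
  "1 + (w - of_real t) / (w + of_real t) = 2 * w / (w + of_real t)"
  using nz by (simp_all add: field_simps)
 moreover have "of_real t * (2 * w / d) / (2 * of_real t / d) = w" if "d ~= 0" for d
  using that t by simp
 ultimately have "of_real t * (1 + (w - of_real t) / (w + of_real t)) / (1 - (w - of_real t) / (w + of_real t)) = w"
  using nz by metis
 thus "G ((w - of_real t) / (w + of_real t)) = f w / f (of_real t)" by (simp add: G_def)
qed

lemma NP_plus_schwarz_pick: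
 assumes t: "t > 0" and w: "Re w > 0"
 defines "u \<equiv> f w / f (of_real t)"
 shows "norm ((u - 1) / (u + 1)) <= norm ((w - of_real t) / (w + of_real t))"
 using half_plane_schwarz(1)[OF NP_plus_disc(1)[OF t] NP_plus_disc(2)[OF t] NP_plus_disc(3)[OF t]
   NP_plus_disc(4)[OF t w]]
 unfolding NP_plus_disc(5)[OF t w] u_def by simp

text \<open>On the ray the Moebius image \<zeta> of w has |\<zeta>|^2 = (1 - cos p)/(1 + cos p),
  whatever s is. Schwarz-Pick for u = f(w)/f(t) then reads cos p (|u|^2 + 1) <= 2 Re u, which yields
  the first two bounds. For the third it is too weak, and a symmetrisation is used instead.\<close>

lemma NP_plus_ray:
 fixes s p :: real
 assumes p: "abs p < pi / 2"
 defines "w \<equiv> exp (Complex s p)" and "r \<equiv> Re (f (of_real (exp s)))"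
 shows NP_plus_Re_ge_cos_norm: "Re (f w) >= cos p * norm (f w)"
  and NP_plus_norm_le: "norm (f w) <= 2 / cos p * r"
  and NP_plus_Re_ge: "Re (f w) >= cos p * r"
proof -
 define t where "t = exp s"
 have t: "t > 0" by (simp add: t_def)
 have c: "cos p > 0" "cos p <= 1" using p cos_gt_zero_pi[of p] by auto
 have rp: "r > 0" and fr: "f (of_real t) = of_real r"
  using NP_plus_real[OF t] NP_plus_real_pos[OF t] by (auto simp: r_def t_def)
 have wt: "w = of_real t * cis p" by (simp add: w_def t_def exp_eq_polar cis_conv_exp[symmetric])
 have w: "Re w > 0" using c t by (simp add: wt)
 define u where "u = f w / f (of_real t)"
 have fu: "f w = of_real r * u" using rp by (simp add: u_def fr)
 have reu: "Re u > 0" using NP_plus_Re_pos[OF w] rp by (simp add: fu zero_less_mult_iff)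
 have n1: "(norm (w - of_real t))^2 = t^2 * (2 * (1 - cos p))"
 proof -
  have "w - of_real t = of_real t * (cis p - 1)" by (simp add: wt algebra_simps)
  moreover have "(norm (cis p - 1))^2 = 2 * (1 - cos p)"
   unfolding cmod_power2 using sin_cos_squared_add[of p] by (simp add: power2_eq_square algebra_simps)
  ultimately show ?thesis by (simp add: norm_mult power_mult_distrib)
 qed
 have n2: "(norm (w + of_real t))^2 = t^2 * (2 * (1 + cos p))"
 proof -
  have "w + of_real t = of_real t * (cis p + 1)" by (simp add: wt algebra_simps)
  moreover have "(norm (cis p + 1))^2 = 2 * (1 + cos p)"
   unfolding cmod_power2 using sin_cos_squared_add[of p] by (simp add: power2_eq_square algebra_simps)
  ultimately show ?thesis by (simp add: norm_mult power_mult_distrib)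
 qed
 have rho: "(norm ((w - of_real t) / (w + of_real t)))^2 = (1 - cos p) / (1 + cos p)"
  unfolding norm_divide power_divide n1 n2 using t
  by (simp del: right_diff_distrib_numeral distrib_left_numeral)
 have u1: "norm (u + 1) > 0" using reu by (auto simp: complex_eq_iff)
 have "(norm ((u - 1) / (u + 1)))^2 <= (1 - cos p) / (1 + cos p)"
  using power_mono[OF NP_plus_schwarz_pick[OF t w], of 2] by (simp only: u_def[symmetric] rho) simp
 hence "(norm (u - 1))^2 * (1 + cos p) <= (1 - cos p) * (norm (u + 1))^2"
  using u1 c by (simp add: norm_divide power_divide field_simps)
 hence "cos p * ((norm u)^2 + 1) <= 2 * Re u"
  unfolding cmod_power2 by (simp add: power2_eq_square algebra_simps)
 moreover have "cos p * (2 * norm u) <= cos p * ((norm u)^2 + 1)"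
  using c sum_squares_bound[of "norm u" 1] by (intro mult_left_mono) auto
 ultimately have A: "cos p * norm u <= Re u" and B: "cos p * ((norm u)^2 + 1) <= 2 * norm u"
  using complex_Re_le_cmod[of u] by auto
 have nf: "norm (f w) = r * norm u" using rp by (simp add: fu norm_mult)
 have ref: "Re (f w) = r * Re u" by (simp add: fu)
 show "Re (f w) >= cos p * norm (f w)" using mult_left_mono[OF A, of r] rp by (simp add: nf ref mult_ac)
 have "norm u <= 2 / cos p"
 proof -
  have "cos p * norm u * norm u <= 2 * norm u" using B c by (simp add: power2_eq_square distrib_left mult.assoc)
  hence "cos p * norm u <= 2" using reu by (subst (asm) mult_le_cancel_right) auto
  thus ?thesis using c by (simp add: field_simps)
 qed
 thus "norm (f w) <= 2 / cos p * r" using mult_left_mono[of "norm u" "2 / cos p" r] rp by (simp add: nf mult_ac)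
 define G where "G \<zeta> = f (of_real t * (1 + \<zeta>) / (1 - \<zeta>)) / f (of_real t)" for \<zeta>
 \<comment> \<open>Replacing \<zeta> by -\<zeta> means replacing w by t^2/w, which is complex
   conjugation on |w| = t. So the even part of G takes the value Re u at \<zeta>, and the quadratic
   Schwarz estimate gives Re u >= cos p, with equality for f(l) = l.\<close>
 define E where "E \<zeta> = (G \<zeta> + G (- \<zeta>)) / 2" for \<zeta>
 have G: "G holomorphic_on ball 0 1" "!!\<zeta>. norm \<zeta> < 1 ==> Re (G \<zeta>) > 0" "G 0 = 1"
  "!!v. Re v > 0 ==> G ((v - of_real t) / (v + of_real t)) = f v / f (of_real t)"
  unfolding G_def using NP_plus_disc[OF t] by blast+
 have holE: "E holomorphic_on ball 0 1" unfolding E_def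
  by (intro holomorphic_intros G holomorphic_on_compose[OF _ holomorphic_on_subset[OF G(1)], unfolded o_def]) auto
 define \<zeta> where "\<zeta> = (w - of_real t) / (w + of_real t)"
 have \<zeta>1: "norm \<zeta> < 1" unfolding \<zeta>_def by (rule NP_plus_disc(4)[OF t w])
 have "E \<zeta> = of_real (Re u)"
 proof -
  have wc: "w * cnj w = of_real t * of_real t"
   by (simp add: wt cis_cnj[symmetric] cis_mult mult_ac)
    (simp add: cis_cnj cis_mult mult.assoc[symmetric])
  have nz: "w + of_real t ~= 0" "cnj w + of_real t ~= 0" using w t by (auto simp: complex_eq_iff)
  have "- \<zeta> = (cnj w - of_real t) / (cnj w + of_real t)"
   using nz wc by (simp add: \<zeta>_def field_simps)
  hence "G (- \<zeta>) = cnj u"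
   using G(4)[of "cnj w"] w NP_plus_cnj[OF w] by (simp add: u_def fr)
  moreover have "G \<zeta> = u" using G(4)[OF w] by (simp add: \<zeta>_def u_def)
  ultimately show ?thesis by (simp add: E_def complex_add_cnj)
 qed
 moreover have "norm ((E \<zeta> - 1) / (E \<zeta> + 1)) <= (norm \<zeta>)^2"
  by (rule half_plane_schwarz(2)[OF holE _ _ \<zeta>1]) (auto simp: E_def G add.commute intro!: add_pos_pos)
 ultimately have "norm ((of_real (Re u) - 1) / (of_real (Re u) + 1) :: complex) <= (1 - cos p) / (1 + cos p)"
  using rho by (simp add: \<zeta>_def)
 moreover have "(of_real (Re u) - 1) / (of_real (Re u) + 1) = complex_of_real ((Re u - 1) / (Re u + 1))"
  by simp
 hence "norm ((of_real (Re u) - 1) / (of_real (Re u) + 1) :: complex) = abs ((Re u - 1) / (Re u + 1))"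
  by (simp only: norm_of_real)
 ultimately have "- ((Re u - 1) / (Re u + 1)) <= (1 - cos p) / (1 + cos p)" by linarith
 hence "(1 - Re u) * (1 + cos p) <= (1 - cos p) * (1 + Re u)"
  using reu c by (simp add: field_simps)
 hence "cos p <= Re u" by (simp add: algebra_simps)
 thus "Re (f w) >= cos p * r" using rp by (simp add: ref mult.commute mult_left_mono)
qed

text \<open>Harnack's inequality: Schwarz-Pick between the points 1 and e^s of the positive axis,
  where all values are real.\<close>

lemma NP_plus_growth_real: "Re (f (of_real (exp s))) <= exp (abs s) * Re (f 1)"
proof -
 define x where "x = Re (f (of_real (exp s))) / Re (f 1)"
 have f1: "Re (f 1) > 0" "f 1 = of_real (Re (f 1))" using NP_plus_real_pos[of 1] NP_plus_real[of 1] by auto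
 have fs: "Re (f (of_real (exp s))) > 0" "f (of_real (exp s)) = of_real (Re (f (of_real (exp s))))"
  using NP_plus_real_pos[of "exp s"] NP_plus_real[of "exp s"] by auto
 have xp: "x > 0" using f1 fs by (simp add: x_def)
 have eq: "f (of_real (exp s)) / f (of_real 1) = of_real x"
  using f1 fs by (metis x_def of_real_1 of_real_divide)
 have "norm ((of_real x - 1) / (of_real x + 1) :: complex) <= norm ((of_real (exp s) - of_real 1) / (of_real (exp s) + of_real 1) :: complex)"
  using NP_plus_schwarz_pick[of 1 "of_real (exp s)"] unfolding eq by simp
 moreover have "(of_real x - 1) / (of_real x + 1) = complex_of_real ((x - 1) / (x + 1))"
  "(of_real (exp s) - of_real 1) / (of_real (exp s) + of_real 1) = complex_of_real ((exp s - 1) / (exp s + 1))"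
  by simp_all
 ultimately have "abs ((x - 1) / (x + 1)) <= abs ((exp s - 1) / (exp s + 1))"
  by (simp only: norm_of_real)
 moreover have "(x - 1) / (x + 1) <= abs ((x - 1) / (x + 1))" by (rule abs_ge_self)
 moreover have "abs ((exp s - 1) / (exp s + 1)) = abs (exp s - 1) / (exp s + 1)" by simp
 ultimately have le: "(x - 1) / (x + 1) <= abs (exp s - 1) / (exp s + 1)" by linarith
 have "x <= exp (abs s)"
 proof (cases "s >= 0")
  case True
  hence "(x - 1) * (exp s + 1) <= (exp s - 1) * (x + 1)"
   using le xp by (simp add: divide_le_eq pos_le_divide_eq add_pos_pos mult.commute)
  thus ?thesis using True by (simp add: algebra_simps)
 next
  case False
  hence "(x - 1) * (exp s + 1) <= (1 - exp s) * (x + 1)"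
   using le xp by (simp add: divide_le_eq pos_le_divide_eq add_pos_pos mult.commute)
  hence "x * exp s <= 1" by (simp add: algebra_simps)
  hence "x <= 1 / exp s" by (simp add: field_simps)
  thus ?thesis using False by (simp add: exp_minus divide_inverse)
 qed
 thus ?thesis using f1 by (simp add: x_def field_simps)
qed

lemma NP_plus_growth:
 assumes "0 <= a" "a < pi / 2"
 obtains C where "C > 0" "!!w. abs (Im w) <= a ==> norm (f (exp w)) <= C * exp (abs (Re w))"
proof
 have ca: "cos a > 0" using assms cos_gt_zero_pi[of a] by auto
 have f1: "Re (f 1) > 0" using NP_plus_real_pos[of 1] by simp
 thus "2 / cos a * Re (f 1) > 0" using ca by simp
 fix w assume w: "abs (Im w) <= a"
 have cw: "cos a <= cos (Im w)"
  using w assms cos_monotone_0_pi_le[of "abs (Im w)" a] by simp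
 have r: "Re (f (of_real (exp (Re w)))) > 0" by (rule NP_plus_real_pos) simp
 have "norm (f (exp w)) <= 2 / cos (Im w) * Re (f (of_real (exp (Re w))))"
  using NP_plus_norm_le[of "Im w" "Re w"] w assms by simp
 also have "... <= 2 / cos a * (exp (abs (Re w)) * Re (f 1))"
  using cw ca NP_plus_growth_real[of "Re w"] r by (intro mult_mono divide_left_mono) auto
 finally show "norm (f (exp w)) <= 2 / cos a * Re (f 1) * exp (abs (Re w))" by (simp add: mult_ac)
qed

lemma NP_plus_exp_holomorphic: "(%w. f (exp w)) holomorphic_on {w. abs (Im w) < pi / 2}"
proof (rule holomorphic_on_compose[OF _ holomorphic_on_subset[OF NP_plus_holomorphic], unfolded o_def])
 show "exp ` {w. abs (Im w) < pi / 2} \<subseteq> right_half_plane"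
  by (auto simp: Re_exp intro!: mult_pos_pos cos_gt_zero_pi)
qed (intro holomorphic_intros)

text \<open>The bound Re u >= cos(Im w) |u| for u = f(e^w) says that |Arg u| <= |Im w|. Hence v = Ln
  u - Ln z has imaginary part at most a + \<theta>, and factoring out z reduces the claim to the
  bound for |1 + e^v|.\<close>

lemma NP_plus_add_lower_bound:
 assumes w: "abs (Im w) <= a" "a < pi / 2" and z: "z ~= 0" "abs (Arg z) <= \<theta>" and a\<theta>: "a + \<theta> < pi"
 shows "cos ((a + \<theta>) / 2) * (norm z + norm (f (exp w))) <= norm (z + f (exp w))"
proof -
 define u where "u = f (exp w)"
 have "Re (exp w) > 0" using w by (simp add: Re_exp cos_gt_zero_pi)
 hence reu: "Re u > 0" unfolding u_def by (rule NP_plus_Re_pos)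
 hence u0: "u ~= 0" by auto
 have "cos (Im w) * norm u <= Re u"
  using NP_plus_Re_ge_cos_norm[of "Im w" "Re w"] w by (simp add: u_def)
 also have "Re u = norm u * cos (Arg u)" using u0 by (metis Re_rcis rcis_cmod_Arg)
 finally have "cos (abs (Im w)) <= cos (abs (Arg u))" using u0 by (simp add: mult.commute)
 hence "abs (Arg u) <= abs (Im w)"
  using cos_mono_le_eq[of "abs (Im w)" "abs (Arg u)"] w Arg_bounded[of u] by auto
 hence ua: "abs (Arg u) <= a" using w by linarith
 define v where "v = Ln u - Ln z"
 have ev: "exp v = u / z" using u0 z by (simp add: v_def exp_diff)
 have iv: "abs (Im v) <= a + \<theta>" using ua z u0 by (simp add: v_def Arg_eq_Im_Ln[symmetric])
 have "cos ((a + \<theta>) / 2) <= cos (abs (Im v) / 2)" using iv a\<theta> by (intro cos_monotone_0_pi_le) auto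
 hence "cos ((a + \<theta>) / 2) <= abs (cos (Im v / 2))" by (metis abs_divide abs_ge_self abs_numeral cos_abs_real order_trans)
 hence "cos ((a + \<theta>) / 2) * (1 + exp (Re v)) <= norm (1 + exp v)"
  using norm_one_plus_exp_ge[of v] by (elim order_trans[rotated]) (simp add: mult_right_mono)
 hence "norm z * (cos ((a + \<theta>) / 2) * (1 + norm (exp v))) <= norm z * norm (1 + exp v)"
  by (intro mult_left_mono) auto
 also have "norm z * norm (1 + exp v) = norm (z + u)"
  unfolding ev norm_mult[symmetric] using z by (simp add: distrib_left)
 also have "norm z * (cos ((a + \<theta>) / 2) * (1 + norm (exp v))) = cos ((a + \<theta>) / 2) * (norm z + norm u)"
  using z by (simp add: ev norm_divide field_simps)
 finally show ?thesis by (simp add: u_def)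
qed

end

section \<open>Logarithmic change of variables\<close>

text \<open>Substitution on [e^-n, e^n] followed by monotone convergence. No integrability is
  presupposed, so finiteness can be transferred in both directions.\<close>

lemma nn_integral_half_line_log:
 fixes G :: "real => real"
 assumes G: "continuous_on {0<..} G" "!!t. t > 0 ==> G t >= 0"
 shows "(\<integral>\<^sup>+ t. ennreal (indicator {0<..} t * (G t / t)) \<partial>lborel) = (\<integral>\<^sup>+ y. ennreal (G (exp y)) \<partial>lborel)"
proof -
 define h where "h t = indicator {0<..} t * (G t / t)" for t
 have "continuous_on {0<..} (%t. G t / t)" by (intro continuous_intros G) auto
 hence hm[measurable]: "h \<in> borel_measurable borel"
  unfolding h_def using borel_measurable_continuous_on_indicator[of "{0<..}" "%t. G t / t"] by simp
 have cm[measurable]: "(%y. G (exp y)) \<in> borel_measurable borel"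
  by (intro borel_measurable_continuous_onI continuous_on_compose2[OF G(1)] continuous_intros) auto
 have eq: "(\<integral>\<^sup>+ t. ennreal (h t) * indicator {exp (- real n)..exp (real n)} t \<partial>lborel) =
   (\<integral>\<^sup>+ y. ennreal (G (exp y)) * indicator {- real n..real n} y \<partial>lborel)" for n
 proof -
  have "(\<integral>\<^sup>+ t. ennreal (h t) * indicator {exp (- real n)..exp (real n)} t \<partial>lborel) =
    (\<integral>\<^sup>+ t. ennreal (h t * indicator {exp (- real n)..exp (real n)} t) \<partial>lborel)"
   by (intro nn_integral_cong) (auto simp: indicator_def)
  also have "... = (\<integral>\<^sup>+ y. ennreal (h (exp y) * exp y * indicator {- real n..real n} y) \<partial>lborel)"
   by (rule nn_integral_substitution)
    (auto simp: set_borel_measurable_def intro!: derivative_eq_intros continuous_intros)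
  also have "... = (\<integral>\<^sup>+ y. ennreal (G (exp y)) * indicator {- real n..real n} y \<partial>lborel)"
   by (intro nn_integral_cong) (auto simp: h_def indicator_def)
  finally show ?thesis .
 qed
 have "(\<integral>\<^sup>+ t. ennreal (h t) \<partial>lborel) =
   (\<integral>\<^sup>+ t. (SUP n. ennreal (h t) * indicator {exp (- real n)..exp (real n)} t) \<partial>lborel)"
 proof (rule nn_integral_cong)
  fix t :: real
  show "ennreal (h t) = (SUP n. ennreal (h t) * indicator {exp (- real n)..exp (real n)} t)"
  proof (rule antisym)
   show "(SUP n. ennreal (h t) * indicator {exp (- real n)..exp (real n)} t) <= ennreal (h t)"
    by (rule SUP_least) (auto simp: indicator_def)
   show "ennreal (h t) <= (SUP n. ennreal (h t) * indicator {exp (- real n)..exp (real n)} t)"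
   proof (cases "t > 0")
    case True
    obtain n :: nat where "abs (ln t) <= real n" using real_arch_simple by blast
    hence "exp (- real n) <= exp (ln t)" "exp (ln t) <= exp (real n)" by auto
    hence "exp (- real n) <= t" "t <= exp (real n)" using True by simp_all
    thus ?thesis by (intro SUP_upper2[of n]) auto
   qed (simp add: h_def)
  qed
 qed
 also have "... = (SUP n. \<integral>\<^sup>+ t. ennreal (h t) * indicator {exp (- real n)..exp (real n)} t \<partial>lborel)"
 proof (rule nn_integral_monotone_convergence_SUP)
  have le: "exp (- real (Suc n)) <= exp (- real n)" "exp (real n) <= exp (real (Suc n))" for n
   by simp_all
  show "incseq (%n t. ennreal (h t) * indicator {exp (- real n)..exp (real n)} t)"
   by (intro incseq_SucI le_funI)
    (auto simp: indicator_def simp del: of_nat_Suc intro: order_trans[OF le(1)] order_trans[OF _ le(2)])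
 qed simp
 also have "... = (SUP n. \<integral>\<^sup>+ y. ennreal (G (exp y)) * indicator {- real n..real n} y \<partial>lborel)"
  by (simp add: eq)
 also have "... = (\<integral>\<^sup>+ y. (SUP n. ennreal (G (exp y)) * indicator {- real n..real n} y) \<partial>lborel)"
  by (rule nn_integral_monotone_convergence_SUP[symmetric])
   (auto simp: incseq_def le_fun_def indicator_def)
 also have "... = (\<integral>\<^sup>+ y. ennreal (G (exp y)) \<partial>lborel)"
 proof (rule nn_integral_cong)
  fix y :: real
  show "(SUP n. ennreal (G (exp y)) * indicator {- real n..real n} y) = ennreal (G (exp y))"
  proof (rule antisym)
   obtain n :: nat where "abs y <= real n" using real_arch_simple by blast
   thus "ennreal (G (exp y)) <= (SUP n. ennreal (G (exp y)) * indicator {- real n..real n} y)"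
    by (intro SUP_upper2[of n]) (auto simp: indicator_def abs_le_iff)
  qed (rule SUP_least, auto simp: indicator_def)
 qed
 finally show ?thesis by (simp add: h_def)
qed

lemma set_integral_half_line_log:
 fixes G :: "real => real"
 assumes G: "continuous_on {0<..} G" "!!t. t > 0 ==> G t >= 0"
 shows "set_integrable lborel {0<..} (%t. G t / t) \<longleftrightarrow> integrable lborel (%y. G (exp y))"
  and "(LINT t:{0<..}|lborel. G t / t) = (LINT y|lborel. G (exp y))"
proof -
 have "continuous_on {0<..} (%t. G t / t)" by (intro continuous_intros G) auto
 hence hm: "(%t. indicator {0<..} t * (G t / t)) \<in> borel_measurable borel"
  using borel_measurable_continuous_on_indicator[of "{0<..}" "%t. G t / t"] by simp
 have cm: "(%y. G (exp y)) \<in> borel_measurable borel"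
  by (intro borel_measurable_continuous_onI continuous_on_compose2[OF G(1)] continuous_intros) auto
 have nn: "indicator {0<..} t * (G t / t) >= 0" "G (exp t) >= 0" for t
  using G(2) by (auto simp: indicator_def)
 show "set_integrable lborel {0<..} (%t. G t / t) \<longleftrightarrow> integrable lborel (%y. G (exp y))"
  unfolding set_integrable_def integrable_iff_bounded real_scaleR_def real_norm_def abs_of_nonneg[OF nn(1)] abs_of_nonneg[OF nn(2)]
  using hm cm nn_integral_half_line_log[OF G] by simp
 show "(LINT t:{0<..}|lborel. G t / t) = (LINT y|lborel. G (exp y))"
 proof -
  have "(LINT t|lborel. indicator {0<..} t * (G t / t)) = enn2real (\<integral>\<^sup>+ t. ennreal (indicator {0<..} t * (G t / t)) \<partial>lborel)"
   by (rule integral_eq_nn_integral) (use hm nn in auto)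
  moreover have "(LINT y|lborel. G (exp y)) = enn2real (\<integral>\<^sup>+ y. ennreal (G (exp y)) \<partial>lborel)"
   by (rule integral_eq_nn_integral) (use cm nn in auto)
  ultimately show ?thesis
   unfolding set_lebesgue_integral_def real_scaleR_def by (simp only: nn_integral_half_line_log[OF G])
 qed
qed

section \<open>An integral representation of the resolvent function\<close>

definition psi :: "real => complex => complex" where
 "psi q w = 1 / (1 + exp (of_real q * w))"

text \<open>The jump of 1/(z + f(e^w)) between the two edges is -2i times this; the numerator is
  real because f commutes with conjugation.\<close>

definition resolvent_jump :: "(complex => complex) => real => complex => real => complex" where
 "resolvent_jump f a z y = of_real (Im (f (exp (Complex y a)))) /
  ((z + f (exp (Complex y a))) * (z + f (exp (Complex y (- a)))))"

lemma exp_Complex: "exp (Complex s t) = of_real (exp s) * cis t"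
 by (simp add: exp_eq_polar)

lemma Re_exp_Complex_pos: "abs t < pi / 2 ==> Re (exp (Complex s t)) > 0"
 by (simp add: Re_exp cos_gt_zero_pi)

lemma psi_bound:
 assumes "abs (q * Im w) < pi"
 shows "1 + exp (of_real q * w) ~= 0" "norm (psi q w) <= 1 / cos (q * Im w / 2)"
  "norm (1 - psi q w) <= 1 / cos (q * Im w / 2)"
proof -
 have c: "cos (q * Im w / 2) > 0" using assms by (intro cos_gt_zero_pi) auto
 define v where "v = of_real q * w"
 have n: "cos (q * Im w / 2) * (1 + exp (Re v)) <= norm (1 + exp v)"
  using norm_one_plus_exp_ge[of v] c by (simp add: v_def)
 have c1: "cos (q * Im w / 2) * 1 <= cos (q * Im w / 2) * (1 + exp (Re v))"
  using c by (intro mult_left_mono) auto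
 have c2: "cos (q * Im w / 2) * exp (Re v) <= cos (q * Im w / 2) * (1 + exp (Re v))"
  using c by (intro mult_left_mono) auto
 have pos: "norm (1 + exp v) > 0" using n c1 c by linarith
 thus nz: "1 + exp (of_real q * w) ~= 0" by (auto simp: v_def)
 show "norm (psi q w) <= 1 / cos (q * Im w / 2)"
  unfolding psi_def v_def[symmetric] norm_divide norm_one
  by (rule divide_left_mono) (use order_trans[OF c1 n] c pos in \<open>auto intro!: mult_pos_pos simp del: zero_less_norm_iff\<close>)
 have "1 - psi q w = exp v / (1 + exp v)"
 proof -
  have "1 - 1 / (1 + x) = x / (1 + x)" if "1 + x ~= 0" for x :: complex
   using that by (simp add: field_simps)
  from this[OF nz] show ?thesis unfolding psi_def v_def .
 qed
 hence "norm (1 - psi q w) = exp (Re v) / norm (1 + exp v)" by (simp add: norm_divide)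
 also have "... <= exp (Re v) / (cos (q * Im w / 2) * exp (Re v))"
  by (rule divide_left_mono) (use order_trans[OF c2 n] c pos in \<open>auto intro!: mult_pos_pos simp del: zero_less_norm_iff\<close>)
 finally show "norm (1 - psi q w) <= 1 / cos (q * Im w / 2)" by simp
qed

lemma kappa_bound_log_iff:
 assumes f: "f \<in> NP_plus" and a: "abs a < pi / 2"
 shows "kappa_bound f a \<kappa> \<longleftrightarrow> (ALL r>0.
  integrable lborel (%y. abs (Im (f (exp (Complex y a)))) / (r + Re (f (of_real (exp y))))^2) \<and>
  (LINT y|lborel. abs (Im (f (exp (Complex y a)))) / (r + Re (f (of_real (exp y))))^2) <= \<kappa> / r)"
proof -
 define G where "G r t = abs (Im (f (of_real t * cis a))) / (r + Re (f (of_real t)))^2" for r t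
 have cf: "continuous_on right_half_plane f"
  using NP_plus_holomorphic[OF f] holomorphic_on_imp_continuous_on by blast
 have c: "cos a > 0" using a by (intro cos_gt_zero_pi) auto
 have pos: "r + Re (f (of_real t)) > 0" if "t > 0" "r > 0" for r t
  using NP_plus_real_pos[OF f that(1)] that(2) by simp
 have "continuous_on {0<..} (%t. f (of_real t * cis a))" "continuous_on {0<..} (%t. f (of_real t))"
  by (rule continuous_on_compose2[OF cf]; use c in \<open>auto intro!: continuous_intros\<close>)+
 hence cont: "continuous_on {0<..} (G r)" if "r > 0" for r unfolding G_def
  using pos[OF _ that] by (intro continuous_intros) force+
 have G0: "G r t >= 0" for r t by (simp add: G_def)
 have Gt: "abs (Im (f (of_real t * cis a))) / ((r + Re (f (of_real t)))^2 * t) = G r t / t" for r t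
  by (simp add: G_def)
 have Ge: "abs (Im (f (exp (Complex y a)))) / (r + Re (f (of_real (exp y))))^2 = G r (exp y)" for r y
  by (simp add: G_def exp_Complex)
 show ?thesis unfolding kappa_bound_def Gt Ge
  using set_integral_half_line_log[OF cont G0] by auto
qed

locale np_resolvent =
 fixes f :: "complex => complex" and q a \<theta> :: real and z :: complex
 assumes f: "f \<in> NP_plus" and q: "q > 2" "q * a = pi" and z: "z ~= 0" "abs (Arg z) <= \<theta>"
  and \<theta>: "a + \<theta> < pi"
begin

abbreviation "J \<equiv> resolvent_jump f a z"

definition g :: "complex => complex" where "g w = 1 / (z + f (exp w))"

lemma a: "0 < a" "a < pi / 2" "q * a = pi"
proof -
 show "q * a = pi" by (rule q)
 show a: "0 < a" using zero_less_mult_pos[of q a] q by simp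
 have "2 * a < q * a" using a q by (intro mult_strict_right_mono) auto
 thus "a < pi / 2" using q by simp
qed

lemma q_less_pi: "abs t < a ==> abs (q * t) < pi"
 using q mult_strict_left_mono[of "abs t" a q] by (simp add: abs_mult)

lemma \<theta>0: "0 <= \<theta>" using z(2) by linarith

lemma cos_pos: "cos a > 0" "cos ((a + \<theta>) / 2) > 0"
 using a \<theta> \<theta>0 by (auto intro!: cos_gt_zero_pi)

lemma denominator:
 assumes w: "abs (Im w) < pi - \<theta>" "abs (Im w) < pi / 2"
 shows "z + f (exp w) ~= 0"
proof -
 have "0 < cos ((abs (Im w) + \<theta>) / 2)" using w \<theta>0 by (intro cos_gt_zero_pi) auto
 moreover have "cos ((abs (Im w) + \<theta>) / 2) * (norm z + norm (f (exp w))) <= norm (z + f (exp w))"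
  by (rule NP_plus_add_lower_bound[OF f]) (use w z in auto)
 moreover have "norm z + norm (f (exp w)) > 0" using z by (simp add: add_pos_nonneg)
 ultimately have "norm (z + f (exp w)) > 0" by (smt (verit) mult_pos_pos)
 thus ?thesis by auto
qed

lemma denominator_bound:
 assumes w: "abs (Im w) <= a"
 shows "cos ((a + \<theta>) / 2) * (norm z + norm (f (exp w))) <= norm (z + f (exp w))"
 by (rule NP_plus_add_lower_bound[OF f w]) (use a z \<theta> in auto)

lemma g_bound:
 assumes w: "abs (Im w) <= a"
 shows "norm (g w) <= 1 / (cos ((a + \<theta>) / 2) * norm z)"
proof -
 have "cos ((a + \<theta>) / 2) * norm z <= cos ((a + \<theta>) / 2) * (norm z + norm (f (exp w)))"
  using cos_pos by (intro mult_left_mono) auto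
 hence "cos ((a + \<theta>) / 2) * norm z <= norm (z + f (exp w))" using denominator_bound[OF w] by linarith
 moreover have "cos ((a + \<theta>) / 2) * norm z > 0" using cos_pos z by simp
 ultimately show ?thesis unfolding g_def norm_divide norm_one
  by (intro divide_left_mono) (auto intro!: mult_pos_pos simp del: zero_less_norm_iff)
qed

text \<open>The half-width on which z + f(e^w) is known not to vanish. It exceeds \<open>a\<close>,
  so the edges of the contour are interior points.\<close>

definition strip_width :: real where "strip_width = min (pi / 2) (pi - \<theta>)"

lemma strip_width: "a < strip_width" "strip_width <= pi / 2"
proof -
 show "strip_width <= pi / 2" unfolding strip_width_def by (rule min.cobounded1)
qed (use a \<theta> in \<open>auto simp: strip_width_def\<close>)

lemma g_holomorphic: "g holomorphic_on {w. abs (Im w) < strip_width}"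
 unfolding g_def
 by (intro holomorphic_intros holomorphic_on_subset[OF NP_plus_exp_holomorphic[OF f]])
  (use denominator in \<open>auto simp: strip_width_def\<close>)

lemma f_cnj_ray: "abs t < pi / 2 ==> f (exp (Complex y (- t))) = cnj (f (exp (Complex y t)))"
 using NP_plus_cnj[OF f Re_exp_Complex_pos, of t y] by (simp add: exp_cnj complex_cnj)

lemma g_jump: "g (Complex y a) - g (Complex y (- a)) = - 2 * \<i> * J y"
proof -
 have n: "z + f (exp (Complex y a)) ~= 0" "z + f (exp (Complex y (- a))) ~= 0"
  by (rule denominator; use a \<theta> in simp)+
 have "f (exp (Complex y (- a))) - f (exp (Complex y a)) = - 2 * \<i> * of_real (Im (f (exp (Complex y a))))"
  using f_cnj_ray[of a y] a by (simp add: complex_eq_iff)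
 moreover have "g (Complex y a) - g (Complex y (- a)) =
   (f (exp (Complex y (- a))) - f (exp (Complex y a))) / ((z + f (exp (Complex y a))) * (z + f (exp (Complex y (- a)))))"
  using n by (simp add: g_def field_simps)
 ultimately show ?thesis by (simp add: resolvent_jump_def)
qed

lemma f_ray_continuous: "abs t < pi / 2 ==> continuous_on UNIV (%y. f (exp (Complex y t)))"
 by (rule continuous_on_compose2[OF holomorphic_on_imp_continuous_on[OF NP_plus_exp_holomorphic[OF f]]])
  (auto intro!: continuous_intros)

lemma J_continuous: "continuous_on UNIV J"
proof -
 have "z + f (exp (Complex y a)) ~= 0" "z + f (exp (Complex y (- a))) ~= 0" for y
  by (rule denominator; use a \<theta> in simp)+
 thus ?thesis unfolding resolvent_jump_def[abs_def] using a
  by (intro continuous_intros f_ray_continuous) auto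
qed

text \<open>Each of the two denominators is at least cos((a + \<theta>)/2) cos(a) (|z| + f(e^y)):
  the first cosine separates z from f(e^w), the second passes from the ray to the positive
  axis.\<close>

lemma J_bound:
 "norm (J y) <= 1 / ((cos a)^2 * (cos ((a + \<theta>) / 2))^2) *
  (abs (Im (f (exp (Complex y a)))) / (norm z + Re (f (of_real (exp y))))^2)"
proof -
 define r C where "r = norm z + Re (f (of_real (exp y)))" and "C = cos a * cos ((a + \<theta>) / 2)"
 have fp: "Re (f (of_real (exp y))) > 0" by (rule NP_plus_real_pos[OF f]) simp
 hence r: "r > 0" by (simp add: r_def add_nonneg_pos)
 have C: "C > 0" using cos_pos by (simp add: C_def)
 have le: "C * r <= norm (z + f (exp (Complex y t)))" if t: "t = a \<or> t = - a" for t
 proof -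
  have "cos a * Re (f (of_real (exp y))) <= Re (f (exp (Complex y t)))"
   using NP_plus_Re_ge[OF f, of t y] t a by auto
  also have "... <= norm (f (exp (Complex y t)))" by (rule complex_Re_le_cmod)
  finally have "cos a * r <= norm z + norm (f (exp (Complex y t)))"
   using mult_right_mono[of "cos a" 1 "norm z"] by (simp add: r_def distrib_left)
  hence "cos ((a + \<theta>) / 2) * (cos a * r) <= cos ((a + \<theta>) / 2) * (norm z + norm (f (exp (Complex y t))))"
   using cos_pos by (intro mult_left_mono) auto
  also have "... <= norm (z + f (exp (Complex y t)))"
   by (rule denominator_bound) (use t a in auto)
  finally show ?thesis by (simp add: C_def mult_ac)
 qed
 have "(C * r) * (C * r) <= norm (z + f (exp (Complex y a))) * norm (z + f (exp (Complex y (- a))))"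
  using le[of a] le[of "-a"] C r by (intro mult_mono) auto
 hence "norm (J y) <= abs (Im (f (exp (Complex y a)))) / ((C * r) * (C * r))"
  unfolding resolvent_jump_def norm_divide norm_mult norm_of_real
  using C r order_less_le_trans[OF mult_pos_pos[OF C r] le[of a]] order_less_le_trans[OF mult_pos_pos[OF C r] le[of "-a"]]
  by (intro divide_left_mono mult_pos_pos) auto
 thus ?thesis by (simp add: C_def r_def power2_eq_square mult_ac)
qed

lemma kappa_bound_log:
 assumes "kappa_bound f a \<kappa>" "r > 0"
 shows "integrable lborel (%y. abs (Im (f (exp (Complex y a)))) / (r + Re (f (of_real (exp y))))^2)"
  "(LINT y|lborel. abs (Im (f (exp (Complex y a)))) / (r + Re (f (of_real (exp y))))^2) <= \<kappa> / r"
proof -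
 have "abs a < pi / 2" using a by simp
 from kappa_bound_log_iff[OF f this] assms
 show "integrable lborel (%y. abs (Im (f (exp (Complex y a)))) / (r + Re (f (of_real (exp y))))^2)"
  "(LINT y|lborel. abs (Im (f (exp (Complex y a)))) / (r + Re (f (of_real (exp y))))^2) <= \<kappa> / r"
  by auto
qed

lemma J_integral:
 assumes "kappa_bound f a \<kappa>"
 shows "integrable lborel J"
  "(LINT y|lborel. norm (J y)) <= \<kappa> / (norm z * (cos a)^2 * (cos ((a + \<theta>) / 2))^2)"
proof -
 have zp: "norm z > 0" using z by simp
 note k = kappa_bound_log[OF assms zp]
 define C where "C = 1 / ((cos a)^2 * (cos ((a + \<theta>) / 2))^2)"
 have C: "C >= 0" by (simp add: C_def)
 note kC = integrable_mult_right[OF k(1), of C]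
 show J: "integrable lborel J"
  by (rule integrable_continuous_dominated[OF J_continuous J_bound[folded C_def] kC])
 have "(LINT y|lborel. norm (J y)) <=
   (LINT y|lborel. C * (abs (Im (f (exp (Complex y a)))) / (norm z + Re (f (of_real (exp y))))^2))"
  by (rule integral_mono[OF integrable_norm[OF J] kC J_bound[folded C_def]])
 also have "... = C * (LINT y|lborel. abs (Im (f (exp (Complex y a)))) / (norm z + Re (f (of_real (exp y))))^2)"
  by (rule integral_mult_right_zero)
 also have "... <= C * (\<kappa> / norm z)" by (rule mult_left_mono[OF k(2) C])
 finally show "(LINT y|lborel. norm (J y)) <= \<kappa> / (norm z * (cos a)^2 * (cos ((a + \<theta>) / 2))^2)"
  by (simp add: C_def mult_ac)
qed

lemma J_psi_integrable:
 assumes J: "integrable lborel J" and w: "abs (Im w) < a"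
 shows "integrable lborel (%y. J y * psi q (w - of_real y))"
proof (rule integrable_continuous_dominated)
 have "1 + exp (of_real q * (w - of_real y)) ~= 0" for y
  by (rule psi_bound(1)) (use q_less_pi[OF w] in auto)
 thus "continuous_on UNIV (%y. J y * psi q (w - of_real y))"
  unfolding psi_def by (intro continuous_intros J_continuous) auto
 show "norm (J y * psi q (w - of_real y)) <= norm (J y) * (1 / cos (q * Im w / 2))" for y
  unfolding norm_mult using psi_bound(2)[of q "w - of_real y"] q_less_pi[OF w] by (intro mult_left_mono) auto
qed (use J in auto)

text \<open>The kernel K is the Cauchy kernel in the variable q w with pole at w0. Since q a = pi,
  the points s + ia and s - ia both produce the factor -1, so K equals psi(w0 - s) on either edge
  and the edge difference of (g - g(w0)) K sees only the jump of g.\<close>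

theorem representation:
 assumes J: "integrable lborel J"
 obtains c where "!!w. abs (Im w) < a ==> g w = c + of_real (q / pi) * (LINT y|lborel. J y * psi q (w - of_real y))"
proof -
 let ?S = "{w. abs (Im w) < strip_width}"
 \<comment> \<open>Pointwise convergence of g at infinity is not at hand here; its cross-section
   converges, because the derivative -2 J is integrable, and this suffices.\<close>
 define A where "A s = integral {-a..a} (%t. g (Complex s t))" for s
 have A': "(A has_vector_derivative (g (Complex s a) - g (Complex s (-a))) / \<i>) (at s)" for s
  unfolding A_def by (rule strip_integral_derivative[OF g_holomorphic open_strip]) (use strip_width a in auto)
 hence A': "(A has_vector_derivative - 2 * J s) (at s)" for s
  unfolding g_jump by (simp add: field_simps)
 obtain Atop where Atop: "(A \<longlongrightarrow> Atop) at_top"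
 proof (rule exE[OF antiderivative_limits(1)[OF _ _ _ A']])
  show "continuous_on UNIV (%s. - 2 * J s)" by (intro continuous_intros J_continuous)
  show "norm (- 2 * J s) <= 2 * norm (J s)" for s by (simp add: norm_mult)
  show "integrable lborel (%s. 2 * norm (J s))" using J by simp
 qed
 show thesis
 proof (rule that[of "of_real (q / (2 * pi)) * Atop"])
  fix w0 assume w0: "abs (Im w0) < a"
  \<comment> \<open>The poles of K are spaced 2a apart in the vertical direction, as q a = pi;
    within this half-width only w0 is left.\<close>
  define c where "c = min strip_width (2 * a - abs (Im w0))"
  have c: "a < c" "c <= strip_width" "c <= 2 * a - abs (Im w0)" using strip_width w0 by (auto simp: c_def)
  let ?C = "{w. abs (Im w) < c}"
  have holg: "g holomorphic_on ?C" by (rule holomorphic_on_subset[OF g_holomorphic]) (use c in auto)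
  define K where "K w = cauchy_kernel (of_real q * w0) (of_real q * w)" for w
  have nz: "exp (of_real q * w0 - of_real q * w) ~= 1" if "abs (Im w) < c" "w ~= w0" for w
  proof -
   have "abs (Im (of_real q * w0 - of_real q * w)) = q * abs (Im w0 - Im w)"
    using q by (simp add: abs_mult right_diff_distrib[symmetric] del: right_diff_distrib)
   also have "... < q * (2 * a)" using that c q by (intro mult_strict_left_mono) linarith+
   finally have "abs (Im (of_real q * w0 - of_real q * w)) < 2 * pi" using a(3) by simp
   moreover have "of_real q * w0 - of_real q * w ~= 0" using that q by simp
   ultimately show ?thesis using exp_eq_one_strip by blast
  qed
  have w0C: "w0 \<in> ?C" using w0 c by simp
  define N where "N w = (if w = w0 then deriv g w0 else (g w - g w0) / (w - w0))" for w
  define E where "E w = 1 - exp (of_real q * w0 - of_real q * w)" for w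
  define D where "D w = (if w = w0 then deriv E w0 else (E w - E w0) / (w - w0))" for w
  have holN: "N holomorphic_on ?C" unfolding N_def by (rule pole_lemma_open[OF holg open_strip])
  have holD: "D holomorphic_on ?C" unfolding D_def
   by (rule pole_lemma_open[OF _ open_strip]) (unfold E_def, intro holomorphic_intros)
  have "(E has_field_derivative of_real q) (at w0)" unfolding E_def by (auto intro!: derivative_eq_intros)
  hence "deriv E w0 = of_real q" by (rule DERIV_imp_deriv)
  hence D0: "D w ~= 0" if "w \<in> ?C" for w
   using nz[of w] that q by (auto simp: D_def E_def)
  define H where "H w = of_real q * N w / D w" for w
  have holH: "H holomorphic_on ?C" unfolding H_def
   by (intro holomorphic_on_divide holomorphic_intros holN holD D0)
  have H: "H w = of_real q * (g w - g w0) * K w" if "w ~= w0" for w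
   using that by (simp add: H_def N_def D_def E_def K_def cauchy_kernel_def)
  have contH: "continuous_on ?C H" and contg: "continuous_on ?C g"
   using holH holg holomorphic_on_imp_continuous_on by blast+
  have ct: "continuous_on {-a..a} (%t. H (Complex s t))" "continuous_on {-a..a} (%t. g (Complex s t))" for s
   by (rule continuous_on_compose2[OF contH] continuous_on_compose2[OF contg];
     use c in \<open>auto intro!: continuous_intros\<close>)+
  have Ka: "K (Complex s t) = psi q (w0 - of_real s)" if "t = a \<or> t = - a" for s t
  proof -
   have "of_real q * w0 - of_real q * Complex s t = of_real q * (w0 - of_real s) - \<i> * of_real (q * t)"
    by (simp add: Complex_eq_of_real algebra_simps)
   moreover have "exp (\<i> * of_real (q * t)) = - 1"
   proof (cases "t = a")
    case True thus ?thesis by (simp only: a(3)) simp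
   next
    case False
    hence "q * t = - pi" using that a(3) by simp
    thus ?thesis by (simp only:) (simp add: exp_minus)
   qed
   ultimately have "exp (of_real q * w0 - of_real q * Complex s t) = - exp (of_real q * (w0 - of_real s))"
    by (simp only: exp_diff) simp
   thus ?thesis by (simp add: K_def cauchy_kernel_def psi_def)
  qed
  have Hd: "H (Complex s a) - H (Complex s (- a)) = - 2 * \<i> * of_real q * (J s * psi q (w0 - of_real s))" for s
  proof -
   have "Complex s a ~= w0" "Complex s (- a) ~= w0" using w0 by auto
   hence "H (Complex s a) - H (Complex s (- a)) =
     of_real q * (g (Complex s a) - g (Complex s (- a))) * psi q (w0 - of_real s)"
    by (simp add: H Ka algebra_simps)
   thus ?thesis by (simp add: g_jump)
  qed
  have int: "integrable lborel (%s. H (Complex s a) - H (Complex s (- a)))"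
   unfolding Hd by (intro integrable_mult_right J_psi_integrable J w0)
  define B where "B = 1 / (cos ((a + \<theta>) / 2) * norm z) + norm (g w0)"
  have B: "norm (g w - g w0) <= B" if "abs (Im w) <= a" for w
   using norm_triangle_ineq4[of "g w" "g w0"] g_bound[OF that] by (simp add: B_def)
  have B0: "B >= 0" using order_trans[OF norm_ge_zero B[of 0]] a by simp
  have qlim: "filterlim (%s. q * s) at_top at_top" "filterlim (%s. q * s) at_bot at_bot"
   using q by (auto intro: filterlim_tendsto_pos_mult_at_top[OF tendsto_const]
     filterlim_tendsto_pos_mult_at_bot[OF tendsto_const] filterlim_ident)
  have Kq: "K (Complex s t) = cauchy_kernel (of_real q * w0) (Complex (q * s) (q * t))" for s t
   by (simp add: K_def Complex_eq_of_real algebra_simps)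
  have neq: "\<forall>\<^sub>F s in at_top. ALL t. Complex s t ~= w0" "\<forall>\<^sub>F s in at_bot. ALL t. Complex s t ~= w0"
   by (auto intro: eventually_mono[OF eventually_gt_at_top[of "Re w0"]]
      eventually_mono[OF eventually_gt_at_bot[of "Re w0"]])
  \<comment> \<open>K tends to 1, so H differs from q (g - g(w0)) by the vanishing remainder R. The
    limit of the cross-section of H therefore involves g only through A, and 2 a q = 2 pi later
    isolates g(w0).\<close>
  have top: "((%s. integral {-a..a} (%t. H (Complex s t))) \<longlongrightarrow> of_real q * (Atop - of_real (2 * a) * g w0)) at_top"
  proof -
   define R where "R w = H w - of_real q * (g w - g w0)" for w
   have ctR: "continuous_on {-a..a} (%t. R (Complex s t))" for s
    unfolding R_def by (intro continuous_intros ct)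
   have "((%s. integral {-a..a} (%t. R (Complex s t))) \<longlongrightarrow> of_real (a - - a) * 0) at_top"
   proof (rule cross_section_integral_tendsto[OF ctR])
    let ?e = "%s. q * B * (2 * exp (Re (of_real q * w0) - q * s))"
    show "\<forall>\<^sub>F s in at_top. \<forall>t\<in>{- a..a}. norm (R (Complex s t) - 0) <= ?e s"
     using eventually_compose_filterlim[OF cauchy_kernel_tendsto(1)[of "of_real q * w0"] qlim(1)] neq(1)
    proof eventually_elim
     case (elim s)
     show ?case
     proof
      fix t assume t: "t \<in> {-a..a}"
      have "R (Complex s t) = of_real q * (g (Complex s t) - g w0) * (K (Complex s t) - 1)"
       using elim by (simp add: R_def H algebra_simps)
      also have "norm ... <= ?e s"
       unfolding norm_mult using B[of "Complex s t"] elim t q B0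
       by (intro mult_mono) (auto simp: Kq)
      finally show "norm (R (Complex s t) - 0) <= ?e s" by simp
     qed
    qed
    have "(?e \<longlongrightarrow> q * B * 0) at_top"
     by (intro tendsto_mult_left filterlim_compose[OF exp_shift_tendsto_0(1) qlim(1)])
    thus "(?e \<longlongrightarrow> 0) at_top" by simp
   qed (use a in auto)
   moreover have "((%s. of_real q * (A s - of_real (2 * a) * g w0)) \<longlongrightarrow> of_real q * (Atop - of_real (2 * a) * g w0)) at_top"
    by (intro tendsto_intros Atop)
   ultimately have "((%s. integral {-a..a} (%t. R (Complex s t)) + of_real q * (A s - of_real (2 * a) * g w0))
     \<longlongrightarrow> 0 + of_real q * (Atop - of_real (2 * a) * g w0)) at_top"
    by (intro tendsto_add) auto
   moreover have "integral {-a..a} (%t. R (Complex s t)) + of_real q * (A s - of_real (2 * a) * g w0) =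
     integral {-a..a} (%t. H (Complex s t))" for s
   proof -
    have "integral {-a..a} (%t. R (Complex s t)) =
      integral {-a..a} (%t. H (Complex s t)) - integral {-a..a} (%t. of_real q * (g (Complex s t) - g w0))"
     unfolding R_def
     by (intro Henstock_Kurzweil_Integration.integral_diff integrable_continuous_interval continuous_intros ct)
    also have "integral {-a..a} (%t. of_real q * (g (Complex s t) - g w0)) =
      of_real q * (A s - integral {-a..a} (%t. g w0))"
     unfolding A_def integral_mult_right
     by (subst Henstock_Kurzweil_Integration.integral_diff)
      (auto intro: integrable_continuous_interval ct)
    also have "integral {-a..a} (%t. g w0) = of_real (2 * a) * g w0"
     using a by (simp add: scaleR_conv_of_real)
    finally show ?thesis by simp
   qed
   ultimately show ?thesis by simp
  qed
  have bot: "((%s. integral {-a..a} (%t. H (Complex s t))) \<longlongrightarrow> of_real (a - - a) * 0) at_bot"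
  proof (rule cross_section_integral_tendsto[OF ct(1)])
   let ?e = "%s. q * B * (2 * exp (q * s - Re (of_real q * w0)))"
   show "\<forall>\<^sub>F s in at_bot. \<forall>t\<in>{- a..a}. norm (H (Complex s t) - 0) <= ?e s"
    using eventually_compose_filterlim[OF cauchy_kernel_tendsto(2)[of "of_real q * w0"] qlim(2)] neq(2)
   proof eventually_elim
    case (elim s)
    show ?case
    proof
     fix t assume t: "t \<in> {-a..a}"
     have "H (Complex s t) = of_real q * (g (Complex s t) - g w0) * K (Complex s t)"
      using elim by (simp add: H)
     also have "norm ... <= ?e s"
      unfolding norm_mult using B[of "Complex s t"] elim t q B0
      by (intro mult_mono) (auto simp: Kq)
     finally show "norm (H (Complex s t) - 0) <= ?e s" by simp
    qed
   qed
   have "(?e \<longlongrightarrow> q * B * 0) at_bot"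
    by (intro tendsto_mult_left filterlim_compose[OF exp_shift_tendsto_0(2) qlim(2)])
   thus "(?e \<longlongrightarrow> 0) at_bot" by simp
  qed (use a in auto)
  have "(LINT s|lborel. H (Complex s a) - H (Complex s (- a))) =
    \<i> * (of_real q * (Atop - of_real (2 * a) * g w0) - of_real (a - - a) * 0)"
   by (rule strip_integral_limits[OF holH open_strip _ _ top bot int]) (use a c in auto)
  hence 1: "- 2 * \<i> * of_real q * (LINT s|lborel. J s * psi q (w0 - of_real s)) =
    \<i> * (of_real q * Atop - of_real (q * (2 * a)) * g w0)"
   unfolding Hd integral_mult_right_zero by (simp add: algebra_simps)
  define X where "X = (LINT s|lborel. J s * psi q (w0 - of_real s))"
  have "q * (2 * a) = 2 * pi" using a(3) by simp
  hence "\<i> * (- 2 * of_real q * X) = \<i> * (of_real q * Atop - 2 * of_real pi * g w0)"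
   using 1 unfolding X_def[symmetric] by (simp only: mult_ac of_real_mult of_real_numeral)
  hence "- 2 * of_real q * X = of_real q * Atop - 2 * of_real pi * g w0"
   by (simp only: mult_cancel_left) simp
  hence "2 * of_real pi * g w0 = of_real q * Atop + 2 * of_real q * X" by (simp add: algebra_simps)
  thus "g w0 = of_real (q / (2 * pi)) * Atop + of_real (q / pi) * X"
   by (simp add: field_simps)
 qed
qed

text \<open>Along the real axis the kernel tends to 0 on the right and to 1 on the left, so c is the
  limit of g at +infinity, and c plus the full integral of J is its limit at -infinity. There f is
  real and positive, and |z + r| >= sin(a) |z| for r > 0 because |Arg z| <= \<theta> < pi - a; this
  is the source of the summand 1/sin(pi/q).\<close>

lemma representation_limits:
 assumes J: "integrable lborel J"
  and c: "!!w. abs (Im w) < a ==> g w = c + of_real (q / pi) * (LINT y|lborel. J y * psi q (w - of_real y))"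
 shows "(%n. g (of_real (real n))) \<longlonglongrightarrow> c"
  and "(%n. g (of_real (- real n))) \<longlonglongrightarrow> c + of_real (q / pi) * (LINT y|lborel. J y)"
  and "norm c <= 1 / (sin a * norm z)"
proof -
 have q0: "q > 0" using q by simp
 have psi_le: "norm (psi q (of_real x)) <= 1" for x using psi_bound(2)[of q "of_real x"] by simp
 have psi_real: "psi q (of_real x) = of_real (1 / (1 + exp (q * x)))" for x
  by (simp add: psi_def flip: of_real_mult exp_of_real)
 have qx: "filterlim (%n. q * (real n - y)) at_top sequentially" "filterlim (%n. q * (- real n - y)) at_bot sequentially" for y
  using q0 by real_asymp+
 have lim0: "(%n. psi q (of_real (real n) - of_real y)) \<longlonglongrightarrow> 0" for y
 proof -
  have "(%n. 1 / (1 + exp (q * (real n - y)))) \<longlonglongrightarrow> 0" using q0 by real_asymp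
  hence "(%n. complex_of_real (1 / (1 + exp (q * (real n - y))))) \<longlonglongrightarrow> of_real 0" by (rule tendsto_of_real)
  thus ?thesis by (simp only: psi_real[symmetric] of_real_diff of_real_0)
 qed
 have lim1: "(%n. psi q (of_real (- real n) - of_real y)) \<longlonglongrightarrow> 1" for y
 proof -
  have "(%n. 1 / (1 + exp (q * (- real n - y)))) \<longlonglongrightarrow> 1" using q0 by real_asymp
  hence "(%n. complex_of_real (1 / (1 + exp (q * (- real n - y))))) \<longlonglongrightarrow> of_real 1" by (rule tendsto_of_real)
  thus ?thesis by (simp only: psi_real[symmetric] of_real_diff of_real_1)
 qed
 have dc: "(%n. LINT y|lborel. J y * psi q (of_real (x n) - of_real y)) \<longlonglongrightarrow> (LINT y|lborel. J y * l)"
  if "!!y. (%n. psi q (of_real (x n) - of_real y)) \<longlonglongrightarrow> l" for x :: "nat => real" and l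
 proof (rule integral_dominated_convergence)
  show "integrable lborel (%y. norm (J y))" using J by simp
  show "(%y. J y * l) \<in> borel_measurable lborel" using J by measurable
  show "(%y. J y * psi q (of_real (x n) - of_real y)) \<in> borel_measurable lborel" for n
   by (rule borel_measurable_integrable[OF J_psi_integrable[OF J]]) (use a in auto)
  show "AE y in lborel. (%n. J y * psi q (of_real (x n) - of_real y)) \<longlonglongrightarrow> J y * l"
   by (intro AE_I2 tendsto_mult_left that)
  show "AE y in lborel. norm (J y * psi q (of_real (x n) - of_real y)) <= norm (J y)" for n
   using psi_le[of "x n - _"] by (intro AE_I2) (simp add: norm_mult mult_left_le)
 qed
 have g_eq: "g (of_real x) = c + of_real (q / pi) * (LINT y|lborel. J y * psi q (of_real x - of_real y))" for x
  by (rule c) (use a in auto)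
 have "(%n. c + of_real (q / pi) * (LINT y|lborel. J y * psi q (of_real (real n) - of_real y))) \<longlonglongrightarrow>
   c + of_real (q / pi) * (LINT y|lborel. J y * 0)"
  by (intro tendsto_intros dc lim0)
 thus top: "(%n. g (of_real (real n))) \<longlonglongrightarrow> c" unfolding g_eq by simp
 have "(%n. c + of_real (q / pi) * (LINT y|lborel. J y * psi q (of_real (- real n) - of_real y))) \<longlonglongrightarrow>
   c + of_real (q / pi) * (LINT y|lborel. J y * 1)"
  by (intro tendsto_intros dc lim1)
 thus "(%n. g (of_real (- real n))) \<longlonglongrightarrow> c + of_real (q / pi) * (LINT y|lborel. J y)" unfolding g_eq by simp
 have sin: "sin a > 0" using a by (intro sin_gt_zero) auto
 have "norm (g (of_real x)) <= 1 / (sin a * norm z)" for x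
 proof -
  define r where "r = Re (f (of_real (exp x)))"
  have r: "r > 0" "f (of_real (exp x)) = of_real r"
   using NP_plus_real_pos[OF f, of "exp x"] NP_plus_real[OF f, of "exp x"] by (auto simp: r_def)
  have "sin a * norm z <= norm (z + of_real r)"
  proof (cases "Re z >= 0")
   case True
   have "(norm z)^2 <= (norm (z + of_real r))^2"
    unfolding cmod_power2 using True r by (simp add: power2_eq_square algebra_simps)
   hence "norm z <= norm (z + of_real r)" by (rule power2_le_imp_le) simp
   moreover have "sin a * norm z <= 1 * norm z" by (intro mult_right_mono) auto
   ultimately show ?thesis by simp
  next
   case False
   define t where "t = abs (Arg z)"
   have zz: "Re z = norm z * cos (Arg z)" "Im z = norm z * sin (Arg z)"
    using rcis_cmod_Arg[of z] by (auto simp: complex_eq_iff)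
   have re: "Re z = norm z * cos t" unfolding t_def cos_abs_real by (rule zz)
   have "abs (sin t) = abs (sin (Arg z))" by (cases "Arg z >= 0") (simp_all add: t_def)
   hence im: "abs (Im z) = norm z * abs (sin t)" by (simp add: zz(2) abs_mult)
   have cost: "cos t < 0" using False re by (simp add: not_le mult_less_0_iff)
   have t: "0 <= t" "t <= \<theta>" using z by (auto simp: t_def)
   have "t > pi / 2"
   proof (rule ccontr)
    assume "\<not> t > pi / 2"
    hence "cos t >= 0" using t by (intro cos_ge_zero) auto
    thus False using cost by simp
   qed
   hence "sin a <= sin (pi - t)" using a t \<theta> by (intro sin_monotone_2pi_le) auto
   hence "norm z * sin a <= abs (Im z)" unfolding im by (simp add: mult_left_mono)
   also have "abs (Im z) <= norm (z + of_real r)" using abs_Im_le_cmod[of "z + of_real r"] by simp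
   finally show ?thesis by (simp add: mult.commute)
  qed
  hence le: "sin a * norm z <= norm (z + f (exp (of_real x)))"
   by (simp add: r(2)[symmetric] exp_of_real)
  have pos: "sin a * norm z > 0" using sin z by simp
  show ?thesis
   unfolding g_def norm_divide norm_one
   by (rule divide_left_mono[OF le _ mult_pos_pos[OF order_less_le_trans[OF pos le] pos]]) simp
 qed
 thus "norm c <= 1 / (sin a * norm z)"
  by (intro LIMSEQ_le_const2[OF tendsto_norm[OF top]] exI[of _ 0] allI impI)
qed

end

section \<open>Functional calculus for sectorial operators\<close>

definition resolvent_region :: "real => complex set" where
 "resolvent_region \<omega> = {l. l ~= 0 \<and> \<omega> < abs (Arg l)}"

text \<open>Heights up to 2 pi occur because contours around the complement of the sector pass
  across the negative axis, which sits at height pi.\<close>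

lemma abs_Arg_exp:
 assumes "abs (Im w) < 2 * pi" shows "abs (Arg (exp w)) = min (abs (Im w)) (2 * pi - abs (Im w))"
proof -
 consider "- pi < Im w \<and> Im w <= pi" | "pi < Im w" | "Im w <= - pi" by linarith
 thus ?thesis
 proof cases
  case 1 thus ?thesis by (auto simp: Arg_exp)
 next
  case 2
  have "exp w = exp (w - 2 * of_real pi * \<i>)" by (simp only: exp_diff exp_two_pi_i div_by_1)
  hence "Arg (exp w) = Im w - 2 * pi" using 2 assms by (simp add: Arg_exp)
  thus ?thesis using 2 assms by auto
 next
  case 3
  have "exp w = exp (w + 2 * of_real pi * \<i>)" by (simp only: exp_add exp_two_pi_i mult_1_right)
  hence "Arg (exp w) = Im w + 2 * pi" using 3 assms by (simp add: Arg_exp)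
  thus ?thesis using 3 assms by auto
 qed
qed

text \<open>The two boundary lines of a strip, with the orientation of the boundary of a sector.\<close>

definition line_diff :: "real => (complex => 'b::minus) => real => 'b" where
 "line_diff a G s = G (Complex s (- a)) - G (Complex s a)"

lemma norm_line_diff:
 fixes G :: "complex => 'b::real_normed_vector"
 assumes "!!t. abs t = a ==> norm (G (Complex s t)) <= B" and a: "0 <= a"
 shows "norm (line_diff a G s) <= 2 * B"
 unfolding line_diff_def using assms(1)[of a] assms(1)[of "-a"] a
 by (intro order_trans[OF norm_triangle_ineq4]) auto

lemma continuous_on_line_diff:
 fixes G :: "complex => 'b::real_normed_vector"
 assumes "!!t. abs t = a ==> continuous_on UNIV (%s. G (Complex s t))" "0 <= a"
 shows "continuous_on UNIV (line_diff a G)"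
 unfolding line_diff_def[abs_def] using assms(1)[of a] assms(1)[of "-a"] assms(2)
 by (intro continuous_intros) auto

lemma line_diff_functional:
 "clinear_bounded ph ==> ph (line_diff a G s) = line_diff a (%w. ph (G w)) s"
 by (simp add: line_diff_def clinear_boundedD)

lemma has_wint_scaleC_const:
 assumes "integrable lborel c" shows "has_wint (%s. c s *\<^sub>C v) ((LINT s|lborel. c s) *\<^sub>C v)"
 unfolding has_wint_def using assms
 by (auto simp: functional_scaleC has_bochner_integral_iff)

lemma sin_ge_min: "0 <= x1 ==> x1 <= x ==> x <= x2 ==> x2 <= pi ==> min (sin x1) (sin x2) <= sin x"
proof (cases "x <= pi / 2")
 case True
 assume "0 <= x1" "x1 <= x"
 hence "sin x1 <= sin x" using True by (intro sin_monotone_2pi_le) auto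
 thus ?thesis by simp
next
 case False
 assume "x <= x2" "x2 <= pi"
 hence "sin (pi - x2) <= sin (pi - x)" using False by (intro sin_monotone_2pi_le) auto
 thus ?thesis by simp
qed

text \<open>For v outside the strip, half of |Im (w - v)| ranges over an interval inside (0, pi), on
  which the sine is smallest at one of the ends; this explains the minimum.\<close>

lemma cauchy_kernel_strip:
 assumes v: "a < abs (Im v)" "abs (Im v) < 2 * pi - a" and a: "0 <= a"
 shows "EX c>a. (%w. cauchy_kernel w v) holomorphic_on {w. abs (Im w) < c}"
  and "abs (Im w) <= a ==> exp v ~= exp w"
  and "abs (Im w) <= a ==> norm (cauchy_kernel w v) <= 1 / min (sin ((abs (Im v) - a) / 2)) (sin ((abs (Im v) + a) / 2))"
  and "0 < min (sin ((abs (Im v) - a) / 2)) (sin ((abs (Im v) + a) / 2))"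
proof -
 show pos: "0 < min (sin ((abs (Im v) - a) / 2)) (sin ((abs (Im v) + a) / 2))"
  using v a by (auto intro!: sin_gt_zero)
 define c where "c = min (abs (Im v)) (2 * pi - abs (Im v))"
 have c: "c > a" using v by (simp add: c_def)
 have nz: "exp (w - v) ~= 1" if "abs (Im w) < c" for w
 proof -
  have "abs (Im (w - v)) < 2 * pi" "w - v ~= 0" using that by (auto simp: c_def)
  thus ?thesis using exp_eq_one_strip by blast
 qed
 hence "(%w. cauchy_kernel w v) holomorphic_on {w. abs (Im w) < c}"
  unfolding cauchy_kernel_def by (intro holomorphic_intros) auto
 thus "EX c>a. (%w. cauchy_kernel w v) holomorphic_on {w. abs (Im w) < c}" using c by blast
 assume w: "abs (Im w) <= a"
 hence "exp (w - v) ~= 1" using nz c by simp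
 thus "exp v ~= exp w" by (simp add: exp_diff)
 define x where "x = (if Im v >= 0 then (Im v - Im w) / 2 else (Im w - Im v) / 2)"
 have "min (sin ((abs (Im v) - a) / 2)) (sin ((abs (Im v) + a) / 2)) <= sin x"
  using w v a by (intro sin_ge_min) (auto simp: x_def)
 also have "sin x <= abs (sin (Im (w - v) / 2))"
 proof (cases "Im v >= 0")
  case True
  hence "2 * x = Im v - Im w" by (simp add: x_def)
  hence "x = - (Im (w - v) / 2)" unfolding minus_complex.sel by (simp add: field_simps)
  thus ?thesis by (simp only: sin_minus)
 next
  case False
  thus ?thesis by (simp add: x_def)
 qed
 finally have m: "min (sin ((abs (Im v) - a) / 2)) (sin ((abs (Im v) + a) / 2)) <= abs (sin (Im (w - v) / 2))" .
 have "norm (cauchy_kernel w v) <= 1 / abs (sin (Im (w - v) / 2))"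
  by (rule cauchy_kernel_bound(1)) (use w v a in auto)
 also have "... <= 1 / min (sin ((abs (Im v) - a) / 2)) (sin ((abs (Im v) + a) / 2))"
  by (rule divide_left_mono[OF m _ mult_pos_pos[OF pos order_less_le_trans[OF pos m], THEN eq_refl[THEN order_less_le_trans[rotated], OF mult.commute]]]) simp
 finally show "norm (cauchy_kernel w v) <= 1 / min (sin ((abs (Im v) - a) / 2)) (sin ((abs (Im v) + a) / 2))" .
qed

text \<open>\<open>R l\<close> stands for (l - A)^-1. Bounding l R(l) on closed subsectors gives
  uniform bounds along horizontal lines in the logarithmic variable.\<close>

locale sectorial_resolvent =
 fixes A :: "'a::complex_banach graph" and \<omega> :: real and R :: "complex => 'a => 'a"
 assumes \<omega>: "0 <= \<omega>" "\<omega> < pi / 2"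
  and linear: "linear_operator A"
  and R_clinear: "!!l. l \<in> resolvent_region \<omega> ==> clinear_bounded (R l)"
  and R_left: "!!l x y. l \<in> resolvent_region \<omega> ==> (x, y) \<in> A ==> R l (l *\<^sub>C x - y) = x"
  and R_right: "!!l u. l \<in> resolvent_region \<omega> ==> (R l u, l *\<^sub>C R l u - u) \<in> A"
  and R_bound: "!!\<alpha>. \<omega> < \<alpha> ==> EX C>=0. ALL l u. l ~= 0 --> \<alpha> <= abs (Arg l) --> norm (l *\<^sub>C R l u) <= C * norm u"
begin

text \<open>With l = e^w one has dl = l dw; the factor e^w turns the resolvent into a density with
  respect to dw that is bounded along every horizontal line of \<open>region\<close>.\<close>

definition Q :: "complex => 'a => 'a" where "Q w u = exp w *\<^sub>C R (exp w) u"

text \<open>Two copies of the complement of the sector, above and below the real axis. A shift by 2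
  pi i carries the lower one onto the upper one and leaves \<open>Q\<close> unchanged.\<close>

definition region :: "complex set" where "region = {w. \<omega> < abs (Im w) \<and> abs (Im w) < 2 * pi - \<omega>}"

lemma open_region: "open region"
 unfolding region_def by (intro open_Collect_conj open_Collect_less continuous_intros)

lemma exp_region: "w \<in> region ==> exp w \<in> resolvent_region \<omega>"
 using \<omega> by (auto simp: region_def resolvent_region_def abs_Arg_exp)

lemma A_add: "(x, y) \<in> A ==> (u, v) \<in> A ==> (x + u, y + v) \<in> A"
 and A_scaleC: "(x, y) \<in> A ==> (c *\<^sub>C x, c *\<^sub>C y) \<in> A"
 and A_unique: "(x, y) \<in> A ==> (x, y') \<in> A ==> y = y'"
 using linear unfolding linear_operator_def single_valued_def by blast+

lemma Q_clinear: "w \<in> region ==> clinear_bounded (Q w)"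
 unfolding Q_def[abs_def] using R_clinear[OF exp_region] by (intro clinear_bounded_scaleC)

lemmas Q_simps = clinear_boundedD[OF Q_clinear]

lemma Q_graph: "w \<in> region ==> (Q w u, exp w *\<^sub>C (Q w u - u)) \<in> A"
 using A_scaleC[OF R_right[OF exp_region], of w "exp w" u]
 by (simp add: Q_def scaleC.diff_right)

lemma Q_commute_A:
 assumes w: "w \<in> region" and xy: "(x, y) \<in> A"
 shows "exp w *\<^sub>C (Q w x - x) = Q w y" "(Q w x, Q w y) \<in> A"
proof -
 have "R (exp w) (exp w *\<^sub>C x - y) = x" by (rule R_left[OF exp_region[OF w] xy])
 hence "exp w *\<^sub>C x = Q w (exp w *\<^sub>C x - y)" by (simp add: Q_def)
 thus eq: "exp w *\<^sub>C (Q w x - x) = Q w y"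
  by (simp add: Q_simps[OF w] scaleC.diff_right algebra_simps)
 show "(Q w x, Q w y) \<in> A" using Q_graph[OF w, of x] by (simp add: eq)
qed

lemma Q_bound:
 assumes "\<omega> < \<alpha>"
 obtains C where "C >= 0" "!!w u. \<alpha> <= abs (Im w) ==> abs (Im w) <= 2 * pi - \<alpha> ==> norm (Q w u) <= C * norm u"
proof -
 obtain C where C: "C >= 0" "!!l u. l ~= 0 ==> \<alpha> <= abs (Arg l) ==> norm (l *\<^sub>C R l u) <= C * norm u"
  using R_bound[OF assms] by blast
 have "norm (Q w u) <= C * norm u" if "\<alpha> <= abs (Im w)" "abs (Im w) <= 2 * pi - \<alpha>" for w u
  unfolding Q_def by (rule C(2)) (use that assms \<omega> in \<open>auto simp: abs_Arg_exp\<close>)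
 thus ?thesis using that C(1) by blast
qed

lemma resolvent_identity:
 assumes w: "w \<in> region" "v \<in> region"
 shows "(exp v - exp w) *\<^sub>C Q w (Q v u) = exp v *\<^sub>C Q w u - exp w *\<^sub>C Q v u"
proof -
 have "exp w *\<^sub>C (Q w (Q v u) - Q v u) = Q w (exp v *\<^sub>C (Q v u - u))"
  by (rule Q_commute_A(1)[OF w(1) Q_graph[OF w(2)]])
 hence "exp w *\<^sub>C Q w (Q v u) - exp w *\<^sub>C Q v u = exp v *\<^sub>C Q w (Q v u) - exp v *\<^sub>C Q w u"
  by (simp add: Q_simps[OF w(1)] scaleC.diff_right)
 thus ?thesis by (simp add: scaleC.diff_left algebra_simps)
qed

text \<open>The resolvent identity in the logarithmic variable: the two coefficients are Cauchy
  kernels that add up to 1. The multiplicativity of \<open>Psi\<close> rests on this form.\<close>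

lemma resolvent_identity_kernel:
 assumes w: "w \<in> region" "v \<in> region" "exp v ~= exp w"
 shows "Q w (Q v u) = cauchy_kernel w v *\<^sub>C Q w u - (cauchy_kernel w v - 1) *\<^sub>C Q v u"
proof -
 have e: "exp v - exp w ~= 0" using w(3) by simp
 have k: "cauchy_kernel w v = exp v / (exp v - exp w)"
 proof -
  have "1 - exp (w - v) = (exp v - exp w) / exp v" by (simp add: exp_diff diff_divide_distrib)
  thus ?thesis by (simp add: cauchy_kernel_def)
 qed
 have k1: "cauchy_kernel w v - 1 = exp w / (exp v - exp w)" using e by (simp add: k field_simps)
 have "Q w (Q v u) = (1 / (exp v - exp w)) *\<^sub>C (exp v - exp w) *\<^sub>C Q w (Q v u)" using e by simp
 also have "... = (1 / (exp v - exp w)) *\<^sub>C (exp v *\<^sub>C Q w u - exp w *\<^sub>C Q v u)"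
  by (simp only: resolvent_identity[OF w(1,2)])
 finally show ?thesis unfolding k1 unfolding k by (simp add: scaleC.diff_right)
qed

lemma Q_commute:
 assumes w: "w \<in> region" "v \<in> region" shows "Q w (Q v u) = Q v (Q w u)"
proof (cases "exp v = exp w")
 case True thus ?thesis by (simp add: Q_def)
next
 case False
 have "(exp w - exp v) *\<^sub>C Q v (Q w u) = exp w *\<^sub>C Q v u - exp v *\<^sub>C Q w u"
  by (rule resolvent_identity[OF w(2,1)])
 hence "(exp v - exp w) *\<^sub>C Q v (Q w u) = exp v *\<^sub>C Q w u - exp w *\<^sub>C Q v u"
  by (metis minus_diff_eq scaleC.minus_left)
 hence "(exp v - exp w) *\<^sub>C (Q w (Q v u) - Q v (Q w u)) = 0"
  using resolvent_identity[OF w] by (simp add: scaleC.diff_right)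
 hence "norm (exp v - exp w) * norm (Q w (Q v u) - Q v (Q w u)) = 0"
  by (metis norm_scaleC norm_zero)
 thus ?thesis using False by simp
qed

lemma Q_tendsto: "w \<in> region ==> ((%v. Q v u) \<longlongrightarrow> Q w u) (at w)"
proof -
 assume w: "w \<in> region"
 define m where "m = min (abs (Im w)) (2 * pi - abs (Im w))"
 define \<alpha> where "\<alpha> = (\<omega> + m) / 2"
 have "\<omega> < m" "m <= abs (Im w)" "m <= 2 * pi - abs (Im w)" using w by (auto simp: m_def region_def)
 hence \<alpha>: "\<omega> < \<alpha>" "\<alpha> < abs (Im w)" "abs (Im w) < 2 * pi - \<alpha>" unfolding \<alpha>_def by (simp_all add: field_simps)
 obtain C where C: "C >= 0" "!!w u. \<alpha> <= abs (Im w) ==> abs (Im w) <= 2 * pi - \<alpha> ==> norm (Q w u) <= C * norm u"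
  using Q_bound[OF \<alpha>(1)] by metis
 have op: "open {v. \<alpha> < abs (Im v) \<and> abs (Im v) < 2 * pi - \<alpha>}"
  by (intro open_Collect_conj open_Collect_less continuous_intros)
 have ev: "\<forall>\<^sub>F v in at w. \<alpha> < abs (Im v) \<and> abs (Im v) < 2 * pi - \<alpha>"
  using eventually_at_topological op \<alpha> by blast
 text \<open>The resolvent identity gives $e^v (Q_v - Q_w) = (e^v - e^w)(Q_v - Q_v Q_w)$.\<close>
 have le: "norm (Q v u - Q w u) <= norm (exp v - exp w) * (C * (norm u + norm (Q w u))) / norm (exp v)"
  if v: "\<alpha> < abs (Im v)" "abs (Im v) < 2 * pi - \<alpha>" for v
 proof -
  have vr: "v \<in> region" using v \<alpha> by (auto simp: region_def)
  have "(exp w - exp v) *\<^sub>C Q v (Q w u) = exp w *\<^sub>C Q v u - exp v *\<^sub>C Q w u"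
   by (rule resolvent_identity[OF vr w])
  hence "exp v *\<^sub>C (Q v u - Q w u) = (exp v - exp w) *\<^sub>C (Q v u - Q v (Q w u))"
   by (simp add: scaleC.diff_right scaleC.diff_left algebra_simps)
  hence "norm (exp v) * norm (Q v u - Q w u) = norm (exp v - exp w) * norm (Q v (u - Q w u))"
   by (metis norm_scaleC Q_simps(2)[OF vr])
  also have "... <= norm (exp v - exp w) * (C * norm (u - Q w u))"
   by (intro mult_left_mono C) (use v in auto)
  also have "... <= norm (exp v - exp w) * (C * (norm u + norm (Q w u)))"
   by (intro mult_left_mono norm_triangle_ineq4 C) auto
  finally show ?thesis by (simp add: field_simps)
 qed
 have "((%v. norm (exp v - exp w) * (C * (norm u + norm (Q w u))) / norm (exp v)) \<longlongrightarrow>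
   norm (exp w - exp w) * (C * (norm u + norm (Q w u))) / norm (exp w)) (at w)"
  by (intro tendsto_intros) auto
 hence "((%v. norm (exp v - exp w) * (C * (norm u + norm (Q w u))) / norm (exp v)) \<longlongrightarrow> 0) (at w)" by simp
 hence "((%v. Q v u - Q w u) \<longlongrightarrow> 0) (at w)"
  by (rule Lim_null_comparison[rotated]) (use ev le in \<open>auto elim: eventually_mono\<close>)
 thus ?thesis by (rule Lim_null[THEN iffD2])
qed

lemma Q_continuous_on: "S \<subseteq> region ==> continuous_on S (%w. Q w u)"
 using Q_tendsto by (intro continuous_at_imp_continuous_on) (auto simp: isCont_def)

lemma Q_line_continuous:
 assumes "\<omega> < abs t" "abs t < 2 * pi - \<omega>"
 shows "continuous_on UNIV (%s. Q (Complex s t) u)"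
 by (rule continuous_on_compose2[OF Q_continuous_on[of region]])
  (use assms in \<open>auto simp: region_def intro!: continuous_intros\<close>)

text \<open>The resolvent identity rewrites the difference quotient as (e^v - e^w)/(v - w) times a
  factor that converges by strong continuity of \<open>Q\<close>.\<close>

lemma Q_holomorphic:
 assumes ph: "clinear_bounded (ph :: 'a => complex)"
 shows "(%w. ph (Q w u)) holomorphic_on region"
 unfolding holomorphic_on_open[OF open_region]
proof
 fix w assume w: "w \<in> region"
 have "((%v. (ph (Q v u) - ph (Q w u)) / (v - w)) \<longlongrightarrow> (exp w * ph (Q w u - Q w (Q w u))) / exp w) (at w)"
 proof (rule Lim_transform_eventually)
  have "((%v. (exp v - exp w) / (v - w)) \<longlongrightarrow> exp w) (at w)"
   using DERIV_exp[of w] by (simp add: has_field_derivative_iff)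
  thus "((%v. ((exp v - exp w) / (v - w)) * ph (Q v u - Q v (Q w u)) / exp v) \<longlongrightarrow>
    (exp w * ph (Q w u - Q w (Q w u))) / exp w) (at w)"
   using Q_tendsto[OF w] by (intro tendsto_intros clinear_bounded_tendsto[OF ph]) auto
  have "\<forall>\<^sub>F v in at w. v \<in> region \<and> v ~= w"
   using w open_region by (auto simp: eventually_at_topological)
  thus "\<forall>\<^sub>F v in at w. ((exp v - exp w) / (v - w)) * ph (Q v u - Q v (Q w u)) / exp v =
    (ph (Q v u) - ph (Q w u)) / (v - w)"
  proof eventually_elim
   case (elim v)
   have "(exp w - exp v) *\<^sub>C Q v (Q w u) = exp w *\<^sub>C Q v u - exp v *\<^sub>C Q w u"
    by (rule resolvent_identity) (use elim w in auto)
   hence "exp v *\<^sub>C (Q v u - Q w u) = (exp v - exp w) *\<^sub>C (Q v u - Q v (Q w u))"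
    by (simp add: scaleC.diff_right scaleC.diff_left algebra_simps)
   hence "exp v * (ph (Q v u) - ph (Q w u)) = (exp v - exp w) * ph (Q v u - Q v (Q w u))"
    using functional_scaleC[OF ph] clinear_boundedD(2)[OF ph] by metis
   hence "(exp v - exp w) * ph (Q v u - Q v (Q w u)) / exp v = ph (Q v u) - ph (Q w u)"
    by (simp add: divide_eq_eq mult.commute)
   thus ?case by (metis times_divide_eq_left divide_divide_eq_left mult.commute)
  qed
 qed
 thus "EX f'. ((%w. ph (Q w u)) has_field_derivative f') (at w)"
  by (auto simp: has_field_derivative_iff)
qed

text \<open>In the variable l = e^w this is 1/(2 pi i) times the integral of h (l - A)^-1 over the
  positively oriented boundary of the sector of half-angle a. It converges absolutely when h decays
  in the sense of \<open>strip_decay\<close>.\<close>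

definition Psi :: "real => (complex => complex) => 'a => 'a" where
 "Psi a h u = (1 / (2 * of_real pi * \<i>)) *\<^sub>C wint (line_diff a (%w. h w *\<^sub>C Q w u))"

lemma line_bound:
 assumes a: "\<omega> < a" "a < pi" and h: "strip_decay a h"
 obtains C where "C >= 0" "!!s t u. abs t = a ==> norm (h (Complex s t) *\<^sub>C Q (Complex s t) u) <= C * exp (- abs s) * norm u"
proof -
 obtain C1 where C1: "C1 >= 0" "!!w u. a <= abs (Im w) ==> abs (Im w) <= 2 * pi - a ==> norm (Q w u) <= C1 * norm u"
  using Q_bound[OF a(1)] by metis
 obtain C2 where C2: "C2 >= 0" "!!s t. abs t <= a ==> norm (h (Complex s t)) <= C2 * exp (- abs s)"
  using strip_decay_bound[OF h] by metis
 show ?thesis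
 proof (rule that[of "C2 * C1"])
  fix s t u assume t: "abs t = a"
  have "norm (h (Complex s t)) * norm (Q (Complex s t) u) <= (C2 * exp (- abs s)) * (C1 * norm u)"
   by (intro mult_mono C1 C2) (use t a C2(1) in auto)
  thus "norm (h (Complex s t) *\<^sub>C Q (Complex s t) u) <= C2 * C1 * exp (- abs s) * norm u"
   by (simp add: norm_scaleC mult_ac)
 qed (use C1 C2 in auto)
qed

lemma has_wint_Psi:
 assumes a: "\<omega> < a" "a < pi" and h: "strip_decay a h"
 shows "has_wint (line_diff a (%w. h w *\<^sub>C Q w u)) ((2 * of_real pi * \<i>) *\<^sub>C Psi a h u)"
proof -
 obtain C where C: "!!s t. abs t = a ==> norm (h (Complex s t) *\<^sub>C Q (Complex s t) u) <= C * exp (- abs s) * norm u"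
  using line_bound[OF a h] by metis
 have "has_wint (line_diff a (%w. h w *\<^sub>C Q w u)) (wint (line_diff a (%w. h w *\<^sub>C Q w u)))"
 proof (rule has_wint_wintI)
  show "continuous_on UNIV (line_diff a (%w. h w *\<^sub>C Q w u))"
   using a \<omega> by (intro continuous_on_line_diff continuous_on_scaleC strip_decay_continuous[OF h] Q_line_continuous) auto
  show "norm (line_diff a (%w. h w *\<^sub>C Q w u) s) <= 2 * (C * exp (- abs s) * norm u)" for s
   by (rule norm_line_diff) (use C a \<omega> in auto)
  show "integrable lborel (%s. 2 * (C * exp (- abs s) * norm u))"
   by (intro integrable_mult_right integrable_mult_left integrable_exp_neg_abs)
 qed
 thus ?thesis by (simp add: Psi_def)
qed

lemma Psi_functional:
 assumes a: "\<omega> < a" "a < pi" and h: "strip_decay a h" and ph: "clinear_bounded (ph :: 'a => complex)"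
 shows "integrable lborel (line_diff a (%w. h w * ph (Q w u)))"
  "(LINT s|lborel. line_diff a (%w. h w * ph (Q w u)) s) = 2 * of_real pi * \<i> * ph (Psi a h u)"
 using has_wintD[OF has_wint_Psi[OF a h] ph, of u]
 by (simp_all add: line_diff_functional[OF ph] functional_scaleC[OF ph])

lemma Psi_eqI:
 assumes a: "\<omega> < a" "a < pi" and h: "strip_decay a h"
  and w: "has_wint (line_diff a (%w. h w *\<^sub>C Q w u)) ((2 * of_real pi * \<i>) *\<^sub>C v)"
 shows "Psi a h u = v"
proof -
 have "(2 * of_real pi * \<i>) *\<^sub>C Psi a h u = (2 * of_real pi * \<i>) *\<^sub>C v"
  by (rule has_wint_unique[OF has_wint_Psi[OF a h] w])
 hence "(1 / (2 * of_real pi * \<i>)) *\<^sub>C (2 * of_real pi * \<i>) *\<^sub>C Psi a h u = (1 / (2 * of_real pi * \<i>)) *\<^sub>C (2 * of_real pi * \<i>) *\<^sub>C v"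
  by (simp only:)
 thus ?thesis by simp
qed

lemma Psi_clinear:
 assumes a: "\<omega> < a" "a < pi" and h: "strip_decay a h"
 shows "clinear_bounded (Psi a h)"
proof -
 obtain C where C: "!!s t u. abs t = a ==> norm (h (Complex s t) *\<^sub>C Q (Complex s t) u) <= C * exp (- abs s) * norm u"
  using line_bound[OF a h] by metis
 have reg: "Complex s (- a) \<in> region" "Complex s a \<in> region" for s using a \<omega> by (auto simp: region_def)
 note W = has_wint_Psi[OF a h]
 show ?thesis
 proof (rule clinear_boundedI)
  fix x y c
  show "Psi a h (x + y) = Psi a h x + Psi a h y"
  proof (rule Psi_eqI[OF a h])
   show "has_wint (line_diff a (%w. h w *\<^sub>C Q w (x + y))) ((2 * of_real pi * \<i>) *\<^sub>C (Psi a h x + Psi a h y))"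
    using has_wint_add[OF W[of x] W[of y]]
    by (simp add: line_diff_def[abs_def] Q_simps[OF reg(1)] Q_simps[OF reg(2)] scaleC_add_right algebra_simps)
  qed
  show "Psi a h (c *\<^sub>C x) = c *\<^sub>C Psi a h x"
  proof (rule Psi_eqI[OF a h])
   show "has_wint (line_diff a (%w. h w *\<^sub>C Q w (c *\<^sub>C x))) ((2 * of_real pi * \<i>) *\<^sub>C c *\<^sub>C Psi a h x)"
    using has_wint_scaleC[OF W[of x], of c]
    by (simp add: line_diff_def[abs_def] Q_simps[OF reg(1)] Q_simps[OF reg(2)] scaleC.diff_right mult_ac)
  qed
  have "norm ((2 * of_real pi * \<i>) *\<^sub>C Psi a h x) <= (LINT s|lborel. 2 * (C * exp (- abs s) * norm x))"
  proof (rule has_wint_norm_bound[OF W])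
   show "norm (line_diff a (%w. h w *\<^sub>C Q w x) s) <= 2 * (C * exp (- abs s) * norm x)" for s
    by (rule norm_line_diff) (use C a \<omega> in auto)
   show "integrable lborel (%s. 2 * (C * exp (- abs s) * norm x))"
    by (intro integrable_mult_right integrable_mult_left integrable_exp_neg_abs)
  qed
  also have "... = 4 * C * norm x" by (simp add: integral_exp_neg_abs)
  finally show "norm (Psi a h x) <= (4 * C / (2 * pi)) * norm x"
   by (simp add: norm_scaleC norm_mult field_simps)
 qed
qed

lemma Psi_commute:
 assumes a: "\<omega> < a" "a < pi" and h: "strip_decay a h"
  and B: "clinear_bounded B" "!!w u. w \<in> region ==> B (Q w u) = Q w (B u)"
 shows "B (Psi a h u) = Psi a h (B u)"
proof (rule sym, rule Psi_eqI[OF a h])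
 have reg: "Complex s (- a) \<in> region" "Complex s a \<in> region" for s using a \<omega> by (auto simp: region_def)
 show "has_wint (line_diff a (%w. h w *\<^sub>C Q w (B u))) ((2 * of_real pi * \<i>) *\<^sub>C B (Psi a h u))"
  using has_wint_compose[OF has_wint_Psi[OF a h] B(1), of u]
  by (simp add: line_diff_def[abs_def] clinear_boundedD[OF B(1)] B(2) reg)
qed

text \<open>Between the heights a and b, and likewise below the axis, the scalar integrands are
  holomorphic and decay, so each edge can be moved separately.\<close>

lemma Psi_angle_independent:
 assumes a: "\<omega> < a" "a <= b" "b < pi" and h: "strip_decay b h"
 shows "Psi a h u = Psi b h u"
proof (rule Psi_eqI)
 show "\<omega> < a" "a < pi" using a by auto
 show ha: "strip_decay a h" by (rule strip_decay_mono[OF h a(2)])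
 obtain c where c: "c > b" "h holomorphic_on {w. abs (Im w) < c}" using h by (auto simp: strip_decay_def)
 obtain C1 where C1: "C1 >= 0" "!!w u. a <= abs (Im w) ==> abs (Im w) <= 2 * pi - a ==> norm (Q w u) <= C1 * norm u"
  using Q_bound[OF a(1)] by metis
 obtain C2 where C2: "C2 >= 0" "!!s t. abs t <= b ==> norm (h (Complex s t)) <= C2 * exp (- abs s)"
  using strip_decay_bound[OF h] by metis
 have a0: "0 <= a" using a \<omega> by simp
 have bpi: "\<omega> < b" "b < pi" using a by auto
 show "has_wint (line_diff a (%w. h w *\<^sub>C Q w u)) ((2 * of_real pi * \<i>) *\<^sub>C Psi b h u)"
  unfolding has_wint_def has_bochner_integral_iff
 proof (intro allI impI conjI)
  fix ph :: "'a => complex" assume ph: "clinear_bounded ph"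
  note apc = \<open>\<omega> < a\<close> \<open>a < pi\<close>
  obtain K where K: "K >= 0" "!!x. norm (ph x) <= K * norm x" using clinear_bounded_bound[OF ph] by blast
  define H where "H w = h w * ph (Q w u)" for w
  define U where "U = region \<inter> {w. abs (Im w) < c}"
  have U: "open U" unfolding U_def by (intro open_Int open_region open_strip)
  have holH: "H holomorphic_on U" unfolding H_def U_def
   by (intro holomorphic_on_mult holomorphic_on_subset[OF c(2)] holomorphic_on_subset[OF Q_holomorphic[OF ph]]) auto
  have le: "norm (H (Complex s t)) <= (C2 * (K * (C1 * norm u))) * exp (- abs s)" if "a <= abs t" "abs t <= b" for s t
  proof -
   have "norm (ph (Q (Complex s t) u)) <= K * (C1 * norm u)"
    using K(2)[of "Q (Complex s t) u"] mult_left_mono[OF C1(2)[of "Complex s t" u] K(1)] that a by auto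
   hence "norm (h (Complex s t)) * norm (ph (Q (Complex s t) u)) <= (C2 * exp (- abs s)) * (K * (C1 * norm u))"
    by (intro mult_mono C2) (use that C2 in auto)
   thus ?thesis by (simp add: H_def norm_mult mult_ac)
  qed
  have cont: "continuous_on UNIV (%s. H (Complex s t))" if "a <= abs t" "abs t <= b" for t
   using that a c by (intro continuous_on_compose2[OF holomorphic_on_imp_continuous_on[OF holH]])
    (auto intro!: continuous_intros simp: U_def region_def)
  have int: "integrable lborel (%s. H (Complex s t))" if "a <= abs t" "abs t <= b" for t
   by (rule integrable_continuous_dominated[OF cont[OF that] le[OF that]])
    (intro integrable_mult_right integrable_exp_neg_abs)
  have "(LINT s|lborel. H (Complex s b) - H (Complex s a)) = 0"
   by (rule cauchy_decaying[OF holH U, where C = "C2 * (K * (C1 * norm u))"])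
    (use a a0 c le in \<open>auto simp: U_def region_def\<close>)
  moreover have "(LINT s|lborel. H (Complex s (- a)) - H (Complex s (- b))) = 0"
   by (rule cauchy_decaying[OF holH U, where C = "C2 * (K * (C1 * norm u))"])
    (use a a0 c le in \<open>auto simp: U_def region_def\<close>)
  ultimately have "(LINT s|lborel. line_diff a H s) = (LINT s|lborel. line_diff b H s)"
   unfolding line_diff_def using int a a0 by (simp add: Bochner_Integration.integral_diff)
  also have "... = 2 * of_real pi * \<i> * ph (Psi b h u)"
   unfolding H_def by (rule Psi_functional(2)[OF bpi h ph])
  finally show "(LINT s|lborel. ph (line_diff a (%w. h w *\<^sub>C Q w u) s)) = ph ((2 * of_real pi * \<i>) *\<^sub>C Psi b h u)"
   by (simp add: line_diff_functional[OF ph] functional_scaleC[OF ph] H_def[abs_def])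
  show "integrable lborel (%s. ph (line_diff a (%w. h w *\<^sub>C Q w u) s))"
   using Psi_functional(1)[OF apc ha ph, of u]
   by (simp add: line_diff_functional[OF ph] functional_scaleC[OF ph])
 qed
qed

text \<open>The resolvent identity splits h Q_w Q_v into (h k) Q_w minus h (k - 1) Q_v, with k the
  Cauchy kernel at v. Since v lies outside the strip, h (k - 1) is holomorphic inside it and its
  contour integral vanishes.\<close>

lemma Psi_Q:
 assumes a: "\<omega> < a" "a < pi" and h: "strip_decay a h"
  and v: "a < abs (Im v)" "abs (Im v) < 2 * pi - a"
 shows "strip_decay a (%w. h w * cauchy_kernel w v)"
  and "Psi a h (Q v u) = Psi a (%w. h w * cauchy_kernel w v) u"
proof -
 have a0: "0 <= a" using a \<omega> by simp
 note ker = cauchy_kernel_strip[OF v a0]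
 obtain c where c: "c > a" "(%w. cauchy_kernel w v) holomorphic_on {w. abs (Im w) < c}" using ker(1) by blast
 define D where "D = 1 / min (sin ((abs (Im v) - a) / 2)) (sin ((abs (Im v) + a) / 2))"
 have k: "norm (cauchy_kernel w v) <= D" if "abs (Im w) <= a" for w using ker(3)[OF that] by (simp add: D_def)
 show hk: "strip_decay a (%w. h w * cauchy_kernel w v)"
  by (rule strip_decay_mult[OF h c(2,1) k])
 have hk1: "strip_decay a (%w. h w * (cauchy_kernel w v - 1))"
 proof (rule strip_decay_mult[OF h _ c(1)])
  show "(%w. cauchy_kernel w v - 1) holomorphic_on {w. abs (Im w) < c}" by (intro holomorphic_intros c(2))
  show "norm (cauchy_kernel w v - 1) <= D + 1" if "abs (Im w) <= a" for w
   using norm_triangle_ineq4[of "cauchy_kernel w v" 1] k[OF that] by simp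
 qed
 have vr: "v \<in> region" using v a by (auto simp: region_def)
 define e where "e = line_diff a (%w. h w * (cauchy_kernel w v - 1))"
 have ie: "integrable lborel e"
  unfolding e_def line_diff_def using strip_decay_integrable[OF hk1] a0 by (intro Bochner_Integration.integrable_diff) auto
 have "(LINT s|lborel. e s) = - (LINT s|lborel. h (Complex s a) * (cauchy_kernel (Complex s a) v - 1) -
   h (Complex s (- a)) * (cauchy_kernel (Complex s (- a)) v - 1))"
  by (simp add: e_def line_diff_def flip: Bochner_Integration.integral_minus)
 also have "... = 0" using strip_decay_cauchy[OF hk1 a0] by simp
 finally have e0: "(LINT s|lborel. e s) = 0" .
 have eq: "line_diff a (%w. h w *\<^sub>C Q w (Q v u)) s =
   line_diff a (%w. (h w * cauchy_kernel w v) *\<^sub>C Q w u) s - e s *\<^sub>C Q v u" for s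
 proof -
  have "h w *\<^sub>C Q w (Q v u) = (h w * cauchy_kernel w v) *\<^sub>C Q w u - (h w * (cauchy_kernel w v - 1)) *\<^sub>C Q v u"
   if "abs (Im w) = a" for w
  proof -
   have "w \<in> region" using that a a0 \<omega> by (auto simp: region_def)
   thus ?thesis
    using resolvent_identity_kernel[OF _ vr ker(2), of w u] that by (simp add: scaleC.diff_right)
  qed
  from this[of "Complex s a"] this[of "Complex s (- a)"] show ?thesis
   using a0 by (simp add: line_diff_def e_def scaleC.diff_left)
 qed
 have "has_wint (line_diff a (%w. h w *\<^sub>C Q w (Q v u)))
   ((2 * of_real pi * \<i>) *\<^sub>C Psi a (%w. h w * cauchy_kernel w v) u - 0 *\<^sub>C Q v u)"
  unfolding eq using has_wint_diff[OF has_wint_Psi[OF a hk, of u] has_wint_scaleC_const[OF ie, of "Q v u"]] e0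
  by simp
 thus "Psi a h (Q v u) = Psi a (%w. h w * cauchy_kernel w v) u"
  by (intro Psi_eqI[OF a h]) simp
qed

end

section \<open>The operators $t^q (t^q + A^q)^{-1}$\<close>

text \<open>A bound by a product of integrable functions is the form in which joint integrability is
  always obtained below; one of the factors may live on the Levy measure.\<close>

lemma fubini_dominated:
 fixes F :: "'x => 'y => complex"
 assumes "pair_sigma_finite M1 M2" and F[measurable]: "case_prod F \<in> borel_measurable (M1 \<Otimes>\<^sub>M M2)"
  and le: "!!x y. x \<in> space M1 ==> y \<in> space M2 ==> norm (F x y) <= m1 x * m2 y"
  and m: "integrable M1 m1" "integrable M2 m2"
 shows "integrable M1 (%x. LINT y|M2. F x y)"
  and "(\<integral>y. \<integral>x. F x y \<partial>M1 \<partial>M2) = (\<integral>x. \<integral>y. F x y \<partial>M2 \<partial>M1)"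
proof -
 interpret pair_sigma_finite M1 M2 by fact
 note [measurable] = borel_measurable_integrable[OF m(1)] borel_measurable_integrable[OF m(2)]
 have i2: "integrable M2 (F x)" if "x \<in> space M1" for x
  by (rule Bochner_Integration.integrable_bound[OF integrable_mult_right[OF m(2), of "m1 x"]])
   (use le[OF that] that F in \<open>auto intro!: order_trans[OF le[OF that]]\<close>)
 have "integrable M1 (%x. LINT y|M2. norm (F x y))"
 proof (rule Bochner_Integration.integrable_bound[OF integrable_mult_left[OF m(1), of "\<integral>y. m2 y \<partial>M2"]])
  show "(%x. LINT y|M2. norm (F x y)) \<in> borel_measurable M1" by measurable
  show "AE x in M1. norm (LINT y|M2. norm (F x y)) <= norm (m1 x * (LINT y|M2. m2 y))"
  proof (rule AE_I2)
   fix x assume x: "x \<in> space M1"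
   have "(LINT y|M2. norm (F x y)) <= (LINT y|M2. m1 x * m2 y)"
    using i2[OF x] m(2) le[OF x] by (intro integral_mono) auto
   moreover have "0 <= (LINT y|M2. norm (F x y))" by (rule integral_nonneg_AE) simp
   ultimately show "norm (LINT y|M2. norm (F x y)) <= norm (m1 x * (LINT y|M2. m2 y))" by simp
  qed
 qed
 hence int: "integrable (M1 \<Otimes>\<^sub>M M2) (case_prod F)"
  by (intro Fubini_integrable F) (use i2 in auto)
 show "integrable M1 (%x. LINT y|M2. F x y)" using integrable_fst'[OF int] by simp
 show "(\<integral>y. \<integral>x. F x y \<partial>M1 \<partial>M2) = (\<integral>x. \<integral>y. F x y \<partial>M2 \<partial>M1)"
  by (rule Fubini_integral[OF int])
qed

lemma fubini_continuous:
 fixes F :: "real => real => complex"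
 assumes "continuous_on UNIV (%p. F (fst p) (snd p))" and "!!x y. norm (F x y) <= m1 x * m2 y"
  and "integrable lborel m1" "integrable lborel m2"
 shows "integrable lborel (%x. LINT y|lborel. F x y)"
  and "(\<integral>y. \<integral>x. F x y \<partial>lborel \<partial>lborel) = (\<integral>x. \<integral>y. F x y \<partial>lborel \<partial>lborel)"
proof -
 have "pair_sigma_finite lborel (lborel :: real measure)" by unfold_locales
 moreover have "case_prod F \<in> borel_measurable (lborel \<Otimes>\<^sub>M lborel)"
  unfolding lborel_prod using borel_measurable_continuous_onI[OF assms(1)] by (simp add: case_prod_beta')
 ultimately show "integrable lborel (%x. LINT y|lborel. F x y)"
  "(\<integral>y. \<integral>x. F x y \<partial>lborel \<partial>lborel) = (\<integral>x. \<integral>y. F x y \<partial>lborel \<partial>lborel)"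
  using fubini_dominated[of lborel lborel F m1 m2] assms by auto
qed

text \<open>Subtracting \<open>psi 1\<close> cancels the limit 1 at -infinity, so that the
  difference decays on both sides.\<close>

definition phi_fun :: "real => complex => complex" where
 "phi_fun q w = psi q w - psi 1 w"

text \<open>This is where q >= 2 pays off: e^(qs) is at most e^(2s) for s <= 0 and at least e^(2s)
  for s >= 0, which gives the constant 1 in front of e^-|s|.\<close>

lemma phi_fun_real_bound:
 fixes s q :: real
 assumes q: "q >= 2"
 shows "(exp s + exp (q * s)) / ((1 + exp s) * (1 + exp (q * s))) <= exp (- abs s)"
proof -
 have pos: "0 < (1 + exp s) * (1 + exp (q * s))" by (intro mult_pos_pos add_pos_pos) auto
 show ?thesis
 proof (cases "s <= 0")
  case True
  have "q * s <= 2 * s" by (rule mult_right_mono_neg[OF q True])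
  hence "exp (q * s) <= exp (2 * s)" by simp
  also have "... = exp s * exp s" by (simp add: exp_double power2_eq_square)
  finally have "exp s + exp (q * s) <= exp s * (1 + exp s) * 1" by (simp add: distrib_left)
  also have "... <= exp s * (1 + exp s) * (1 + exp (q * s))" by (intro mult_left_mono) (auto simp: add_nonneg_nonneg)
  finally show ?thesis using True pos by (simp add: divide_le_eq mult_ac)
 next
  case False
  have "2 * s <= q * s" by (rule mult_right_mono[OF q]) (use False in auto)
  hence "exp (2 * s) <= exp (q * s)" by simp
  hence "exp s * exp s <= exp (q * s)" by (simp add: exp_double power2_eq_square)
  hence "(exp s + exp (q * s)) * exp s <= (1 + exp s) * (1 + exp (q * s))"
   by (simp add: algebra_simps) (smt (verit) exp_gt_zero)
  hence "(exp s + exp (q * s)) / ((1 + exp s) * (1 + exp (q * s))) <= 1 / exp s"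
   using pos by (simp add: divide_le_eq pos_le_divide_eq mult_ac)
  thus ?thesis using False by (simp add: exp_minus divide_inverse)
 qed
qed

lemma phi_fun_bound:
 assumes q: "q >= 2" and t: "abs (q * Im w) < pi"
 shows "norm (phi_fun q w) <= 1 / (cos (Im w / 2) * cos (q * Im w / 2)) * exp (- abs (Re w))"
proof -
 have "abs (Im w) <= abs (q * Im w)" using q mult_right_mono[of 1 q "abs (Im w)"] by (simp add: abs_mult)
 hence t1: "abs (1 * Im w) < pi" using t by simp
 have c: "cos (Im w / 2) > 0" "cos (q * Im w / 2) > 0"
  using t t1 by (auto intro!: cos_gt_zero_pi)
 define E1 E2 where "E1 = exp w" and "E2 = exp (of_real q * w)"
 have nz: "1 + E1 ~= 0" "1 + E2 ~= 0"
  using psi_bound(1)[OF t1] psi_bound(1)[OF t] by (auto simp: E1_def E2_def)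
 have n1: "cos (Im w / 2) * (1 + exp (Re w)) <= norm (1 + E1)"
  using norm_one_plus_exp_ge[of w] c by (simp add: E1_def)
 have n2: "cos (q * Im w / 2) * (1 + exp (q * Re w)) <= norm (1 + E2)"
  using norm_one_plus_exp_ge[of "of_real q * w"] c by (simp add: E2_def)
 have eq: "phi_fun q w = (E1 - E2) / ((1 + E1) * (1 + E2))"
  unfolding phi_fun_def psi_def using nz by (simp add: E1_def E2_def field_simps)
 define D where "D = (cos (Im w / 2) * (1 + exp (Re w))) * (cos (q * Im w / 2) * (1 + exp (q * Re w)))"
 have D: "D > 0" unfolding D_def by (intro mult_pos_pos c add_pos_pos) auto
 have le: "D <= norm ((1 + E1) * (1 + E2))"
  unfolding norm_mult D_def using n1 n2 c by (intro mult_mono) (auto simp: add_nonneg_nonneg)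
 have "norm (phi_fun q w) = norm (E1 - E2) / norm ((1 + E1) * (1 + E2))"
  by (simp only: eq norm_divide)
 also have "... <= norm (E1 - E2) / D"
  by (rule divide_left_mono[OF le _ mult_pos_pos[OF order_less_le_trans[OF D le] D]]) simp
 also have "... <= (exp (Re w) + exp (q * Re w)) / D"
  using norm_triangle_ineq4[of E1 E2] D by (intro divide_right_mono) (auto simp: E1_def E2_def)
 also have "... = 1 / (cos (Im w / 2) * cos (q * Im w / 2)) *
   ((exp (Re w) + exp (q * Re w)) / ((1 + exp (Re w)) * (1 + exp (q * Re w))))"
  by (simp add: D_def mult_ac)
 also have "... <= 1 / (cos (Im w / 2) * cos (q * Im w / 2)) * exp (- abs (Re w))"
  using c by (intro mult_left_mono phi_fun_real_bound q) auto
 finally show ?thesis .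
qed

lemma cos_half_bounds:
 assumes "0 <= r" "abs t <= b" "r * b < pi" shows "0 < cos (r * b / 2)" "cos (r * b / 2) <= cos (r * t / 2)"
proof -
 have b: "0 <= b" using assms(2) by linarith
 hence rb: "0 <= r * b" using assms(1) by simp
 thus "0 < cos (r * b / 2)" using assms(3) by (intro cos_gt_zero_pi) auto
 have "abs (r * t) <= r * b" using assms by (simp add: abs_mult mult_left_mono)
 hence "cos (r * b / 2) <= cos (abs (r * t) / 2)" using assms rb by (intro cos_monotone_0_pi_le) auto
 also have "abs (r * t) / 2 = abs (r * t / 2)" by simp
 finally show "cos (r * b / 2) <= cos (r * t / 2)" by (simp only: cos_abs_real)
qed

locale sectorial_psi = sectorial_resolvent A \<omega> R
 for A :: "'a::complex_banach graph" and \<omega> R +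
 fixes q b :: real
 assumes q2: "q >= 2" and b: "\<omega> < b" "q * b < pi"
begin

lemma b0: "0 < b" "b < pi / 2" "b < pi"
proof -
 show 0: "0 < b" using b \<omega> by simp
 have "2 * b <= q * b" using q2 0 by (intro mult_right_mono) auto
 hence "2 * b < pi" using b by linarith
 thus "b < pi / 2" "b < pi" using 0 by simp_all
qed

lemma q_strip: "abs t < pi / q ==> abs (q * t) < pi" "b < pi / q"
proof -
 show "abs t < pi / q ==> abs (q * t) < pi" using q2 by (simp add: abs_mult field_simps)
 show "b < pi / q" using q2 b by (simp add: field_simps)
qed

lemma psi_holomorphic: "(%w. psi q (w - of_real y)) holomorphic_on {w. abs (Im w) < pi / q}"
 unfolding psi_def using psi_bound(1)[of q "_ - of_real y"] q_strip(1) by (intro holomorphic_intros) auto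

lemma psi_strip_bound:
 assumes "abs (Im w) <= b" shows "norm (psi q (w - of_real y)) <= 1 / cos (q * b / 2)"
proof -
 have "abs (q * Im (w - of_real y)) < pi" using assms q_strip by simp
 hence "norm (psi q (w - of_real y)) <= 1 / cos (q * Im w / 2)" using psi_bound(2) by fastforce
 also have "... <= 1 / cos (q * b / 2)"
  using cos_half_bounds[of q "Im w" b] assms b q2 by (intro divide_left_mono mult_pos_pos) auto
 finally show ?thesis .
qed

definition phi_const :: real where "phi_const = 1 / (cos (b / 2) * cos (q * b / 2))"

lemma phi_const_pos: "phi_const > 0"
 using cos_half_bounds(1)[of 1 0 b] cos_half_bounds(1)[of q 0 b] b0 b q2 by (simp add: phi_const_def)

lemma phi_strip_bound:
 assumes "abs (Im w) <= b" shows "norm (phi_fun q w) <= phi_const * exp (- abs (Re w))"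
proof -
 have "abs (q * Im w) < pi" using assms q_strip by simp
 hence "norm (phi_fun q w) <= 1 / (cos (Im w / 2) * cos (q * Im w / 2)) * exp (- abs (Re w))"
  by (rule phi_fun_bound[OF q2])
 also have "... <= phi_const * exp (- abs (Re w))"
 proof (rule mult_right_mono)
  have 1: "0 < cos (b / 2)" "cos (b / 2) <= cos (Im w / 2)"
   using cos_half_bounds[of 1 "Im w" b] assms b0 by auto
  have 2: "0 < cos (q * b / 2)" "cos (q * b / 2) <= cos (q * Im w / 2)"
   using cos_half_bounds[of q "Im w" b] assms b q2 by auto
  have "cos (b / 2) * cos (q * b / 2) <= cos (Im w / 2) * cos (q * Im w / 2)"
   using 1 2 by (intro mult_mono) auto
  thus "1 / (cos (Im w / 2) * cos (q * Im w / 2)) <= phi_const"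
   unfolding phi_const_def using 1 2 by (intro divide_left_mono mult_pos_pos) auto
 qed simp
 finally show ?thesis .
qed

lemma phi_decay: "strip_decay b (phi_fun q)"
 unfolding strip_decay_def
proof (intro conjI)
 have "phi_fun q holomorphic_on {w. abs (Im w) < pi / q}"
 proof -
  have "1 + exp w ~= 0" if "abs (Im w) < pi / q" for w
  proof -
   have "abs (Im w) <= abs (q * Im w)" using q2 mult_right_mono[of 1 q "abs (Im w)"] by (simp add: abs_mult)
   thus ?thesis using psi_bound(1)[of 1 w] q_strip(1)[OF that] by simp
  qed
  thus ?thesis unfolding phi_fun_def[abs_def] psi_def
   using psi_bound(1)[of q] q_strip(1) by (intro holomorphic_intros) auto
 qed
 thus "EX c>b. phi_fun q holomorphic_on {w. abs (Im w) < c}" using q_strip(2) by blast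
 show "EX C>=0. ALL w. abs (Im w) <= b --> norm (phi_fun q w) <= C * exp (- abs (Re w))"
  using phi_strip_bound phi_const_pos by (intro exI[of _ phi_const]) auto
qed

definition phi_int :: "real => 'a => real => 'a" where
 "phi_int y u = line_diff b (%v. phi_fun q v *\<^sub>C Q (of_real y + v) u)"

text \<open>At height pi, \<open>Q\<close> is e^y (e^y + A)^-1, that is \<open>psi 1\<close> at log
  A - y; the integral adds \<open>phi_fun\<close> at log A - y, so the sum plays the role of
  \<open>psi q\<close> and no fractional power of A is ever formed. The shift by y is put on
  \<open>Q\<close>, which keeps the decay of \<open>phi_fun\<close> independent of y.\<close>

definition psi_op :: "real => 'a => 'a" where
 "psi_op y u = Q (Complex y pi) u + (1 / (2 * of_real pi * \<i>)) *\<^sub>C wint (phi_int y u)"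

lemma of_real_plus_Complex: "of_real y + Complex s t = Complex (y + s) t"
 by (simp add: complex_eq_iff)

lemma line_region: "abs t = b ==> Complex s t \<in> region" "Complex s pi \<in> region"
 using b b0 \<omega> by (auto simp: region_def)

lemma shifted_line_continuous:
 assumes "abs t = b" shows "continuous_on UNIV (%s. Q (of_real y + Complex s t) u)"
 unfolding of_real_plus_Complex
 by (rule continuous_on_compose2[OF Q_continuous_on[of region]])
  (use assms line_region in \<open>auto intro!: continuous_intros\<close>)

lemma phi_int_continuous: "continuous_on UNIV (phi_int y u)"
 unfolding phi_int_def using b0
 by (intro continuous_on_line_diff continuous_on_scaleC strip_decay_continuous[OF phi_decay] shifted_line_continuous) auto

lemma Q_bound_b:
 obtains C where "C >= 0" "!!s t u. abs t = b ==> norm (Q (Complex s t) u) <= C * norm u"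
  "!!s u. norm (Q (Complex s pi) u) <= C * norm u"
proof -
 obtain C where "C >= 0" "!!w u. b <= abs (Im w) ==> abs (Im w) <= 2 * pi - b ==> norm (Q w u) <= C * norm u"
  using Q_bound[OF b(1)] by metis
 thus ?thesis using b0 by (intro that[of C]) auto
qed

lemma phi_int_bound:
 assumes C: "!!s t. abs t = b ==> norm (Q (Complex s t) u) <= B"
 shows "norm (phi_int y u s) <= 2 * phi_const * B * exp (- abs s)"
proof -
 have "norm (phi_int y u s) <= 2 * (phi_const * exp (- abs s) * B)"
  unfolding phi_int_def
 proof (rule norm_line_diff)
  fix t assume t: "abs t = b"
  show "norm (phi_fun q (Complex s t) *\<^sub>C Q (of_real y + Complex s t) u) <= phi_const * exp (- abs s) * B"
   unfolding norm_scaleC of_real_plus_Complex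
   using phi_strip_bound[of "Complex s t"] C[OF t] t phi_const_pos by (intro mult_mono) auto
 qed (use b0 in auto)
 thus ?thesis by (simp add: mult_ac)
qed

lemma has_wint_phi_int: "has_wint (phi_int y u) (wint (phi_int y u))"
proof -
 obtain C where C: "!!s t u. abs t = b ==> norm (Q (Complex s t) u) <= C * norm u" using Q_bound_b by metis
 show ?thesis
  by (rule has_wint_wintI[OF phi_int_continuous phi_int_bound[OF C]])
   (auto intro: integrable_exp_neg_abs)
qed

text \<open>Each of the two edges contributes \<open>phi_const\<close> times C times 2, the integral
  of e^-|s|; dividing the total 4 by 2 pi gives the second term of
  \<open>tilde_const\<close>.\<close>

lemma psi_op_bound:
 assumes M: "!!s. norm (Q (Complex s pi) u) <= M" and C: "!!s t. abs t = b ==> norm (Q (Complex s t) u) <= C"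
 shows "norm (psi_op y u) <= M + 2 * C / (pi * cos (b / 2) * cos (q * b / 2))"
proof -
 have "norm (wint (phi_int y u)) <= (LINT s|lborel. 2 * phi_const * C * exp (- abs s))"
  by (rule has_wint_norm_bound[OF has_wint_phi_int phi_int_bound[OF C]]) (auto intro: integrable_exp_neg_abs)
 also have "... = 4 * phi_const * C" by (simp add: integral_exp_neg_abs)
 finally have le: "norm (wint (phi_int y u)) <= 4 * phi_const * C" .
 have "norm ((1 / (2 * of_real pi * \<i>)) *\<^sub>C wint (phi_int y u)) = norm (wint (phi_int y u)) / (2 * pi)"
  by (simp add: norm_scaleC norm_divide norm_mult)
 also have "... <= 4 * phi_const * C / (2 * pi)" by (rule divide_right_mono[OF le]) simp
 also have "... = 2 * C / (pi * cos (b / 2) * cos (q * b / 2))" by (simp add: phi_const_def)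
 finally show ?thesis unfolding psi_op_def
  using norm_triangle_ineq[of "Q (Complex y pi) u" "(1 / (2 * of_real pi * \<i>)) *\<^sub>C wint (phi_int y u)"] M[of y] by linarith
qed

lemma psi_op_bounded: obtains K where "K >= 0" "!!y u. norm (psi_op y u) <= K * norm u"
proof -
 obtain C where C: "C >= 0" "!!s t u. abs t = b ==> norm (Q (Complex s t) u) <= C * norm u"
  "!!s u. norm (Q (Complex s pi) u) <= C * norm u" using Q_bound_b by metis
 have d: "0 < pi * cos (b / 2) * cos (q * b / 2)"
  using cos_half_bounds(1)[of 1 0 b] cos_half_bounds(1)[of q 0 b] b0 b q2 by simp
 show ?thesis
 proof (rule that[of "C + 2 * C / (pi * cos (b / 2) * cos (q * b / 2))"])
  show "0 <= C + 2 * C / (pi * cos (b / 2) * cos (q * b / 2))" using C(1) d by simp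
  fix y u
  have "norm (psi_op y u) <= C * norm u + 2 * (C * norm u) / (pi * cos (b / 2) * cos (q * b / 2))"
   by (rule psi_op_bound) (fact C)+
  thus "norm (psi_op y u) <= (C + 2 * C / (pi * cos (b / 2) * cos (q * b / 2))) * norm u"
   by (simp add: distrib_right mult.assoc)
 qed
qed

lemma psi_op_eqI:
 assumes "has_wint (phi_int y u) ((2 * of_real pi * \<i>) *\<^sub>C v)" shows "psi_op y u = Q (Complex y pi) u + v"
 using wint_eqI[OF assms] by (simp add: psi_op_def)

lemma has_wint_psi_op: "has_wint (phi_int y u) ((2 * of_real pi * \<i>) *\<^sub>C (psi_op y u - Q (Complex y pi) u))"
 using has_wint_phi_int by (simp add: psi_op_def)

lemma psi_op_commute:
 assumes B: "clinear_bounded B" "!!w u. w \<in> region ==> B (Q w u) = Q w (B u)"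
 shows "B (psi_op y u) = psi_op y (B u)"
proof -
 have "has_wint (phi_int y (B u)) ((2 * of_real pi * \<i>) *\<^sub>C B (psi_op y u - Q (Complex y pi) u))"
  using has_wint_compose[OF has_wint_psi_op B(1), of y u] b0
  by (simp add: phi_int_def line_diff_def[abs_def] clinear_boundedD[OF B(1)] B(2) line_region of_real_plus_Complex)
 from psi_op_eqI[OF this] show ?thesis
  by (simp add: clinear_boundedD[OF B(1)] B(2) line_region)
qed

lemma psi_op_clinear: "clinear_bounded (psi_op y)"
proof -
 obtain K where K: "!!y u. norm (psi_op y u) <= K * norm u" using psi_op_bounded by metis
 note simps = Q_simps[OF line_region(1)[of b]] Q_simps[OF line_region(1)[of "-b"]] Q_simps[OF line_region(2)]
 show ?thesis
 proof (rule clinear_boundedI)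
  show "norm (psi_op y u) <= K * norm u" for u by (rule K)
  fix u v c
  have "phi_int y (u + v) = (%s. phi_int y u s + phi_int y v s)"
   using b0 by (auto simp: phi_int_def line_diff_def of_real_plus_Complex simps scaleC_add_right)
  hence "has_wint (phi_int y (u + v)) ((2 * of_real pi * \<i>) *\<^sub>C ((psi_op y u - Q (Complex y pi) u) + (psi_op y v - Q (Complex y pi) v)))"
   using has_wint_add[OF has_wint_psi_op[of y u] has_wint_psi_op[of y v]] by (simp only: scaleC_add_right)
  from psi_op_eqI[OF this] show "psi_op y (u + v) = psi_op y u + psi_op y v" by (simp add: simps)
  have "phi_int y (c *\<^sub>C u) = (%s. c *\<^sub>C phi_int y u s)"
   using b0 by (auto simp: phi_int_def line_diff_def of_real_plus_Complex simps scaleC.diff_right mult.commute)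
  hence "has_wint (phi_int y (c *\<^sub>C u)) ((2 * of_real pi * \<i>) *\<^sub>C (c *\<^sub>C (psi_op y u - Q (Complex y pi) u)))"
   using has_wint_scaleC[OF has_wint_psi_op[of y u], of c] by (simp only: scaleC_scaleC mult.commute)
  from psi_op_eqI[OF this] show "psi_op y (c *\<^sub>C u) = c *\<^sub>C psi_op y u" by (simp add: simps scaleC.diff_right)
 qed
qed

text \<open>Dominated convergence is applied to the scalar norms of the differences of the
  integrands; their integrals bound the differences of the weak integrals.\<close>

lemma psi_op_continuous: "continuous_on UNIV (%y. psi_op y u)"
proof -
 obtain C where C: "C >= 0" "!!s t u. abs t = b ==> norm (Q (Complex s t) u) <= C * norm u" using Q_bound_b by metis
 define B where "B s = 2 * phi_const * (C * norm u) * exp (- abs s)" for s :: real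
 have B: "norm (phi_int y u s) <= B s" for y s unfolding B_def by (rule phi_int_bound[OF C(2)])
 have iB: "integrable lborel B" unfolding B_def by (intro integrable_mult_right integrable_exp_neg_abs)
 have "(%n. wint (phi_int (y n) u)) \<longlonglongrightarrow> wint (phi_int l u)" if y: "y \<longlonglongrightarrow> l" for y l
 proof -
  let ?d = "%n s. norm (phi_int (y n) u s - phi_int l u s)"
  have cd: "continuous_on UNIV (?d n)" for n by (intro continuous_intros phi_int_continuous)
  have dB: "norm (?d n s) <= 2 * B s" for n s
   using norm_triangle_ineq4[of "phi_int (y n) u s" "phi_int l u s"] B[of "y n" s] B[of l s] by simp
  have id: "integrable lborel (?d n)" for n
   by (rule integrable_continuous_dominated[OF cd dB]) (use iB in auto)
  have "(%n. LINT s|lborel. ?d n s) \<longlonglongrightarrow> (LINT s|(lborel::real measure). (0::real))"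
  proof (rule integral_dominated_convergence)
   show "integrable lborel (%s. 2 * B s)" using iB by simp
   show "AE s in lborel. (%n. ?d n s) \<longlonglongrightarrow> 0"
   proof (rule AE_I2)
    fix s
    have Qc: "(%n. Q (of_real (y n) + Complex s t) u) \<longlonglongrightarrow> Q (of_real l + Complex s t) u" if t: "abs t = b" for t
    proof (rule continuous_on_tendsto_compose[OF Q_continuous_on[of region]])
     show "(%n. of_real (y n) + Complex s t) \<longlonglongrightarrow> of_real l + Complex s t" by (intro tendsto_intros y)
    qed (use line_region(1)[OF t] in \<open>auto simp: of_real_plus_Complex\<close>)
    have "(%n. phi_int (y n) u s) \<longlonglongrightarrow> phi_int l u s"
     unfolding phi_int_def line_diff_def
     by (rule tendsto_diff; rule scaleC.tendsto[OF tendsto_const Qc]; use b0 in simp)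
    hence "(%n. phi_int (y n) u s - phi_int l u s) \<longlonglongrightarrow> 0" by (rule LIM_zero)
    thus "(%n. ?d n s) \<longlonglongrightarrow> 0" by (rule tendsto_norm_zero)
   qed
   show "AE s in lborel. norm (?d n s) <= 2 * B s" for n using dB by simp
  qed (use id in auto)
  hence "(%n. LINT s|lborel. ?d n s) \<longlonglongrightarrow> 0" by simp
  moreover have "norm (wint (phi_int (y n) u) - wint (phi_int l u)) <= (LINT s|lborel. ?d n s)" for n
  proof (rule has_wint_norm_bound)
   show "has_wint (%s. phi_int (y n) u s - phi_int l u s) (wint (phi_int (y n) u) - wint (phi_int l u))"
    by (rule has_wint_diff[OF has_wint_phi_int has_wint_phi_int])
   show "integrable lborel (?d n)" by (rule id)
  qed (rule order_refl)
  ultimately have "(%n. wint (phi_int (y n) u) - wint (phi_int l u)) \<longlonglongrightarrow> 0"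
   by (rule Lim_null_comparison[where g = "%n. \<integral>s. ?d n s \<partial>lborel", OF always_eventually[OF allI], rotated])
  thus ?thesis by (rule LIM_zero_cancel)
 qed
 hence "continuous_on UNIV (%y. wint (phi_int y u))"
  by (auto simp: continuous_on_sequentially o_def)
 moreover have "continuous_on UNIV (%y. Q (Complex y pi) u)"
  by (rule continuous_on_compose2[OF Q_continuous_on[of region]]) (use line_region in \<open>auto intro!: continuous_intros\<close>)
 ultimately show ?thesis unfolding psi_op_def
  by (rule continuous_on_add[OF _ scaleC.continuous_on[OF continuous_on_const], rotated])
qed

text \<open>Fubini for two nested contours. Integrating first over the inner one, at angle a, gives
  \<open>Psi\<close> composed with resolvents via \<open>Psi_Q\<close>; integrating first over the
  outer one, at angle b > a, evaluates \<open>phi_fun\<close> by the Cauchy formula in the strip.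
  The resolvent summand of \<open>psi_op\<close> supplies the missing \<open>psi 1\<close>.\<close>

theorem Psi_psi_op:
 assumes a: "\<omega> < a" "a < b" and h: "strip_decay a h"
 shows "strip_decay a (%w. h w * psi q (w - of_real y))"
  and "Psi a h (psi_op y u) = Psi a (%w. h w * psi q (w - of_real y)) u"
proof -
 have a0: "0 < a" "a < pi" using a \<omega> b0 by auto
 have bapi: "a < abs t \<and> abs t < 2 * pi - a" if "abs t = b \<or> t = pi" for t using that a b0 by auto
 show hpsi: "strip_decay a (%w. h w * psi q (w - of_real y))"
  by (rule strip_decay_mult[OF h psi_holomorphic, where D = "1 / cos (q * b / 2)"]) (use q_strip a psi_strip_bound in auto)
 have K1: "cauchy_kernel w (Complex y pi) = psi 1 (w - of_real y)" for w
 proof -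
  have "exp (w - Complex y pi) = exp (w - of_real y) * exp (- (of_real pi * \<i>))"
   unfolding exp_add[symmetric] by (rule arg_cong[where f = exp]) (simp add: complex_eq_iff)
  also have "... = - exp (w - of_real y)" by (simp add: exp_minus)
  finally show ?thesis by (simp add: cauchy_kernel_def psi_def)
 qed
 have hphi: "strip_decay a (%w. h w * phi_fun q (w - of_real y))"
 proof (rule strip_decay_mult[OF h])
  have "phi_fun q holomorphic_on {w. abs (Im w) < b}"
   using phi_decay by (auto simp: strip_decay_def elim: holomorphic_on_subset)
  thus "(%w. phi_fun q (w - of_real y)) holomorphic_on {w. abs (Im w) < b}"
   by (intro holomorphic_on_compose[of "%w. w - of_real y" _ "phi_fun q", unfolded o_def] holomorphic_intros)
    (auto elim!: holomorphic_on_subset)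
  have "norm (phi_fun q w) <= phi_const" if "abs (Im w) <= b" for w
  proof -
   have "phi_const * exp (- abs (Re w)) <= phi_const * 1" using phi_const_pos by (intro mult_left_mono) auto
   thus ?thesis using phi_strip_bound[OF that] by linarith
  qed
  thus "norm (phi_fun q (w - of_real y)) <= phi_const" if "abs (Im w) <= a" for w
   using that a by simp
 qed (use a in auto)
 have hpsi1: "strip_decay a (%w. h w * psi 1 (w - of_real y))"
  using Psi_Q(1)[OF a(1) a0(2) h, of "Complex y pi"] a0 a b0 by (simp add: K1)
 obtain Ch where Ch: "Ch >= 0" "!!s t u. abs t = a ==> norm (h (Complex s t) *\<^sub>C Q (Complex s t) u) <= Ch * exp (- abs s) * norm u"
  using line_bound[OF a(1) a0(2) h] by metis
 show "Psi a h (psi_op y u) = Psi a (%w. h w * psi q (w - of_real y)) u"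
 proof (rule functional_eqI)
  fix ph :: "'a => complex" assume ph: "clinear_bounded ph"
  obtain K where K: "K >= 0" "!!x. norm (ph x) <= K * norm x" using clinear_bounded_bound[OF ph] by blast
  note \<Phi> = clinear_bounded_compose[OF ph Psi_clinear[OF a(1) a0(2) h]]
  define H where "H w = h w * ph (Q w u)" for w
  define Kb where "Kb = 1 / min (sin ((b - a) / 2)) (sin ((b + a) / 2))"
  have Kb: "norm (cauchy_kernel w v) <= Kb" "exp v ~= exp w" "Kb > 0"
   if "abs (Im w) <= a" "abs (Im v) = b" for w v
   using cauchy_kernel_strip(2,3)[of a v w] cauchy_kernel_strip(4)[of a v] that a a0 b0 by (auto simp: Kb_def)
  have Hb: "norm (H (Complex s t)) <= K * (Ch * norm u) * exp (- abs s)" if "abs t = a" for s t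
  proof -
   have "H (Complex s t) = ph (h (Complex s t) *\<^sub>C Q (Complex s t) u)" by (simp add: H_def functional_scaleC ph)
   also have "norm ... <= K * (Ch * exp (- abs s) * norm u)"
    using K(2) mult_left_mono[OF Ch(2)[OF that] K(1)] order_trans by blast
   finally show ?thesis by (simp add: mult_ac)
  qed
  define F where "F s x = line_diff b (%v. line_diff a (%w. phi_fun q v * (H w * cauchy_kernel (w - of_real y) v)) x) s" for s x
  have Fc: "continuous_on UNIV (%p. F (fst p) (snd p))"
  proof -
   have c1: "continuous_on UNIV (%p::real \<times> real. phi_fun q (Complex (fst p) t))" if "abs t = b" for t
    by (rule continuous_on_compose2[OF strip_decay_continuous[OF phi_decay, of t]]) (use that in \<open>auto intro!: continuous_intros\<close>)
   have Hcont: "continuous_on UNIV (%s. H (Complex s t))" if "abs t = a" for t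
    unfolding H_def using that a a0 b0 \<omega>
    by (intro continuous_intros strip_decay_continuous[OF h] clinear_bounded_continuous_on[OF ph] Q_line_continuous) auto
   have c2: "continuous_on UNIV (%p::real \<times> real. H (Complex (snd p) t))" if "abs t = a" for t
    by (rule continuous_on_compose2[OF Hcont[OF that]]) (auto intro!: continuous_intros)
   have c3: "continuous_on UNIV (%p::real \<times> real. cauchy_kernel (Complex (snd p) t' - of_real y) (Complex (fst p) t))"
    if "abs t = b" "abs t' = a" for t t'
   proof -
    have "exp (Complex (snd p) t' - of_real y - Complex (fst p) t) ~= 1" for p :: "real \<times> real"
    proof -
     have "exp (X - V) ~= 1" if "exp V ~= exp X" for X V :: complex using that by (simp add: exp_diff)
     moreover have "exp (Complex (fst p) t) ~= exp (Complex (snd p) t' - of_real y)"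
      by (rule Kb(2)) (use that in auto)
     ultimately show ?thesis by blast
    qed
    thus ?thesis unfolding cauchy_kernel_def by (intro continuous_intros) auto
   qed
   show ?thesis unfolding F_def line_diff_def
    by (intro continuous_intros c1 c2 c3) (use a0 b0 in auto)
  qed
  have Fb: "norm (F s x) <= (4 * phi_const * Kb * exp (- abs s)) * (K * (Ch * norm u) * exp (- abs x))" for s x
  proof -
   have "norm (F s x) <= 2 * (2 * ((phi_const * exp (- abs s)) * ((K * (Ch * norm u) * exp (- abs x)) * Kb)))"
    unfolding F_def
   proof (intro norm_line_diff)
    fix t t' assume t: "abs t = b" "abs t' = a"
    have "norm (H (Complex x t')) * norm (cauchy_kernel (Complex x t' - of_real y) (Complex s t)) <=
      (K * (Ch * norm u) * exp (- abs x)) * Kb"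
     by (intro mult_mono Hb Kb(1)) (use t K Ch in auto)
    thus "norm (phi_fun q (Complex s t) * (H (Complex x t') * cauchy_kernel (Complex x t' - of_real y) (Complex s t))) <=
      (phi_const * exp (- abs s)) * ((K * (Ch * norm u) * exp (- abs x)) * Kb)"
     unfolding norm_mult
     by (rule mult_mono[rotated 1]) (use phi_strip_bound[of "Complex s t"] t phi_const_pos in auto)
   qed (use a0 b0 in auto)
   thus ?thesis by (simp add: mult_ac)
  qed
  note fub = fubini_continuous[OF Fc Fb integrable_mult_right[OF integrable_exp_neg_abs] integrable_mult_right[OF integrable_exp_neg_abs]]
  have inner1: "(LINT x|lborel. F s x) = 2 * of_real pi * \<i> * line_diff b (%v. phi_fun q v * ph (Psi a h (Q (of_real y + v) u))) s" for s
  proof -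
   have P: "integrable lborel (line_diff a (%w. phi_fun q v * (H w * cauchy_kernel (w - of_real y) v)))"
    "(LINT x|lborel. line_diff a (%w. phi_fun q v * (H w * cauchy_kernel (w - of_real y) v)) x) =
     2 * of_real pi * \<i> * (phi_fun q v * ph (Psi a h (Q (of_real y + v) u)))" if v: "abs (Im v) = b" for v
   proof -
    have v': "a < abs (Im (of_real y + v))" "abs (Im (of_real y + v)) < 2 * pi - a" using v bapi by auto
    have ck: "cauchy_kernel (w - of_real y) v = cauchy_kernel w (of_real y + v)" for w
     by (simp add: cauchy_kernel_def algebra_simps)
    note PF = Psi_functional[OF a(1) a0(2) Psi_Q(1)[OF a(1) a0(2) h v'] ph, of u]
    have eq: "line_diff a (%w. phi_fun q v * (H w * cauchy_kernel (w - of_real y) v)) x =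
      phi_fun q v * line_diff a (%w. h w * cauchy_kernel w (of_real y + v) * ph (Q w u)) x" for x
     by (simp add: line_diff_def H_def ck algebra_simps)
    show "integrable lborel (line_diff a (%w. phi_fun q v * (H w * cauchy_kernel (w - of_real y) v)))"
     unfolding eq[abs_def] by (rule integrable_mult_right[OF PF(1)])
    show "(LINT x|lborel. line_diff a (%w. phi_fun q v * (H w * cauchy_kernel (w - of_real y) v)) x) =
     2 * of_real pi * \<i> * (phi_fun q v * ph (Psi a h (Q (of_real y + v) u)))"
     unfolding eq integral_mult_right_zero PF(2) Psi_Q(2)[OF a(1) a0(2) h v'] by simp
   qed
   show ?thesis
    using P[of "Complex s b"] P[of "Complex s (- b)"] b0
    by (simp add: F_def line_diff_def[of b] Bochner_Integration.integral_diff algebra_simps)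
  qed
  have inner2: "(LINT s|lborel. F s x) = 2 * of_real pi * \<i> * line_diff a (%w. H w * phi_fun q (w - of_real y)) x" for x
  proof -
   have C: "integrable lborel (line_diff b (%v. phi_fun q v * cauchy_kernel w v))"
    "(LINT s|lborel. line_diff b (%v. phi_fun q v * cauchy_kernel w v) s) = 2 * of_real pi * \<i> * phi_fun q w" if "abs (Im w) = a" for w
    unfolding line_diff_def[abs_def] by (rule strip_cauchy_formula[OF phi_decay]; use that a b0 in auto)+
   have eq: "F s x = H (Complex x (- a)) * line_diff b (%v. phi_fun q v * cauchy_kernel (Complex x (- a) - of_real y) v) s -
     H (Complex x a) * line_diff b (%v. phi_fun q v * cauchy_kernel (Complex x a - of_real y) v) s" for s
    by (simp add: F_def line_diff_def algebra_simps)
   show ?thesis unfolding eq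
    using C[of "Complex x (- a) - of_real y"] C[of "Complex x a - of_real y"] a0
    by (simp add: Bochner_Integration.integral_diff) (simp add: line_diff_def algebra_simps)
  qed
  have lhs: "(LINT s|lborel. line_diff b (%v. phi_fun q v * ph (Psi a h (Q (of_real y + v) u))) s) =
    2 * of_real pi * \<i> * (ph (Psi a h (psi_op y u)) - ph (Psi a h (Q (Complex y pi) u)))"
   using has_wintD(2)[OF has_wint_psi_op[of y u] \<Phi>]
   by (simp add: phi_int_def line_diff_functional[OF \<Phi>] functional_scaleC[OF \<Phi>] clinear_boundedD(2)[OF \<Phi>])
  have rhs: "(LINT x|lborel. line_diff a (%w. H w * phi_fun q (w - of_real y)) x) =
    2 * of_real pi * \<i> * ph (Psi a (%w. h w * phi_fun q (w - of_real y)) u)"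
   using Psi_functional(2)[OF a(1) a0(2) hphi ph, of u] by (simp add: H_def mult_ac)
  have "(\<integral>s. \<integral>x. F s x \<partial>lborel \<partial>lborel) = (\<integral>x. \<integral>s. F s x \<partial>lborel \<partial>lborel)" using fub(2) by simp
  hence main: "ph (Psi a h (psi_op y u)) = ph (Psi a h (Q (Complex y pi) u)) + ph (Psi a (%w. h w * phi_fun q (w - of_real y)) u)"
   unfolding inner1 inner2 integral_mult_right_zero lhs rhs by (simp add: diff_eq_eq add.commute)
  have Qpi: "Psi a h (Q (Complex y pi) u) = Psi a (%w. h w * psi 1 (w - of_real y)) u"
   using Psi_Q(2)[OF a(1) a0(2) h, of "Complex y pi" u] a0 a b0 by (simp add: K1)
  have "line_diff a (%w. h w * psi q (w - of_real y) * ph (Q w u)) x =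
    line_diff a (%w. h w * psi 1 (w - of_real y) * ph (Q w u)) x + line_diff a (%w. h w * phi_fun q (w - of_real y) * ph (Q w u)) x" for x
   by (simp add: line_diff_def phi_fun_def algebra_simps)
  hence "2 * of_real pi * \<i> * ph (Psi a (%w. h w * psi q (w - of_real y)) u) =
    2 * of_real pi * \<i> * ph (Psi a (%w. h w * psi 1 (w - of_real y)) u) + 2 * of_real pi * \<i> * ph (Psi a (%w. h w * phi_fun q (w - of_real y)) u)"
   using Psi_functional[OF a(1) a0(2) hphi ph, of u] Psi_functional[OF a(1) a0(2) hpsi1 ph, of u]
    Psi_functional(2)[OF a(1) a0(2) hpsi ph, of u]
   by simp
  thus "ph (Psi a h (psi_op y u)) = ph (Psi a (%w. h w * psi q (w - of_real y)) u)"
   unfolding main Qpi by (simp flip: distrib_left)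
 qed
qed

end

section \<open>The resolvent of $f(A)$\<close>

text \<open>The angles are nested: \<open>Psi\<close> is used below b, the operators
  \<open>psi_op\<close> are built at b, and the poles of \<open>psi q\<close> lie at height a, where
  the jump J is taken.\<close>

locale resolvent_calculus = sectorial_psi A \<omega> R q b + np_resolvent f q a \<theta> z
 for A :: "'a::complex_banach graph" and \<omega> R q b f a \<theta> z +
 assumes ba: "b < a" and J_int: "integrable lborel J"
begin

definition c0 :: complex where
 "c0 = (SOME c. ALL w. abs (Im w) < a --> g w = c + of_real (q / pi) * (LINT y|lborel. J y * psi q (w - of_real y)))"

lemma g_eq: "abs (Im w) < a ==> g w = c0 + of_real (q / pi) * (LINT y|lborel. J y * psi q (w - of_real y))"
proof -
 have "EX c. ALL w. abs (Im w) < a --> g w = c + of_real (q / pi) * (LINT y|lborel. J y * psi q (w - of_real y))"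
  using representation[OF J_int] by metis
 from someI_ex[OF this] show "abs (Im w) < a ==> g w = c0 + of_real (q / pi) * (LINT y|lborel. J y * psi q (w - of_real y))"
  unfolding c0_def by blast
qed

definition Rz :: "'a => 'a" where
 "Rz u = c0 *\<^sub>C u + of_real (q / pi) *\<^sub>C wint (%y. J y *\<^sub>C psi_op y u)"

lemma J_psi_op:
 shows "continuous_on UNIV (%y. J y *\<^sub>C psi_op y u)"
  and "(!!y. norm (psi_op y u) <= N) ==> norm (J y *\<^sub>C psi_op y u) <= norm (J y) * N"
  and "has_wint (%y. J y *\<^sub>C psi_op y u) (wint (%y. J y *\<^sub>C psi_op y u))"
proof -
 show c: "continuous_on UNIV (%y. J y *\<^sub>C psi_op y u)"
  by (intro continuous_on_scaleC J_continuous psi_op_continuous)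
 show le: "norm (J y *\<^sub>C psi_op y u) <= norm (J y) * N" if "!!y. norm (psi_op y u) <= N" for N y
  unfolding norm_scaleC by (rule mult_left_mono[OF that]) simp
 obtain K where K: "!!y u. norm (psi_op y u) <= K * norm u" using psi_op_bounded by metis
 show "has_wint (%y. J y *\<^sub>C psi_op y u) (wint (%y. J y *\<^sub>C psi_op y u))"
  by (rule has_wint_wintI[OF c le[OF K]]) (use J_int in auto)
qed

lemma Rz_bound:
 assumes N: "!!y. norm (psi_op y u) <= N"
 shows "norm (Rz u) <= norm c0 * norm u + q / pi * (N * (LINT y|lborel. norm (J y)))"
proof -
 have "norm (wint (%y. J y *\<^sub>C psi_op y u)) <= (LINT y|lborel. norm (J y) * N)"
  by (rule has_wint_norm_bound[OF J_psi_op(3)]) (use J_psi_op(2)[OF N] J_int in auto)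
 also have "... = N * (LINT y|lborel. norm (J y))" by simp
 finally have "q / pi * norm (wint (%y. J y *\<^sub>C psi_op y u)) <= q / pi * (N * (LINT y|lborel. norm (J y)))"
  using q by (intro mult_left_mono) auto
 thus ?thesis unfolding Rz_def
  using q by (intro order_trans[OF norm_triangle_ineq] add_mono) (auto simp: norm_scaleC norm_divide)
qed

lemma has_wint_Rz:
 "has_wint (%y. J y *\<^sub>C psi_op y u) (of_real (pi / q) *\<^sub>C (Rz u - c0 *\<^sub>C u))"
 using J_psi_op(3)[of u] q by (simp add: Rz_def)

lemma Rz_eqI:
 assumes "has_wint (%y. J y *\<^sub>C psi_op y u) (of_real (pi / q) *\<^sub>C v)" shows "Rz u = c0 *\<^sub>C u + v"
 using wint_eqI[OF assms] q by (simp add: Rz_def)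

lemma Rz_clinear: "clinear_bounded Rz"
proof -
 obtain K where K: "!!y u. norm (psi_op y u) <= K * norm u" using psi_op_bounded by metis
 show ?thesis
 proof (rule clinear_boundedI)
  fix u v c
  show "norm (Rz u) <= (norm c0 + q / pi * (K * (LINT y|lborel. norm (J y)))) * norm u"
   using Rz_bound[OF K, of u] by (simp add: distrib_left distrib_right mult_ac)
  have "(%y. J y *\<^sub>C psi_op y (u + v)) = (%y. J y *\<^sub>C psi_op y u + J y *\<^sub>C psi_op y v)"
   by (simp add: clinear_boundedD[OF psi_op_clinear] scaleC_add_right)
  hence "has_wint (%y. J y *\<^sub>C psi_op y (u + v)) (of_real (pi / q) *\<^sub>C ((Rz u - c0 *\<^sub>C u) + (Rz v - c0 *\<^sub>C v)))"
   using has_wint_add[OF has_wint_Rz[of u] has_wint_Rz[of v]] by (simp only: scaleC_add_right)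
  from Rz_eqI[OF this] show "Rz (u + v) = Rz u + Rz v" by (simp add: scaleC_add_right)
  have "(%y. J y *\<^sub>C psi_op y (c *\<^sub>C u)) = (%y. c *\<^sub>C (J y *\<^sub>C psi_op y u))"
   by (simp add: clinear_boundedD[OF psi_op_clinear] mult.commute)
  hence "has_wint (%y. J y *\<^sub>C psi_op y (c *\<^sub>C u)) (of_real (pi / q) *\<^sub>C (c *\<^sub>C (Rz u - c0 *\<^sub>C u)))"
   using has_wint_scaleC[OF has_wint_Rz[of u], of c] by (simp only: scaleC_scaleC mult.commute)
  from Rz_eqI[OF this] show "Rz (c *\<^sub>C u) = c *\<^sub>C Rz u" by (simp add: scaleC.diff_right mult.commute)
 qed
qed

lemma Rz_commute:
 assumes B: "clinear_bounded B" "!!w u. w \<in> region ==> B (Q w u) = Q w (B u)"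
 shows "B (Rz u) = Rz (B u)"
proof -
 have "has_wint (%y. J y *\<^sub>C psi_op y (B u)) (of_real (pi / q) *\<^sub>C B (Rz u - c0 *\<^sub>C u))"
  using has_wint_compose[OF has_wint_Rz B(1), of u]
  by (simp add: clinear_boundedD(5)[OF B(1)] psi_op_commute[OF B, symmetric])
 from Rz_eqI[OF this] show ?thesis by (simp add: clinear_boundedD[OF B(1)])
qed

lemma g_decay:
 assumes \<alpha>: "0 <= \<alpha>" "\<alpha> <= a" and h: "strip_decay \<alpha> h"
 shows "strip_decay \<alpha> (%w. h w * g w)"
 by (rule strip_decay_mult[OF h g_holomorphic, where D = "1 / (cos ((a + \<theta>) / 2) * norm z)"])
  (use \<alpha> strip_width g_bound in auto)

text \<open>Fubini between y and the contour: for fixed y the contour integral is given by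
  \<open>Psi_psi_op\<close>, for a fixed point of the contour the y-integral is the scalar
  representation of g. Multiplicativity for g is thus inherited from the kernel.\<close>

theorem Psi_Rz:
 assumes \<alpha>: "\<omega> < \<alpha>" "\<alpha> < b" and h: "strip_decay \<alpha> h"
 shows "Psi \<alpha> h (Rz u) = Psi \<alpha> (%w. h w * g w) u"
proof (rule functional_eqI)
 fix ph :: "'a => complex" assume ph: "clinear_bounded ph"
 have \<alpha>0: "0 < \<alpha>" "\<alpha> < pi" using \<alpha> \<omega> b0 by auto
 have hg: "strip_decay \<alpha> (%w. h w * g w)" using g_decay[OF _ _ h] \<alpha> \<alpha>0 ba by simp
 note \<Phi> = clinear_bounded_compose[OF ph Psi_clinear[OF \<alpha>(1) \<alpha>0(2) h]]
 obtain Ch where Ch: "Ch >= 0" "!!s t u. abs t = \<alpha> ==> norm (h (Complex s t) *\<^sub>C Q (Complex s t) u) <= Ch * exp (- abs s) * norm u"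
  using line_bound[OF \<alpha>(1) \<alpha>0(2) h] by metis
 obtain K where K: "K >= 0" "!!x. norm (ph x) <= K * norm x" using clinear_bounded_bound[OF ph] by blast
 define H where "H w = h w * ph (Q w u)" for w
 have Hb: "norm (H (Complex s t)) <= K * (Ch * norm u) * exp (- abs s)" if "abs t = \<alpha>" for s t
 proof -
  have "H (Complex s t) = ph (h (Complex s t) *\<^sub>C Q (Complex s t) u)" by (simp add: H_def functional_scaleC ph)
  also have "norm ... <= K * (Ch * exp (- abs s) * norm u)"
   using K(2) mult_left_mono[OF Ch(2)[OF that] K(1)] order_trans by blast
  finally show ?thesis by (simp add: mult_ac)
 qed
 have Hcont: "continuous_on UNIV (%s. H (Complex s t))" if "abs t = \<alpha>" for t
  unfolding H_def using that \<alpha> \<alpha>0 b0 \<omega>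
  by (intro continuous_on_mult strip_decay_continuous[OF h] clinear_bounded_continuous_on[OF ph] Q_line_continuous) auto
 define F where "F y x = J y * line_diff \<alpha> (%w. H w * psi q (w - of_real y)) x" for y x
 have Fc: "continuous_on UNIV (%p. F (fst p) (snd p))"
 proof -
  have c1: "continuous_on UNIV (%p::real \<times> real. J (fst p))"
   by (rule continuous_on_compose2[OF J_continuous]) (auto intro!: continuous_intros)
  have c2: "continuous_on UNIV (%p::real \<times> real. H (Complex (snd p) t))" if "abs t = \<alpha>" for t
   by (rule continuous_on_compose2[OF Hcont[OF that]]) (auto intro!: continuous_intros)
  have c3: "continuous_on UNIV (%p::real \<times> real. psi q (Complex (snd p) t - of_real (fst p)))" if "abs t = \<alpha>" for t
   unfolding psi_def using psi_bound(1)[of q "Complex _ t - of_real _"] q_strip \<alpha> that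
   by (intro continuous_on_divide continuous_on_add continuous_on_exp continuous_on_mult continuous_on_diff
     continuous_on_const continuous_on_Complex continuous_on_of_real continuous_on_fst continuous_on_snd continuous_on_id) auto
  show ?thesis unfolding F_def line_diff_def
   by (intro continuous_on_mult continuous_on_diff c1 c2 c3) (use \<alpha>0 in auto)
 qed
 define C where "C = 1 / cos (q * b / 2)"
 have C: "norm (psi q (w - of_real y)) <= C" if "abs (Im w) = \<alpha>" for w y
  unfolding C_def by (rule psi_strip_bound) (use that \<alpha> in auto)
 have Fb: "norm (F y x) <= norm (J y) * (2 * (K * (Ch * norm u) * C) * exp (- abs x))" for y x
 proof -
  have "norm (line_diff \<alpha> (%w. H w * psi q (w - of_real y)) x) <= 2 * (K * (Ch * norm u) * exp (- abs x) * C)"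
  proof (rule norm_line_diff)
   fix t assume t: "abs t = \<alpha>"
   show "norm (H (Complex x t) * psi q (Complex x t - of_real y)) <= K * (Ch * norm u) * exp (- abs x) * C"
    unfolding norm_mult by (rule mult_mono[OF Hb[OF t] C]) (use t K Ch in auto)
  qed (use \<alpha>0 in auto)
  thus ?thesis unfolding F_def norm_mult by (intro mult_left_mono) (auto simp: mult_ac)
 qed
 note fub = fubini_continuous[OF Fc Fb integrable_norm[OF J_int] integrable_mult_right[OF integrable_exp_neg_abs]]
 have inner1: "(LINT x|lborel. F y x) = 2 * of_real pi * \<i> * (J y * ph (Psi \<alpha> h (psi_op y u)))" for y
  unfolding F_def integral_mult_right_zero
  using Psi_functional(2)[OF \<alpha>(1) \<alpha>0(2) Psi_psi_op(1)[OF \<alpha> h] ph, of y u] Psi_psi_op(2)[OF \<alpha> h, of y u]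
  by (simp add: H_def mult_ac)
 have inner2: "of_real (q / pi) * (LINT y|lborel. F y x) = line_diff \<alpha> (%w. H w * (g w - c0)) x" for x
 proof -
  have I: "integrable lborel (%y. J y * psi q (w - of_real y))"
   "of_real (q / pi) * (LINT y|lborel. J y * psi q (w - of_real y)) = g w - c0" if "abs (Im w) = \<alpha>" for w
  proof -
   have w: "abs (Im w) < a" using that \<alpha> ba by simp
   show "integrable lborel (%y. J y * psi q (w - of_real y))" by (rule J_psi_integrable[OF J_int w])
   show "of_real (q / pi) * (LINT y|lborel. J y * psi q (w - of_real y)) = g w - c0" using g_eq[OF w] by simp
  qed
  have eq: "F y x = H (Complex x (- \<alpha>)) * (J y * psi q (Complex x (- \<alpha>) - of_real y)) -
    H (Complex x \<alpha>) * (J y * psi q (Complex x \<alpha> - of_real y))" for y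
   by (simp add: F_def line_diff_def algebra_simps)
  have "(LINT y|lborel. F y x) = H (Complex x (- \<alpha>)) * (LINT y|lborel. J y * psi q (Complex x (- \<alpha>) - of_real y)) -
    H (Complex x \<alpha>) * (LINT y|lborel. J y * psi q (Complex x \<alpha> - of_real y))"
   unfolding eq using I(1)[of "Complex x (- \<alpha>)"] I(1)[of "Complex x \<alpha>"] \<alpha>0
   by (simp add: Bochner_Integration.integral_diff)
  hence "of_real (q / pi) * (LINT y|lborel. F y x) =
    H (Complex x (- \<alpha>)) * (of_real (q / pi) * (LINT y|lborel. J y * psi q (Complex x (- \<alpha>) - of_real y))) -
    H (Complex x \<alpha>) * (of_real (q / pi) * (LINT y|lborel. J y * psi q (Complex x \<alpha> - of_real y)))"
   by (simp only: right_diff_distrib mult.left_commute)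
  thus ?thesis
   using I(2)[of "Complex x (- \<alpha>)"] I(2)[of "Complex x \<alpha>"] \<alpha>0 by (simp only: line_diff_def) simp
 qed
 have lhs: "(LINT y|lborel. J y * ph (Psi \<alpha> h (psi_op y u))) = of_real (pi / q) * (ph (Psi \<alpha> h (Rz u)) - c0 * ph (Psi \<alpha> h u))"
  using has_wintD(2)[OF has_wint_Rz[of u] \<Phi>]
  by (simp add: functional_scaleC[OF \<Phi>] clinear_boundedD(2)[OF \<Phi>])
 have i1: "integrable lborel (line_diff \<alpha> (%w. H w * g w))"
  "(LINT x|lborel. line_diff \<alpha> (%w. H w * g w) x) = 2 * of_real pi * \<i> * ph (Psi \<alpha> (%w. h w * g w) u)"
  using Psi_functional[OF \<alpha>(1) \<alpha>0(2) hg ph, of u] by (simp_all add: H_def mult_ac)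
 have i2: "integrable lborel (line_diff \<alpha> H)"
  "(LINT x|lborel. line_diff \<alpha> H x) = 2 * of_real pi * \<i> * ph (Psi \<alpha> h u)"
  using Psi_functional[OF \<alpha>(1) \<alpha>0(2) h ph, of u] by (simp_all add: H_def[abs_def])
 have "(LINT x|lborel. line_diff \<alpha> (%w. H w * (g w - c0)) x) =
   (LINT x|lborel. line_diff \<alpha> (%w. H w * g w) x - c0 * line_diff \<alpha> H x)"
  by (rule Bochner_Integration.integral_cong) (auto simp: line_diff_def algebra_simps)
 also have "... = 2 * of_real pi * \<i> * (ph (Psi \<alpha> (%w. h w * g w) u) - c0 * ph (Psi \<alpha> h u))"
  using i1 i2 by (simp add: Bochner_Integration.integral_diff algebra_simps)
 finally have r: "(LINT x|lborel. line_diff \<alpha> (%w. H w * (g w - c0)) x) =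
   2 * of_real pi * \<i> * (ph (Psi \<alpha> (%w. h w * g w) u) - c0 * ph (Psi \<alpha> h u))" .
 have "of_real (q / pi) * (\<integral>y. \<integral>x. F y x \<partial>lborel \<partial>lborel) = (LINT x|lborel. of_real (q / pi) * (LINT y|lborel. F y x))"
  using fub(2) by simp
 hence "of_real (q / pi) * (2 * of_real pi * \<i> * (of_real (pi / q) * (ph (Psi \<alpha> h (Rz u)) - c0 * ph (Psi \<alpha> h u)))) =
   2 * of_real pi * \<i> * (ph (Psi \<alpha> (%w. h w * g w) u) - c0 * ph (Psi \<alpha> h u))"
  unfolding inner1 inner2 integral_mult_right_zero lhs r .
 moreover have "of_real (q / pi) * (2 * of_real pi * \<i> * (of_real (pi / q) * X)) = 2 * of_real pi * \<i> * X" for X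
  using q by simp
 ultimately have "2 * of_real pi * \<i> * (ph (Psi \<alpha> h (Rz u)) - c0 * ph (Psi \<alpha> h u)) =
   2 * of_real pi * \<i> * (ph (Psi \<alpha> (%w. h w * g w) u) - c0 * ph (Psi \<alpha> h u))" by simp
 thus "ph (Psi \<alpha> h (Rz u)) = ph (Psi \<alpha> (%w. h w * g w) u)" by simp
qed

end

subsection \<open>The regulariser\<close>

context sectorial_resolvent
begin

text \<open>Since e^(i pi) = -1, P is (1 + A)^-1, and N below is P - P^2 = A (1 + A)^-2, that is
  tau(A).\<close>

definition P :: "'a => 'a" where "P = Q (Complex 0 pi)"

definition N :: "'a => 'a" where "N u = P u - P (P u)"

lemma P_region: "Complex 0 pi \<in> region" using \<omega> by (auto simp: region_def)

lemma P_clinear: "clinear_bounded P" unfolding P_def by (rule Q_clinear[OF P_region])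

lemma N_clinear: "clinear_bounded N"
 unfolding N_def[abs_def] by (rule clinear_bounded_diff[OF P_clinear clinear_bounded_compose[OF P_clinear P_clinear]])

lemma P_graph: "(P u, u - P u) \<in> A"
 using Q_graph[OF P_region, of u] by (simp add: P_def exp_Complex)

lemma P_left: "(x, v) \<in> A ==> P (v + x) = x"
 using Q_commute_A(1)[OF P_region, of x v] by (simp add: P_def exp_Complex Q_simps[OF P_region] algebra_simps)

lemma N_graph: "(P (P u), N u) \<in> A" "(N u, (u - P u) - N u) \<in> A"
proof -
 show "(P (P u), N u) \<in> A" using P_graph[of "P u"] by (simp add: N_def)
 have "N u = P (u - P u)" by (simp add: N_def clinear_boundedD[OF P_clinear])
 thus "(N u, (u - P u) - N u) \<in> A" using P_graph[of "u - P u"] by simp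
qed

lemma N_commute: "w \<in> region ==> N (Q w u) = Q w (N u)"
 unfolding N_def P_def by (simp add: Q_commute[OF P_region] Q_simps)

lemma Q_P: "w \<in> region ==> exp w ~= -1 ==> psi 1 w *\<^sub>C Q w u = Q w (P u) - (1 - psi 1 w) *\<^sub>C P u"
proof -
 assume w: "w \<in> region" "exp w ~= -1"
 have "exp (w - Complex 0 pi) = - exp w" by (simp add: exp_diff exp_Complex)
 hence "cauchy_kernel w (Complex 0 pi) = psi 1 w" by (simp add: cauchy_kernel_def psi_def)
 moreover have "exp (Complex 0 pi) ~= exp w" using w(2) by (simp add: exp_Complex)
 ultimately have "Q w (P u) = psi 1 w *\<^sub>C Q w u - (psi 1 w - 1) *\<^sub>C P u"
  unfolding P_def using resolvent_identity_kernel[OF w(1) P_region] by metis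
 thus ?thesis by (simp add: scaleC.diff_left algebra_simps)
qed

lemma tau_psi: "1 + exp w ~= 0 ==> tau (exp w) = psi 1 w * (1 - psi 1 w)"
 by (simp add: tau_def psi_def field_simps power2_eq_square)

text \<open>Division with remainder: repeated use of \<open>Q_P\<close> moves tau^2 from the scalar
  to the operator side, where it becomes N^2. What is left over consists of fixed vectors with
  coefficients polynomial in p = \<open>psi 1 w\<close>, holomorphic for |Im w| < pi.\<close>

lemma tau2_Q:
 assumes w: "w \<in> region" "exp w ~= -1"
 defines "p \<equiv> psi 1 w"
 shows "(tau (exp w))^2 *\<^sub>C Q w u = Q w (N (N u)) -
  (1 - p) *\<^sub>C ((N (N u) - p *\<^sub>C P (N u)) + (p * (1 - p)) *\<^sub>C (N u - p *\<^sub>C P u))"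
proof -
 have nz: "1 + exp w ~= 0" using w(2) by (metis add.commute add_eq_0_iff)
 have 1: "(p * (1 - p)) *\<^sub>C Q w v = Q w (N v) - (1 - p) *\<^sub>C (N v - p *\<^sub>C P v)" for v
 proof -
  have a: "p *\<^sub>C Q w v = Q w (P v) - (1 - p) *\<^sub>C P v" for v unfolding p_def by (rule Q_P[OF w])
  have "(p * (1 - p)) *\<^sub>C Q w v = p *\<^sub>C Q w v - p *\<^sub>C p *\<^sub>C Q w v"
   by (simp add: right_diff_distrib scaleC.diff_left)
  also have "p *\<^sub>C p *\<^sub>C Q w v = p *\<^sub>C (Q w (P v) - (1 - p) *\<^sub>C P v)" by (simp only: a[of v])
  also have "... = (Q w (P (P v)) - (1 - p) *\<^sub>C P (P v)) - (p * (1 - p)) *\<^sub>C P v"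
   by (simp add: scaleC.diff_right a[of "P v"])
  also have "p *\<^sub>C Q w v - ... = Q w (N v) - (1 - p) *\<^sub>C (N v - p *\<^sub>C P v)"
   by (simp add: a N_def Q_simps[OF w(1)] scaleC.diff_right scaleC.diff_left scaleC_add_right algebra_simps)
  finally show ?thesis .
 qed
 have t: "tau (exp w) = p * (1 - p)" unfolding p_def by (rule tau_psi[OF nz])
 have "(tau (exp w))^2 *\<^sub>C Q w u = (p * (1 - p)) *\<^sub>C ((p * (1 - p)) *\<^sub>C Q w u)"
  by (simp add: t power2_eq_square)
 also have "... = (p * (1 - p)) *\<^sub>C (Q w (N u)) - (p * (1 - p)) *\<^sub>C (1 - p) *\<^sub>C (N u - p *\<^sub>C P u)"
  unfolding 1[of u] by (rule scaleC.diff_right)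
 also have "... = Q w (N (N u)) - (1 - p) *\<^sub>C (N (N u) - p *\<^sub>C P (N u)) - (1 - p) *\<^sub>C (p * (1 - p)) *\<^sub>C (N u - p *\<^sub>C P u)"
  unfolding 1[of "N u"] by (simp add: mult.commute)
 also have "... = Q w (N (N u)) -
  (1 - p) *\<^sub>C ((N (N u) - p *\<^sub>C P (N u)) + (p * (1 - p)) *\<^sub>C (N u - p *\<^sub>C P u))"
  unfolding scaleC_add_right by simp
 finally show ?thesis .
qed

lemma tau_bound:
 assumes t: "abs (Im w) <= t" "t < pi"
 shows "1 + exp w ~= 0" "norm (tau (exp w)) <= 1 / (cos (t / 2))^2 * exp (- abs (Re w))"
proof -
 have c: "0 < cos (t / 2)" "cos (t / 2) <= cos (Im w / 2)" using cos_half_bounds[of 1 "Im w" t] t by auto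
 have n: "cos (t / 2) * (1 + exp (Re w)) <= norm (1 + exp w)"
  using c norm_one_plus_exp_ge[of w] mult_right_mono[OF c(2), of "1 + exp (Re w)"] by (simp add: add_nonneg_nonneg)
 have pos: "0 < cos (t / 2) * (1 + exp (Re w))" using c by (simp add: add_pos_pos)
 show nz: "1 + exp w ~= 0" using n pos by auto
 have "norm (tau (exp w)) = exp (Re w) / (norm (1 + exp w))^2" by (simp add: tau_def norm_divide norm_power)
 also have "... <= exp (Re w) / (cos (t / 2) * (1 + exp (Re w)))^2"
 proof (rule divide_left_mono)
  show "(cos (t / 2) * (1 + exp (Re w)))^2 <= (norm (1 + exp w))^2"
   by (rule power_mono[OF n less_imp_le[OF pos]])
  show "0 < (norm (1 + exp w))^2 * (cos (t / 2) * (1 + exp (Re w)))^2"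
   using nz by (intro mult_pos_pos zero_less_power[OF pos]) simp
 qed simp
 also have "... = 1 / (cos (t / 2))^2 * (exp (Re w) / (1 + exp (Re w))^2)" by (simp add: power_mult_distrib)
 also have "... <= 1 / (cos (t / 2))^2 * exp (- abs (Re w))"
  by (intro mult_left_mono exp_ratio_le_exp_neg_abs) auto
 finally show "norm (tau (exp w)) <= 1 / (cos (t / 2))^2 * exp (- abs (Re w))" .
qed

lemma tau_holomorphic: "(%w. tau (exp w)) holomorphic_on {w. abs (Im w) < pi}"
 unfolding tau_def using tau_bound(1) by (intro holomorphic_intros) auto

lemma tau_decay:
 assumes "t < pi" shows "strip_decay t (%w. tau (exp w))"
 unfolding strip_decay_def using assms tau_bound(2)[OF _ assms] tau_holomorphic
 by (intro conjI exI[of _ pi] exI[of _ "1 / (cos (t / 2))^2"]) auto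

lemma tau2_decay:
 assumes t: "t < pi" shows "strip_decay t (%w. (tau (exp w))^2)"
proof -
 have "norm (tau (exp w)) <= 1 / (cos (t / 2))^2" if "abs (Im w) <= t" for w
  using order_trans[OF tau_bound(2)[OF that t] mult_left_mono[of "exp (- abs (Re w))" 1 "1 / (cos (t / 2))^2"]] by simp
 thus ?thesis unfolding power2_eq_square
  by (rule strip_decay_mult[OF tau_decay[OF t] tau_holomorphic t])
qed

text \<open>The contour is closed around the complement of the sector for the resolvent part of
 \<open>tau2_Q\<close> and around the sector for the remaining rational function; the arcs at infinity
 contribute the two fractions of the full circle.\<close>

theorem Psi_tau2:
 assumes a: "\<omega> < a" "a < pi"
 shows "Psi a (%w. (tau (exp w))^2) u = N (N u)"
proof (rule functional_eqI)
 fix ph :: "'a => complex" assume ph: "clinear_bounded ph"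
 obtain K where K: "K >= 0" "!!x. norm (ph x) <= K * norm x" using clinear_bounded_bound[OF ph] by blast
 have a0: "0 < a" using a \<omega> by simp
 define t0 where "t0 = ph (N (N u))"
 define H where "H w = ph (Q w (N (N u)))" for w
 define e where "e w = (1 - psi 1 w) * ((t0 - psi 1 w * ph (P (N u))) +
  (psi 1 w * (1 - psi 1 w)) * (ph (N u) - psi 1 w * ph (P u)))" for w
 have reg: "Complex s t \<in> region" if "abs t = a" for s t using that a \<omega> by (auto simp: region_def)
 have nz: "1 + exp w ~= 0" if "abs (Im w) < pi" for w using psi_bound(1)[of 1 w] that by simp
 have split: "(tau (exp w))^2 * ph (Q w u) = H w - e w" if "w \<in> region" "abs (Im w) < pi" for w
 proof -
  have "exp w ~= -1" using nz[OF that(2)] by auto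
  from arg_cong[OF tau2_Q[OF that(1) this, of u], of ph]
  show ?thesis
   by (simp add: clinear_boundedD[OF ph] scaleC_complex_def H_def e_def t0_def)
 qed
 define k where "k = 1 / cos (a / 2)"
 have ca: "cos (a / 2) > 0" using a a0 by (intro cos_gt_zero_pi) auto
 have k: "k >= 1" using ca cos_le_one[of "a / 2"] by (simp add: k_def)
 have pb: "norm (psi 1 w) <= k" "norm (1 - psi 1 w) <= k" "norm (psi 1 w) <= k * exp (- Re w)" "norm (1 - psi 1 w) <= k * exp (Re w)"
  if w: "abs (Im w) <= a" for w
 proof -
  have c: "cos (a / 2) <= cos (Im w / 2)" using cos_half_bounds(2)[of 1 "Im w" a] w a by simp
  have n: "cos (a / 2) * (1 + exp (Re w)) <= norm (1 + exp w)"
   using ca c norm_one_plus_exp_ge[of w] mult_right_mono[OF c, of "1 + exp (Re w)"] by (simp add: add_nonneg_nonneg)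
  have pos: "0 < cos (a / 2) * (1 + exp (Re w))" using ca by (simp add: add_pos_pos)
  have nz': "1 + exp w ~= 0" using n pos by auto
  have d: "X / norm (1 + exp w) <= k * (X / (1 + exp (Re w)))" if "X >= 0" for X
  proof -
   have "X / norm (1 + exp w) <= X / (cos (a / 2) * (1 + exp (Re w)))"
    by (rule divide_left_mono[OF n that mult_pos_pos[OF order_less_le_trans[OF pos n] pos]])
   thus ?thesis by (simp add: k_def)
  qed
  have r: "1 / (1 + exp (Re w)) <= 1" "1 / (1 + exp (Re w)) <= exp (- Re w)"
   "exp (Re w) / (1 + exp (Re w)) <= 1" "exp (Re w) / (1 + exp (Re w)) <= exp (Re w)"
   by (simp_all add: divide_le_eq add_pos_pos exp_minus field_simps)
  have p1: "norm (psi 1 w) = 1 / norm (1 + exp w)" by (simp add: psi_def norm_divide)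
  have "1 - psi 1 w = exp w / (1 + exp w)" unfolding psi_def using nz' by (simp add: field_simps)
  hence p2: "norm (1 - psi 1 w) = exp (Re w) / norm (1 + exp w)" by (simp add: norm_divide)
  have k0: "k >= 0" using k by simp
  show "norm (psi 1 w) <= k" "norm (psi 1 w) <= k * exp (- Re w)"
   using d[of 1] mult_left_mono[OF r(1) k0] mult_left_mono[OF r(2) k0] p1 by linarith+
  show "norm (1 - psi 1 w) <= k" "norm (1 - psi 1 w) <= k * exp (Re w)"
   using d[of "exp (Re w)"] mult_left_mono[OF r(3) k0] mult_left_mono[OF r(4) k0] p2 by auto
 qed
 define S where "S = norm t0 + norm (ph (P (N u))) + norm (ph (N u)) + norm (ph (P u))"
 have S: "norm t0 <= S" "norm (ph (P (N u))) <= S" "norm (ph (N u)) <= S" "norm (ph (P u)) <= S" "0 <= S"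
  by (auto simp: S_def)
 have bracket: "norm (t0 - p * x1 + (p * (1 - p)) * (x2 - p * x3)) <= S + k * S + (k * k) * (S + k * S)"
  if "norm p <= k" "norm (1 - p) <= k" "norm x1 <= S" "norm x2 <= S" "norm x3 <= S" for p x1 x2 x3 :: complex
 proof -
  have k0: "0 <= k" using k by simp
  have "norm (p * x1) <= k * S" "norm (p * x3) <= k * S" "norm (p * (1 - p)) <= k * k"
   unfolding norm_mult using that k0 S by (auto intro!: mult_mono)
  moreover from this have "norm (x2 - p * x3) <= S + k * S" using norm_triangle_ineq4[of x2 "p * x3"] that by linarith
  ultimately have "norm ((p * (1 - p)) * (x2 - p * x3)) <= (k * k) * (S + k * S)"
   unfolding norm_mult[of "p * (1 - p)"] using k0 by (intro mult_mono) auto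
  moreover have "norm (t0 - p * x1) <= S + k * S" using norm_triangle_ineq4[of t0 "p * x1"] S(1) \<open>norm (p * x1) <= k * S\<close> by linarith
  ultimately show ?thesis using norm_triangle_ineq[of "t0 - p * x1" "(p * (1 - p)) * (x2 - p * x3)"] by linarith
 qed
 define M where "M = k * (S + k * S + (k * k) * (S + k * S)) + (k * S + k * (S + k * S + (k * k) * (S + k * S)) + (k * k) * (S + k * S))"
 have e1: "norm (e w) <= M * exp (Re w)" if "abs (Im w) <= a" for w
 proof -
  have k0: "0 <= k" using k by simp
  have "norm (e w) <= (k * exp (Re w)) * (S + k * S + (k * k) * (S + k * S))"
   unfolding e_def norm_mult[of "1 - psi 1 w"]
   by (rule mult_mono[OF pb(4)[OF that] bracket]) (use pb[OF that] S k0 in auto)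
  also have "... <= M * exp (Re w)"
  proof -
   have "k * (S + k * S + (k * k) * (S + k * S)) <= M" unfolding M_def using k0 S by simp
   from mult_right_mono[OF this, of "exp (Re w)"] show ?thesis by (simp add: mult_ac)
  qed
  finally show ?thesis .
 qed
 have e2: "norm (e w - t0) <= M * exp (- Re w)" if w: "abs (Im w) <= a" for w
 proof -
  have k0: "0 <= k" using k by simp
  define p where "p = psi 1 w"
  define B where "B = t0 - p * ph (P (N u)) + (p * (1 - p)) * (ph (N u) - p * ph (P u))"
  have "e w - t0 = p * (- ph (P (N u)) - B + (1 - p) * (ph (N u) - p * ph (P u)))"
   unfolding e_def B_def p_def by (simp add: algebra_simps)
  also have "norm ... <= (k * exp (- Re w)) * (S + (S + k * S + (k * k) * (S + k * S)) + k * (S + k * S))"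
   unfolding norm_mult[of p]
  proof (rule mult_mono)
   show "norm p <= k * exp (- Re w)" using pb(3)[OF w] by (simp add: p_def)
   have B: "norm B <= S + k * S + (k * k) * (S + k * S)" unfolding B_def
    by (rule bracket) (use pb[OF w] S in \<open>auto simp: p_def\<close>)
   have "norm (p * ph (P u)) <= k * S" unfolding norm_mult using pb(1)[OF w] S k0 by (intro mult_mono) (auto simp: p_def)
   hence "norm (ph (N u) - p * ph (P u)) <= S + k * S" using norm_triangle_ineq4[of "ph (N u)" "p * ph (P u)"] S(3) by linarith
   hence "norm ((1 - p) * (ph (N u) - p * ph (P u))) <= k * (S + k * S)"
    unfolding norm_mult using pb(2)[OF w] k0 by (intro mult_mono) (auto simp: p_def)
   moreover have "norm (- ph (P (N u)) - B) <= S + (S + k * S + (k * k) * (S + k * S))"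
    using norm_triangle_ineq4[of "- ph (P (N u))" B] B S(2) by simp
   ultimately show "norm (- ph (P (N u)) - B + (1 - p) * (ph (N u) - p * ph (P u))) <= S + (S + k * S + (k * k) * (S + k * S)) + k * (S + k * S)"
    using norm_triangle_ineq[of "- ph (P (N u)) - B" "(1 - p) * (ph (N u) - p * ph (P u))"] by linarith
  qed (use k0 in auto)
  also have "... <= M * exp (- Re w)"
  proof -
   have "k * (S + (S + k * S + (k * k) * (S + k * S)) + k * (S + k * S)) <= M"
    unfolding M_def using k0 S by (simp add: distrib_left mult.assoc)
   from mult_right_mono[OF this, of "exp (- Re w)"] show ?thesis by (simp add: mult_ac)
  qed
  finally show ?thesis .
 qed
 have hole: "e holomorphic_on {w. abs (Im w) < pi}"
 proof -
  have "psi 1 holomorphic_on {w. abs (Im w) < pi}" unfolding psi_def[abs_def] using nz by (intro holomorphic_intros) auto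
  thus ?thesis unfolding e_def[abs_def] by (intro holomorphic_intros)
 qed
 have conte: "continuous_on {w. abs (Im w) < pi} e" using hole holomorphic_on_imp_continuous_on by blast
 have ce: "continuous_on UNIV (%s. e (Complex s t))" if "abs t <= a" for t
  by (rule continuous_on_compose2[OF conte]) (use that a in \<open>auto intro!: continuous_intros\<close>)
 have ie: "integrable lborel (line_diff a e)"
 proof (rule integrable_continuous_dominated)
  show "continuous_on UNIV (line_diff a e)" by (rule continuous_on_line_diff) (use ce a0 in auto)
  show "norm (line_diff a e s) <= 2 * M * exp (- abs s)" for s
  proof (cases "s <= 0")
   case True
   have "norm (line_diff a e s) <= 2 * (M * exp s)"
    by (rule norm_line_diff) (use e1[of "Complex s _"] a0 in auto)
   thus ?thesis using True by simp
  next
   case False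
   have "norm (line_diff a (%w. e w - t0) s) <= 2 * (M * exp (- s))"
    by (rule norm_line_diff) (use e2[of "Complex s _"] a0 in auto)
   thus ?thesis using False by (simp add: line_diff_def)
  qed
 qed (intro integrable_mult_right integrable_exp_neg_abs)
 have es: "(LINT s|lborel. e (Complex s a) - e (Complex s (- a))) = \<i> * (of_real (a - - a) * t0 - of_real (a - - a) * 0)"
 proof (rule strip_integral_limits[OF hole open_strip])
  have ct: "continuous_on {- a..a} (%t. e (Complex s t))" for s
   by (rule continuous_on_compose2[OF conte]) (use a in \<open>auto intro!: continuous_intros\<close>)
  show "((%s. integral {- a..a} (%t. e (Complex s t))) \<longlongrightarrow> of_real (a - - a) * t0) at_top"
  proof (rule cross_section_integral_tendsto[OF ct])
   show "\<forall>\<^sub>F s in at_top. \<forall>t\<in>{- a..a}. norm (e (Complex s t) - t0) <= M * exp (- s)"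
    using e2[of "Complex _ _"] by (intro always_eventually) auto
   show "((%s. M * exp (- s)) \<longlongrightarrow> 0) at_top" by real_asymp
  qed (use a0 in auto)
  show "((%s. integral {- a..a} (%t. e (Complex s t))) \<longlongrightarrow> of_real (a - - a) * 0) at_bot"
  proof (rule cross_section_integral_tendsto[OF ct])
   show "\<forall>\<^sub>F s in at_bot. \<forall>t\<in>{- a..a}. norm (e (Complex s t) - 0) <= M * exp s"
    using e1[of "Complex _ _"] by (intro always_eventually) auto
   show "((%s. M * exp s) \<longlongrightarrow> 0) at_bot" using tendsto_mult_left[OF exp_at_bot, of M] by simp
  qed (use a0 in auto)
  have "(%s. e (Complex s a) - e (Complex s (- a))) = (%s. - line_diff a e s)" by (simp add: line_diff_def)
  thus "integrable lborel (%s. e (Complex s a) - e (Complex s (- a)))" using ie by simp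
 qed (use a a0 in auto)
 have contH: "continuous_on region H" unfolding H_def using Q_holomorphic[OF ph] holomorphic_on_imp_continuous_on by blast
 \<comment> \<open>Heights -a and 2 pi - a carry the same resolvents. Moving the lower edge up by 2
   pi makes the two edges bound a strip in which all resolvents exist.\<close>
 have per: "H (Complex s (2 * pi - a)) = H (Complex s (- a))" for s
 proof -
  have "exp (Complex s (2 * pi - a)) = exp (Complex s (- a))" by (simp add: exp_Complex cis.code cos_diff sin_diff)
  thus ?thesis by (simp add: H_def Q_def)
 qed
 note tau2 = tau2_decay[OF a(2)]
 note PF = Psi_functional[OF a tau2 ph, of u]
 have Heq: "line_diff a H s = line_diff a (%w. (tau (exp w))^2 * ph (Q w u)) s + line_diff a e s" for s
  using split[of "Complex s a"] split[of "Complex s (- a)"] reg[of a] reg[of "- a"] a a0 by (simp add: line_diff_def)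
 have iH: "integrable lborel (line_diff a H)"
  unfolding Heq[abs_def] by (rule Bochner_Integration.integrable_add[OF PF(1) ie])
 have Hs: "(LINT s|lborel. H (Complex s (2 * pi - a)) - H (Complex s a)) = \<i> * (of_real (2 * pi - a - a) * t0 - of_real (2 * pi - a - a) * 0)"
 proof (rule strip_integral_limits)
  show "H holomorphic_on region" unfolding H_def by (rule Q_holomorphic[OF ph])
  show "open region" by (rule open_region)
  show "w \<in> region" if "a <= Im w" "Im w <= 2 * pi - a" for w using that a a0 by (auto simp: region_def)
  have ct: "continuous_on {a..2 * pi - a} (%t. H (Complex s t))" for s
   by (rule continuous_on_compose2[OF contH]) (use a a0 in \<open>auto simp: region_def intro!: continuous_intros\<close>)
  obtain C where C: "C >= 0" "!!w u. a <= abs (Im w) ==> abs (Im w) <= 2 * pi - a ==> norm (Q w u) <= C * norm u"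
   using Q_bound[OF a(1)] by metis
  have regt: "Complex s t \<in> region" if "t \<in> {a..2 * pi - a}" for s t using that a a0 by (auto simp: region_def)
  \<comment> \<open>v is A N^2 u, and x further down satisfies A x = N^2 u. The former makes Q N^2 u
    tend to N^2 u on the right at rate e^-s, the latter makes it tend to 0 on the left at rate
    e^s.\<close>
  define v where "v = (N u - P (N u)) - N (N u)"
  have b1: "norm (H (Complex s t) - t0) <= K * (C * norm v) * exp (- s)" if t: "t \<in> {a..2 * pi - a}" for s t
  proof -
   let ?w = "Complex s t"
   have "exp ?w *\<^sub>C (Q ?w (N (N u)) - N (N u)) = Q ?w v"
    unfolding v_def by (rule Q_commute_A(1)[OF regt[OF t] N_graph(2)])
   hence "exp s * norm (Q ?w (N (N u)) - N (N u)) <= C * norm v"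
    using C(2)[of ?w v] t a a0 by (metis (no_types, lifting) abs_of_nonneg atLeastAtMost_iff complex.sel norm_exp_eq_Re norm_scaleC order_less_imp_le order_trans)
   hence "norm (Q ?w (N (N u)) - N (N u)) <= C * norm v * exp (- s)" by (simp add: exp_minus field_simps)
   from mult_left_mono[OF this K(1)] K(2)[of "Q ?w (N (N u)) - N (N u)"]
   show ?thesis by (simp add: H_def t0_def clinear_boundedD[OF ph] mult.assoc)
  qed
  define x where "x = P (P (N u))"
  have b2: "norm (H (Complex s t) - 0) <= K * ((C + 1) * norm x) * exp s" if t: "t \<in> {a..2 * pi - a}" for s t
  proof -
   let ?w = "Complex s t"
   have "Q ?w (N (N u)) = exp ?w *\<^sub>C (Q ?w x - x)"
    unfolding x_def by (rule Q_commute_A(1)[OF regt[OF t] N_graph(1), symmetric])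
   hence "norm (Q ?w (N (N u))) = exp s * norm (Q ?w x - x)" by (simp add: norm_scaleC)
   also have "norm (Q ?w x - x) <= C * norm x + norm x"
    using norm_triangle_ineq4[of "Q ?w x" x] C(2)[of ?w x] t a a0 by auto
   finally have "norm (Q ?w (N (N u))) <= exp s * ((C + 1) * norm x)" by (simp add: distrib_right)
   from mult_left_mono[OF this K(1)] K(2)[of "Q ?w (N (N u))"]
   show ?thesis by (simp add: H_def mult_ac)
  qed
  show "((%s. integral {a..2 * pi - a} (%t. H (Complex s t))) \<longlongrightarrow> of_real (2 * pi - a - a) * t0) at_top"
  proof (rule cross_section_integral_tendsto[OF ct])
   show "\<forall>\<^sub>F s in at_top. \<forall>t\<in>{a..2 * pi - a}. norm (H (Complex s t) - t0) <= K * (C * norm v) * exp (- s)"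
    using b1 by (intro always_eventually) auto
   show "((%s. K * (C * norm v) * exp (- s)) \<longlongrightarrow> 0) at_top" by real_asymp
  qed (use a in auto)
  show "((%s. integral {a..2 * pi - a} (%t. H (Complex s t))) \<longlongrightarrow> of_real (2 * pi - a - a) * 0) at_bot"
  proof (rule cross_section_integral_tendsto[OF ct])
   show "\<forall>\<^sub>F s in at_bot. \<forall>t\<in>{a..2 * pi - a}. norm (H (Complex s t) - 0) <= K * ((C + 1) * norm x) * exp s"
    using b2 by (intro always_eventually) auto
   show "((%s. K * ((C + 1) * norm x) * exp s) \<longlongrightarrow> 0) at_bot"
    using tendsto_mult_left[OF exp_at_bot, of "K * ((C + 1) * norm x)"] by simp
  qed (use a in auto)
  show "integrable lborel (%s. H (Complex s (2 * pi - a)) - H (Complex s a))"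
   using iH by (simp add: per line_diff_def[abs_def])
 qed (use a in auto)
 have "(LINT s|lborel. line_diff a H s) = \<i> * (of_real (2 * pi - a - a) * t0)"
  using Hs by (simp add: per line_diff_def)
 moreover have "(LINT s|lborel. line_diff a e s) = - (\<i> * (of_real (a - - a) * t0))"
 proof -
  have "(LINT s|lborel. line_diff a e s) = (LINT s|lborel. - (e (Complex s a) - e (Complex s (- a))))"
   by (simp add: line_diff_def)
  also have "... = - (LINT s|lborel. e (Complex s a) - e (Complex s (- a)))" by (rule Bochner_Integration.integral_minus)
  finally show ?thesis using es by simp
 qed
 moreover have "(LINT s|lborel. line_diff a H s) = (LINT s|lborel. line_diff a (%w. (tau (exp w))^2 * ph (Q w u)) s) + (LINT s|lborel. line_diff a e s)"
  unfolding Heq by (rule Bochner_Integration.integral_add[OF PF(1) ie])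
 ultimately have "2 * of_real pi * \<i> * ph (Psi a (%w. (tau (exp w))^2) u) = 2 * of_real pi * \<i> * t0"
  unfolding PF(2) by (simp add: algebra_simps)
 thus "ph (Psi a (%w. (tau (exp w))^2) u) = ph (N (N u))" by (simp add: t0_def)
qed

end

section \<open>How fast the operators \<open>psi_op\<close> approach the identity on the domain of
  A\<close>

lemma le_sqrt_mult:
 fixes x a b :: real
 assumes "0 <= x" "x <= a" "x <= b" shows "x <= sqrt (a * b)"
proof -
 have "x * x <= a * b" using assms by (intro mult_mono) auto
 thus ?thesis using assms(1) by (intro real_le_rsqrt) (simp add: power2_eq_square)
qed

lemma integrable_exp_neg_abs_half: "integrable lborel (%s::real. exp (- abs s / 2))"
proof -
 have "integrable lborel (%s::real. exp (- abs (0 + (1 / 2) * s)))"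
  by (rule lborel_integrable_real_affine[OF integrable_exp_neg_abs]) simp
 thus ?thesis by (simp add: abs_divide)
qed

context sectorial_psi
begin

text \<open>The contour integral of \<open>phi_fun\<close> vanishes, so x may be subtracted under
  the integral, and Q x - x is e^-w Q v on the domain. The geometric mean of the bounds by |x| and
  by e^-s |v| is used because the full factor e^-s would destroy the decay of \<open>phi_fun\<close>
  on the left; its square root still leaves e^(-|s|/2).\<close>

theorem psi_op_defect:
 obtains K where "K >= 0"
  "!!x v y. (x, v) \<in> A ==> norm (x - psi_op y x) <= K * sqrt (norm x * norm v * exp (- y))"
proof -
 obtain C where C: "C >= 0" "!!s t u. abs t = b ==> norm (Q (Complex s t) u) <= C * norm u"
  "!!s u. norm (Q (Complex s pi) u) <= C * norm u" using Q_bound_b by metis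
 define I where "I = (LINT s|(lborel :: real measure). exp (- abs s / 2))"
 have defect: "norm (Q (Complex s t) x - x) <= (C + 1) * sqrt (norm x * norm v * exp (- s))"
  if xv: "(x, v) \<in> A" and t: "abs t = b \<or> t = pi" for s t x v
 proof -
  have reg: "Complex s t \<in> region" and Cb: "norm (Q (Complex s t) u) <= C * norm u" for u
   using t line_region C by auto
  have "exp (Complex s t) *\<^sub>C (Q (Complex s t) x - x) = Q (Complex s t) v" by (rule Q_commute_A(1)[OF reg xv])
  hence "exp s * norm (Q (Complex s t) x - x) = norm (Q (Complex s t) v)"
   by (metis complex.sel(1) norm_exp_eq_Re norm_scaleC)
  also have "... <= (C + 1) * norm v" using Cb[of v] norm_ge_zero[of v] unfolding distrib_right by linarith
  finally have 1: "norm (Q (Complex s t) x - x) <= (C + 1) * norm v * exp (- s)"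
   by (simp add: exp_minus field_simps)
  have 2: "norm (Q (Complex s t) x - x) <= (C + 1) * norm x"
   using norm_triangle_ineq4[of "Q (Complex s t) x" x] Cb[of x] by (simp add: distrib_right)
  have "norm (Q (Complex s t) x - x) <= sqrt (((C + 1) * norm x) * ((C + 1) * norm v * exp (- s)))"
   by (rule le_sqrt_mult[OF norm_ge_zero 2 1])
  also have "... = sqrt ((C + 1)^2 * (norm x * norm v * exp (- s)))" by (simp add: power2_eq_square mult_ac)
  also have "... = (C + 1) * sqrt (norm x * norm v * exp (- s))" using C(1) by (simp add: real_sqrt_mult)
  finally show ?thesis .
 qed
 define K where "K = (C + 1) + 2 * (phi_const * (C + 1)) * I / (2 * pi)"
 have I: "I >= 0" unfolding I_def by (rule integral_nonneg_AE) simp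
 show ?thesis
 proof (rule that[of K])
  show "K >= 0" using C I phi_const_pos by (simp add: K_def)
  fix x v y assume xv: "(x, v) \<in> A"
  define r where "r = sqrt (norm x * norm v * exp (- y))"
  define G where "G = line_diff b (%w. phi_fun q w *\<^sub>C (Q (of_real y + w) x - x))"
  have b0': "0 <= b" using b0 by simp
  have ie: "integrable lborel (line_diff b (phi_fun q))"
   unfolding line_diff_def[abs_def] using strip_decay_integrable[OF phi_decay] b0' by (intro Bochner_Integration.integrable_diff) auto
  have "(LINT s|lborel. line_diff b (phi_fun q) s) = - (LINT s|lborel. phi_fun q (Complex s b) - phi_fun q (Complex s (- b)))"
   by (simp add: line_diff_def flip: Bochner_Integration.integral_minus)
  also have "... = 0" using strip_decay_cauchy[OF phi_decay b0'] by simp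
  finally have e0: "(LINT s|lborel. line_diff b (phi_fun q) s) = 0" .
  have "G = (%s. phi_int y x s - line_diff b (phi_fun q) s *\<^sub>C x)"
   by (auto simp: G_def phi_int_def line_diff_def scaleC.diff_right scaleC.diff_left)
  hence wG: "has_wint G (wint (phi_int y x))"
   using has_wint_diff[OF has_wint_phi_int[of y x] has_wint_scaleC_const[OF ie, of x]] e0 by simp
  have Gb: "norm (G s) <= 2 * (phi_const * (C + 1)) * r * exp (- abs s / 2)" for s
  proof -
   have "norm (G s) <= 2 * (phi_const * exp (- abs s) * ((C + 1) * (r * exp (- s / 2))))"
    unfolding G_def
   proof (rule norm_line_diff[OF _ b0'])
    fix t assume t: "abs t = b"
    have "sqrt (exp (- s)) = exp (- s / 2)"
    proof (rule real_sqrt_unique)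
     show "(exp (- s / 2))^2 = exp (- s)" by (simp add: power2_eq_square flip: exp_add)
    qed simp
    moreover have "norm x * norm v * exp (- (y + s)) = (norm x * norm v * exp (- y)) * exp (- s)"
     by (simp add: mult.assoc flip: exp_add)
    ultimately have "sqrt (norm x * norm v * exp (- (y + s))) = r * exp (- s / 2)"
     by (simp only: real_sqrt_mult[of "norm x * norm v * exp (- y)"] r_def)
    thus "norm (phi_fun q (Complex s t) *\<^sub>C (Q (of_real y + Complex s t) x - x)) <=
      phi_const * exp (- abs s) * ((C + 1) * (r * exp (- s / 2)))"
     unfolding norm_scaleC of_real_plus_Complex
     using defect[OF xv, of t "y + s"] phi_strip_bound[of "Complex s t"] t phi_const_pos
     by (intro mult_mono) auto
   qed
   also have "... = 2 * (phi_const * (C + 1)) * r * (exp (- abs s) * exp (- s / 2))" by (simp add: mult_ac)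
   also have "... <= 2 * (phi_const * (C + 1)) * r * exp (- abs s / 2)"
   proof (rule mult_left_mono)
    have "exp (- abs s) * exp (- s / 2) = exp (- abs s - s / 2)" by (simp flip: exp_add)
    also have "... <= exp (- abs s / 2)" unfolding exp_le_cancel_iff by linarith
    finally show "exp (- abs s) * exp (- s / 2) <= exp (- abs s / 2)" .
   qed (use C phi_const_pos in \<open>simp add: r_def\<close>)
   finally show ?thesis .
  qed
  have "norm (wint (phi_int y x)) <= (LINT s|lborel. 2 * (phi_const * (C + 1)) * r * exp (- abs s / 2))"
   by (rule has_wint_norm_bound[OF wG Gb]) (intro integrable_mult_right integrable_exp_neg_abs_half)
  hence le: "norm (wint (phi_int y x)) <= 2 * (phi_const * (C + 1)) * r * I" by (simp add: I_def)
  have eq: "x - psi_op y x = (x - Q (Complex y pi) x) - (1 / (2 * of_real pi * \<i>)) *\<^sub>C wint (phi_int y x)"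
   by (simp add: psi_op_def)
  have "norm ((1 / (2 * of_real pi * \<i>)) *\<^sub>C wint (phi_int y x)) = norm (wint (phi_int y x)) / (2 * pi)"
   by (simp add: norm_scaleC norm_divide norm_mult)
  also have "... <= 2 * (phi_const * (C + 1)) * r * I / (2 * pi)" by (rule divide_right_mono[OF le]) simp
  finally have 2: "norm ((1 / (2 * of_real pi * \<i>)) *\<^sub>C wint (phi_int y x)) <= 2 * (phi_const * (C + 1)) * I / (2 * pi) * r"
   by (simp add: mult_ac)
  have 1: "norm (x - Q (Complex y pi) x) <= (C + 1) * r"
   using defect[OF xv, of pi y] by (simp add: r_def norm_minus_commute)
  show "norm (x - psi_op y x) <= K * sqrt (norm x * norm v * exp (- y))"
  proof -
   have "K * r = (C + 1) * r + 2 * (phi_const * (C + 1)) * I / (2 * pi) * r"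
    unfolding K_def by (rule distrib_right)
   thus ?thesis
    unfolding eq r_def[symmetric] by (simp only: order_trans[OF norm_triangle_ineq4 add_mono[OF 1 2]])
  qed
 qed
qed

end

section \<open>The function f tau^2 and its composition with \<open>Rz\<close>\<close>

context sectorial_resolvent
begin

lemma N_injective:
 assumes inj: "!!x. (x, 0) \<in> A ==> x = 0" and u: "N u = 0"
 shows "u = 0"
proof -
 have Pinj: "v = 0" if "P v = 0" for v
  using P_graph[of v] A_unique[of 0 0 v] A_scaleC[OF P_graph[of 0], of 0] that by simp
 have "P (P u) = 0" using N_graph(1)[of u] u inj by simp
 thus ?thesis using Pinj by blast
qed

lemma Psi_diff:
 assumes a: "\<omega> < a" "a < pi" and h: "strip_decay a h" "strip_decay a k"
  and d: "strip_decay a (%w. h w - c * k w)"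
 shows "Psi a (%w. h w - c * k w) u = Psi a h u - c *\<^sub>C Psi a k u"
proof (rule Psi_eqI[OF a d])
 have "line_diff a (%w. (h w - c * k w) *\<^sub>C Q w u) =
   (%s. line_diff a (%w. h w *\<^sub>C Q w u) s - c *\<^sub>C line_diff a (%w. k w *\<^sub>C Q w u) s)"
  by (auto simp: line_diff_def scaleC.diff_left scaleC.diff_right)
 moreover have "(2 * of_real pi * \<i>) *\<^sub>C (Psi a h u - c *\<^sub>C Psi a k u) =
   (2 * of_real pi * \<i>) *\<^sub>C Psi a h u - c *\<^sub>C (2 * of_real pi * \<i>) *\<^sub>C Psi a k u"
  by (simp add: scaleC.diff_right mult.commute)
 ultimately show "has_wint (line_diff a (%w. (h w - c * k w) *\<^sub>C Q w u)) ((2 * of_real pi * \<i>) *\<^sub>C (Psi a h u - c *\<^sub>C Psi a k u))"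
  using has_wint_diff[OF has_wint_Psi[OF a h(1), of u] has_wint_scaleC[OF has_wint_Psi[OF a h(2), of u], of c]] by simp
qed

definition ftau :: "(complex => complex) => complex => complex" where
 "ftau f w = f (exp w) * (tau (exp w))^2"

text \<open>In the strip f grows at most like e^|Re w|, while tau^2 decays like e^(-2|Re w|); one
  power of tau would leave no decay.\<close>

lemma ftau_decay:
 assumes f: "f \<in> NP_plus" and t: "0 <= t" "t < pi / 2"
 shows "strip_decay t (ftau f)"
 unfolding strip_decay_def
proof (intro conjI)
 have "ftau f holomorphic_on {w. abs (Im w) < pi / 2}"
  unfolding ftau_def[abs_def]
  by (intro holomorphic_intros NP_plus_exp_holomorphic[OF f] holomorphic_on_subset[OF tau_holomorphic]) auto
 thus "EX c>t. ftau f holomorphic_on {w. abs (Im w) < c}" using t by blast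
 obtain C where C: "C > 0" "!!w. abs (Im w) <= t ==> norm (f (exp w)) <= C * exp (abs (Re w))"
  using NP_plus_growth[OF f t] by metis
 define D where "D = 1 / (cos (t / 2))^2"
 have D: "norm (tau (exp w)) <= D * exp (- abs (Re w))" if "abs (Im w) <= t" for w
  using tau_bound(2)[OF that] t by (simp add: D_def)
 have D0: "D >= 0" by (simp add: D_def)
 have "norm (ftau f w) <= (C * D^2) * exp (- abs (Re w))" if w: "abs (Im w) <= t" for w
 proof -
  have "norm (ftau f w) <= (C * exp (abs (Re w))) * (D * exp (- abs (Re w)))^2"
   unfolding ftau_def norm_mult norm_power by (intro mult_mono power_mono C D w) (use C in auto)
  also have "... = (C * D^2) * (exp (abs (Re w)) * exp (- abs (Re w)) * exp (- abs (Re w)))"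
   by (simp only: power2_eq_square mult_ac)
  finally show ?thesis by (simp flip: exp_add)
 qed
 thus "EX C>=0. ALL w. abs (Im w) <= t --> norm (ftau f w) <= C * exp (- abs (Re w))"
  using C(1) by (intro exI[of _ "C * D^2"]) auto
qed

end

context resolvent_calculus
begin

definition \<alpha>0 :: real where "\<alpha>0 = (\<omega> + b) / 2"

lemma \<alpha>0: "\<omega> < \<alpha>0" "\<alpha>0 < b" "0 <= \<alpha>0" "\<alpha>0 < pi" "\<alpha>0 < pi / 2" "\<alpha>0 <= a"
 using b ba b0 \<omega> by (auto simp: \<alpha>0_def)

lemma Rz_Q: "w \<in> region ==> Rz (Q w u) = Q w (Rz u)"
 by (rule Rz_commute[symmetric, OF Q_clinear Q_commute])

lemma Rz_P: "Rz (P u) = P (Rz u)" unfolding P_def by (rule Rz_Q[OF P_region])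

lemma Rz_N: "Rz (N u) = N (Rz u)"
 by (simp add: N_def clinear_boundedD[OF Rz_clinear] Rz_P)

lemma Rz_Psi:
 assumes "\<omega> < t" "t < pi" "strip_decay t h" shows "Rz (Psi t h u) = Psi t h (Rz u)"
 by (rule Psi_commute[OF assms Rz_clinear Rz_Q])

text \<open>The scalar identity f g = 1 - z g, multiplied by tau^2 and pushed through
  \<open>Psi_Rz\<close>. The angle t comes from the definition of f(A) and may exceed b, so the
  contour is first moved to \<alpha>0.\<close>

theorem Psi_ftau_Rz:
 assumes t: "\<omega> < t" "t < pi / 2"
 shows "Psi t (ftau f) (Rz u) = N (N u) - z *\<^sub>C N (N (Rz u))"
proof -
 have t0: "0 <= t" using t \<omega> by simp
 have ind: "Psi t (ftau f) v = Psi \<alpha>0 (ftau f) v" for v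
 proof (cases "t <= \<alpha>0")
  case True
  thus ?thesis by (rule Psi_angle_independent[OF t(1) _ \<alpha>0(4) ftau_decay[OF f \<alpha>0(3,5)]])
 next
  case False
  moreover have "t < pi" using t(2) pi_gt_zero by linarith
  ultimately show ?thesis using t
   by (intro Psi_angle_independent[OF \<alpha>0(1) _ _ ftau_decay[OF f t0 t(2)], symmetric]) auto
 qed
 note tau2 = tau2_decay[OF \<alpha>0(4)]
 note fd = ftau_decay[OF f \<alpha>0(3,5)]
 note tg = g_decay[OF \<alpha>0(3,6) tau2]
 have eq: "ftau f w * g w = (tau (exp w))^2 - z * ((tau (exp w))^2 * g w)" if "abs (Im w) <= \<alpha>0" for w
 proof -
  have "z + f (exp w) ~= 0" by (rule denominator) (use that \<alpha>0 a \<theta> in auto)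
  hence fg: "f (exp w) * g w = 1 - z * g w" by (simp add: g_def field_simps)
  have "ftau f w * g w = (tau (exp w))^2 * (f (exp w) * g w)" by (simp add: ftau_def)
  thus ?thesis by (simp only: fg right_diff_distrib mult_1_right mult.left_commute)
 qed
 have d: "strip_decay \<alpha>0 (%w. (tau (exp w))^2 - z * ((tau (exp w))^2 * g w))"
 proof -
  obtain c1 where c1: "c1 > \<alpha>0" "(%w. (tau (exp w))^2) holomorphic_on {w. abs (Im w) < c1}" using tau2 by (auto simp: strip_decay_def)
  obtain c2 where c2: "c2 > \<alpha>0" "(%w. (tau (exp w))^2 * g w) holomorphic_on {w. abs (Im w) < c2}" using tg by (auto simp: strip_decay_def)
  obtain C where C: "C >= 0" "!!w. abs (Im w) <= \<alpha>0 ==> norm (ftau f w * g w) <= C * exp (- abs (Re w))"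
   using g_decay[OF \<alpha>0(3,6) fd] by (auto simp: strip_decay_def)
  show ?thesis unfolding strip_decay_def
  proof (rule conjI)
   have "(%w. (tau (exp w))^2 - z * ((tau (exp w))^2 * g w)) holomorphic_on {w. abs (Im w) < min c1 c2}"
    by (intro holomorphic_intros holomorphic_on_subset[OF c1(2)] holomorphic_on_subset[OF c2(2)]) auto
   moreover have "min c1 c2 > \<alpha>0" using c1 c2 by simp
   ultimately show "EX c>\<alpha>0. (%w. (tau (exp w))^2 - z * ((tau (exp w))^2 * g w)) holomorphic_on {w. abs (Im w) < c}" by blast
   have "norm ((tau (exp w))^2 - z * ((tau (exp w))^2 * g w)) <= C * exp (- abs (Re w))" if "abs (Im w) <= \<alpha>0" for w
    using C(2)[OF that] unfolding eq[OF that] .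
   thus "EX C>=0. ALL w. abs (Im w) <= \<alpha>0 --> norm ((tau (exp w))^2 - z * ((tau (exp w))^2 * g w)) <= C * exp (- abs (Re w))"
    using C(1) by blast
  qed
 qed
 have "Psi \<alpha>0 (ftau f) (Rz u) = Psi \<alpha>0 (%w. ftau f w * g w) u" by (rule Psi_Rz[OF \<alpha>0(1,2) fd])
 also have "... = Psi \<alpha>0 (%w. (tau (exp w))^2 - z * ((tau (exp w))^2 * g w)) u"
 proof -
  have "line_diff \<alpha>0 (%w. (ftau f w * g w) *\<^sub>C Q w u) = line_diff \<alpha>0 (%w. ((tau (exp w))^2 - z * ((tau (exp w))^2 * g w)) *\<^sub>C Q w u)"
   unfolding line_diff_def[abs_def] using eq[of "Complex _ \<alpha>0"] eq[of "Complex _ (- \<alpha>0)"] \<alpha>0(3) by simp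
  thus ?thesis by (simp add: Psi_def)
 qed
 also have "... = N (N u) - z *\<^sub>C Psi \<alpha>0 (%w. (tau (exp w))^2 * g w) u"
  unfolding Psi_diff[OF \<alpha>0(1,4) tau2 tg d] Psi_tau2[OF \<alpha>0(1,4)] ..
 also have "Psi \<alpha>0 (%w. (tau (exp w))^2 * g w) u = N (N (Rz u))"
  using Psi_Rz[OF \<alpha>0(1,2) tau2, of u] Psi_tau2[OF \<alpha>0(1,4)] by simp
 finally show ?thesis by (simp add: ind)
qed

text \<open>One direction is \<open>Psi_ftau_Rz\<close> at the vector y + z x. For the other,
  \<open>Rz\<close> commutes with N and with \<open>Psi\<close>, and the resulting equation is
  cancelled by the injective N^2.\<close>

theorem regularised_resolvent:
 assumes inj: "!!x. (x, 0) \<in> A ==> x = 0" and t: "\<omega> < t" "t < pi / 2"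
 shows "N (N y) = Psi t (ftau f) x \<longleftrightarrow> Rz (y + z *\<^sub>C x) = x"
proof
 have t0: "0 <= t" "t < pi" using t \<omega> pi_gt_zero by linarith+
 note fd = ftau_decay[OF f t0(1) t(2)]
 note Nl = clinear_boundedD[OF N_clinear] and Rl = clinear_boundedD[OF Rz_clinear]
 {
  assume "Rz (y + z *\<^sub>C x) = x"
  hence "Psi t (ftau f) x = N (N (y + z *\<^sub>C x)) - z *\<^sub>C N (N x)" using Psi_ftau_Rz[OF t] by metis
  thus "N (N y) = Psi t (ftau f) x" by (simp add: Nl)
 }
 assume "N (N y) = Psi t (ftau f) x"
 hence "Rz (N (N y)) = Psi t (ftau f) (Rz x)" using Rz_Psi[OF t(1) t0(2) fd] by simp
 also have "... = N (N x) - z *\<^sub>C N (N (Rz x))" by (rule Psi_ftau_Rz[OF t])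
 finally have "N (N (Rz (y + z *\<^sub>C x) - x)) = 0" by (simp add: Nl Rl Rz_N)
 hence "N (Rz (y + z *\<^sub>C x) - x) = 0" using N_injective[OF inj] by blast
 hence "Rz (y + z *\<^sub>C x) - x = 0" using N_injective[OF inj] by blast
 thus "Rz (y + z *\<^sub>C x) = x" by simp
qed

text \<open>The value $1 / (z + f(0+))$ of the resolvent function at the origin.\<close>

definition g0 :: complex where "g0 = c0 + of_real (q / pi) * (LINT y|lborel. J y)"

text \<open>Replacing every \<open>psi_op y\<close> by the identity turns \<open>Rz\<close> into the
  scalar g0, so the difference is an average of the defects x - psi_op y x with weight J.\<close>

lemma Rz_near_g0:
 assumes m: "!!y. norm (x - psi_op y x) <= m y" and int: "integrable lborel (%y. norm (J y) * m y)"
 shows "norm (Rz x - g0 *\<^sub>C x) <= q / pi * (LINT y|lborel. norm (J y) * m y)"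
proof -
 have "has_wint (%y. J y *\<^sub>C x - J y *\<^sub>C psi_op y x) ((LINT y|lborel. J y) *\<^sub>C x - wint (%y. J y *\<^sub>C psi_op y x))"
  by (rule has_wint_diff[OF has_wint_scaleC_const[OF J_int] J_psi_op(3)])
 hence "norm ((LINT y|lborel. J y) *\<^sub>C x - wint (%y. J y *\<^sub>C psi_op y x)) <= (LINT y|lborel. norm (J y) * m y)"
 proof (rule has_wint_norm_bound[OF _ _ int])
  show "norm (J y *\<^sub>C x - J y *\<^sub>C psi_op y x) <= norm (J y) * m y" for y
   unfolding scaleC.diff_right[symmetric] norm_scaleC by (rule mult_left_mono[OF m]) simp
 qed
 moreover have "Rz x - g0 *\<^sub>C x = - (of_real (q / pi) *\<^sub>C ((LINT y|lborel. J y) *\<^sub>C x - wint (%y. J y *\<^sub>C psi_op y x)))"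
  by (simp add: Rz_def g0_def scaleC_add_left scaleC.diff_right algebra_simps)
 moreover have "norm (of_real (q / pi) :: complex) = q / pi" using q by (simp add: norm_divide)
 ultimately show ?thesis using q by (simp add: norm_scaleC mult_left_mono divide_right_mono)
qed

lemma g_limit_g0: "(%n. g (of_real (- real n))) \<longlonglongrightarrow> g0"
 unfolding g0_def by (rule representation_limits(2)[OF J_int g_eq])

lemma c0_bound: "norm c0 <= 1 / (sin a * norm z)"
 by (rule representation_limits(3)[OF J_int g_eq])

text \<open>Multiplying by |z| cancels its powers in the bounds for c0 and for the L^1 norm of J; in
  the latter the condition on \<kappa> is used at r = |z|.\<close>

theorem Rz_norm_bound:
 assumes \<kappa>: "kappa_bound f a \<kappa>" and M: "!!s u. norm (Q (Complex s pi) u) <= M * norm u"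
  and C: "!!s t u. abs t = b ==> norm (Q (Complex s t) u) <= C * norm u" and MC: "0 <= M" "0 <= C"
 shows "norm (z *\<^sub>C Rz u) <= (1 / sin a + q * (M + 2 * C / (pi * cos (b / 2) * cos (q * b / 2))) / (pi * (cos a)^2) *
  (\<kappa> / (cos ((a + \<theta>) / 2))^2)) * norm u"
proof -
 define T where "T = M + 2 * C / (pi * cos (b / 2) * cos (q * b / 2))"
 have cb: "0 < cos (b / 2)" "0 < cos (q * b / 2)"
  using cos_half_bounds(1)[of 1 0 b] cos_half_bounds(1)[of q 0 b] b0 b q2 by auto
 have T0: "T >= 0" using MC cb by (simp add: T_def)
 have "norm (psi_op y u) <= M * norm u + 2 * (C * norm u) / (pi * cos (b / 2) * cos (q * b / 2))" for y
  by (rule psi_op_bound) (fact M C)+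
 hence N: "norm (psi_op y u) <= T * norm u" for y by (simp add: T_def distrib_right mult.assoc)
 define I where "I = (LINT y|lborel. norm (J y))"
 have zp: "norm z > 0" using z by simp
 have "norm (z *\<^sub>C Rz u) <= norm z * (norm c0 * norm u + q / pi * (T * norm u * I))"
  unfolding norm_scaleC I_def by (rule mult_left_mono[OF Rz_bound[OF N]]) simp
 also have "... = (norm z * norm c0 + q / pi * T * (norm z * I)) * norm u" by (simp add: algebra_simps)
 also have "... <= (1 / sin a + q / pi * T * (\<kappa> / ((cos a)^2 * (cos ((a + \<theta>) / 2))^2))) * norm u"
 proof (intro mult_right_mono add_mono mult_left_mono)
  show "norm z * norm c0 <= 1 / sin a" using mult_left_mono[OF c0_bound, of "norm z"] zp by simp
  show "norm z * I <= \<kappa> / ((cos a)^2 * (cos ((a + \<theta>) / 2))^2)"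
   using mult_left_mono[OF J_integral(2)[OF \<kappa>], of "norm z"] zp by (simp add: I_def)
 qed (use T0 q in auto)
 finally show ?thesis by (simp add: T_def mult_ac)
qed

end

section \<open>Bernstein functions\<close>

locale bernstein_function =
 fixes f :: "complex => complex"
 assumes f: "f \<in> NP_plus" and bernstein: "bernstein (pos_restrict f)"
begin

abbreviation "half_plane \<equiv> right_half_plane"

lemma open_half_plane: "open half_plane" by (rule open_right_half_plane[OF f])

lemma higher_deriv_holomorphic: "(deriv ^^ n) f holomorphic_on half_plane"
 by (rule holomorphic_higher_deriv[OF NP_plus_holomorphic[OF f] open_half_plane])

text \<open>Transfers the sign conditions, which concern real derivatives, to the Taylor
  coefficients of the holomorphic f at points of the positive axis.\<close>

lemma higher_deriv_real:
 "t > 0 ==> (deriv ^^ n) f (of_real t) = of_real ((deriv ^^ n) (pos_restrict f) t)"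
proof (induction n arbitrary: t)
 case 0
 thus ?case using NP_plus_real[OF f] by (simp add: pos_restrict_def)
next
 case (Suc n)
 let ?F = "(deriv ^^ n) f" and ?g = "(deriv ^^ n) (pos_restrict f)"
 have D: "(?F has_field_derivative deriv ?F (of_real t)) (at (of_real t))"
  by (rule holomorphic_derivI[OF higher_deriv_holomorphic open_half_plane]) (use Suc.prems in auto)
 have "((%s. of_real s :: complex) has_vector_derivative 1) (at t)"
  by (auto intro!: derivative_eq_intros)
 from field_vector_diff_chain_at[OF this D]
 have v: "((%s. ?F (of_real s)) has_vector_derivative deriv ?F (of_real t)) (at t)" by (simp add: o_def)
 have "((%s. of_real (?g s)) has_vector_derivative deriv ?F (of_real t)) (at t)"
  by (rule has_vector_derivative_transform_within_open[OF v, of "{0<..}"]) (use Suc in auto)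
 from bounded_linear.has_vector_derivative[OF bounded_linear_Re this]
  bounded_linear.has_vector_derivative[OF bounded_linear_Im this]
 have re: "(?g has_vector_derivative Re (deriv ?F (of_real t))) (at t)"
  and im: "((%s. 0) has_vector_derivative Im (deriv ?F (of_real t))) (at t)" by simp_all
 have "Im (deriv ?F (of_real t)) = 0"
  using vector_derivative_unique_at[OF im has_vector_derivative_const] .
 moreover have "deriv ?g t = Re (deriv ?F (of_real t))"
  using re by (intro DERIV_imp_deriv) (simp add: has_real_derivative_iff_has_vector_derivative)
 ultimately show ?case by (simp add: complex_eq_iff)
qed

definition f' :: "real => real" where "f' t = Re (deriv f (of_real t))"

lemma f_real_derivative: "t > 0 ==> (pos_restrict f has_real_derivative f' t) (at t)"
proof -
 assume t: "t > 0"
 have D: "(f has_field_derivative deriv f (of_real t)) (at (of_real t))"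
  by (rule holomorphic_derivI[OF NP_plus_holomorphic[OF f] open_half_plane]) (use t in auto)
 have "((%s. of_real s :: complex) has_vector_derivative 1) (at t)"
  by (auto intro!: derivative_eq_intros)
 from bounded_linear.has_vector_derivative[OF bounded_linear_Re field_vector_diff_chain_at[OF this D]]
 show ?thesis
  by (simp add: has_real_derivative_iff_has_vector_derivative pos_restrict_def[abs_def] f'_def o_def)
qed

lemma f'_nonneg: "t > 0 ==> f' t >= 0"
proof -
 assume t: "t > 0"
 have "(-1) ^ (1 - 1) * (deriv ^^ 1) (pos_restrict f) t >= 0"
  using bernstein t unfolding bernstein_def by blast
 thus ?thesis using DERIV_imp_deriv[OF f_real_derivative[OF t]] by simp
qed

lemma f'_continuous: "continuous_on {0<..} f'"
proof -
 have "continuous_on half_plane (deriv f)"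
  using higher_deriv_holomorphic[of 1] holomorphic_on_imp_continuous_on by simp
 thus ?thesis unfolding f'_def[abs_def]
  by (intro continuous_on_Re continuous_on_compose2[OF _ continuous_on_of_real[OF continuous_on_id]]) auto
qed

lemma f_mono: "0 < s ==> s <= t ==> pos_restrict f s <= pos_restrict f t"
 using DERIV_nonneg_imp_nondecreasing[of s t "pos_restrict f"] f_real_derivative f'_nonneg
 by (metis order_less_le_trans)

lemma f_pos: "0 < t ==> pos_restrict f t > 0"
 using NP_plus_real_pos[OF f] by (simp add: pos_restrict_def)

text \<open>All terms of the Taylor expansion of $f'$ at a large $U > 0$ are nonnegative at points of
 $(0, U)$, so $|f'(\lambda)| \le f'(U - |\lambda - U|)$; let $U \to \infty$.\<close>

lemma deriv_bound:
 assumes l: "Re l > 0" shows "norm (deriv f l) <= f' (Re l)"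
proof -
 have bound: "norm (deriv f l) <= f' (U - norm (l - of_real U))" if U: "norm (l - of_real U) < U" for U
 proof -
  define d where "d = norm (l - of_real U)"
  have sub: "ball (of_real U :: complex) U \<subseteq> half_plane"
  proof
   fix w assume "w \<in> ball (of_real U :: complex) U"
   hence "norm (of_real U - w) < U" by (simp add: dist_norm)
   hence "Re (of_real U - w) < U" using complex_Re_le_cmod order_le_less_trans by blast
   thus "w \<in> half_plane" by simp
  qed
  have hol: "deriv f holomorphic_on ball (of_real U) U"
   using higher_deriv_holomorphic[of 1] sub holomorphic_on_subset by simp
  define c where "c n = (deriv ^^ n) (deriv f) (of_real U) / fact n" for n
  have Up: "U > 0" using U norm_ge_zero order_le_less_trans by blast
  have sums: "(%n. c n * (w - of_real U) ^ n) sums deriv f w" if "w \<in> ball (of_real U) U" for w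
   unfolding c_def by (rule holomorphic_power_series[OF hol that])
  have cn: "c n * (of_real (U - d) - of_real U) ^ n = of_real (norm (c n) * d ^ n)" for n
  proof -
   have e: "(deriv ^^ n) (deriv f) (of_real U) = of_real ((deriv ^^ Suc n) (pos_restrict f) U)"
    using higher_deriv_real[OF Up, of "Suc n"] by (simp add: funpow_Suc_right del: funpow.simps)
   have "(-1) ^ (Suc n - 1) * (deriv ^^ Suc n) (pos_restrict f) U >= 0"
    using bernstein Up unfolding bernstein_def by (metis Suc_eq_plus1 le_add2)
   hence s: "(-1) ^ n * (deriv ^^ Suc n) (pos_restrict f) U >= 0" by simp
   define r where "r = (deriv ^^ Suc n) (pos_restrict f) U / fact n"
   have cr: "c n = of_real r" by (simp only: c_def e r_def of_real_divide of_real_fact)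
   have rs: "(-1) ^ n * r >= 0" using s by (simp add: r_def)
   have "(-1) ^ n * r = abs ((-1) ^ n * r)" using rs by simp
   also have "... = abs r" by (simp add: abs_mult power_abs)
   finally have "r * (- d) ^ n = abs r * d ^ n" by (simp add: power_minus[of d] mult.commute mult.left_commute)
   hence "complex_of_real (r * (- d) ^ n) = of_real (abs r * d ^ n)" by (simp only:)
   thus ?thesis by (simp add: cr)
  qed
  have "of_real (U - d) \<in> ball (of_real U :: complex) U"
   using U by (simp add: d_def dist_norm flip: of_real_diff)
  from sums[OF this] have s1: "(%n. complex_of_real (norm (c n) * d ^ n)) sums deriv f (of_real (U - d))"
   unfolding cn .
  hence s2: "(%n. norm (c n) * d ^ n) sums f' (U - d)"
   using sums_Re[OF s1] by (simp add: f'_def)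
  have "l \<in> ball (of_real U) U" using U by (simp add: dist_norm norm_minus_commute)
  from sums[OF this] have s3: "(%n. c n * (l - of_real U) ^ n) sums deriv f l" .
  have n: "norm (c n * (l - of_real U) ^ n) = norm (c n) * d ^ n" for n by (simp add: norm_mult norm_power d_def)
  have "norm (deriv f l) <= (\<Sum>n. norm (c n * (l - of_real U) ^ n))"
   unfolding sums_unique[OF s3] by (rule summable_norm) (use s2 in \<open>simp add: n sums_summable\<close>)
  also have "... = f' (U - d)" by (simp add: n sums_unique[OF s2, symmetric])
  finally show ?thesis by (simp add: d_def)
 qed
 define u v where "u = Re l" and "v = Im l"
 have nd: "norm (l - of_real U) = sqrt ((u - U)^2 + v^2)" for U by (simp add: cmod_def u_def v_def)
 have lim: "((%U. U - sqrt ((u - U)^2 + v^2)) \<longlongrightarrow> u) at_top" by real_asymp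
 have up: "u > 0" using l by (simp add: u_def)
 have ev: "\<forall>\<^sub>F U in at_top. 0 < U - sqrt ((u - U)^2 + v^2)" by (rule order_tendstoD(1)[OF lim up])
 have "isCont f' u" using f'_continuous up by (simp add: continuous_on_eq_continuous_at open_greaterThan)
 hence "((%U. f' (U - sqrt ((u - U)^2 + v^2))) \<longlongrightarrow> f' u) at_top"
  by (rule isCont_tendsto_compose[OF _ lim])
 hence "norm (deriv f l) <= f' u"
  by (rule tendsto_lowerbound) (use ev bound in \<open>auto simp: nd elim!: eventually_mono\<close>)
 thus ?thesis by (simp add: u_def)
qed

text \<open>f is real at u, so the imaginary part is produced entirely on the vertical segment above
  u, where |deriv f| is at most f'(u).\<close>

lemma Im_bound:
 assumes u: "u > 0" shows "abs (Im (f (Complex u v))) <= f' u * abs v"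
proof -
 let ?S = "{w. Re w = u}"
 have "norm (f (Complex u v) - f (of_real u)) <= f' u * norm (Complex u v - of_real u)"
 proof (rule field_differentiable_bound[of ?S])
  show "convex ?S" using convex_hyperplane[of "1::complex" u] by (simp add: inner_complex_def)
  show "(f has_field_derivative deriv f w) (at w within ?S)" if "w \<in> ?S" for w
   by (rule has_field_derivative_at_within, rule holomorphic_derivI[OF NP_plus_holomorphic[OF f] open_half_plane])
    (use that u in auto)
  show "norm (deriv f w) <= f' u" if "w \<in> ?S" for w using deriv_bound[of w] that u by simp
 qed auto
 moreover have "norm (Complex u v - of_real u) = abs v" by (simp add: cmod_def)
 moreover have "Im (f (Complex u v) - f (of_real u)) = Im (f (Complex u v))"
  using NP_plus_real[OF f u] by (metis Im_complex_of_real diff_zero minus_complex.simps(2))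
 ultimately show ?thesis using abs_Im_le_cmod[of "f (Complex u v) - f (of_real u)"] by simp
qed

text \<open>Put u = e^y cos p on the ray of angle p. Monotonicity allows f(u) in place of f(e^y) in
  the denominator, and |Im f| <= f'(u) u tan p. The resulting majorant is the y-derivative of -tan p
  / (r + f(u)), a function with values between -tan p / r and 0; its total increment is at most tan
  p / r.\<close>

theorem kappa_bound_tan:
 assumes p: "0 < p" "p < pi / 2"
 shows "kappa_bound f p (tan p)"
proof -
 have "abs p < pi / 2" using p by simp
 show ?thesis unfolding kappa_bound_log_iff[OF f \<open>abs p < pi / 2\<close>]
proof (intro allI impI)
 fix r :: real assume r: "r > 0"
 have c: "cos p > 0" and s: "sin p > 0" using p by (auto intro!: cos_gt_zero_pi sin_gt_zero)
 define D where "D y = abs (Im (f (exp (Complex y p)))) / (r + Re (f (of_real (exp y))))^2" for y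
 define G where "G y = - tan p / (r + pos_restrict f (exp y * cos p))" for y
 define E where "E y = sin p * exp y * f' (exp y * cos p) / (r + pos_restrict f (exp y * cos p))^2" for y
 have ec: "exp y * cos p > 0" for y using c by simp
 have rf: "r + pos_restrict f (exp y * cos p) > 0" for y using f_pos[OF ec, of y] r by simp
 have G': "(G has_real_derivative E y) (at y)" for y
 proof -
  have "((%y. pos_restrict f (exp y * cos p)) has_real_derivative f' (exp y * cos p) * (exp y * cos p)) (at y)"
   by (rule DERIV_chain2[where f = "pos_restrict f" and g = "%y. exp y * cos p", OF f_real_derivative[OF ec]])
    (auto intro!: derivative_eq_intros)
  hence F: "((%y. r + pos_restrict f (exp y * cos p)) has_real_derivative f' (exp y * cos p) * (exp y * cos p)) (at y)"
   by (auto intro!: derivative_eq_intros)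
  have "((%y. - tan p / (r + pos_restrict f (exp y * cos p))) has_real_derivative
    (0 * (r + pos_restrict f (exp y * cos p)) - (- tan p) * (f' (exp y * cos p) * (exp y * cos p))) /
    ((r + pos_restrict f (exp y * cos p)) * (r + pos_restrict f (exp y * cos p)))) (at y)"
   by (rule DERIV_divide[OF DERIV_const F]) (use rf[of y] in simp)
  moreover have "tan p * cos p = sin p" using c by (simp add: tan_def)
  hence "tan p * (f' (exp y * cos p) * (exp y * cos p)) = sin p * exp y * f' (exp y * cos p)"
   by (metis mult.assoc mult.commute)
  ultimately show ?thesis unfolding G_def[abs_def] E_def by (simp add: power2_eq_square)
 qed
 have E0: "E y >= 0" for y unfolding E_def using s f'_nonneg[OF ec, of y] by simp
 have pc: "continuous_on {0<..} (pos_restrict f)"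
  using f_real_derivative DERIV_isCont by (intro continuous_at_imp_continuous_on) auto
 have Ec: "continuous_on UNIV E"
  unfolding E_def
  by (intro continuous_intros continuous_on_compose2[OF f'_continuous] continuous_on_compose2[OF pc])
   (use ec rf in \<open>auto simp: less_imp_neq[symmetric]\<close>)
 have DE: "D y <= E y" for y
 proof -
  have w: "exp (Complex y p) = Complex (exp y * cos p) (exp y * sin p)" by (simp add: exp_Complex complex_eq_iff)
  have "abs (Im (f (exp (Complex y p)))) <= f' (exp y * cos p) * (exp y * sin p)"
   unfolding w using Im_bound[OF ec, of y "exp y * sin p"] s by (simp add: abs_mult)
  moreover have "(r + pos_restrict f (exp y * cos p))^2 <= (r + Re (f (of_real (exp y))))^2"
  proof (rule power_mono)
   have "exp y * cos p <= exp y * 1" by (intro mult_left_mono) auto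
   hence "exp y * cos p <= exp y" by simp
   thus "r + pos_restrict f (exp y * cos p) <= r + Re (f (of_real (exp y)))"
    using f_mono[OF ec, of y "exp y"] by (simp add: pos_restrict_def)
  qed (use rf in \<open>simp add: less_imp_le\<close>)
  ultimately have "D y <= f' (exp y * cos p) * (exp y * sin p) / (r + pos_restrict f (exp y * cos p))^2"
   unfolding D_def using rf[of y] by (intro frac_le) auto
  thus ?thesis by (simp add: E_def mult_ac)
 qed
 have "(\<integral>\<^sup>+ y. ennreal (E y) \<partial>lborel) = (\<integral>\<^sup>+ y. (SUP n. ennreal (E y) * indicator {- real n..real n} y) \<partial>lborel)"
 proof (rule nn_integral_cong)
  fix y :: real
  show "ennreal (E y) = (SUP n. ennreal (E y) * indicator {- real n..real n} y)"
  proof (rule antisym)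
   obtain n :: nat where "abs y <= real n" using real_arch_simple by blast
   thus "ennreal (E y) <= (SUP n. ennreal (E y) * indicator {- real n..real n} y)"
    by (intro SUP_upper2[of n]) (auto simp: indicator_def abs_le_iff)
  qed (rule SUP_least, auto simp: indicator_def)
 qed
 also have "... = (SUP n. \<integral>\<^sup>+ y. ennreal (E y) * indicator {- real n..real n} y \<partial>lborel)"
 proof (rule nn_integral_monotone_convergence_SUP)
  have [measurable]: "E \<in> borel_measurable borel" by (rule borel_measurable_continuous_onI[OF Ec])
  show "(%y. ennreal (E y) * indicator {- real n..real n} y) \<in> borel_measurable lborel" for n by measurable
 qed (auto simp: incseq_def le_fun_def indicator_def)
 also have "... <= ennreal (tan p / r)"
 proof (rule SUP_least)
  fix n :: nat
  have "(\<integral>\<^sup>+ y. ennreal (E y) * indicator {- real n..real n} y \<partial>lborel) = ennreal (G (real n) - G (- real n))"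
   by (rule nn_integral_FTC_Icc) (use G' E0 borel_measurable_continuous_onI[OF Ec] in \<open>auto intro: has_field_derivative_at_within\<close>)
  also have "... <= ennreal (tan p / r)"
  proof (rule ennreal_leI)
   have t: "tan p > 0" using c s by (simp add: tan_def)
   have "G (real n) <= 0" unfolding G_def using t rf[of "real n"] by (simp add: divide_nonneg_pos less_imp_le)
   moreover have "- G (- real n) <= tan p / r"
    unfolding G_def using t r f_pos[OF ec, of "- real n"] by (simp add: frac_le less_imp_le)
   ultimately show "G (real n) - G (- real n) <= tan p / r" by simp
  qed
  finally show "(\<integral>\<^sup>+ y. ennreal (E y) * indicator {- real n..real n} y \<partial>lborel) <= ennreal (tan p / r)" .
 qed
 finally have nn: "(\<integral>\<^sup>+ y. ennreal (E y) \<partial>lborel) <= ennreal (tan p / r)" .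
 hence "(\<integral>\<^sup>+ y. ennreal (norm (E y)) \<partial>lborel) < \<infinity>" using E0 le_less_trans by (simp add: le_less_trans)
 hence iE: "integrable lborel E"
  using borel_measurable_continuous_onI[OF Ec] by (simp add: integrable_iff_bounded)
 have tr: "0 <= tan p / r" using c s r by (simp add: tan_def)
 have "ennreal (LINT y|lborel. E y) <= ennreal (tan p / r)"
  using nn nn_integral_eq_integral[OF iE] E0 by simp
 hence "(LINT y|lborel. E y) <= tan p / r" using tr by simp
 have cD: "continuous_on UNIV D"
 proof -
  have ch: "continuous_on half_plane f" using NP_plus_holomorphic[OF f] holomorphic_on_imp_continuous_on by blast
  have "continuous_on UNIV (%y. f (exp (Complex y p)))"
   by (rule continuous_on_compose2[OF ch]) (use p in \<open>auto intro!: continuous_intros Re_exp_Complex_pos simp: Re_exp cos_gt_zero_pi\<close>)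
  moreover have "continuous_on UNIV (%y. f (of_real (exp y)))"
   by (rule continuous_on_compose2[OF ch]) (auto intro!: continuous_intros)
  moreover have "r + Re (f (of_real (exp y))) ~= 0" for y
   using NP_plus_real_pos[OF f, of "exp y"] r by auto
  ultimately show ?thesis unfolding D_def[abs_def] by (intro continuous_intros) auto
 qed
 have iD: "integrable lborel D"
  by (rule integrable_continuous_dominated[OF cD _ iE]) (use DE in \<open>auto simp: D_def\<close>)
 have "(LINT y|lborel. D y) <= (LINT y|lborel. E y)" by (rule integral_mono[OF iD iE DE])
 with \<open>(LINT y|lborel. E y) <= tan p / r\<close> iD
 show "integrable lborel (%y. abs (Im (f (exp (Complex y p)))) / (r + Re (f (of_real (exp y))))^2) \<and>
  (LINT y|lborel. abs (Im (f (exp (Complex y p)))) / (r + Re (f (of_real (exp y))))^2) <= tan p / r"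
  by (simp add: D_def[abs_def])
qed
qed

lemma f_zero_limit:
 obtains a0 where "a0 >= 0" "(%n. pos_restrict f (exp (- real n))) \<longlonglongrightarrow> a0"
proof -
 have "decseq (%n. pos_restrict f (exp (- real n)))"
  unfolding decseq_def by (intro allI impI f_mono) auto
 then obtain l where "(%n. pos_restrict f (exp (- real n))) \<longlonglongrightarrow> l"
  using decseq_convergent[of _ 0] f_pos by (metis exp_gt_zero less_imp_le)
 moreover from this have "l >= 0"
  by (intro LIMSEQ_le_const[of _ l 0] exI[of _ 0]) (auto intro: less_imp_le[OF f_pos])
 ultimately show ?thesis using that by blast
qed

end

section \<open>Sectorial operators and their resolvents\<close>

lemma abs_Arg_minus: "w ~= 0 ==> abs (Arg (- w)) = pi - abs (Arg w)"
 using Arg_minus[of w] Arg_bounded[of w] by (auto split: if_splits)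

text \<open>The sector lies in the closed cone K, which also covers \<omega> = 0, where
  \<open>sector\<close> is a half-line; in that case the condition Re w >= 0 is what excludes the
  negative axis.\<close>

lemma closure_sector:
 assumes \<omega>: "0 <= \<omega>" "\<omega> < pi / 2" and w: "w \<in> closure (sector \<omega>)"
 shows "w = 0 \<or> abs (Arg w) <= \<omega>"
proof -
 define K where "K = {w::complex. abs (Im w) * cos \<omega> <= Re w * sin \<omega>} \<inter> {w. 0 <= Re w}"
 have "closed K" unfolding K_def
  by (intro closed_Int closed_Collect_le continuous_intros)
 have c: "cos \<omega> > 0" using \<omega> by (intro cos_gt_zero_pi) auto
 have polar: "Re w = norm w * cos (abs (Arg w))" "abs (Im w) = norm w * sin (abs (Arg w))" for w
 proof -
  have e: "Re w = norm w * cos (Arg w)" "Im w = norm w * sin (Arg w)"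
   using rcis_cmod_Arg[of w] by (auto simp: complex_eq_iff)
  show "Re w = norm w * cos (abs (Arg w))" unfolding cos_abs_real by (rule e)
  have s: "sin (abs (Arg w)) >= 0" using Arg_bounded[of w] by (intro sin_ge_zero) auto
  have "abs (sin (Arg w)) = abs (sin (abs (Arg w)))" by (cases "Arg w >= 0") simp_all
  hence "abs (sin (Arg w)) = sin (abs (Arg w))" using s by simp
  thus "abs (Im w) = norm w * sin (abs (Arg w))" by (simp add: e(2) abs_mult)
 qed
 have "sector \<omega> \<subseteq> K"
 proof
  fix v assume v: "v \<in> sector \<omega>"
  hence av: "abs (Arg v) <= \<omega>" using Arg_of_real[of "Re v"] by (auto simp: sector_def split: if_splits)
  have "0 <= sin (\<omega> - abs (Arg v))" using av \<omega> by (intro sin_ge_zero) auto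
  hence "sin (abs (Arg v)) * cos \<omega> <= cos (abs (Arg v)) * sin \<omega>" by (simp add: sin_diff mult.commute)
  hence "norm v * (sin (abs (Arg v)) * cos \<omega>) <= norm v * (cos (abs (Arg v)) * sin \<omega>)" by (rule mult_left_mono) simp
  moreover have "0 <= cos (abs (Arg v))" using av \<omega> by (intro cos_ge_zero) auto
  ultimately show "v \<in> K" unfolding K_def by (auto simp: polar mult.assoc)
 qed
 hence wK: "w \<in> K" using w \<open>closed K\<close> closure_minimal by blast
 show ?thesis
 proof (rule ccontr)
  assume "\<not> (w = 0 \<or> abs (Arg w) <= \<omega>)"
  hence w0: "w ~= 0" and aw: "\<omega> < abs (Arg w)" by auto
  have "norm w * (sin (abs (Arg w)) * cos \<omega>) <= norm w * (cos (abs (Arg w)) * sin \<omega>)" "0 <= norm w * cos (abs (Arg w))"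
   using wK unfolding K_def by (auto simp: polar[of w] mult.assoc)
  hence "sin (abs (Arg w) - \<omega>) <= 0" and cw: "0 <= cos (abs (Arg w))" using w0
   by (auto simp: sin_diff zero_le_mult_iff)
  moreover have "abs (Arg w) - \<omega> < pi"
  proof -
   have "abs (Arg w) ~= pi"
   proof
    assume "abs (Arg w) = pi"
    hence "cos (abs (Arg w)) = -1" by (simp only: cos_pi)
    thus False using cw by linarith
   qed
   thus ?thesis using Arg_bounded[of w] \<omega> by auto
  qed
  hence "sin (abs (Arg w) - \<omega>) > 0" using aw by (intro sin_gt_zero) auto
  ultimately show False by simp
 qed
qed

lemma resolvent_region_not_closure_sector:
 "0 <= \<omega> ==> \<omega> < pi / 2 ==> w \<in> resolvent_region \<omega> ==> w \<notin> closure (sector \<omega>)"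
 using closure_sector[of \<omega> w] by (auto simp: resolvent_region_def)

text \<open>The origin is approached by positive reals, and a point on a boundary ray by shrinking
  its argument slightly.\<close>

lemma not_closure_sector_resolvent_region:
 assumes \<omega>: "0 <= \<omega>" "\<omega> < pi / 2" and w: "w \<notin> closure (sector \<omega>)"
 shows "w \<in> resolvent_region \<omega>"
proof (rule ccontr)
 assume "w \<notin> resolvent_region \<omega>"
 hence aw: "w = 0 \<or> abs (Arg w) <= \<omega>" by (auto simp: resolvent_region_def)
 have "w \<in> closure (sector \<omega>)"
 proof (cases "w = 0")
  case True
  have "(%n. of_real (inverse (real (Suc n))) :: complex) \<longlonglongrightarrow> of_real 0"
   by (intro tendsto_of_real LIMSEQ_inverse_real_of_nat)
  moreover have "(of_real (inverse (real (Suc n))) :: complex) \<in> sector \<omega>" for n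
   using \<omega> by (auto simp: sector_def Arg_of_real simp del: of_real_inverse of_nat_Suc)
  ultimately show ?thesis using True by (metis closure_sequential of_real_0)
 next
  case False
  hence a: "abs (Arg w) <= \<omega>" using aw by simp
  show ?thesis
  proof (cases "\<omega> = 0")
   case True
   hence "Arg w = 0" using a by simp
   hence "w \<in> sector \<omega>" using False True Arg_eq_0[of w]
    by (auto simp: sector_def complex_eq_iff image_iff complex_is_Real_iff intro!: exI[of _ "Re w"] bexI[of _ "Re w"])
   thus ?thesis using closure_subset by blast
  next
   case om: False
   define v where "v n = of_real (norm w) * cis ((1 - inverse (real (Suc n))) * Arg w)" for n
   have "v \<longlonglongrightarrow> of_real (norm w) * cis ((1 - 0) * Arg w)"
    unfolding v_def cis_conv_exp by (intro tendsto_intros LIMSEQ_inverse_real_of_nat)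
   hence "v \<longlonglongrightarrow> w" using rcis_cmod_Arg[of w] by (simp add: rcis_def)
   moreover have "v n \<in> sector \<omega>" for n
   proof -
    define c where "c = 1 - inverse (real (Suc n))"
    have c: "0 <= c" "c < 1" unfolding c_def by (auto simp: field_simps)
    have ab: "abs (c * Arg w) <= c * \<omega>" using a c by (simp add: abs_mult mult_left_mono)
    moreover have "c * \<omega> < 1 * \<omega>" using c om \<omega> by (intro mult_strict_right_mono) auto
    ultimately have cw: "abs (c * Arg w) < \<omega>" by simp
    have "v n = exp (Complex (ln (norm w)) (c * Arg w))" using False by (simp add: v_def c_def exp_Complex)
    hence "abs (Arg (v n)) = abs (c * Arg w)" "v n ~= 0" using cw \<omega> by (auto simp: abs_Arg_exp)
    thus ?thesis using cw om by (simp add: sector_def)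
   qed
   ultimately show ?thesis by (metis closure_sequential)
  qed
 qed
 thus False using w by simp
qed

text \<open>Says that B consists of the pairs (S u, u - z S u). Single-valuedness of B is not
  included; it amounts to injectivity of S and is established separately.\<close>

definition is_resolvent_at :: "'a::complex_banach graph => complex => ('a => 'a) => bool" where
 "is_resolvent_at B z S \<longleftrightarrow> clinear_bounded S \<and> (ALL x y. (x, y) \<in> B \<longleftrightarrow> S (y + z *\<^sub>C x) = x)"

lemma is_resolvent_at_inverse:
 assumes "is_resolvent_at B z S"
 shows "(op_plus_scalar B z)\<inverse> = {(u, S u) |u. True}" "(scalar_minus_op (- z) B)\<inverse> = {(u, - S u) |u. True}"
proof -
 have S: "clinear_bounded S" and B: "!!x y. (x, y) \<in> B \<longleftrightarrow> S (y + z *\<^sub>C x) = x"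
  using assms by (auto simp: is_resolvent_at_def)
 show "(op_plus_scalar B z)\<inverse> = {(u, S u) |u. True}"
 proof (intro set_eqI)
  fix p :: "'a \<times> 'a"
  obtain u x where p: "p = (u, x)" by fastforce
  have "(u, x) \<in> (op_plus_scalar B z)\<inverse> \<longleftrightarrow> (EX y. u = y + z *\<^sub>C x \<and> (x, y) \<in> B)"
   by (auto simp: op_plus_scalar_def)
  also have "... \<longleftrightarrow> (x, u - z *\<^sub>C x) \<in> B" by (metis add_diff_cancel_right' diff_add_cancel)
  also have "... \<longleftrightarrow> S u = x" by (simp add: B)
  finally show "p \<in> (op_plus_scalar B z)\<inverse> \<longleftrightarrow> p \<in> {(u, S u) |u. True}" by (auto simp: p)
 qed
 show "(scalar_minus_op (- z) B)\<inverse> = {(u, - S u) |u. True}"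
 proof (intro set_eqI)
  fix p :: "'a \<times> 'a"
  obtain u x where p: "p = (u, x)" by fastforce
  have "(u, x) \<in> (scalar_minus_op (- z) B)\<inverse> \<longleftrightarrow> (EX y. u = - z *\<^sub>C x - y \<and> (x, y) \<in> B)"
   by (auto simp: scalar_minus_op_def)
  also have "... \<longleftrightarrow> (EX y. y = - u - z *\<^sub>C x \<and> (x, y) \<in> B)"
   by (metis (no_types, lifting) add.commute diff_add_cancel diff_minus_eq_add minus_diff_eq scaleC.minus_left uminus_add_conv_diff)
  also have "... \<longleftrightarrow> S (- u) = x" by (simp add: B)
  also have "... \<longleftrightarrow> - S u = x" by (simp add: clinear_boundedD[OF S])
  finally show "p \<in> (scalar_minus_op (- z) B)\<inverse> \<longleftrightarrow> p \<in> {(u, - S u) |u. True}" by (auto simp: p)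
 qed
qed

lemma op_apply_graph: "op_apply {(u, S u) |u. True} x = S x"
 unfolding op_apply_def by (rule the_equality) auto

lemma scaled_resolvent_eq: "is_resolvent_at B z S ==> scaled_resolvent B z x = z *\<^sub>C S x"
 unfolding scaled_resolvent_def by (simp only: is_resolvent_at_inverse(1) op_apply_graph)

locale sect_operator =
 fixes A :: "'a::complex_banach graph" and \<omega> :: real
 assumes \<omega>: "0 <= \<omega>" "\<omega> < pi / 2" and A: "A \<in> Sect \<omega>"
begin

definition R :: "complex => 'a => 'a" where "R l = op_apply ((scalar_minus_op l A)\<inverse>)"

lemma A_linear: "linear_operator A" using A by (simp add: Sect_def)

lemma R_inverse:
 assumes l: "l \<in> resolvent_region \<omega>"
 shows "(scalar_minus_op l A)\<inverse> = {(u, R l u) |u. True}" "bounded_linear (R l)"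
proof -
 have "l \<notin> op_spectrum A"
  using resolvent_region_not_closure_sector[OF \<omega> l] A by (auto simp: Sect_def)
 then obtain S where S: "bounded_linear S" "(scalar_minus_op l A)\<inverse> = {(u, S u) |u. True}"
  by (auto simp: op_spectrum_def boundedly_invertible_def)
 have "R l = S" unfolding R_def S(2) by (rule ext) (rule op_apply_graph)
 thus "(scalar_minus_op l A)\<inverse> = {(u, R l u) |u. True}" "bounded_linear (R l)" using S by auto
qed

lemma R_graph: "l \<in> resolvent_region \<omega> ==> (R l u, l *\<^sub>C R l u - u) \<in> A"
proof -
 assume l: "l \<in> resolvent_region \<omega>"
 have "(u, R l u) \<in> (scalar_minus_op l A)\<inverse>" unfolding R_inverse(1)[OF l] by blast
 then obtain y where "u = l *\<^sub>C R l u - y" "(R l u, y) \<in> A" by (auto simp: scalar_minus_op_def)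
 thus ?thesis by (metis add_diff_cancel_left' diff_add_cancel)
qed

lemma R_unique: "l \<in> resolvent_region \<omega> ==> (x, y) \<in> A ==> R l (l *\<^sub>C x - y) = x"
proof -
 assume l: "l \<in> resolvent_region \<omega>" and xy: "(x, y) \<in> A"
 have "(l *\<^sub>C x - y, x) \<in> (scalar_minus_op l A)\<inverse>" using xy by (auto simp: scalar_minus_op_def)
 hence "(l *\<^sub>C x - y, x) \<in> {(u, R l u) |u. True}" by (simp only: R_inverse(1)[OF l])
 thus ?thesis by auto
qed

lemma R_clinear: "l \<in> resolvent_region \<omega> ==> clinear_bounded (R l)"
proof -
 assume l: "l \<in> resolvent_region \<omega>"
 have "R l (c *\<^sub>C u) = c *\<^sub>C R l u" for c u
 proof -
  have "(c *\<^sub>C R l u, c *\<^sub>C (l *\<^sub>C R l u - u)) \<in> A"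
   using A_linear R_graph[OF l, of u] by (auto simp: linear_operator_def)
  from R_unique[OF l this] show ?thesis by (simp add: scaleC.diff_right mult.commute)
 qed
 thus ?thesis using R_inverse(2)[OF l] by (simp add: clinear_bounded_def)
qed

lemma resolvent_at: "l \<in> resolvent_region \<omega> ==> is_resolvent_at A (- l) (%u. - R l u)"
 unfolding is_resolvent_at_def
proof (intro conjI allI)
 assume l: "l \<in> resolvent_region \<omega>"
 show "clinear_bounded (%u. - R l u)" using clinear_bounded_scaleC[OF R_clinear[OF l], of "-1"] by simp
 fix x y
 have e: "- R l (y + - l *\<^sub>C x) = R l (l *\<^sub>C x - y)"
  using clinear_boundedD(3)[OF R_clinear[OF l], of "y - l *\<^sub>C x"] by simp
 show "(x, y) \<in> A \<longleftrightarrow> - R l (y + - l *\<^sub>C x) = x"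
 proof
  assume "(x, y) \<in> A" thus "- R l (y + - l *\<^sub>C x) = x" unfolding e by (rule R_unique[OF l])
 next
  assume "- R l (y + - l *\<^sub>C x) = x"
  hence "R l (l *\<^sub>C x - y) = x" unfolding e .
  hence "(x, l *\<^sub>C x - (l *\<^sub>C x - y)) \<in> A" using R_graph[OF l, of "l *\<^sub>C x - y"] by simp
  thus "(x, y) \<in> A" by simp
 qed
qed

lemma scaled_resolvent_A: "l \<in> resolvent_region \<omega> ==> scaled_resolvent A (- l) u = l *\<^sub>C R l u"
 using scaled_resolvent_eq[OF resolvent_at] by simp

lemma sect_bound_R:
 assumes C: "sect_bound A \<beta> C" and \<beta>: "\<omega> < \<beta>" "\<beta> < pi" and l: "l ~= 0" "\<beta> < abs (Arg l)"
 shows "norm (l *\<^sub>C R l u) <= C * norm u"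
proof -
 have lr: "l \<in> resolvent_region \<omega>" using l \<beta> by (auto simp: resolvent_region_def)
 have "- l \<in> sector (pi - \<beta>)" using l \<beta> by (auto simp: sector_def abs_Arg_minus)
 hence "onorm (scaled_resolvent A (- l)) <= C" using C by (auto simp: sect_bound_def)
 moreover have "bounded_linear (scaled_resolvent A (- l))"
  unfolding scaled_resolvent_A[OF lr, abs_def]
  by (rule clinear_bounded_imp_bounded_linear[OF clinear_bounded_scaleC[OF R_clinear[OF lr]]])
 ultimately have "norm (scaled_resolvent A (- l) u) <= C * norm u"
  using onorm[of "scaled_resolvent A (- l)" u] mult_right_mono[of _ C "norm u"] by (meson norm_ge_zero order_trans)
 thus ?thesis by (simp add: scaled_resolvent_A[OF lr])
qed

lemma R_bound: "\<omega> < \<alpha> ==> EX C>=0. ALL l u. l ~= 0 --> \<alpha> <= abs (Arg l) --> norm (l *\<^sub>C R l u) <= C * norm u"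
proof -
 assume \<alpha>: "\<omega> < \<alpha>"
 \<comment> \<open>An angle strictly below \<alpha> turns the bound on an open sector into one on
   the closed sector; the minimum with pi keeps the angle admissible for large \<alpha>.\<close>
 define \<beta> where "\<beta> = (\<omega> + min \<alpha> pi) / 2"
 have \<beta>: "\<omega> < \<beta>" "\<beta> < pi" "\<beta> < \<alpha>" using \<alpha> \<omega> by (auto simp: \<beta>_def min_def)
 have "\<forall>\<omega>'\<in>{\<omega><..<pi}. EX C. sect_bound A \<omega>' C" using A by (simp add: Sect_def)
 then obtain C where C: "sect_bound A \<beta> C" using \<beta> by (meson greaterThanLessThan_iff)
 have "norm (l *\<^sub>C R l u) <= abs C * norm u" if "l ~= 0" "\<alpha> <= abs (Arg l)" for l u
 proof -
  have "norm (l *\<^sub>C R l u) <= C * norm u" by (rule sect_bound_R[OF C \<beta>(1,2) that(1)]) (use that \<beta> in simp)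
  also have "... <= abs C * norm u" by (intro mult_right_mono) auto
  finally show ?thesis .
 qed
 thus ?thesis by (intro exI[of _ "abs C"]) auto
qed

sublocale sectorial_resolvent A \<omega> R
 by unfold_locales (use \<omega> A_linear R_clinear R_unique R_graph R_bound in auto)

text \<open>\<open>sect_bound\<close> concerns the open sector, but the contour runs along its
  boundary rays. Continuity of \<open>Q\<close> carries the same constant over, so that M(A,
  \<beta>) itself enters the estimate.\<close>

lemma Q_sect_bound:
 assumes C: "sect_bound A \<beta> C" and \<beta>: "\<omega> < \<beta>" "\<beta> < pi"
 shows "abs t = \<beta> ==> norm (Q (Complex s t) u) <= C * norm u" "0 <= C"
proof -
 have strict: "norm (Q (Complex s t) u) <= C * norm u" if "\<beta> < abs t" "abs t < pi" for s t
  unfolding Q_def by (rule sect_bound_R[OF C \<beta>]) (use that in \<open>auto simp: abs_Arg_exp\<close>)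
 obtain p where p: "\<beta> < p" "p < pi" using dense[OF \<beta>(2)] by blast
 define l where "l = exp (Complex 0 p)"
 have "abs (Arg l) = p" unfolding l_def using p \<beta> \<omega> by (subst abs_Arg_exp) (auto simp: min_def)
 hence l: "l ~= 0" "\<beta> < abs (Arg l)" using p by (auto simp: l_def)
 have lr: "l \<in> resolvent_region \<omega>" using l \<beta> by (auto simp: resolvent_region_def)
 have "- l \<in> sector (pi - \<beta>)" using l \<beta> by (auto simp: sector_def abs_Arg_minus)
 hence "onorm (scaled_resolvent A (- l)) <= C" using C by (auto simp: sect_bound_def)
 moreover have "bounded_linear (scaled_resolvent A (- l))"
  unfolding scaled_resolvent_A[OF lr, abs_def]
  by (rule clinear_bounded_imp_bounded_linear[OF clinear_bounded_scaleC[OF R_clinear[OF lr]]])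
 ultimately show "0 <= C" using onorm_pos_le order_trans by blast
 assume t: "abs t = \<beta>"
 have tr: "Complex s t \<in> region" using t \<beta> \<omega> by (auto simp: region_def)
 have "(%n. Complex s (t * (1 + inverse (real (Suc n))))) \<longlonglongrightarrow> Complex s (t * (1 + 0))"
  unfolding Complex_eq_of_real by (intro tendsto_intros LIMSEQ_inverse_real_of_nat)
 hence lim: "(%n. Complex s (t * (1 + inverse (real (Suc n))))) \<longlonglongrightarrow> Complex s t" by simp
 have "isCont (%w. Q w u) (Complex s t)" using Q_tendsto[OF tr] by (simp add: isCont_def)
 from isCont_tendsto_compose[OF this lim]
 have "(%n. norm (Q (Complex s (t * (1 + inverse (real (Suc n))))) u)) \<longlonglongrightarrow> norm (Q (Complex s t) u)"
  by (rule tendsto_norm)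
 moreover have "\<forall>\<^sub>F n in sequentially. norm (Q (Complex s (t * (1 + inverse (real (Suc n))))) u) <= C * norm u"
 proof -
  have "(%n. \<beta> * (1 + inverse (real (Suc n)))) \<longlonglongrightarrow> \<beta> * (1 + 0)"
   by (intro tendsto_intros LIMSEQ_inverse_real_of_nat)
  hence "\<forall>\<^sub>F n in sequentially. \<beta> * (1 + inverse (real (Suc n))) < pi"
   by (rule order_tendstoD) (use \<beta> in simp)
  thus ?thesis
  proof eventually_elim
   case (elim n)
   have i: "0 < inverse (real (Suc n))" by simp
   have ab: "abs (t * (1 + inverse (real (Suc n)))) = \<beta> * (1 + inverse (real (Suc n)))"
    using t i by (simp add: abs_mult)
   have "0 < \<beta>" using \<beta> \<omega> by simp
   hence "\<beta> * 1 < \<beta> * (1 + inverse (real (Suc n)))" using i by (intro mult_strict_left_mono) auto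
   thus ?case using elim ab by (intro strict) auto
  qed
 qed
 ultimately show "norm (Q (Complex s t) u) <= C * norm u" by (rule tendsto_upperbound) simp
qed

text \<open>Height pi is the negative axis, so \<open>Q\<close> there is the scaled resolvent at e^s
  > 0. Boundedness on some sector around the positive axis makes the supremum in
  \<open>sect_const\<close> finite.\<close>

lemma Q_sect_const: "norm (Q (Complex s pi) u) <= sect_const A * norm u" "0 <= sect_const A"
proof -
 have bd: "bdd_above ((%s. onorm (scaled_resolvent A (complex_of_real s))) ` {0<..})"
 proof -
  define \<beta> where "\<beta> = (\<omega> + pi) / 2"
  have \<beta>: "\<omega> < \<beta>" "\<beta> < pi" using \<omega> by (auto simp: \<beta>_def)
  have "\<forall>\<omega>'\<in>{\<omega><..<pi}. EX C. sect_bound A \<omega>' C" using A by (simp add: Sect_def)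
  then obtain C where "sect_bound A \<beta> C" using \<beta> by (meson greaterThanLessThan_iff)
  hence "onorm (scaled_resolvent A (complex_of_real s)) <= C" if "s > 0" for s
   using that \<beta> by (auto simp: sect_bound_def sector_def Arg_of_real)
  thus ?thesis by (auto simp: bdd_above_def)
 qed
 have r: "- of_real s \<in> resolvent_region \<omega>" if "s > 0" for s :: real
  using that \<omega> by (auto simp: resolvent_region_def abs_Arg_minus Arg_of_real)
 have bl: "bounded_linear (scaled_resolvent A (of_real s))" if "s > 0" for s
 proof -
  have "scaled_resolvent A (of_real s) = (%u. (- of_real s) *\<^sub>C R (- of_real s) u)"
   using scaled_resolvent_A[OF r[OF that]] by (auto simp: fun_eq_iff)
  thus ?thesis
   using clinear_bounded_imp_bounded_linear[OF clinear_bounded_scaleC[OF R_clinear[OF r[OF that]]]] by metis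
 qed
 have le: "onorm (scaled_resolvent A (of_real s)) <= sect_const A" if "s > 0" for s
  unfolding sect_const_def using that by (intro cSUP_upper bd) auto
 show "0 <= sect_const A" using le[of 1] onorm_pos_le[OF bl[of 1]] by simp
 have e: "Q (Complex s pi) u = scaled_resolvent A (of_real (exp s)) u"
  using scaled_resolvent_A[OF r[of "exp s"], of u] by (simp add: Q_def exp_Complex)
 have "norm (Q (Complex s pi) u) <= onorm (scaled_resolvent A (of_real (exp s))) * norm u"
  unfolding e by (rule onorm[OF bl]) simp
 also have "... <= sect_const A * norm u" by (intro mult_right_mono le) auto
 finally show "norm (Q (Complex s pi) u) <= sect_const A * norm u" .
qed

lemma P_eq: "op_apply ((op_plus_scalar A 1)\<inverse>) u = P u"
proof -
 have "Arg 1 = 0" using Arg_of_real[of 1] by simp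
 hence "-1 \<in> resolvent_region \<omega>"
  using \<omega> abs_Arg_minus[of 1] by (simp add: resolvent_region_def)
 from is_resolvent_at_inverse(1)[OF resolvent_at[OF this]]
 have "op_apply ((op_plus_scalar A 1)\<inverse>) u = - R (- 1) u" by (simp only: minus_minus op_apply_graph)
 thus ?thesis by (simp add: P_def Q_def exp_Complex)
qed

lemma op_apply_A: "(x, y) \<in> A ==> op_apply A x = y"
 unfolding op_apply_def using A_unique by blast

lemma tau2_op_eq: "tau2_op A u = N (N u)"
 by (simp add: tau2_op_def tau_op_def P_eq op_apply_A[OF N_graph(1)])

text \<open>Putting r = e^s on a ray supplies the factor e^w contained in \<open>Q\<close>, and the
  lower ray minus the upper one is \<open>line_diff\<close>.\<close>

lemma ftau2_op_eq:
 assumes f: "f \<in> NP_plus" and t: "\<omega> < t" "t < pi / 2"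
 shows "ftau2_op t f A u = Psi t (ftau f) u"
proof -
 have t0: "0 <= t" "t < pi" using t \<omega> pi_gt_zero by linarith+
 note d = ftau_decay[OF f t0(1) t(2)]
 obtain C where C: "!!s p u. abs p = t ==> norm (ftau f (Complex s p) *\<^sub>C Q (Complex s p) u) <= C * exp (- abs s) * norm u"
  using line_bound[OF t(1) t0(2) d] by metis
 have ray: "has_wint (%s. ftau f (Complex s p) *\<^sub>C Q (Complex s p) u) (ray_integral f A p u)" if p: "abs p = t" for p
 proof -
  define G where "G r = (let l = of_real r * cis p in
   (f l * (tau l)^2 * cis p) *\<^sub>C op_apply ((scalar_minus_op l A)\<inverse>) u)" for r
  have eq: "exp s *\<^sub>R G (exp s) = ftau f (Complex s p) *\<^sub>C Q (Complex s p) u" for s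
   by (simp add: G_def Let_def exp_Complex[symmetric] ftau_def Q_def R_def scaleR_scaleC)
    (simp add: exp_Complex mult_ac)
  have cont: "continuous_on UNIV (%s. ftau f (Complex s p) *\<^sub>C Q (Complex s p) u)"
   using p t0 t \<omega> by (intro continuous_on_scaleC strip_decay_continuous[OF d] Q_line_continuous) auto
  have int: "integrable lborel (%s. C * exp (- abs s) * norm u)"
   by (intro integrable_mult_left integrable_mult_right integrable_exp_neg_abs)
  have "(G has_integral wint (%s. exp s *\<^sub>R G (exp s))) {0<..}"
  proof (rule has_integral_half_line_log[where m = "%s. C * exp (- abs s) * norm u"])
   show "continuous_on UNIV (%s. exp s *\<^sub>R G (exp s))" unfolding eq by (rule cont)
   show "norm (exp s *\<^sub>R G (exp s)) <= C * exp (- abs s) * norm u" for s unfolding eq by (rule C[OF p])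
   show "integrable lborel (%s. C * exp (- abs s) * norm u)" by (rule int)
  qed
  hence "ray_integral f A p u = wint (%s. ftau f (Complex s p) *\<^sub>C Q (Complex s p) u)"
   unfolding ray_integral_def G_def[symmetric] eq by (rule integral_unique)
  thus ?thesis using has_wint_wintI[OF cont C[OF p] int] by simp
 qed
 have "has_wint (line_diff t (%w. ftau f w *\<^sub>C Q w u)) (ray_integral f A (- t) u - ray_integral f A t u)"
  using has_wint_diff[OF ray[of "- t"] ray[of t]] t0 by (simp add: line_diff_def[abs_def])
 thus ?thesis unfolding ftau2_op_def Psi_def by (simp add: wint_eqI)
qed

end

section \<open>From resolvents of f(A) to membership in \<open>Sect\<close>\<close>

context sect_operator begin

text \<open>With a = pi/q the contour angle of \<open>psi_op\<close>, the midpoint of \<omega> and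
  a, is the \<beta> of the theorem.\<close>

lemma resolvent_calculus_instance:
 assumes f: "f \<in> NP_plus" and q: "q > 2" "q * a = pi" and a: "\<omega> < a" and z: "z ~= 0" "abs (Arg z) <= \<theta>" "a + \<theta> < pi"
  and \<kappa>: "kappa_bound f a \<kappa>"
 shows "resolvent_calculus A \<omega> R q ((\<omega> + a) / 2) f a \<theta> z"
proof -
 interpret np: np_resolvent f q a \<theta> z by unfold_locales (fact f q z)+
 have b: "\<omega> < (\<omega> + a) / 2" "(\<omega> + a) / 2 < a" using a by auto
 have "q * ((\<omega> + a) / 2) < q * a" using b q by (intro mult_strict_left_mono) auto
 hence "q * ((\<omega> + a) / 2) < pi" using q by simp
 thus ?thesis
  by unfold_locales (use q b np.J_integral(1)[OF \<kappa>] in auto)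
qed

text \<open>The midpoint of \<omega> and min(p, pi/2) is below both p and pi/2, so q = pi/a exceeds
  2 and a + (pi - p) < pi.\<close>

lemma resolvent_calculus_exists:
 assumes f: "f \<in> class_E" and p: "\<omega> < p" "p <= pi"
 obtains q a \<kappa> where "q > 2" "q * a = pi" "\<omega> < a" "kappa_bound f a \<kappa>" "a < p"
  "!!z. z ~= 0 ==> abs (Arg z) <= pi - p ==> resolvent_calculus A \<omega> R q ((\<omega> + a) / 2) f a (pi - p) z"
proof -
 define a where "a = (\<omega> + min p (pi / 2)) / 2"
 have a: "\<omega> < a" "a < p" "a < pi / 2" using p \<omega> by (auto simp: a_def min_def)
 hence "2 * a < pi" and a0: "a > 0" using \<omega> by auto
 hence q: "pi / a > 2" "pi / a * a = pi" by (auto simp: field_simps)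
 have "\<forall>\<theta>\<in>{0<..<pi / 2}. EX \<kappa>. kappa_bound f \<theta> \<kappa>" using f by (simp add: class_E_def)
 moreover have "a \<in> {0<..<pi / 2}" using a0 a(3) by simp
 ultimately obtain \<kappa> where \<kappa>: "kappa_bound f a \<kappa>" by blast
 have f': "f \<in> NP_plus" using f by (simp add: class_E_def)
 show ?thesis
  using that[OF q a(1) \<kappa> a(2)] resolvent_calculus_instance[OF f' q a(1) _ _ _ \<kappa>] a(2) by force
qed

text \<open>All properties of B are read off from its resolvents: additivity and closedness from the
  one at z = 1, the spectrum from all of them, and the uniform bounds from the fact that the
  constant in \<open>Rz_norm_bound\<close> depends on z only through \<theta>.\<close>

lemma sectorialI:
 assumes f: "f \<in> class_E"
  and res: "!!q b a \<theta> z. resolvent_calculus A \<omega> R q b f a \<theta> z ==>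
   is_resolvent_at B z (resolvent_calculus.Rz R q b f a z)"
  and inj: "!!u. (0, u) \<in> B ==> u = 0" and dense: "closure (Domain B) = UNIV"
 shows "B \<in> Sect \<omega> \<and> (ALL \<theta> q. 0 < \<theta> \<and> \<theta> < pi - \<omega> \<and> max (pi / (pi - \<theta>)) 2 < q \<and> (\<omega> ~= 0 --> q < pi / \<omega>) -->
   (ALL \<kappa> \<beta> C z. kappa_bound f (pi / q) \<kappa> \<and> \<beta> = (\<omega> + pi / q) / 2 \<and> sect_bound A \<beta> C \<and>
    z \<in> sector \<theta> -->
    onorm (scaled_resolvent B z) <=
     1 / sin (pi / q) +
     q * tilde_const A q \<beta> C / (pi * (cos (pi / q))^2) *
      (\<kappa> / (cos ((pi / q + \<theta>) / 2))^2)))"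
  (is "_ \<and> ?bound")
proof
 have fN: "f \<in> NP_plus" using f by (simp add: class_E_def)
 have bound: "onorm (scaled_resolvent B z) <= 1 / sin a + q * tilde_const A q b C / (pi * (cos a)^2) *
   (\<kappa> / (cos ((a + \<theta>) / 2))^2)"
  if rc: "resolvent_calculus A \<omega> R q b f a \<theta> z" and \<kappa>: "kappa_bound f a \<kappa>" and C: "sect_bound A b C"
  for q b a \<theta> z \<kappa> C
 proof -
  interpret rc: resolvent_calculus A \<omega> R q b f a \<theta> z by (rule rc)
  note QC = Q_sect_bound[OF C rc.b(1) rc.b0(3)]
  note rb = rc.Rz_norm_bound[OF \<kappa> Q_sect_const(1) QC(1) Q_sect_const(2) QC(2), folded tilde_const_def]
  have cb: "0 < cos (b / 2)" "0 < cos (q * b / 2)"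
   using cos_half_bounds(1)[of 1 0 b] cos_half_bounds(1)[of q 0 b] rc.b0 rc.b rc.q2 by auto
  have t0: "0 <= tilde_const A q b C"
   unfolding tilde_const_def using Q_sect_const(2) QC(2) cb by simp
  \<comment> \<open>\<kappa> is any admissible number; the nonnegative integral at r = 1 shows that
    \<kappa> >= 0, which the operator norm bound requires.\<close>
  have "0 <= (LINT y|lborel. abs (Im (f (exp (Complex y a)))) / (1 + Re (f (of_real (exp y))))^2)"
   by (intro Bochner_Integration.integral_nonneg) auto
  also have "... <= \<kappa> / 1" by (rule rc.kappa_bound_log(2)[OF \<kappa>]) simp
  finally have \<kappa>0: "0 <= \<kappa>" by simp
  show ?thesis
  proof (rule onorm_bound)
   show "norm (scaled_resolvent B z x) <= (1 / sin a + q * tilde_const A q b C / (pi * (cos a)^2) *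
     (\<kappa> / (cos ((a + \<theta>) / 2))^2)) * norm x" for x
    unfolding scaled_resolvent_eq[OF res[OF rc]] by (rule rb)
   have "sin a > 0" using rc.a by (intro sin_gt_zero) auto
   thus "0 <= 1 / sin a + q * tilde_const A q b C / (pi * (cos a)^2) * (\<kappa> / (cos ((a + \<theta>) / 2))^2)"
    using t0 \<kappa>0 rc.q2 by simp
  qed
 qed
 show ?bound
 proof (intro allI impI, elim conjE)
  fix \<theta> q \<kappa> \<beta> C z
  assume \<theta>: "0 < \<theta>" "\<theta> < pi - \<omega>" and q: "max (pi / (pi - \<theta>)) 2 < q" "\<omega> ~= 0 --> q < pi / \<omega>"
   and \<kappa>: "kappa_bound f (pi / q) \<kappa>" and \<beta>: "\<beta> = (\<omega> + pi / q) / 2" and C: "sect_bound A \<beta> C"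
   and z: "z \<in> sector \<theta>"
  have q2: "q > 2" "pi / (pi - \<theta>) < q" using q(1) by auto
  have "pi < q * (pi - \<theta>)" using q2(2) \<theta> \<omega> by (simp add: pos_divide_less_eq)
  hence aq: "pi / q + \<theta> < pi" using q2 by (simp add: field_simps)
  have "\<omega> < pi / q" using q(2) \<omega> q2 by (cases "\<omega> = 0") (auto simp: field_simps)
  moreover have "z ~= 0" "abs (Arg z) <= \<theta>" using z \<theta> by (auto simp: sector_def)
  ultimately have "resolvent_calculus A \<omega> R q ((\<omega> + pi / q) / 2) f (pi / q) \<theta> z"
   using q2 aq by (intro resolvent_calculus_instance[OF fN _ _ _ _ _ _ \<kappa>]) auto
  thus "onorm (scaled_resolvent B z) <= 1 / sin (pi / q) + q * tilde_const A q \<beta> C / (pi * (cos (pi / q))^2) *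
    (\<kappa> / (cos ((pi / q + \<theta>) / 2))^2)" unfolding \<beta> by (rule bound[OF _ \<kappa> C[unfolded \<beta>]])
 qed
 have resolvent: "EX S. is_resolvent_at B z S" if "z ~= 0" "abs (Arg z) < pi - \<omega>" for z
 proof -
  have p: "\<omega> < pi - abs (Arg z)" "pi - abs (Arg z) <= pi" using that by auto
  show ?thesis
   by (rule resolvent_calculus_exists[OF f p]) (use that res in fastforce)
 qed
 have Arg1: "Arg 1 = 0" using Arg_of_real[of 1] by simp
 obtain S where S: "is_resolvent_at B 1 S" using resolvent[of 1] \<omega> Arg1 pi_gt_zero by auto
 hence Sc: "clinear_bounded S" and SB: "!!x y. (x, y) \<in> B \<longleftrightarrow> S (y + x) = x"
  by (auto simp: is_resolvent_at_def)
 have lin: "linear_operator B" unfolding linear_operator_def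
 proof (intro conjI allI impI)
  show add: "(x + u, y + v) \<in> B" if "(x, y) \<in> B" "(u, v) \<in> B" for x y u v
  proof -
   have "S ((y + v) + (x + u)) = S (y + x) + S (v + u)"
    by (simp add: clinear_boundedD(1)[OF Sc, symmetric] algebra_simps)
   thus ?thesis using that by (simp add: SB)
  qed
  show sc: "(c *\<^sub>C x, c *\<^sub>C y) \<in> B" if "(x, y) \<in> B" for c x y
   using that by (simp add: SB scaleC_add_right[symmetric] clinear_boundedD(5)[OF Sc])
  show "(0, 0) \<in> B" by (simp add: SB clinear_boundedD[OF Sc])
  show "single_valued B"
  proof (rule single_valuedI)
   fix x y y' assume xy: "(x, y) \<in> B" "(x, y') \<in> B"
   have "(x + (- 1) *\<^sub>C x, y + (- 1) *\<^sub>C y') \<in> B" by (rule add[OF xy(1) sc[OF xy(2)]])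
   hence "(0, y - y') \<in> B" by simp
   from inj[OF this] show "y = y'" by simp
  qed
 qed
 have Scont: "continuous_on UNIV S"
  using clinear_bounded_continuous_on[OF Sc continuous_on_id] by simp
 have "closed {p. S (snd p + fst p) = fst p}"
  by (intro closed_Collect_eq continuous_intros continuous_on_compose2[OF Scont]) auto
 moreover have "B = {p. S (snd p + fst p) = fst p}" by (auto simp: SB)
 ultimately have cl: "closed B" by simp
 have sp: "op_spectrum B \<subseteq> closure (sector \<omega>)"
 proof (rule ccontr)
  assume "\<not> op_spectrum B \<subseteq> closure (sector \<omega>)"
  then obtain w where w: "w \<in> op_spectrum B" "w \<notin> closure (sector \<omega>)" by blast
  hence "w \<in> resolvent_region \<omega>" by (intro not_closure_sector_resolvent_region \<omega>)
  hence w0: "w ~= 0" "\<omega> < abs (Arg w)" by (auto simp: resolvent_region_def)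
  then obtain S where S: "is_resolvent_at B (- w) S" using resolvent[of "- w"] by (auto simp: abs_Arg_minus)
  have "bounded_linear (%u. - S u)"
   using S clinear_bounded_imp_bounded_linear by (auto simp: is_resolvent_at_def intro: bounded_linear_minus)
  hence "boundedly_invertible (scalar_minus_op w B)"
   using is_resolvent_at_inverse(2)[OF S] unfolding boundedly_invertible_def by force
  thus False using w(1) by (simp add: op_spectrum_def)
 qed
 have "EX C. sect_bound B p C" if p: "\<omega> < p" "p < pi" for p
 proof -
  obtain q a \<kappa> where q: "\<omega> < a" "kappa_bound f a \<kappa>" "a < p"
   "!!z. z ~= 0 ==> abs (Arg z) <= pi - p ==> resolvent_calculus A \<omega> R q ((\<omega> + a) / 2) f a (pi - p) z"
   using resolvent_calculus_exists[OF f p(1) less_imp_le[OF p(2)]] by metis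
  have "(\<omega> + a) / 2 \<in> {\<omega><..<pi}" using q p by auto
  moreover have "\<forall>\<omega>'\<in>{\<omega><..<pi}. EX C. sect_bound A \<omega>' C" using A by (simp add: Sect_def)
  ultimately obtain C where C: "sect_bound A ((\<omega> + a) / 2) C" by blast
  have "sect_bound B p (1 / sin a + q * tilde_const A q ((\<omega> + a) / 2) C / (pi * (cos a)^2) *
    (\<kappa> / (cos ((a + (pi - p)) / 2))^2))"
   unfolding sect_bound_def by (intro ballI bound[OF q(4) q(2) C]) (use p in \<open>auto simp: sector_def\<close>)
  thus ?thesis by blast
 qed
 thus "B \<in> Sect \<omega>" using lin cl dense sp by (simp add: Sect_def)
qed

end

section \<open>Deviation of \<open>Rz\<close> from the scalar g0 for increasing f\<close>

context resolvent_calculus begin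

text \<open>The frequencies above \<open>Y\<close> contribute little because \<open>x\<close> is in the domain, those below \<open>Y\<close>
 because $f$ is bounded by $f(e^Y)$ there.\<close>

lemma Rz_near_g0_domain:
 assumes \<kappa>: "kappa_bound f a \<kappa>" and mono: "!!s t. 0 < s ==> s <= t ==> pos_restrict f s <= pos_restrict f t"
  and z1: "norm z >= 1" and K: "K >= 0" "!!y. norm (x - psi_op y x) <= K * min 1 (exp (- y / 2))"
 shows "norm (Rz x - g0 *\<^sub>C x) <= q / pi * (K / ((cos a)^2 * (cos ((a + \<theta>) / 2))^2) *
  (\<kappa> / norm z * exp (- Y / 2) + ((1 + pos_restrict f (exp Y)) / norm z)^2 * \<kappa>))"
proof -
 define D r F where "D = 1 / ((cos a)^2 * (cos ((a + \<theta>) / 2))^2)" and "r = norm z" and "F = pos_restrict f (exp Y)"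
 define h where "h r y = abs (Im (f (exp (Complex y a)))) / (r + Re (f (of_real (exp y))))^2" for r y
 define m where "m y = K * min 1 (exp (- y / 2))" for y :: real
 have r1: "r >= 1" using z1 by (simp add: r_def)
 have D0: "D >= 0" by (simp add: D_def)
 have Jb: "norm (J y) <= D * h r y" for y using J_bound[of y] by (simp add: D_def h_def r_def)
 have fpos: "pos_restrict f (exp y) > 0" for y using NP_plus_real_pos[OF f, of "exp y"] by (simp add: pos_restrict_def)
 have h0: "h r y >= 0" for r y by (simp add: h_def)
 have m0: "0 <= m y" "m y <= K" for y using K(1) by (auto simp: m_def mult_left_le)
 have le: "h r y * min 1 (exp (- y / 2)) <= h r y * exp (- Y / 2) + ((1 + F) / r)^2 * h 1 y" for y
 proof (cases "Y <= y")
  case True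
  hence "h r y * min 1 (exp (- y / 2)) <= h r y * exp (- Y / 2)" by (intro mult_left_mono h0 min.coboundedI2) auto
  thus ?thesis using mult_nonneg_nonneg[OF zero_le_power2[of "(1 + F) / r"] h0[of 1 y]] by linarith
 next
  case False
  define p where "p = pos_restrict f (exp y)"
  have p: "0 < p" "p <= F" using False fpos mono[of "exp y" "exp Y"] by (auto simp: p_def F_def)
  \<comment> \<open>Compares the integrand at r with the one at 1. Below Y the ratio (1 + f)/(r + f)
    is at most (1 + F)/r, and its square gains the extra power of 1/r that makes this part
    negligible after multiplication by z.\<close>
  have "(1 + p) * r <= (1 + F) * (r + p)"
  proof -
   have "p * r <= F * r" "0 <= F * p" using p r1 by (auto intro: mult_right_mono)
   thus ?thesis using p unfolding distrib_left distrib_right by linarith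
  qed
  moreover have rp: "0 < r + p" "0 < (1 + p) * r" using p r1 by auto
  ultimately have "((1 + p) * r) / (r + p) <= 1 + F" by (simp only: pos_divide_le_eq)
  hence "(1 / (r + p)) * ((1 + p) * r) <= 1 + F" by simp
  hence "1 / (r + p) <= (1 + F) / ((1 + p) * r)" using rp(2) by (simp only: pos_le_divide_eq)
  also have "... = ((1 + F) / r) * (1 / (1 + p))" by (simp add: mult.commute)
  finally have "1 / (r + p) <= ((1 + F) / r) * (1 / (1 + p))" .
  hence "(1 / (r + p))^2 <= (((1 + F) / r) * (1 / (1 + p)))^2" using p r1 by (intro power_mono) auto
  hence "abs (Im (f (exp (Complex y a)))) * (1 / (r + p))^2 <= abs (Im (f (exp (Complex y a)))) * (((1 + F) / r) * (1 / (1 + p)))^2"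
   by (rule mult_left_mono) simp
  hence "h r y <= ((1 + F) / r)^2 * h 1 y"
   by (simp add: h_def p_def pos_restrict_def power_divide power_mult_distrib mult_ac)
  moreover have "h r y * min 1 (exp (- y / 2)) <= h r y * 1" by (intro mult_left_mono h0) auto
  moreover have "0 <= h r y * exp (- Y / 2)" using h0 by simp
  ultimately show ?thesis by linarith
 qed
 have i1: "integrable lborel (h r)" "(LINT y|lborel. h r y) <= \<kappa> / r"
  unfolding h_def by (rule kappa_bound_log[OF \<kappa>]; use r1 in simp)+
 have i2: "integrable lborel (h 1)" "(LINT y|lborel. h 1 y) <= \<kappa>"
  unfolding h_def using kappa_bound_log[OF \<kappa>, of 1] by simp_all
 have int: "integrable lborel (%y. norm (J y) * m y)"
 proof (rule Bochner_Integration.integrable_bound[of _ "%y. norm (J y) * K"])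
  show "integrable lborel (%y. norm (J y) * K)" using J_int by simp
  show "(%y. norm (J y) * m y) \<in> borel_measurable lborel"
   using borel_measurable_integrable[OF J_int] unfolding m_def by measurable
  show "AE y in lborel. norm (norm (J y) * m y) <= norm (norm (J y) * K)"
   using m0 K by (intro AE_I2) (simp add: abs_mult mult_left_mono)
 qed
 have "(LINT y|lborel. norm (J y) * m y) <= (LINT y|lborel. D * K * (h r y * exp (- Y / 2) + ((1 + F) / r)^2 * h 1 y))"
 proof (rule integral_mono[OF int])
  show "integrable lborel (%y. D * K * (h r y * exp (- Y / 2) + ((1 + F) / r)^2 * h 1 y))"
   using i1 i2 by (intro integrable_mult_right Bochner_Integration.integrable_add integrable_mult_left) auto
  fix y
  have "norm (J y) * m y <= (D * h r y) * m y" by (intro mult_right_mono Jb m0)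
  also have "... = (D * K) * (h r y * min 1 (exp (- y / 2)))" by (simp add: m_def)
  also have "... <= (D * K) * (h r y * exp (- Y / 2) + ((1 + F) / r)^2 * h 1 y)"
   using D0 K by (intro mult_left_mono le) auto
  finally show "norm (J y) * m y <= D * K * (h r y * exp (- Y / 2) + ((1 + F) / r)^2 * h 1 y)" .
 qed
 also have "... = D * K * ((LINT y|lborel. h r y) * exp (- Y / 2) + ((1 + F) / r)^2 * (LINT y|lborel. h 1 y))"
  using i1 i2 by simp
 also have "... <= D * K * (\<kappa> / r * exp (- Y / 2) + ((1 + F) / r)^2 * \<kappa>)"
  using D0 K i1 i2 by (intro mult_left_mono add_mono mult_right_mono) auto
 finally have "(LINT y|lborel. norm (J y) * m y) <= D * K * (\<kappa> / r * exp (- Y / 2) + ((1 + F) / r)^2 * \<kappa>)" .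
 hence "q / pi * (LINT y|lborel. norm (J y) * m y) <= q / pi * (D * K * (\<kappa> / r * exp (- Y / 2) + ((1 + F) / r)^2 * \<kappa>))"
  using q by (intro mult_left_mono) auto
 thus ?thesis
  using order_trans[OF Rz_near_g0[OF K(2)[folded m_def] int]] by (simp add: D_def r_def F_def)
qed

lemma g0_eq:
 assumes "(%n. pos_restrict f (exp (- real n))) \<longlonglongrightarrow> a0"
 shows "g0 * (z + of_real a0) = 1"
proof -
 have "f (of_real (exp (- real n))) = of_real (pos_restrict f (exp (- real n)))" for n
  using NP_plus_real[OF f, of "exp (- real n)"] by (simp add: pos_restrict_def)
 hence fe: "f (exp (of_real (- real n))) = of_real (pos_restrict f (exp (- real n)))" for n
  by (metis exp_of_real)
 have "g (of_real (- real n)) * (z + of_real (pos_restrict f (exp (- real n)))) = 1" for n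
  using denominator[of "of_real (- real n)"] a \<theta> unfolding g_def fe by simp
 moreover have "(%n. g (of_real (- real n)) * (z + of_real (pos_restrict f (exp (- real n))))) \<longlonglongrightarrow> g0 * (z + of_real a0)"
  by (intro tendsto_intros g_limit_g0 assms)
 ultimately show ?thesis by (simp add: LIMSEQ_const_iff)
qed

end

section \<open>Strong convergence of z (z + f(A))^-1 to the identity, and the case of injective
  A\<close>

context sect_operator begin

text \<open>On the domain of A the operator \<open>Rz\<close> differs from g0 by o(1/z), and z g0 =
  z/(z + f(0+)) tends to 1; the uniform bound and density extend this to all vectors. It serves to
  prove density of the domain of f(A) when the range of A is not assumed dense.\<close>

lemma bernstein_resolvent_tendsto:
 assumes f: "f \<in> class_E" and bernstein: "bernstein (pos_restrict f)"
 obtains q b a where "!!n. resolvent_calculus A \<omega> R q b f a 0 (of_nat (Suc n))"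
  "!!u. (%n. of_nat (Suc n) *\<^sub>C resolvent_calculus.Rz R q b f a (of_nat (Suc n)) u) \<longlonglongrightarrow> u"
proof -
 have fN: "f \<in> NP_plus" using f by (simp add: class_E_def)
 interpret bf: bernstein_function f by unfold_locales (fact fN bernstein)+
 obtain a0 where a0: "a0 >= 0" "(%n. pos_restrict f (exp (- real n))) \<longlonglongrightarrow> a0" by (rule bf.f_zero_limit)
 have "\<omega> < pi" using \<omega> by simp
 then obtain q a \<kappa> where \<kappa>: "kappa_bound f a \<kappa>"
  and rc': "!!z. z ~= 0 ==> abs (Arg z) <= pi - pi ==> resolvent_calculus A \<omega> R q ((\<omega> + a) / 2) f a (pi - pi) z"
  using resolvent_calculus_exists[OF f _ order_refl] by metis
 define b where "b = (\<omega> + a) / 2"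
 define z :: "nat => complex" where "z n = of_nat (Suc n)" for n
 have nz: "norm (z n) = real (Suc n)" for n unfolding z_def by (rule norm_of_nat)
 have rc: "resolvent_calculus A \<omega> R q b f a 0 (z n)" for n
 proof -
  have "Arg (z n) = 0" unfolding z_def using Arg_of_real[of "real (Suc n)"] by (simp del: of_nat_Suc)
  thus ?thesis unfolding b_def using rc'[of "z n"] nz[of n] by (simp del: of_nat_Suc) fastforce
 qed
 define S where "S n = resolvent_calculus.Rz R q b f a (z n)" for n
 define G where "G n = resolvent_calculus.g0 q f a (z n)" for n
 interpret r0: resolvent_calculus A \<omega> R q b f a 0 "z 0" by (rule rc)
 obtain C where C: "C >= 0" "!!s t u. abs t = b ==> norm (Q (Complex s t) u) <= C * norm u"
  "!!s u. norm (Q (Complex s pi) u) <= C * norm u" using r0.Q_bound_b by metis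
 define M where "M = \<bar>1 / sin a + q * (C + 2 * C / (pi * cos (b / 2) * cos (q * b / 2))) / (pi * (cos a)^2) *
  (\<kappa> / (cos ((a + 0) / 2))^2)\<bar>"
 have Sn: "norm (z n *\<^sub>C S n u) <= M * norm u" for n u
 proof -
  interpret r: resolvent_calculus A \<omega> R q b f a 0 "z n" by (rule rc)
  note r.Rz_norm_bound[OF \<kappa> C(3,2,1,1), of u]
  also have "(1 / sin a + q * (C + 2 * C / (pi * cos (b / 2) * cos (q * b / 2))) / (pi * (cos a)^2) *
   (\<kappa> / (cos ((a + 0) / 2))^2)) * norm u <= M * norm u" unfolding M_def by (intro mult_right_mono abs_ge_self) simp
  finally show ?thesis unfolding S_def .
 qed
 have Sc: "clinear_bounded (S n)" for n
 proof -
  interpret r: resolvent_calculus A \<omega> R q b f a 0 "z n" by (rule rc)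
  show ?thesis unfolding S_def by (rule r.Rz_clinear)
 qed
 have dom: "(%n. z n *\<^sub>C S n x) \<longlonglongrightarrow> x" if xv: "(x, v) \<in> A" for x v
 proof -
  obtain K where K: "K >= 0" "!!x v y. (x, v) \<in> A ==> norm (x - r0.psi_op y x) <= K * sqrt (norm x * norm v * exp (- y))"
   using r0.psi_op_defect by metis
  obtain K0 where K0: "!!y u. norm (r0.psi_op y u) <= K0 * norm u" using r0.psi_op_bounded by metis
  define K1 where "K1 = max (norm x + K0 * norm x) (K * sqrt (norm x * norm v))"
  have K1: "norm (x - r0.psi_op y x) <= K1 * min 1 (exp (- y / 2))" for y
  proof -
   have "sqrt (exp (- y)) = exp (- y / 2)"
    by (rule real_sqrt_unique) (auto simp: power2_eq_square exp_add[symmetric])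
   hence "norm (x - r0.psi_op y x) <= (K * sqrt (norm x * norm v)) * exp (- y / 2)"
    using K(2)[OF xv, of y] by (simp add: real_sqrt_mult mult.assoc)
   also have "... <= K1 * exp (- y / 2)" unfolding K1_def by (intro mult_right_mono) auto
   finally have 1: "norm (x - r0.psi_op y x) <= K1 * exp (- y / 2)" .
   have "norm (x - r0.psi_op y x) <= norm x + K0 * norm x"
    using norm_triangle_ineq4[of x "r0.psi_op y x"] K0[of y x] by linarith
   hence "norm (x - r0.psi_op y x) <= K1 * 1" by (simp add: K1_def)
   with 1 show ?thesis by (simp add: min_def)
  qed
  have K10: "K1 >= 0" using K by (simp add: K1_def le_max_iff_disj)
  define L where "L = q / pi * (K1 / ((cos a)^2 * (cos ((a + 0) / 2))^2))"
  have L0: "L >= 0" using K10 r0.q2 by (simp add: L_def)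
  have est: "norm (z n *\<^sub>C S n x - (z n * G n) *\<^sub>C x) <=
    L * \<kappa> * exp (- Y / 2) + L * \<kappa> * (1 + pos_restrict f (exp Y))^2 * inverse (real (Suc n))" for n Y
  proof -
   interpret r: resolvent_calculus A \<omega> R q b f a 0 "z n" by (rule rc)
   have z1: "norm (z n) >= 1" unfolding nz by simp
   have "norm (S n x - G n *\<^sub>C x) <= q / pi * (K1 / ((cos a)^2 * (cos ((a + 0) / 2))^2) *
     (\<kappa> / norm (z n) * exp (- Y / 2) + ((1 + pos_restrict f (exp Y)) / norm (z n))^2 * \<kappa>))"
    unfolding S_def G_def by (rule r.Rz_near_g0_domain[OF \<kappa> bf.f_mono z1 K10 K1])
   also have "... = L * (\<kappa> / real (Suc n) * exp (- Y / 2) + ((1 + pos_restrict f (exp Y)) / real (Suc n))^2 * \<kappa>)"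
    unfolding nz L_def by simp
   finally have "real (Suc n) * norm (S n x - G n *\<^sub>C x) <= real (Suc n) *
     (L * (\<kappa> / real (Suc n) * exp (- Y / 2) + ((1 + pos_restrict f (exp Y)) / real (Suc n))^2 * \<kappa>))"
    by (rule mult_left_mono) simp
   also have "... = L * \<kappa> * exp (- Y / 2) + L * \<kappa> * (1 + pos_restrict f (exp Y))^2 * inverse (real (Suc n))"
    by (simp add: field_simps power2_eq_square del: of_nat_Suc)
   finally show ?thesis by (simp only: scaleC_scaleC[symmetric] scaleC.diff_right[symmetric] norm_scaleC nz)
  qed
  have lim: "(%n. z n *\<^sub>C S n x - (z n * G n) *\<^sub>C x) \<longlonglongrightarrow> 0"
  proof (rule tendstoI)
   fix e :: real assume e: "e > 0"
   \<comment> \<open>Y is fixed before n: the first summand of the estimate is small for large Y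
     uniformly in n, and the second tends to 0 for this Y.\<close>
   have "((%Y. L * \<kappa> * exp (- Y / 2)) \<longlongrightarrow> L * \<kappa> * 0) at_top"
    by (intro tendsto_intros) real_asymp
   hence "\<forall>\<^sub>F Y in at_top. L * \<kappa> * exp (- Y / 2) < e / 2"
    by (rule order_tendstoD) (use e in simp)
   then obtain Y where Y: "L * \<kappa> * exp (- Y / 2) < e / 2" by (metis eventually_at_top_linorder order_refl)
   have "(%n. L * \<kappa> * (1 + pos_restrict f (exp Y))^2 * inverse (real (Suc n))) \<longlonglongrightarrow>
     L * \<kappa> * (1 + pos_restrict f (exp Y))^2 * 0"
    by (intro tendsto_intros LIMSEQ_inverse_real_of_nat)
   hence "\<forall>\<^sub>F n in sequentially. L * \<kappa> * (1 + pos_restrict f (exp Y))^2 * inverse (real (Suc n)) < e / 2"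
    by (rule order_tendstoD) (use e in simp)
   thus "\<forall>\<^sub>F n in sequentially. dist (z n *\<^sub>C S n x - (z n * G n) *\<^sub>C x) 0 < e"
   proof eventually_elim
    case (elim n)
    show ?case unfolding dist_0_norm using est[of n Y] elim Y by (simp only: dist_norm diff_zero)
   qed
  qed
  have G: "G n = 1 / (z n + of_real a0)" for n
  proof -
   interpret r: resolvent_calculus A \<omega> R q b f a 0 "z n" by (rule rc)
   have "G n * (z n + of_real a0) = 1" unfolding G_def by (rule r.g0_eq[OF a0(2)])
   thus ?thesis by (metis mult_zero_right nonzero_eq_divide_eq zero_neq_one)
  qed
  have "z n * G n = of_real (real (Suc n) / (real (Suc n) + a0))" for n by (simp add: G z_def)
  moreover have "(%n. real (Suc n) / (real (Suc n) + a0)) \<longlonglongrightarrow> 1" by real_asymp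
  ultimately have "(%n. z n * G n) \<longlonglongrightarrow> of_real 1" by (simp only: tendsto_of_real_iff)
  hence "(%n. z n * G n) \<longlonglongrightarrow> 1" by simp
  hence "(%n. (z n * G n) *\<^sub>C x) \<longlonglongrightarrow> 1 *\<^sub>C x" by (intro scaleC.tendsto tendsto_const)
  from tendsto_add[OF lim this] show ?thesis by simp
 qed
 have "(%n. z n *\<^sub>C S n u) \<longlonglongrightarrow> u" for u
 proof (rule tendstoI)
  fix e :: real assume e: "e > 0"
  have M0: "M >= 0" by (simp add: M_def)
  have "u \<in> closure (Domain A)" using A by (simp add: Sect_def)
  moreover have "0 < e / (2 * (M + 1))" using e M0 by simp
  ultimately obtain x where x: "x \<in> Domain A" "dist x u < e / (2 * (M + 1))" unfolding closure_approachable by blast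
  then obtain v where "(x, v) \<in> A" by blast
  from tendstoD[OF dom[OF this], of "e / 2"] e
  have "\<forall>\<^sub>F n in sequentially. dist (z n *\<^sub>C S n x) x < e / 2" by simp
  thus "\<forall>\<^sub>F n in sequentially. dist (z n *\<^sub>C S n u) u < e"
  proof eventually_elim
   case (elim n)
   have "dist (z n *\<^sub>C S n u) (z n *\<^sub>C S n x) <= M * dist x u"
    using Sn[of n "u - x"] by (simp add: dist_norm clinear_boundedD(2)[OF Sc] scaleC.diff_right norm_minus_commute)
   hence "dist (z n *\<^sub>C S n u) u <= M * dist x u + e / 2 + dist x u"
    using elim dist_triangle[of "z n *\<^sub>C S n u" u "z n *\<^sub>C S n x"] dist_triangle[of "z n *\<^sub>C S n x" u x] by linarith
   moreover have "(M + 1) * dist x u < e / 2" using x(2) M0 by (simp add: field_simps)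
   ultimately show ?case by (simp add: distrib_right)
  qed
 qed
 thus ?thesis using that rc unfolding S_def z_def by blast
qed

lemma is_resolvent_at_Domain: "is_resolvent_at B z S ==> S u \<in> Domain B"
 unfolding is_resolvent_at_def by (metis Domain.intros diff_add_cancel)

lemma closure_range_compose:
 fixes g h :: "'a => 'a"
 assumes "closure (range h) = UNIV" "closure (range g) = UNIV" "continuous_on UNIV g"
 shows "closure (range (%u. g (h u))) = UNIV"
proof -
 have "g ` closure (range h) \<subseteq> closure (range (%u. g (h u)))"
 proof (rule image_closure_subset)
  show "continuous_on (closure (range h)) g" using assms by simp
  show "g ` range h \<subseteq> closure (range (%u. g (h u)))" using closure_subset[of "range (%u. g (h u))"] by auto
 qed simp
 hence "closure (range g) \<subseteq> closure (range (%u. g (h u)))" by (intro closure_minimal) (use assms in auto)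
 thus ?thesis using assms by auto
qed

text \<open>For density of the domain the two alternatives are treated differently. If A has dense
  range, P and 1 - P have dense ranges, hence so has N^2, and its range lies in the domain because
  \<open>Psi t (ftau f)\<close> commutes with N^2. If f is Bernstein, the vectors n Rz u with z = n
  lie in the domain and tend to u.\<close>

theorem regularised_calculus_sectorial:
 assumes f: "f \<in> class_E" and inj: "injective_operator A" and dense: "closure (Range A) = UNIV \<or> bernstein (pos_restrict f)"
  and t: "\<omega> < t" "t < pi / 2"
 defines "B \<equiv> regularised_calculus t f A"
 shows "resolvent_calculus A \<omega> R q b f a \<theta> z ==> is_resolvent_at B z (resolvent_calculus.Rz R q b f a z)"
  and "(0, u) \<in> B ==> u = 0" and "closure (Domain B) = UNIV"
proof -
 have fN: "f \<in> NP_plus" using f by (simp add: class_E_def)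
 have inj': "!!x. (x, 0) \<in> A ==> x = 0" using inj by (simp add: injective_operator_def)
 have t': "0 <= t" "t < pi" using t \<omega> by auto
 note d = ftau_decay[OF fN t'(1) t(2)]
 have B: "(x, y) \<in> B \<longleftrightarrow> N (N y) = Psi t (ftau f) x" for x y
  by (simp add: B_def regularised_calculus_def tau2_op_eq ftau2_op_eq[OF fN t])
 show res: "is_resolvent_at B z (resolvent_calculus.Rz R q b f a z)"
  if rc: "resolvent_calculus A \<omega> R q b f a \<theta> z" for q b a \<theta> z
 proof -
  interpret rc: resolvent_calculus A \<omega> R q b f a \<theta> z by (rule rc)
  show ?thesis unfolding is_resolvent_at_def B using rc.Rz_clinear rc.regularised_resolvent[OF inj' t] by blast
 qed
 show "u = 0" if "(0, u) \<in> B"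
 proof -
  have "N (N u) = 0" using that by (simp add: B clinear_boundedD(4)[OF Psi_clinear[OF t(1) t'(2) d]])
  thus ?thesis using N_injective[OF inj'] by blast
 qed
 show "closure (Domain B) = UNIV" using dense
 proof
  assume range: "closure (Range A) = UNIV"
  have "Domain A \<subseteq> range P"
  proof
   fix x assume "x \<in> Domain A"
   then obtain v where "(x, v) \<in> A" by blast
   from P_left[OF this] show "x \<in> range P" by (metis rangeI)
  qed
  hence rP: "closure (range P) = UNIV" using A closure_mono[of "Domain A" "range P"] by (auto simp: Sect_def)
  have "Range A \<subseteq> range (%u. u - P u)"
  proof
   fix v assume "v \<in> Range A"
   then obtain x where "(x, v) \<in> A" by blast
   from P_left[OF this] have "v = (v + x) - P (v + x)" by simp
   thus "v \<in> range (%u. u - P u)" by blast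
  qed
  hence r1P: "closure (range (%u. u - P u)) = UNIV" using range closure_mono by (metis top.extremum_uniqueI)
  have c: "continuous_on UNIV P" "continuous_on UNIV N"
   by (rule clinear_bounded_continuous_on[OF _ continuous_on_id]; fact P_clinear N_clinear)+
  have "N = (%u. P (u - P u))" by (auto simp: N_def clinear_boundedD[OF P_clinear])
  hence rN: "closure (range N) = UNIV" using closure_range_compose[OF r1P rP c(1)] by simp
  have "N (N (Psi t (ftau f) u)) = Psi t (ftau f) (N (N u))" for u
   by (simp add: Psi_commute[OF t(1) t'(2) d N_clinear N_commute])
  hence "range (%u. N (N u)) \<subseteq> Domain B" using B by blast
  thus ?thesis using closure_range_compose[OF rN rN c(2)] closure_mono by blast
 next
  assume bernstein: "bernstein (pos_restrict f)"
  obtain q b a where rc: "!!n. resolvent_calculus A \<omega> R q b f a 0 (of_nat (Suc n))"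
   and lim: "!!u. (%n. of_nat (Suc n) *\<^sub>C resolvent_calculus.Rz R q b f a (of_nat (Suc n)) u) \<longlonglongrightarrow> u"
   by (rule bernstein_resolvent_tendsto[OF f bernstein]) blast
  have "of_nat (Suc n) *\<^sub>C resolvent_calculus.Rz R q b f a (of_nat (Suc n)) u \<in> Domain B" for n u
  proof -
   interpret r: resolvent_calculus A \<omega> R q b f a 0 "of_nat (Suc n)" by (rule rc)
   show ?thesis unfolding clinear_boundedD(5)[OF r.Rz_clinear, symmetric]
    by (rule is_resolvent_at_Domain[OF res[OF rc]])
  qed
  hence "u \<in> closure (Domain B)" for u
   unfolding closure_sequential
   by (intro exI[of _ "%n. of_nat (Suc n) *\<^sub>C resolvent_calculus.Rz R q b f a (of_nat (Suc n)) u"] conjI allI lim)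
  thus ?thesis by blast
 qed
qed

end

section \<open>Bochner integrals and semigroups\<close>

text \<open>For a contraction the approximating simple functions are composed with it and the L^1
  errors only shrink. The general case follows by scaling with K + 1, which is nonzero even if K =
  0.\<close>

lemma has_bochner_functional:
 fixes ph :: "'a::complex_banach => complex"
 assumes g: "has_bochner M g v" and ph: "clinear_bounded ph"
 shows "has_bochner_integral M (%s. ph (g s)) (ph v)"
proof -
 have contraction: "has_bochner_integral M (%s. ph (g s)) (ph v)"
  if ph: "clinear_bounded ph" and le: "!!x. norm (ph x) <= norm x" for ph :: "'a => complex"
 proof -
  obtain s where gm: "g \<in> borel_measurable M" and s: "!!i. Bochner_Integration.simple_bochner_integrable M (s i)"
   "(%i. \<integral>\<^sup>+ t. ennreal (norm (g t - s i t)) \<partial>M) \<longlonglongrightarrow> 0"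
   "(%i. Bochner_Integration.simple_bochner_integral M (s i)) \<longlonglongrightarrow> v"
   using g unfolding has_bochner_def by blast
  have lin: "linear ph" using clinear_bounded_imp_bounded_linear[OF ph] by (rule bounded_linear.linear)
  show ?thesis
  proof (rule has_bochner_integral.intros)
   show "(%s. ph (g s)) \<in> borel_measurable M"
    using clinear_bounded_continuous_on[OF ph continuous_on_id] by (intro borel_measurable_continuous_on[OF _ gm]) simp
   show "Bochner_Integration.simple_bochner_integrable M (%t. ph (s i t))" for i
    using simple_bochner_integrable_compose2[of "%x y. ph x", OF _ s(1)[of i] s(1)[of i]]
    by (simp add: clinear_boundedD(4)[OF ph])
   show "(%i. \<integral>\<^sup>+ t. ennreal (norm (ph (g t) - ph (s i t))) \<partial>M) \<longlonglongrightarrow> 0"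
   proof (rule tendsto_sandwich[OF _ _ tendsto_const s(2)])
    show "\<forall>\<^sub>F i in sequentially. (\<integral>\<^sup>+ t. ennreal (norm (ph (g t) - ph (s i t))) \<partial>M)
      <= (\<integral>\<^sup>+ t. ennreal (norm (g t - s i t)) \<partial>M)"
     unfolding clinear_boundedD(2)[OF ph, symmetric] using le
     by (intro always_eventually allI nn_integral_mono ennreal_leI)
   qed simp
   show "(%i. Bochner_Integration.simple_bochner_integral M (%t. ph (s i t))) \<longlonglongrightarrow> ph v"
    unfolding simple_bochner_integral_linear[OF lin s(1)] by (rule clinear_bounded_tendsto[OF ph s(3)])
  qed
 qed
 obtain K where K: "K >= 0" "!!x. norm (ph x) <= K * norm x" using clinear_bounded_bound[OF ph] by blast
 define c :: complex where "c = of_real (K + 1)"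
 have c0: "c ~= 0" "norm c = K + 1" using K(1) by (simp_all add: c_def del: of_real_add)
 have "has_bochner_integral M (%s. (1 / c) *\<^sub>C ph (g s)) ((1 / c) *\<^sub>C ph v)"
 proof (rule contraction[OF clinear_bounded_scaleC[OF ph]])
  fix x
  have "norm (ph x) <= (K + 1) * norm x" using K(2)[of x] norm_ge_zero[of x] unfolding distrib_right mult_1 by linarith
  thus "norm ((1 / c) *\<^sub>C ph x) <= norm x"
   using K(1) by (simp add: norm_scaleC norm_divide c0 pos_divide_le_eq mult.commute)
 qed
 hence "has_bochner_integral M (%s. c * ((1 / c) *\<^sub>C ph (g s))) (c * ((1 / c) *\<^sub>C ph v))"
  by (rule has_bochner_integral_mult_right)
 thus ?thesis using c0 by (simp add: scaleC_complex_def)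
qed

lemma has_bochner_norm_bound:
 fixes v :: "'a::complex_banach"
 assumes g: "has_bochner M g v" and le: "!!s. s \<in> space M ==> norm (g s) <= m s" and m: "integrable M m"
 shows "norm v <= integral\<^sup>L M m"
proof -
 obtain ph :: "'a => complex" where ph: "clinear_bounded ph" "!!x. norm (ph x) <= norm x" "ph v = of_real (norm v)"
  using complex_norming_functional by blast
 note h = has_bochner_functional[OF g ph(1)]
 have "norm v = norm (LINT s|M. ph (g s))" using h ph(3) by (simp add: has_bochner_integral_iff)
 also have "... <= (LINT s|M. norm (ph (g s)))" by (rule integral_norm_bound)
 also have "... <= integral\<^sup>L M m"
 proof (rule integral_mono[OF _ m])
  show "integrable M (%s. norm (ph (g s)))" using h by (simp add: has_bochner_integral_iff)
  show "norm (ph (g s)) <= m s" if "s \<in> space M" for s by (rule order_trans[OF ph(2) le[OF that]])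
 qed
 finally show ?thesis .
qed

section \<open>The semigroup generated by -A and its orbits\<close>

locale generated_semigroup = sectorial_resolvent A \<omega> R
 for A :: "'a::complex_banach graph" and \<omega> R +
 fixes T :: "real => 'a => 'a"
 assumes T: "bounded_C0_semigroup T" and generator: "semigroup_generator T = op_uminus A"
begin

lemma T_simps:
 shows T_0: "T 0 x = x" and T_plus: "0 <= s ==> 0 <= t ==> T (s + t) x = T s (T t x)"
  and T_clinear: "0 <= t ==> clinear_bounded (T t)"
 using T by (auto simp: bounded_C0_semigroup_def clinear_bounded_def)

definition C\<^sub>T :: real where "C\<^sub>T = (SOME C. C >= 1 \<and> (ALL t>=0. ALL x. norm (T t x) <= C * norm x))"

lemma C\<^sub>T: "C\<^sub>T >= 1" and T_bound: "0 <= t ==> norm (T t x) <= C\<^sub>T * norm x"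
proof -
 obtain C where C: "!!t. t >= 0 ==> onorm (T t) <= C" using T by (auto simp: bounded_C0_semigroup_def)
 have "norm (T t x) <= (abs C + 1) * norm x" if "t >= 0" for t x
 proof -
  have "norm (T t x) <= onorm (T t) * norm x"
   by (rule onorm[OF clinear_bounded_imp_bounded_linear[OF T_clinear[OF that]]])
  also have "... <= (abs C + 1) * norm x" using C[OF that] by (intro mult_right_mono) auto
  finally show ?thesis .
 qed
 hence "EX C. C >= 1 \<and> (ALL t>=0. ALL x. norm (T t x) <= C * norm x)" by (intro exI[of _ "abs C + 1"]) auto
 from someI_ex[OF this] show "C\<^sub>T >= 1" "0 <= t ==> norm (T t x) <= C\<^sub>T * norm x" unfolding C\<^sub>T_def by blast+
qed

text \<open>Brings forward and backward differences into one form, so that continuity and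
  differentiability from both sides reduce to limits at 0+.\<close>

lemma T_diff_min:
 assumes "0 <= s" "0 <= t"
 shows "T (max s t) x - T (min s t) x = T (min s t) (T (abs (s - t)) x - x)"
proof -
 have "max s t = min s t + abs (s - t)" by auto
 moreover have "T (min s t + abs (s - t)) x = T (min s t) (T (abs (s - t)) x)" using assms by (intro T_plus) auto
 ultimately show ?thesis using clinear_boundedD(2)[OF T_clinear[of "min s t"]] assms by simp
qed

lemma T_dist: "0 <= s ==> 0 <= t ==> norm (T s x - T t x) <= C\<^sub>T * norm (T (abs (s - t)) x - x)"
 using T_diff_min[of s t x] T_bound[of "min s t" "T (abs (s - t)) x - x"] norm_minus_commute[of "T s x" "T t x"]
 by (cases "s <= t") (simp_all add: max_def min_def)

lemma T_continuous: "continuous_on {0..} (%t. T t x)"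
 unfolding continuous_on_iff
proof (intro ballI allI impI)
 fix t e :: real assume t: "t \<in> {0..}" and e: "e > 0"
 have "((%t. T t x) \<longlongrightarrow> x) (at_right 0)" using T by (simp add: bounded_C0_semigroup_def)
 moreover have e': "0 < e / C\<^sub>T" using e C\<^sub>T by simp
 ultimately have "\<forall>\<^sub>F h in at_right 0. dist (T h x) x < e / C\<^sub>T" by (rule tendstoD)
 then obtain d where d: "d > 0" "!!h. 0 < h ==> h < d ==> dist (T h x) x < e / C\<^sub>T"
  unfolding eventually_at_right_field by auto
 show "EX d>0. \<forall>s\<in>{0..}. dist s t < d --> dist (T s x) (T t x) < e"
 proof (intro exI[of _ d] conjI ballI impI)
  fix s assume s: "s \<in> {0..}" "dist s t < d"
  have "norm (T (abs (s - t)) x - x) < e / C\<^sub>T"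
  proof (cases "s = t")
   case True
   thus ?thesis using e' by (simp add: T_0)
  next
   case False
   thus ?thesis using d(2)[of "abs (s - t)"] s by (simp add: dist_norm)
  qed
  hence "C\<^sub>T * norm (T (abs (s - t)) x - x) < e" using C\<^sub>T by (simp add: field_simps)
  thus "dist (T s x) (T t x) < e" using T_dist[of s t x] s t by (simp add: dist_norm)
 qed (fact d)
qed

lemma generator_limit: "(x, v) \<in> A \<longleftrightarrow> ((%h. (T h x - x) /\<^sub>R h) \<longlongrightarrow> - v) (at_right 0)"
proof -
 have "(x, v) \<in> A \<longleftrightarrow> (x, - v) \<in> op_uminus A" by (auto simp: op_uminus_def)
 also have "... \<longleftrightarrow> ((%h. (T h x - x) /\<^sub>R h) \<longlongrightarrow> - v) (at_right 0)"
  unfolding generator[symmetric] by (simp add: semigroup_generator_def)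
 finally show ?thesis .
qed

lemma T_A: "(x, v) \<in> A ==> 0 <= s ==> (T s x, T s v) \<in> A"
proof -
 assume xv: "(x, v) \<in> A" and s: "0 <= s"
 note c = T_clinear[OF s]
 have "((%h. T s ((T h x - x) /\<^sub>R h)) \<longlongrightarrow> T s (- v)) (at_right 0)"
  using xv unfolding generator_limit by (rule clinear_bounded_tendsto[OF c])
 moreover have "\<forall>\<^sub>F h in at_right 0. T s ((T h x - x) /\<^sub>R h) = (T h (T s x) - T s x) /\<^sub>R h"
  using eventually_at_right_less[of 0]
 proof eventually_elim
  case (elim h)
  hence "T h (T s x) = T s (T h x)" using T_plus[of h s x] T_plus[of s h x] s by (simp add: add.commute)
  thus ?case by (simp add: clinear_boundedD[OF c])
 qed
 ultimately show ?thesis unfolding generator_limit clinear_boundedD(3)[OF c]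
  by (rule Lim_transform_eventually)
qed

lemma T_Q: "w \<in> region ==> 0 <= s ==> T s (Q w u) = Q w (T s u)"
proof -
 assume w: "w \<in> region" and s: "0 <= s"
 have "(T s (Q w u), exp w *\<^sub>C (T s (Q w u) - T s u)) \<in> A"
  using T_A[OF Q_graph[OF w, of u] s] by (simp add: clinear_boundedD[OF T_clinear[OF s]])
 from R_left[OF exp_region[OF w] this] show ?thesis
  using R_clinear[OF exp_region[OF w]] by (simp add: Q_def scaleC.diff_right clinear_boundedD)
qed

text \<open>The generator is a limit from the right only. A backward quotient at t is T(m) applied
  to a quotient at 0, with m below t; continuity of T(m) v in m then replaces m by t.\<close>

lemma T_derivative:
 assumes xv: "(x, v) \<in> A" and t: "0 <= t"
 shows "((%t. T t x) has_vector_derivative - T t v) (at t within {0..})"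
 unfolding has_vector_derivative_def has_derivative_within_alt
proof (intro conjI allI impI)
 fix e :: real assume e: "e > 0"
 have e': "0 < e / (2 * C\<^sub>T)" using e C\<^sub>T by simp
 have "\<forall>\<^sub>F h in at_right 0. dist ((T h x - x) /\<^sub>R h) (- v) < e / (2 * C\<^sub>T)"
  using xv e' unfolding generator_limit by (rule tendstoD)
 then obtain d1 where d1: "d1 > 0" "!!h. 0 < h ==> h < d1 ==> dist ((T h x - x) /\<^sub>R h) (- v) < e / (2 * C\<^sub>T)"
  unfolding eventually_at_right_field by auto
 obtain d2 where d2: "d2 > 0" "!!s. 0 <= s ==> abs (s - t) < d2 ==> norm (T s v - T t v) < e / 2"
  using T_continuous[of v] t e unfolding continuous_on_iff dist_norm
  by (metis atLeast_iff half_gt_zero real_norm_def)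
 show "EX d>0. \<forall>s\<in>{0..}. norm (s - t) < d --> norm (T s x - T t x - (s - t) *\<^sub>R - T t v) <= e * norm (s - t)"
 proof (intro exI[of _ "min d1 d2"] conjI ballI impI)
  fix s :: real assume s: "s \<in> {0..}" and st: "norm (s - t) < min d1 d2"
  define h m where "h = abs (s - t)" and "m = min s t"
  have m: "0 <= m" "abs (m - t) <= h" using s t by (auto simp: m_def h_def)
  show "norm (T s x - T t x - (s - t) *\<^sub>R - T t v) <= e * norm (s - t)"
  proof (cases "s = t")
   case False
   hence h: "0 < h" "h < d1" "h < d2" using st by (auto simp: h_def)
   note Tm = clinear_boundedD[OF T_clinear[OF m(1)]]
   have "norm (T (max s t) x - T m x + h *\<^sub>R T t v) = norm (h *\<^sub>R (T m ((T h x - x) /\<^sub>R h + v) + (T t v - T m v)))"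
    using T_diff_min[of s t x] s t h(1) unfolding h_def[symmetric] m_def[symmetric]
    by (simp add: Tm scaleR_add_right algebra_simps)
   also have "... <= h * (norm (T m ((T h x - x) /\<^sub>R h + v)) + norm (T t v - T m v))"
    using h by (simp add: norm_triangle_ineq)
   also have "... <= h * (e / 2 + e / 2)"
   proof (intro mult_left_mono add_mono)
    have "norm (T m ((T h x - x) /\<^sub>R h + v)) <= C\<^sub>T * norm ((T h x - x) /\<^sub>R h + v)" by (rule T_bound[OF m(1)])
    also have "... <= C\<^sub>T * (e / (2 * C\<^sub>T))"
     using d1(2)[OF h(1,2)] C\<^sub>T by (intro mult_left_mono) (auto simp: dist_norm)
    finally show "norm (T m ((T h x - x) /\<^sub>R h + v)) <= e / 2" using C\<^sub>T by simp
    show "norm (T t v - T m v) <= e / 2" using d2(2)[OF m(1)] m(2) h by (simp add: norm_minus_commute)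
   qed (use h in auto)
   finally have le: "norm (T (max s t) x - T m x + h *\<^sub>R T t v) <= e * norm (s - t)" by (simp add: h_def mult.commute)
   show ?thesis
   proof (cases "s <= t")
    case True
    hence "T s x - T t x - (s - t) *\<^sub>R - T t v = - (T (max s t) x - T m x + h *\<^sub>R T t v)"
     by (simp add: h_def m_def max_def min_def algebra_simps)
    thus ?thesis using le by (simp only: norm_minus_cancel)
   next
    case False
    hence "T s x - T t x - (s - t) *\<^sub>R - T t v = T (max s t) x - T m x + h *\<^sub>R T t v"
     by (simp add: h_def m_def max_def min_def algebra_simps)
    thus ?thesis using le by (simp only:)
   qed
  qed simp
 qed (use d1 d2 in auto)
qed (rule bounded_linear_scaleR_left)

lemma T_Lipschitz:
 assumes xv: "(x, v) \<in> A" and st: "0 <= s" "0 <= t"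
 shows "norm (T s x - T t x) <= C\<^sub>T * norm v * abs (s - t)"
proof -
 have "norm (T s x - T t x) <= C\<^sub>T * norm v * norm (s - t)"
 proof (rule differentiable_bound[where S = "{0..}" and f' = "%t h. h *\<^sub>R - T t v"])
  show "((%t. T t x) has_derivative (%h. h *\<^sub>R - T t v)) (at t within {0..})" if "t \<in> {0..}" for t
   using T_derivative[OF xv, of t] that by (simp add: has_vector_derivative_def)
  show "onorm (%h. h *\<^sub>R - T t v) <= C\<^sub>T * norm v" if "t \<in> {0..}" for t
   using T_bound[of t v] that C\<^sub>T by (intro onorm_bound) (auto simp: mult.commute[of "abs _"] intro!: mult_right_mono)
 qed (use st in auto)
 thus ?thesis by simp
qed

text \<open>Linear in t by the Lipschitz bound for t <= 1, bounded for t > 1. The weight t/(1 + t)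
  is comparable with min(t, 1) and is what the Levy measure integrates.\<close>

lemma orbit_bound:
 assumes xv: "(x, v) \<in> A" and t: "t > 0"
 shows "norm (x - T t x) <= 4 * C\<^sub>T * (norm x + norm v) * (t / (1 + t))"
proof -
 have 1: "norm (x - T t x) <= C\<^sub>T * norm v * t"
  using T_Lipschitz[OF xv, of 0 t] t by (simp add: T_0)
 have "norm (x - T t x) <= norm x + C\<^sub>T * norm x"
  using norm_triangle_ineq4[of x "T t x"] T_bound[of t x] t by simp
 also have "... <= 2 * C\<^sub>T * norm x"
 proof -
  have "1 * norm x <= C\<^sub>T * norm x" by (rule mult_right_mono[OF C\<^sub>T]) simp
  thus ?thesis by linarith
 qed
 finally have 2: "norm (x - T t x) <= 2 * C\<^sub>T * norm x" .
 define N where "N = C\<^sub>T * (norm x + norm v)"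
 have N: "N >= 0" "C\<^sub>T * norm v <= N" "C\<^sub>T * norm x <= N" using C\<^sub>T by (auto simp: N_def distrib_left)
 have "norm (x - T t x) * (1 + t) <= 4 * N * t"
 proof (cases "t <= 1")
  case True
  have "norm (x - T t x) * (1 + t) <= (C\<^sub>T * norm v * t) * 2" by (rule mult_mono[OF 1]) (use True t C\<^sub>T in auto)
  also have "... <= (N * t) * 2" using N t by (intro mult_right_mono) auto
  also have "... <= 4 * N * t" using N t by simp
  finally show ?thesis .
 next
  case False
  have "norm (x - T t x) * (1 + t) <= (2 * C\<^sub>T * norm x) * (2 * t)" by (rule mult_mono[OF 2]) (use False C\<^sub>T in auto)
  also have "... = 4 * (C\<^sub>T * norm x) * t" by simp
  also have "... <= 4 * N * t" using N t by (intro mult_right_mono) auto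
  finally show ?thesis .
 qed
 thus ?thesis using t by (simp add: N_def pos_le_divide_eq mult.assoc)
qed

end

section \<open>The integral representation of a Bernstein function\<close>

lemma norm_one_minus_exp_le:
 fixes z :: complex assumes "0 <= Re z" shows "norm (1 - exp (- z)) <= norm z" "norm (1 - exp (- z)) <= 2"
proof -
 have "norm (exp (- 0) - exp (- z)) <= 1 * norm (0 - z)"
 proof (rule field_differentiable_bound[where S = "{z. 0 <= Re z}" and f' = "%z. - exp (- z)"])
  show "((%z. exp (- z)) has_field_derivative - exp (- z)) (at z within {z. 0 <= Re z})" for z :: complex
   by (auto intro!: derivative_eq_intros)
  show "convex {z. 0 <= Re z}" by (rule convex_halfspace_Re_ge)
 qed (use assms in auto)
 thus "norm (1 - exp (- z)) <= norm z" by simp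
 show "norm (1 - exp (- z)) <= 2"
 proof -
  have "exp (- Re z) <= 1" using assms by simp
  thus ?thesis using norm_triangle_ineq4[of 1 "exp (- z)"] by (simp only: norm_exp_eq_Re norm_one uminus_complex.sel)
 qed
qed

lemma le_ratio:
 fixes s x K :: real assumes s: "s > 0" and x: "0 <= x" "x <= K" "x <= K * s" shows "x <= 2 * K * (s / (1 + s))"
proof -
 have "x + x * s <= K * s + K * s" using x s by (intro add_mono mult_right_mono) auto
 hence "x * (1 + s) <= 2 * K * s" by (simp add: distrib_left)
 thus ?thesis using s by (simp add: pos_le_divide_eq)
qed

locale levy_measure =
 fixes \<mu> :: "real measure"
 assumes sets_\<mu>: "sets \<mu> = sets (restrict_space borel {0<..})"
  and finite_\<mu>: "(\<integral>\<^sup>+ s. ennreal (s / (1 + s)) \<partial>\<mu>) < \<infinity>"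
begin

lemma space_\<mu>: "space \<mu> = {0<..}"
 using sets_eq_imp_space_eq[OF sets_\<mu>] by (simp add: space_restrict_space)

lemma measurable_\<mu>: "g \<in> measurable borel N ==> g \<in> measurable \<mu> N"
 unfolding measurable_cong_sets[OF sets_\<mu> refl] by (rule measurable_restrict_space1)

lemma continuous_measurable_\<mu>:
 fixes g :: "real => 'b::topological_space"
 shows "continuous_on {0<..} g ==> g \<in> borel_measurable \<mu>"
 unfolding measurable_cong_sets[OF sets_\<mu> refl] by (rule borel_measurable_continuous_on_restrict)

lemma integrable_ratio: "integrable \<mu> (%s. s / (1 + s))"
proof (rule integrableI_nonneg)
 show "(%s. s / (1 + s)) \<in> borel_measurable \<mu>" by (rule measurable_\<mu>) measurable
 show "AE s in \<mu>. 0 <= s / (1 + s)" by (rule AE_I2) (auto simp: space_\<mu>)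
qed (use finite_\<mu> in simp)

lemma integrable_\<mu>:
 fixes g :: "real => 'b::{banach, second_countable_topology}"
 assumes "g \<in> borel_measurable \<mu>" "!!s. s > 0 ==> norm (g s) <= K * (s / (1 + s))"
 shows "integrable \<mu> g"
proof (rule Bochner_Integration.integrable_bound[OF integrable_mult_right[OF integrable_ratio, of K]])
 show "AE s in \<mu>. norm (g s) <= norm (K * (s / (1 + s)))"
  by (rule AE_I2, unfold real_norm_def, rule order_trans[OF assms(2) abs_ge_self]) (simp add: space_\<mu>)
qed fact

text \<open>On s >= 1/(n+1) the weight s/(1 + s) is at least 1/(n+2), so this set has finite
  measure. Fubini against \<mu> relies on it.\<close>

lemma sigma_finite_\<mu>: "sigma_finite_measure \<mu>"
proof
 define E where "E n = {inverse (real (Suc n))..}" for n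
 have E: "E n \<inter> {0<..} = E n" for n
 proof -
  have "{c..} \<inter> {0<..} = {c..}" if "0 < c" for c :: real using that by auto
  thus ?thesis unfolding E_def by simp
 qed
 have "E n \<inter> {0<..} \<in> sets (restrict_space borel {0<..})" for n
  unfolding sets_restrict_space by (rule image_eqI[of _ _ "E n"]) (auto simp: E_def)
 hence Em: "E n \<in> sets \<mu>" for n unfolding E sets_\<mu> .
 have "emeasure \<mu> (E n) ~= \<infinity>" for n
 proof -
  have "emeasure \<mu> (E n) = (\<integral>\<^sup>+ s. indicator (E n) s \<partial>\<mu>)" using Em by simp
  also have "... <= (\<integral>\<^sup>+ s. ennreal (real (n + 2)) * ennreal (s / (1 + s)) \<partial>\<mu>)"
  proof (intro nn_integral_mono)
   fix s assume s: "s \<in> space \<mu>"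
   show "indicator (E n) s <= ennreal (real (n + 2)) * ennreal (s / (1 + s))"
   proof (cases "s \<in> E n")
    case True
    have s0: "0 < s" using s by (simp add: space_\<mu>)
    have "1 <= real (Suc n) * s" using True by (simp add: E_def field_simps del: of_nat_Suc)
    hence "1 <= real (n + 2) * (s / (1 + s))" using s0 by (simp add: field_simps)
    thus ?thesis using True s0 by (simp add: ennreal_mult'[symmetric] del: ennreal_plus)
   qed simp
  qed
  also have "... = ennreal (real (n + 2)) * (\<integral>\<^sup>+ s. ennreal (s / (1 + s)) \<partial>\<mu>)"
   by (intro nn_integral_cmult measurable_\<mu>) measurable
  also have "... < \<infinity>" using finite_\<mu> by (simp add: ennreal_mult_less_top)
  finally show ?thesis by simp
 qed
 moreover have "(\<Union>n. E n) = space \<mu>"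
 proof
  show "(\<Union>n. E n) \<subseteq> space \<mu>" using E by (auto simp: space_\<mu>)
  show "space \<mu> \<subseteq> (\<Union>n. E n)"
  proof
   fix s assume "s \<in> space \<mu>"
   hence "0 < s" by (simp add: space_\<mu>)
   then obtain n where "inverse (real (Suc n)) < s" using reals_Archimedean by blast
   thus "s \<in> (\<Union>n. E n)" by (auto simp: E_def intro: less_imp_le)
  qed
 qed
 ultimately show "EX D. countable D \<and> D \<subseteq> sets \<mu> \<and> \<Union> D = space \<mu> \<and> (\<forall>a\<in>D. emeasure \<mu> a ~= \<infinity>)"
  using Em by (intro exI[of _ "range E"]) auto
qed

definition levy :: "complex => complex" where "levy l = (LINT s|\<mu>. 1 - exp (- (of_real s * l)))"

lemma levy_integrand:
 assumes l: "0 <= Re l"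
 shows "s > 0 ==> norm (1 - exp (- (of_real s * l))) <= 4 * (1 + norm l) * (s / (1 + s))"
  and "(%s. 1 - exp (- (of_real s * l))) \<in> borel_measurable \<mu>"
  and "integrable \<mu> (%s. 1 - exp (- (of_real s * l)))"
proof -
 show b: "norm (1 - exp (- (of_real s * l))) <= 4 * (1 + norm l) * (s / (1 + s))" if s: "s > 0" for s
 proof -
  have "0 <= Re (of_real s * l)" using l s by simp
  note e = norm_one_minus_exp_le[OF this]
  have "norm (1 - exp (- (of_real s * l))) <= 2 * (2 * (1 + norm l)) * (s / (1 + s))"
  proof (rule le_ratio[OF s norm_ge_zero])
   show "norm (1 - exp (- (of_real s * l))) <= 2 * (1 + norm l)" using e(2) norm_ge_zero[of l] unfolding distrib_left by linarith
   have "norm (of_real s * l) <= 2 * (1 + norm l) * s" using s by (simp add: norm_mult distrib_left distrib_right mult.commute)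
   thus "norm (1 - exp (- (of_real s * l))) <= 2 * (1 + norm l) * s" using e(1) by linarith
  qed
  thus ?thesis by simp
 qed
 show m: "(%s. 1 - exp (- (of_real s * l))) \<in> borel_measurable \<mu>"
  by (intro continuous_measurable_\<mu> continuous_intros)
 show "integrable \<mu> (%s. 1 - exp (- (of_real s * l)))" by (rule integrable_\<mu>[OF m b])
qed

text \<open>Differentiation under the integral along sequences. Once the real parts exceed d = Re l
  / 2, the mean value bound s e^(-s d) for the difference quotients is dominated by a multiple of
  s/(1 + s).\<close>

lemma levy_holomorphic: "levy holomorphic_on right_half_plane"
proof -
 have "(levy has_field_derivative (LINT s|\<mu>. of_real s * exp (- (of_real s * l)))) (at l)" if l: "0 < Re l" for l
  unfolding has_field_derivative_iff tendsto_at_iff_sequentially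
 proof (intro allI impI)
  fix X assume X: "ALL i. X i \<in> UNIV - {l}" "X \<longlonglongrightarrow> l"
  define d where "d = Re l / 2"
  have d: "d > 0" "d < Re l" using l by (auto simp: d_def)
  have "(%i. Re (X i)) \<longlonglongrightarrow> Re l" by (intro tendsto_intros X)
  hence "\<forall>\<^sub>F i in sequentially. d < Re (X i)" by (rule order_tendstoD) (rule d)
  then obtain n where n: "!!i. i >= n ==> d < Re (X i)" unfolding eventually_sequentially by blast
  define Y where "Y i = X (i + n)" for i
  have Y: "Y i ~= l" "d < Re (Y i)" for i using X(1) n by (auto simp: Y_def)
  have Yl: "Y \<longlonglongrightarrow> l" unfolding Y_def by (rule LIMSEQ_ignore_initial_segment[OF X(2)])
  define E where "E s y = 1 - exp (- (of_real s * y))" for s :: real and y :: complex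
  have dE: "(E s has_field_derivative of_real s * exp (- (of_real s * y))) (at y within S)" for s y S
   unfolding E_def by (auto intro!: derivative_eq_intros)
  have "(%i. LINT s|\<mu>. (E s (Y i) - E s l) / (Y i - l)) \<longlonglongrightarrow> (LINT s|\<mu>. of_real s * exp (- (of_real s * l)))"
  proof (rule integral_dominated_convergence)
   show "(%s. of_real s * exp (- (of_real s * l))) \<in> borel_measurable \<mu>"
    by (intro continuous_measurable_\<mu> continuous_intros)
   show "(%s. (E s (Y i) - E s l) / (Y i - l)) \<in> borel_measurable \<mu>" for i
    unfolding E_def using Y(1)[of i] by (intro continuous_measurable_\<mu> continuous_intros) auto
   show "integrable \<mu> (%s. 2 * (1 + 1 / d) * (s / (1 + s)))" by (intro integrable_mult_right integrable_ratio)
   show "AE s in \<mu>. (%i. (E s (Y i) - E s l) / (Y i - l)) \<longlonglongrightarrow> of_real s * exp (- (of_real s * l))"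
   proof (rule AE_I2)
    fix s
    have "((%y. (E s y - E s l) / (y - l)) \<longlongrightarrow> of_real s * exp (- (of_real s * l))) (at l)"
     using dE[of s l UNIV] by (simp add: has_field_derivative_iff)
    thus "(%i. (E s (Y i) - E s l) / (Y i - l)) \<longlonglongrightarrow> of_real s * exp (- (of_real s * l))"
     unfolding tendsto_at_iff_sequentially using Y(1) Yl by (auto simp: comp_def)
   qed
   show "AE s in \<mu>. norm ((E s (Y i) - E s l) / (Y i - l)) <= 2 * (1 + 1 / d) * (s / (1 + s))" for i
   proof (rule AE_I2)
    fix s assume "s \<in> space \<mu>"
    hence s: "s > 0" by (simp add: space_\<mu>)
    have "norm (E s (Y i) - E s l) <= (s * exp (- (s * d))) * norm (Y i - l)"
    proof (rule field_differentiable_bound[where S = "{y. d <= Re y}", OF convex_halfspace_Re_ge dE])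
     show "norm (of_real s * exp (- (of_real s * y))) <= s * exp (- (s * d))" if "y \<in> {y. d <= Re y}" for y
      using s that by (simp add: norm_mult)
    qed (use d Y(2)[of i] in auto)
    hence 1: "norm ((E s (Y i) - E s l) / (Y i - l)) <= s * exp (- (s * d))"
     using Y(1)[of i] by (simp add: norm_divide pos_divide_le_eq)
    have "s * exp (- (s * d)) <= 2 * (1 + 1 / d) * (s / (1 + s))"
    proof (rule le_ratio[OF s])
     show "s * exp (- (s * d)) <= (1 + 1 / d) * s" using s d by (intro mult_mono[of s s _ "1", THEN order_trans, unfolded mult_1_right]) (auto simp: distrib_right)
     have "s * d <= exp (s * d)" using exp_ge_add_one_self[of "s * d"] by linarith
     hence "s * exp (- (s * d)) <= 1 / d" using d by (simp add: exp_minus field_simps)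
     thus "s * exp (- (s * d)) <= 1 + 1 / d" by simp
    qed (use s in simp)
    with 1 show "norm ((E s (Y i) - E s l) / (Y i - l)) <= 2 * (1 + 1 / d) * (s / (1 + s))" by linarith
   qed
  qed
  also have "(%i. LINT s|\<mu>. (E s (Y i) - E s l) / (Y i - l)) = (%i. (levy (Y i) - levy l) / (Y i - l))"
  proof
   fix i
   have "integrable \<mu> (%s. E s (Y i))" "integrable \<mu> (%s. E s l)"
    unfolding E_def by (intro levy_integrand; use d Y(2)[of i] in simp)+
   thus "(LINT s|\<mu>. (E s (Y i) - E s l) / (Y i - l)) = (levy (Y i) - levy l) / (Y i - l)"
    by (simp only: levy_def E_def[symmetric] integral_divide_zero Bochner_Integration.integral_diff)
  qed
  finally show "((%y. (levy y - levy l) / (y - l)) \<circ> X) \<longlonglongrightarrow> (LINT s|\<mu>. of_real s * exp (- (of_real s * l)))"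
   unfolding Y_def comp_def by (rule LIMSEQ_offset)
 qed
 thus ?thesis unfolding holomorphic_on_def
  by (metis field_differentiable_at_within field_differentiable_def mem_Collect_eq)
qed

end

locale bernstein_representation = levy_measure \<mu> for \<mu> +
 fixes f :: "complex => complex" and \<alpha> \<beta> :: real
 assumes f: "f \<in> NP_plus" and rep: "bernstein_rep (pos_restrict f) \<alpha> \<beta> \<mu>"
begin

lemma levy_real: "t > 0 ==> levy (of_real t) = of_real (LINT s|\<mu>. 1 - exp (- t * s))"
proof -
 have "1 - exp (- (of_real s * of_real t)) = complex_of_real (1 - exp (- t * s))" for s
  by (simp add: exp_of_real[symmetric] mult.commute)
 thus ?thesis unfolding levy_def by (simp only: integral_complex_of_real)
qed

text \<open>The representation is given on the positive axis; both sides are holomorphic in the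
  half-plane, so the identity theorem extends it.\<close>

theorem f_representation:
 assumes l: "0 < Re l" shows "f l = of_real \<alpha> + of_real \<beta> * l + levy l"
proof -
 define h where "h l = f l - (of_real \<alpha> + of_real \<beta> * l + levy l)" for l
 have hol: "h holomorphic_on right_half_plane"
  unfolding h_def by (intro holomorphic_intros NP_plus_holomorphic[OF f] levy_holomorphic)
 have "h l = 0"
 proof (rule analytic_continuation[OF hol open_right_half_plane[OF f] connected_right_half_plane[OF f]])
  show "complex_of_real ` {0<..} \<subseteq> right_half_plane" by auto
  show "1 \<in> right_half_plane" by simp
  have "(1::complex) islimpt complex_of_real ` {0<..}"
   unfolding islimpt_sequential
  proof (intro exI[of _ "%n. of_real (1 + inverse (real (Suc n)))"] conjI allI)
   show "complex_of_real (1 + inverse (real (Suc n))) \<in> complex_of_real ` {0<..} - {1}" for n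
    by (auto simp: add_pos_pos simp del: of_real_add of_real_inverse)
   have "(%n. complex_of_real (1 + inverse (real (Suc n)))) \<longlonglongrightarrow> of_real (1 + 0)"
    by (intro tendsto_intros LIMSEQ_inverse_real_of_nat)
   thus "(%n. complex_of_real (1 + inverse (real (Suc n)))) \<longlonglongrightarrow> 1" by simp
  qed
  thus "1 islimpt complex_of_real ` {0<..}" .
  show "h x = 0" if "x \<in> complex_of_real ` {0<..}" for x
  proof -
   obtain t where t: "t > 0" "x = of_real t" using \<open>x \<in> _\<close> by auto
   have "pos_restrict f t = \<alpha> + \<beta> * t + (LINT s|\<mu>. 1 - exp (- t * s))"
    using rep t(1) by (simp add: bernstein_rep_def)
   hence "f (of_real t) = of_real (\<alpha> + \<beta> * t + (LINT s|\<mu>. 1 - exp (- t * s)))"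
    using NP_plus_real[OF f t(1)] by (simp add: pos_restrict_def)
   thus ?thesis by (simp add: h_def t(2) levy_real[OF t(1)])
  qed
  show "l \<in> right_half_plane" using l by simp
 qed
 thus ?thesis by (simp add: h_def)
qed

text \<open>Identifies the coefficient \<alpha> with f(0+), so that g0 = 1/(z + \<alpha>).\<close>

lemma f_limit: "(%n. pos_restrict f (exp (- real n))) \<longlonglongrightarrow> \<alpha>"
proof -
 have "(%n. LINT s|\<mu>. 1 - exp (- (of_real s * of_real (exp (- real n))))) \<longlonglongrightarrow> (LINT s|\<mu>. (0::complex))"
 proof (rule integral_dominated_convergence)
  show "(%s. 1 - exp (- (of_real s * of_real (exp (- real n)))) :: complex) \<in> borel_measurable \<mu>" for n
   by (rule levy_integrand) simp
  show "integrable \<mu> (%s. 8 * (s / (1 + s)))" by (intro integrable_mult_right integrable_ratio)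
  show "AE s in \<mu>. (%n. 1 - exp (- (of_real s * of_real (exp (- real n)))) :: complex) \<longlonglongrightarrow> 0"
  proof (rule AE_I2)
   fix s :: real
   have "(%n. exp (- real n)) \<longlonglongrightarrow> 0" by real_asymp
   hence "(%n. 1 - exp (- (of_real s * of_real (exp (- real n)))) :: complex) \<longlonglongrightarrow> 1 - exp (- (of_real s * of_real 0))"
    by (intro tendsto_intros)
   thus "(%n. 1 - exp (- (of_real s * of_real (exp (- real n)))) :: complex) \<longlonglongrightarrow> 0" by simp
  qed
  show "AE s in \<mu>. norm (1 - exp (- (of_real s * of_real (exp (- real n)))) :: complex) <= 8 * (s / (1 + s))" for n
  proof (rule AE_I2)
   fix s assume "s \<in> space \<mu>"
   hence s: "s > 0" by (simp add: space_\<mu>)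
   have "norm (1 - exp (- (of_real s * of_real (exp (- real n)))) :: complex) <= 4 * (1 + norm (of_real (exp (- real n)) :: complex)) * (s / (1 + s))"
    by (rule levy_integrand(1)) (use s in auto)
   also have "... <= 8 * (s / (1 + s))" using s by (intro mult_right_mono) auto
   finally show "norm (1 - exp (- (of_real s * of_real (exp (- real n)))) :: complex) <= 8 * (s / (1 + s))" .
  qed
 qed simp
 hence "(%n. levy (of_real (exp (- real n)))) \<longlonglongrightarrow> 0" by (simp only: levy_def[symmetric] Bochner_Integration.integral_zero)
 moreover have "(%n. complex_of_real (exp (- real n))) \<longlonglongrightarrow> of_real 0" by (intro tendsto_of_real) real_asymp
 ultimately have "(%n. of_real \<alpha> + of_real \<beta> * of_real (exp (- real n)) + levy (of_real (exp (- real n)))) \<longlonglongrightarrow> of_real \<alpha> + of_real \<beta> * of_real 0 + 0"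
  by (intro tendsto_add[OF tendsto_add[OF tendsto_const tendsto_mult[OF tendsto_const]]])
 moreover have "f (of_real (exp (- real n))) = of_real \<alpha> + of_real \<beta> * of_real (exp (- real n)) + levy (of_real (exp (- real n)))" for n
  by (rule f_representation) simp
 ultimately have "(%n. f (of_real (exp (- real n)))) \<longlonglongrightarrow> of_real \<alpha>" by simp
 hence "(%n. Re (f (of_real (exp (- real n))))) \<longlonglongrightarrow> Re (of_real \<alpha>)" by (rule tendsto_Re)
 thus ?thesis by (simp add: pos_restrict_def)
qed

end

section \<open>Orbits integrated against the Levy measure, and the semigroup as a contour
  integral\<close>

locale bernstein_semigroup = generated_semigroup A \<omega> R T + bernstein_representation \<mu> f \<alpha> \<beta>
 for A :: "'a::complex_banach graph" and \<omega> R T \<mu> f \<alpha> \<beta>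
begin

lemma orbit_measurable: "(%s. x - T s x) \<in> borel_measurable \<mu>"
 by (intro continuous_measurable_\<mu> continuous_on_diff continuous_on_const continuous_on_subset[OF T_continuous]) auto

text \<open>The simple functions are explicit: on [1/(n+1), n+1) the orbit is frozen at the grid
  points of mesh 1/(n+1), elsewhere the value is 0. The Lipschitz bound controls the error inside
  and \<open>orbit_bound\<close> outside; both are dominated by a multiple of s/(1 + s), so the
  errors tend to 0 in L^1.\<close>

theorem orbit_bochner:
 assumes xv: "(x, v) \<in> A"
 obtains u where "has_bochner \<mu> (%s. x - T s x) u"
proof -
 define K where "K = 4 * C\<^sub>T * (norm x + norm v)"
 have K0: "K >= 0" "C\<^sub>T * norm v <= K"
  using C\<^sub>T mult_nonneg_nonneg[of C\<^sub>T "norm x"] mult_nonneg_nonneg[of C\<^sub>T "norm v"]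
  by (simp_all add: K_def distrib_left)
 define J where "J n = {s. inverse (real (Suc n)) <= s \<and> s < real (Suc n)}" for n
 \<comment> \<open>\<open>S n\<close> factors through this integer label, which takes finitely many
   values and is measurable; -1 marks the points outside \<open>J n\<close>, where G is 0.\<close>
 define k where "k n s = (if s \<in> J n then \<lfloor>s * real (Suc n)\<rfloor> else - 1)" for n s
 define G where "G n i = (if 0 <= i then x - T (of_int i / real (Suc n)) x else 0)" for n i
 define S where "S n s = G n (k n s)" for n s
 define h where "h n s = (if s \<in> J n then K * inverse (real (Suc n)) else K * (s / (1 + s)))" for n s
 have J: "J n \<in> sets borel" for n unfolding J_def by measurable
 have err: "norm (x - T s x - S n s) <= h n s" if s: "s > 0" for s n
 proof (cases "s \<in> J n")
  case True
  define m where "m = of_int \<lfloor>s * real (Suc n)\<rfloor> / real (Suc n)"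
  have fl: "0 <= \<lfloor>s * real (Suc n)\<rfloor>" using s by simp
  hence m0: "0 <= m" by (simp add: m_def del: of_nat_Suc)
  have "(m - s) * real (Suc n) = of_int \<lfloor>s * real (Suc n)\<rfloor> - s * real (Suc n)"
   by (simp add: m_def left_diff_distrib del: of_nat_Suc)
  moreover have "abs (m - s) * real (Suc n) = abs ((m - s) * real (Suc n))" by (simp add: abs_mult)
  ultimately have "abs (m - s) * real (Suc n) = abs (of_int \<lfloor>s * real (Suc n)\<rfloor> - s * real (Suc n))" by simp
  also have "... <= 1" by linarith
  finally have ms: "abs (m - s) <= inverse (real (Suc n))" by (simp add: field_simps del: of_nat_Suc)
  have "S n s = x - T m x" using True fl by (simp add: S_def k_def G_def m_def del: of_nat_Suc)
  hence "norm (x - T s x - S n s) = norm (T m x - T s x)" by simp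
  also have "... <= C\<^sub>T * norm v * abs (m - s)" using T_Lipschitz[OF xv m0, of s] s by simp
  also have "... <= K * inverse (real (Suc n))" by (rule mult_mono[OF K0(2) ms]) (use K0 in auto)
  finally show ?thesis using True by (simp add: h_def)
 next
  case False
  thus ?thesis using orbit_bound[OF xv s] by (simp add: S_def k_def G_def h_def K_def)
 qed
 have h_le: "0 <= h n s" "h n s <= 2 * K * (s / (1 + s))" if s: "s > 0" for n s
 proof -
  show "0 <= h n s" using K0 s by (simp add: h_def)
  show "h n s <= 2 * K * (s / (1 + s))"
  proof (cases "s \<in> J n")
   case True
   have i: "inverse (real (Suc n)) <= 1" by (simp add: field_simps)
   have "inverse (real (Suc n)) <= s" using True by (simp add: J_def)
   hence "inverse (real (Suc n)) <= 2 * 1 * (s / (1 + s))" by (intro le_ratio[OF s]) (use i in auto)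
   from mult_left_mono[OF this K0(1)] show ?thesis using True by (simp add: h_def mult_ac)
  next
   case False
   have "K * (s / (1 + s)) <= (2 * K) * (s / (1 + s))" by (rule mult_right_mono) (use K0 s in auto)
   thus ?thesis using False by (simp add: h_def)
  qed
 qed
 have hm: "h n \<in> borel_measurable \<mu>" for n
  unfolding h_def[abs_def] by (rule measurable_\<mu>) (use J in measurable)
 have int_h: "integrable \<mu> (h n)" for n
  by (rule integrable_\<mu>[OF hm, where K = "2 * K"]) (use h_le in auto)
 have lim_h: "(%n. integral\<^sup>L \<mu> (h n)) \<longlonglongrightarrow> (LINT s|\<mu>. 0)"
 proof (rule integral_dominated_convergence)
  show "integrable \<mu> (%s. 2 * K * (s / (1 + s)))" by (intro integrable_mult_right integrable_ratio)
  show "AE s in \<mu>. norm (h n s) <= 2 * K * (s / (1 + s))" for n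
   using h_le by (intro AE_I2) (auto simp: space_\<mu>)
  show "AE s in \<mu>. (%n. h n s) \<longlonglongrightarrow> 0"
  proof (rule AE_I2)
   fix s assume "s \<in> space \<mu>"
   hence s: "0 < s" by (simp add: space_\<mu>)
   have "(%n. inverse (real (Suc n))) \<longlonglongrightarrow> 0" by (rule LIMSEQ_inverse_real_of_nat)
   hence "\<forall>\<^sub>F n in sequentially. inverse (real (Suc n)) < s" using s by (rule order_tendstoD)
   moreover have "\<forall>\<^sub>F n in sequentially. s < real (Suc n)" by real_asymp
   ultimately have "\<forall>\<^sub>F n in sequentially. K * inverse (real (Suc n)) = h n s"
    by eventually_elim (simp add: h_def J_def del: of_nat_Suc)
   moreover have "(%n. K * inverse (real (Suc n))) \<longlonglongrightarrow> K * 0"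
    by (intro tendsto_intros LIMSEQ_inverse_real_of_nat)
   ultimately show "(%n. h n s) \<longlonglongrightarrow> 0" using Lim_transform_eventually by fastforce
  qed
 qed (use hm in auto)
 have nn_h: "(\<integral>\<^sup>+ s. ennreal (norm (g s)) \<partial>\<mu>) <= ennreal (integral\<^sup>L \<mu> m)"
  if "!!s. s > 0 ==> norm (g s) <= m s" "integrable \<mu> m" for g :: "real => 'a" and m
 proof -
  have "(\<integral>\<^sup>+ s. ennreal (norm (g s)) \<partial>\<mu>) <= (\<integral>\<^sup>+ s. ennreal (m s) \<partial>\<mu>)"
   by (intro nn_integral_mono ennreal_leI that) (simp add: space_\<mu>)
  also have "... = ennreal (integral\<^sup>L \<mu> m)"
   by (rule nn_integral_eq_integral[OF that(2)], rule AE_I2, rule order_trans[OF norm_ge_zero that(1)])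
    (simp add: space_\<mu>)
  finally show ?thesis .
 qed
 have Ssimple: "simple_function \<mu> (S n)" for n
  unfolding S_def[abs_def]
 proof (rule simple_function_compose1[where f = "k n"], unfold simple_function_eq_measurable, intro conjI)
  have "k n ` space \<mu> \<subseteq> {- 1..int (Suc n * Suc n)}"
  proof
   fix i assume "i \<in> k n ` space \<mu>"
   then obtain s where s: "i = k n s" by blast
   show "i \<in> {- 1..int (Suc n * Suc n)}"
   proof (cases "s \<in> J n")
    case True
    hence "inverse (real (Suc n)) <= s" "s < real (Suc n)" unfolding J_def mem_Collect_eq by blast+
    moreover have "0 <= inverse (real (Suc n))" by simp
    ultimately have s0: "0 <= s" "s <= real (Suc n)" by linarith+
    hence "s * real (Suc n) <= real (Suc n) * real (Suc n)" by (intro mult_right_mono) auto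
    hence "\<lfloor>s * real (Suc n)\<rfloor> <= \<lfloor>real (Suc n * Suc n)\<rfloor>" by (intro floor_mono) (simp only: of_nat_mult)
    moreover have "0 <= \<lfloor>s * real (Suc n)\<rfloor>" using s0 by simp
    ultimately show ?thesis using True by (simp only: s k_def if_True floor_of_nat atLeastAtMost_iff simp_thms)
   qed (simp add: s k_def)
  qed
  thus "finite (k n ` space \<mu>)" by (rule finite_subset) simp
  show "k n \<in> measurable \<mu> (count_space UNIV)"
   unfolding k_def[abs_def] by (rule measurable_\<mu>) (use J in measurable)
 qed
 have Sint: "Bochner_Integration.simple_bochner_integrable \<mu> (S n)" for n
 proof (rule Bochner_Integration.simple_bochner_integrableI_bounded[OF Ssimple])
  have "norm (S n s) <= K * (s / (1 + s)) + h n s" if "s > 0" for s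
   using norm_triangle_ineq4[of "x - T s x" "x - T s x - S n s"] err[OF that, of n] orbit_bound[OF xv that]
   by (simp add: K_def)
  moreover have "integrable \<mu> (%s. K * (s / (1 + s)) + h n s)"
   by (intro Bochner_Integration.integrable_add integrable_mult_right integrable_ratio int_h)
  ultimately have "(\<integral>\<^sup>+ s. ennreal (norm (S n s)) \<partial>\<mu>) <= ennreal (LINT s|\<mu>. K * (s / (1 + s)) + h n s)"
   by (rule nn_h)
  thus "(\<integral>\<^sup>+ s. ennreal (norm (S n s)) \<partial>\<mu>) < \<infinity>"
   using le_less_trans[OF _ ennreal_less_top] infinity_ennreal_def by metis
 qed
 define I where "I n = Bochner_Integration.simple_bochner_integral \<mu> (S n)" for n
 have dist_I: "dist (I n) (I m) <= integral\<^sup>L \<mu> (h n) + integral\<^sup>L \<mu> (h m)" for m n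
 proof -
  have d: "Bochner_Integration.simple_bochner_integrable \<mu> (%s. S n s - S m s)"
   by (rule Bochner_Integration.simple_bochner_integrable_compose2[where p = "(-)", OF _ Sint Sint]) simp
  have dn: "Bochner_Integration.simple_bochner_integrable \<mu> (%s. norm (S n s - S m s))"
   by (rule Bochner_Integration.simple_bochner_integrable_compose2[where p = "%x y. norm x", OF _ d d]) simp
  have "norm (S n s - S m s) <= h n s + h m s" if "s > 0" for s
   using norm_triangle_ineq4[of "x - T s x - S m s" "x - T s x - S n s"] err[OF that, of n] err[OF that, of m] by simp
  from nn_h[OF this Bochner_Integration.integrable_add[OF int_h int_h]]
  have "ennreal (Bochner_Integration.simple_bochner_integral \<mu> (%s. norm (S n s - S m s)))
    <= ennreal (integral\<^sup>L \<mu> (h n) + integral\<^sup>L \<mu> (h m))"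
   using Bochner_Integration.simple_bochner_integral_eq_nn_integral[OF dn] int_h
   by (simp add: Bochner_Integration.integral_add)
  moreover have "0 <= integral\<^sup>L \<mu> (h n)" for n
   using h_le by (intro integral_nonneg_AE AE_I2) (simp add: space_\<mu>)
  ultimately have "Bochner_Integration.simple_bochner_integral \<mu> (%s. norm (S n s - S m s))
    <= integral\<^sup>L \<mu> (h n) + integral\<^sup>L \<mu> (h m)" by (metis ennreal_le_iff add_nonneg_nonneg)
  thus ?thesis
   using Bochner_Integration.simple_bochner_integral_norm_bound[OF d]
   by (simp add: dist_norm I_def Bochner_Integration.simple_bochner_integral_diff[OF Sint Sint])
 qed
 have "Cauchy I"
  unfolding Cauchy_altdef2
 proof (intro allI impI)
  fix e :: real assume e: "e > 0"
  hence "\<forall>\<^sub>F n in sequentially. integral\<^sup>L \<mu> (h n) < e / 2"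
   by (intro order_tendstoD[OF lim_h]) simp
  then obtain n where n: "!!m. m >= n ==> integral\<^sup>L \<mu> (h m) < e / 2" unfolding eventually_sequentially by blast
  show "EX N. ALL m>=N. dist (I m) (I N) < e"
  proof (intro exI allI impI)
   fix m assume "m >= n"
   thus "dist (I m) (I n) < e" using dist_I[of m n] n[of m] n[of n] by simp
  qed
 qed
 then obtain u where u: "I \<longlonglongrightarrow> u" using Cauchy_convergent convergentD by blast
 have "(%n. \<integral>\<^sup>+ s. ennreal (norm (x - T s x - S n s)) \<partial>\<mu>) \<longlonglongrightarrow> 0"
 proof (rule tendsto_sandwich[OF _ _ tendsto_const])
  show "\<forall>\<^sub>F n in sequentially. (\<integral>\<^sup>+ s. ennreal (norm (x - T s x - S n s)) \<partial>\<mu>) <= ennreal (integral\<^sup>L \<mu> (h n))"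
   using nn_h[OF err int_h] by simp
  show "(%n. ennreal (integral\<^sup>L \<mu> (h n))) \<longlonglongrightarrow> 0" using tendsto_ennrealI[OF lim_h] by simp
 qed simp
 hence "has_bochner \<mu> (%s. x - T s x) u"
  unfolding has_bochner_def using orbit_measurable Sint u unfolding I_def by blast
 thus ?thesis by (rule that)
qed

lemma exp_decay:
 assumes t: "0 <= t" "t < pi / 2" and s: "0 <= s" and h: "strip_decay t h"
 shows "strip_decay t (%w. h w * exp (- (of_real s * exp w)))"
  and "abs (Im w) <= t ==> norm (exp (- (of_real s * exp w))) <= 1"
proof -
 show b: "norm (exp (- (of_real s * exp w))) <= 1" if "abs (Im w) <= t" for w
 proof -
  have "0 < Re (exp w)" using Re_exp_Complex_pos[of "Im w" "Re w"] that t by simp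
  thus ?thesis using s by simp
 qed
 show "strip_decay t (%w. h w * exp (- (of_real s * exp w)))"
  by (rule strip_decay_mult[OF h _ _ b, where c = pi]) (use t in \<open>auto intro!: holomorphic_intros\<close>)
qed

text \<open>The case f(l) = l of \<open>ftau_decay\<close>.\<close>

lemma exp_tau2_decay:
 assumes t: "0 <= t" "t < pi / 2" shows "strip_decay t (%w. exp w * (tau (exp w))^2)"
proof -
 have "(%z. z) \<in> NP_plus" by (auto simp: NP_plus_def)
 from ftau_decay[OF this t] show ?thesis by (simp add: ftau_def[abs_def])
qed

text \<open>$e^{-s\lambda} R(\lambda) - T(s) R(\lambda)$ is the convolution of $-e^{-r\lambda}$ with the semigroup, and the
 contour integral of $\tau(\lambda)^2 e^{-r\lambda}$ vanishes.\<close>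

theorem Psi_semigroup:
 assumes t: "\<omega> < t" "t < pi / 2" and s: "0 <= s"
 shows "Psi t (%w. (tau (exp w))^2 * exp (- (of_real s * exp w))) u = T s (N (N u))"
proof (rule functional_eqI)
 fix ph :: "'a => complex" assume ph: "clinear_bounded ph"
 have t0: "0 <= t" "t < pi" using t \<omega> by auto
 define \<tau> where "\<tau> w = (tau (exp w))^2" for w
 have \<tau>: "strip_decay t \<tau>" unfolding \<tau>_def by (rule tau2_decay) (fact t0)
 note Ts = T_clinear[OF s]
 note phT = clinear_bounded_compose[OF ph Ts]
 obtain K where K: "K >= 0" "!!x. norm (ph x) <= K * norm x" using clinear_bounded_bound[OF ph] by blast
 \<comment> \<open>The cut-off at 0 makes k continuous on the whole line; its values matter for 0 <=
   r <= s.\<close>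
 define k where "k r = ph (T (max 0 (s - r)) u)" for r
 have kc: "continuous_on UNIV k" unfolding k_def
  by (rule clinear_bounded_continuous_on[OF ph], rule continuous_on_compose2[OF T_continuous])
   (auto intro!: continuous_intros)
 have kb: "norm (k r) <= K * (C\<^sub>T * norm u)" for r
  unfolding k_def by (rule order_trans[OF K(2) mult_left_mono[OF T_bound K(1)]]) simp
 have duhamel: "ph (exp (- (of_real s * exp w)) *\<^sub>C Q w u) - ph (T s (Q w u)) =
   - (LINT r|lborel. indicator {0..s} r *\<^sub>R (exp w * exp (- (of_real r * exp w)) * k r))" if w: "w \<in> region" for w
 proof -
  define l where "l = exp w"
  define p where "p = Q w u"
  have pA: "(p, l *\<^sub>C (p - u)) \<in> A" unfolding p_def l_def by (rule Q_graph[OF w])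
  \<comment> \<open>F runs from ph (T(s) p) at r = 0 to e^(-s l) ph(p) at r = s. In its derivative
    the terms with p cancel, because A p = l (p - u), and only T(s - r) u is left.\<close>
  define F where "F r = exp (- (of_real r * l)) * ph (T (s - r) p)" for r
  have dph: "((%r. ph (T (s - r) p)) has_vector_derivative ph (T (s - r) (l *\<^sub>C (p - u)))) (at r within {0..s})"
   if r: "r \<in> {0..s}" for r
  proof -
   have "((%r. s - r) has_vector_derivative - 1) (at r within {0..s})" by (auto intro!: derivative_eq_intros)
   moreover have "((%t. T t p) has_vector_derivative - T (s - r) (l *\<^sub>C (p - u))) (at (s - r) within (%r. s - r) ` {0..s})"
    by (rule has_vector_derivative_within_subset[OF T_derivative[OF pA]]) (use r in auto)
   ultimately have "((%t. T t p) \<circ> (%r. s - r) has_vector_derivative (- 1) *\<^sub>R - T (s - r) (l *\<^sub>C (p - u))) (at r within {0..s})"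
    by (rule vector_diff_chain_within)
   from bounded_linear.has_vector_derivative[OF clinear_bounded_imp_bounded_linear[OF ph] this]
   show ?thesis by (simp add: comp_def)
  qed
  have dE: "((%r. exp (- (of_real r * l))) has_vector_derivative - l * exp (- (of_real r * l))) (at r within S)" for r S
  proof -
   have "((%z. exp (- (z * l))) has_field_derivative - l * exp (- (of_real r * l))) (at (of_real r))"
    by (auto intro!: derivative_eq_intros)
   from has_vector_derivative_real_field[OF this] show ?thesis by (rule has_vector_derivative_at_within)
  qed
  have dF: "(F has_vector_derivative - (l * exp (- (of_real r * l)) * k r)) (at r within {0..s})"
   if r: "r \<in> {0..s}" for r
   unfolding F_def
  proof (rule has_vector_derivative_eq_rhs[OF has_vector_derivative_mult[OF dE dph[OF r]]])
   have "T (s - r) (l *\<^sub>C (p - u)) = l *\<^sub>C (T (s - r) p - T (s - r) u)"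
    using r by (simp add: clinear_boundedD[OF T_clinear])
   thus "exp (- (of_real r * l)) * ph (T (s - r) (l *\<^sub>C (p - u))) + - l * exp (- (of_real r * l)) * ph (T (s - r) p) =
     - (l * exp (- (of_real r * l)) * k r)"
    using r by (simp add: k_def clinear_boundedD(2)[OF ph] functional_scaleC[OF ph] algebra_simps)
  qed
  have "(LINT r|lborel. indicator {0..s} r *\<^sub>R - (l * exp (- (of_real r * l)) * k r)) = F s - F 0"
   by (rule integral_FTC_Icc[OF s dF])
    (auto intro!: continuous_intros continuous_on_subset[OF kc])
  thus ?thesis
   by (simp add: F_def T_0 p_def l_def functional_scaleC[OF ph])
 qed
 define c where "c r w = \<tau> w * exp w * exp (- (of_real r * exp w))" for r :: real and w
 have cd: "strip_decay t (c r)" if "0 <= r" for r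
  using exp_decay(1)[OF t0(1) t(2) that exp_tau2_decay[OF t0(1) t(2)]]
  by (simp add: c_def[abs_def] \<tau>_def mult_ac)
 obtain D where D: "D >= 0" "!!s' p. abs p <= t ==> norm (exp (Complex s' p) * (tau (exp (Complex s' p)))^2) <= D * exp (- abs s')"
  using strip_decay_bound[OF exp_tau2_decay[OF t0(1) t(2)]] by metis
 have cb: "norm (c r (Complex y p)) <= D * exp (- abs y)" if "abs p <= t" "0 <= r" for r y p
 proof -
  have "norm (c r (Complex y p)) = norm (exp (Complex y p) * (tau (exp (Complex y p)))^2) * norm (exp (- (of_real r * exp (Complex y p))))"
   by (simp add: c_def \<tau>_def norm_mult mult_ac)
  also have "... <= (D * exp (- abs y)) * 1"
   by (rule mult_mono[OF D(2) exp_decay(2)[OF t0(1) t(2) that(2) \<tau>]]) (use that D in auto)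
  finally show ?thesis by simp
 qed
 define F where "F r y = indicator {0..s} r *\<^sub>R (k r * line_diff t (c r) y)" for r y
 have meas: "case_prod F \<in> borel_measurable (lborel \<Otimes>\<^sub>M lborel)"
 proof -
  have ct: "continuous_on UNIV (%q. c (fst q) (Complex (snd q) p))" if "abs p = t" for p
  proof -
   have "continuous_on UNIV (%y. exp (Complex y p) * (tau (exp (Complex y p)))^2)"
    by (rule strip_decay_continuous[OF exp_tau2_decay[OF t0(1) t(2)]]) (use that in simp)
   hence "continuous_on UNIV (%q::real \<times> real. exp (Complex (snd q) p) * (tau (exp (Complex (snd q) p)))^2)"
    by (rule continuous_on_compose2) (auto intro!: continuous_intros)
   moreover have "continuous_on UNIV (%q::real \<times> real. exp (- (of_real (fst q) * exp (Complex (snd q) p))))"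
    by (intro continuous_intros)
   ultimately have "continuous_on UNIV (%q::real \<times> real. exp (Complex (snd q) p) * (tau (exp (Complex (snd q) p)))^2 *
     exp (- (of_real (fst q) * exp (Complex (snd q) p))))" by (rule continuous_on_mult)
   thus ?thesis by (simp add: c_def \<tau>_def mult_ac)
  qed
  have "continuous_on UNIV (%q. k (fst q) * line_diff t (c (fst q)) (snd q))"
   unfolding line_diff_def
   by (intro continuous_on_mult continuous_on_diff ct continuous_on_compose2[OF kc]) (use t0 in \<open>auto intro!: continuous_intros\<close>)
  hence [measurable]: "(%q. k (fst q) * line_diff t (c (fst q)) (snd q)) \<in> borel_measurable borel"
   by (rule borel_measurable_continuous_onI)
  have "(%q. indicator {0..s} (fst q) *\<^sub>R (k (fst q) * line_diff t (c (fst q)) (snd q))) \<in> borel_measurable borel"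
   unfolding borel_prod[symmetric] using \<open>_ \<in> borel_measurable borel\<close>[unfolded borel_prod[symmetric]] by measurable
  thus ?thesis unfolding lborel_prod by (simp add: F_def case_prod_beta')
 qed
 have Fb: "norm (F r y) <= (indicator {0..s} r * (K * (C\<^sub>T * norm u))) * (2 * (D * exp (- abs y)))" for r y
 proof (cases "r \<in> {0..s}")
  case True
  have "norm (line_diff t (c r) y) <= 2 * (D * exp (- abs y))"
   by (rule norm_line_diff[OF _ t0(1)], rule cb) (use True in auto)
  hence "norm (k r * line_diff t (c r) y) <= (K * (C\<^sub>T * norm u)) * (2 * (D * exp (- abs y)))"
   unfolding norm_mult by (rule mult_mono[OF kb]) (use K C\<^sub>T in auto)
  thus ?thesis using True by (simp add: F_def)
 qed (simp add: F_def)
 have ps: "pair_sigma_finite lborel (lborel :: real measure)" by unfold_locales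
 have im1: "integrable lborel (%r. indicator {0..s} r * (K * (C\<^sub>T * norm u)))"
  by (intro integrable_mult_left integrable_real_indicator) (auto simp: emeasure_lborel_Icc_eq)
 have im2: "integrable lborel (%y. 2 * (D * exp (- abs y)))" by (intro integrable_mult_right integrable_exp_neg_abs)
 note fub = fubini_dominated(2)[OF ps meas Fb im1 im2]
 have "(LINT y|lborel. F r y) = 0" for r
 proof (cases "r \<in> {0..s}")
  case True
  have "(LINT y|lborel. line_diff t (c r) y) = - (LINT y|lborel. c r (Complex y t) - c r (Complex y (- t)))"
   unfolding line_diff_def Bochner_Integration.integral_minus[symmetric] by simp
  also have "... = 0" using strip_decay_cauchy[OF cd t0(1), of r] True by simp
  finally show ?thesis using True by (simp add: F_def)
 qed (simp add: F_def)
 hence zero: "(\<integral>y. \<integral>r. F r y \<partial>lborel \<partial>lborel) = 0" using fub by simp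
 have exp_\<tau>: "strip_decay t (%w. \<tau> w * exp (- (of_real s * exp w)))" by (rule exp_decay(1)[OF t0(1) t(2) s \<tau>])
 note L1 = Psi_functional[OF t(1) t0(2) exp_\<tau> ph, of u] and L2 = Psi_functional[OF t(1) t0(2) \<tau> phT, of u]
 have "2 * of_real pi * \<i> * (ph (Psi t (%w. \<tau> w * exp (- (of_real s * exp w))) u) - ph (T s (Psi t \<tau> u))) =
   (LINT y|lborel. line_diff t (%w. (\<tau> w * exp (- (of_real s * exp w))) * ph (Q w u)) y - line_diff t (%w. \<tau> w * ph (T s (Q w u))) y)"
  unfolding Bochner_Integration.integral_diff[OF L1(1) L2(1)] L1(2) L2(2) by (simp add: right_diff_distrib)
 also have "... = (LINT y|lborel. - (LINT r|lborel. F r y))"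
 proof (rule Bochner_Integration.integral_cong[OF refl])
  fix y
  define I where "I w = (LINT r|lborel. indicator {0..s} r *\<^sub>R (exp w * exp (- (of_real r * exp w)) * k r))" for w
  have int: "integrable lborel (%r. indicator {0..s} r *\<^sub>R (exp w * exp (- (of_real r * exp w)) * k r))" for w
   by (rule borel_integrable_compact) (auto intro!: continuous_intros continuous_on_subset[OF kc])
  have pt: "(\<tau> w * exp (- (of_real s * exp w))) * ph (Q w u) - \<tau> w * ph (T s (Q w u)) = - (\<tau> w * I w)" if "w \<in> region" for w
  proof -
   have "exp (- (of_real s * exp w)) * ph (Q w u) - ph (T s (Q w u)) = - I w"
    using duhamel[OF that] by (simp only: I_def functional_scaleC[OF ph])
   hence "\<tau> w * (exp (- (of_real s * exp w)) * ph (Q w u) - ph (T s (Q w u))) = - (\<tau> w * I w)" by simp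
   thus ?thesis by (simp only: right_diff_distrib mult.assoc)
  qed
  have reg: "Complex y (- t) \<in> region" "Complex y t \<in> region" using t t0 \<omega> by (simp_all add: region_def)
  have swap: "a - c - (b - d) = - (p - q)" if "a - b = - p" "c - d = - q" for a b c d p q :: complex
   using that by algebra
  have e: "line_diff t (%w. (\<tau> w * exp (- (of_real s * exp w))) * ph (Q w u)) y - line_diff t (%w. \<tau> w * ph (T s (Q w u))) y =
    - (\<tau> (Complex y (- t)) * I (Complex y (- t)) - \<tau> (Complex y t) * I (Complex y t))"
   unfolding line_diff_def by (rule swap[OF pt[OF reg(1)] pt[OF reg(2)]])
  have "(LINT r|lborel. F r y) = (LINT r|lborel. \<tau> (Complex y (- t)) * (indicator {0..s} r *\<^sub>R (exp (Complex y (- t)) * exp (- (of_real r * exp (Complex y (- t)))) * k r)) -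
    \<tau> (Complex y t) * (indicator {0..s} r *\<^sub>R (exp (Complex y t) * exp (- (of_real r * exp (Complex y t))) * k r)))"
   by (rule Bochner_Integration.integral_cong[OF refl])
    (simp add: F_def line_diff_def c_def scaleR_conv_of_real algebra_simps)
  also have "... = \<tau> (Complex y (- t)) * I (Complex y (- t)) - \<tau> (Complex y t) * I (Complex y t)"
   unfolding I_def by (subst Bochner_Integration.integral_diff)
    (intro integrable_mult_right int, intro integrable_mult_right int, simp only: integral_mult_right_zero)
  finally show "line_diff t (%w. (\<tau> w * exp (- (of_real s * exp w))) * ph (Q w u)) y - line_diff t (%w. \<tau> w * ph (T s (Q w u))) y =
    - (LINT r|lborel. F r y)" using e by simp
 qed
 also have "... = 0" using zero by simp
 finally have "ph (Psi t (%w. \<tau> w * exp (- (of_real s * exp w))) u) = ph (T s (Psi t \<tau> u))" by simp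
 thus "ph (Psi t (%w. (tau (exp w))^2 * exp (- (of_real s * exp w))) u) = ph (T s (N (N u)))"
  unfolding \<tau>_def by (simp only: Psi_tau2[OF t(1) t0(2)])
qed

end

section \<open>The kernel of the regulariser N^2\<close>

context sectorial_resolvent begin

text \<open>P is injective, so N^2 u = 0 puts d = u - P u into the kernel of A; but d = A P u is
  also in the range. Kernel and range meet only in 0: d = e^w (Q_w - 1) P u for every w, and this
  tends to 0 as Re w tends to -infinity at height pi.\<close>

lemma N_N_kernel:
 assumes u: "N (N u) = 0" shows "(u, 0) \<in> A" "w \<in> region ==> Q w u = u"
proof -
 have Pinj: "v = 0" if "P v = 0" for v
  using P_graph[of v] A_unique[of 0 0 v] A_scaleC[OF P_graph[of 0], of 0] that by simp
 have fix_kernel: "Q w k = k" if k: "(k, 0) \<in> A" and w: "w \<in> region" for w k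
  using Q_commute_A(1)[OF w k] by (simp add: Q_simps[OF w]) (metis norm_eq_zero norm_scaleC mult_eq_0_iff exp_not_eq_zero right_minus_eq)
 have P: "P (x - y) = P x - P y" for x y by (rule clinear_boundedD(2)[OF P_clinear])
 define d where "d = u - P u"
 have "P (P (d - P d)) = N (N u)" by (simp add: N_def d_def P)
 hence "d - P d = 0" using u Pinj by metis
 hence dA: "(d, 0) \<in> A" using P_graph[of d] by simp
 have PuA: "(P u, d) \<in> A" unfolding d_def by (rule P_graph)
 have "\<omega> < pi" using \<omega> by simp
 then obtain C where C: "!!w u. pi <= abs (Im w) ==> abs (Im w) <= 2 * pi - pi ==> norm (Q w u) <= C * norm u"
  by (rule Q_bound) blast
 have "norm d <= exp (- real n) * (C * norm (P u) + norm (P u))" for n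
 proof -
  define w where "w = Complex (- real n) pi"
  have w: "w \<in> region" using \<omega> by (simp add: w_def region_def)
  have "norm d = norm (exp w *\<^sub>C (Q w (P u) - P u))"
   by (simp add: Q_commute_A(1)[OF w PuA] fix_kernel[OF dA w])
  also have "... <= exp (- real n) * (norm (Q w (P u)) + norm (P u))"
   unfolding norm_scaleC norm_exp_eq_Re by (simp add: w_def norm_triangle_ineq4)
  also have "... <= exp (- real n) * (C * norm (P u) + norm (P u))" using C[of w "P u"] by (simp add: w_def)
  finally show ?thesis .
 qed
 moreover have "(%n. exp (- real n) * (C * norm (P u) + norm (P u))) \<longlonglongrightarrow> 0 * (C * norm (P u) + norm (P u))"
  by (intro tendsto_mult tendsto_const) real_asymp
 ultimately have "norm d <= 0" using LIMSEQ_le_const by fastforce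
 hence "u = P u" by (simp add: d_def)
 thus "(u, 0) \<in> A" using P_graph[of u] by simp
 thus "w \<in> region ==> Q w u = u" by (rule fix_kernel)
qed

end

section \<open>Comparison of the semigroup definition with the contour integral, before taking the
  closure\<close>

context bernstein_semigroup begin

definition G0 :: "'a graph" where
 "G0 = {(x, \<alpha> *\<^sub>R x + \<beta> *\<^sub>R y + v) |x y v. (x, y) \<in> A \<and> has_bochner \<mu> (%t. x - T t x) v}"

text \<open>The transformed integral exists by \<open>orbit_bochner\<close>, since B x is again in
  the domain; only its value has to be compared, and functionals do that.\<close>

lemma bochner_commute:
 assumes B: "clinear_bounded B" "!!x y. (x, y) \<in> A ==> (B x, B y) \<in> A" "!!s u. 0 <= s ==> B (T s u) = T s (B u)"
  and xy: "(x, y) \<in> A" and v: "has_bochner \<mu> (%t. x - T t x) v"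
 shows "has_bochner \<mu> (%t. B x - T t (B x)) (B v)"
proof -
 obtain u where u: "has_bochner \<mu> (%t. B x - T t (B x)) u" by (rule orbit_bochner[OF B(2)[OF xy]])
 have "u = B v"
 proof (rule functional_eqI)
  fix ph :: "'a => complex" assume ph: "clinear_bounded ph"
  have 1: "has_bochner_integral \<mu> (%s. ph (B x - T s (B x))) (ph u)" by (rule has_bochner_functional[OF u ph])
  have 2: "has_bochner_integral \<mu> (%s. ph (B (x - T s x))) (ph (B v))"
   by (rule has_bochner_functional[OF v clinear_bounded_compose[OF ph B(1)]])
  have "(LINT s|\<mu>. ph (B x - T s (B x))) = (LINT s|\<mu>. ph (B (x - T s x)))"
   by (rule Bochner_Integration.integral_cong[OF refl]) (simp add: space_\<mu> B(3) clinear_boundedD(2)[OF B(1)])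
  thus "ph u = ph (B v)" using 1 2 by (simp add: has_bochner_integral_iff)
 qed
 thus ?thesis using u by simp
qed

lemma Q_commutes:
 assumes "w \<in> region"
 shows "clinear_bounded (Q w)" "!!x y. (x, y) \<in> A ==> (Q w x, Q w y) \<in> A" "!!s u. 0 <= s ==> Q w (T s u) = T s (Q w u)"
 using Q_clinear Q_commute_A(2) T_Q assms by auto

lemma G0_commute:
 assumes B: "clinear_bounded B" "!!x y. (x, y) \<in> A ==> (B x, B y) \<in> A" "!!s u. 0 <= s ==> B (T s u) = T s (B u)"
  and xw: "(x, w) \<in> G0"
 shows "(B x, B w) \<in> G0"
proof -
 obtain y v where y: "(x, y) \<in> A" and v: "has_bochner \<mu> (%t. x - T t x) v" and w: "w = \<alpha> *\<^sub>R x + \<beta> *\<^sub>R y + v"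
  using xw by (auto simp: G0_def)
 have "B w = \<alpha> *\<^sub>R B x + \<beta> *\<^sub>R B y + B v" by (simp add: w clinear_boundedD[OF B(1)])
 thus ?thesis unfolding G0_def using B(2)[OF y] bochner_commute[OF B y v] by blast
qed

text \<open>The relation e^w (Q_w x - x) = Q_w y absorbs the factor e^w; the remaining multiple e^w
  tau^2 of the fixed vector x has vanishing contour integral.\<close>

lemma exp_Psi_tau2:
 assumes t: "\<omega> < t" "t < pi / 2" and xy: "(x, y) \<in> A"
 shows "Psi t (%w. exp w * (tau (exp w))^2) x = N (N y)"
proof (rule functional_eqI)
 fix ph :: "'a => complex" assume ph: "clinear_bounded ph"
 have t0: "0 <= t" "t < pi" using t \<omega> by auto
 define e where "e w = exp w * (tau (exp w))^2" for w
 have ed: "strip_decay t e" unfolding e_def by (rule exp_tau2_decay[OF t0(1) t(2)])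
 note 1 = Psi_functional[OF t(1) t0(2) ed ph, of x]
 note 2 = Psi_functional[OF t(1) t0(2) tau2_decay[OF t0(2)] ph, of y]
 have i: "integrable lborel (%s. e (Complex s p))" if "abs p = t" for p
  by (rule strip_decay_integrable[OF ed]) (use that in simp)
 have pt: "line_diff t (%w. e w * ph (Q w x)) s = line_diff t (%w. (tau (exp w))^2 * ph (Q w y)) s -
   (e (Complex s t) - e (Complex s (- t))) * ph x" for s
 proof -
  have "e w * ph (Q w x) = (tau (exp w))^2 * ph (Q w y) + e w * ph x" if "w \<in> region" for w
   unfolding Q_commute_A(1)[OF that xy, symmetric]
   by (simp add: e_def functional_scaleC[OF ph] clinear_boundedD(2)[OF ph] algebra_simps)
  thus ?thesis using t t0 \<omega> by (simp add: line_diff_def region_def algebra_simps)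
 qed
 have "(LINT s|lborel. line_diff t (%w. e w * ph (Q w x)) s) =
   (LINT s|lborel. line_diff t (%w. (tau (exp w))^2 * ph (Q w y)) s) -
   (LINT s|lborel. (e (Complex s t) - e (Complex s (- t))) * ph x)"
  unfolding pt by (rule Bochner_Integration.integral_diff[OF 2(1)])
   (intro integrable_mult_left Bochner_Integration.integrable_diff i; use t0 in simp)
 also have "(LINT s|lborel. (e (Complex s t) - e (Complex s (- t))) * ph x) = 0"
  using strip_decay_cauchy[OF ed t0(1)] by simp
 finally have "ph (Psi t e x) = ph (Psi t (%w. (tau (exp w))^2) y)" unfolding 1(2) 2(2) by simp
 thus "ph (Psi t (%w. exp w * (tau (exp w))^2) x) = ph (N (N y))"
  unfolding Psi_tau2[OF t(1) t0(2)] e_def .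
qed

text \<open>Fubini between \<mu> and the contour. For fixed s the contour integral gives N^2 (x -
  T(s) x) by \<open>Psi_tau2\<close> and \<open>Psi_semigroup\<close>; for a fixed point of the
  contour the \<mu>-integral gives \<open>levy\<close>. The majorant contains 1 + |e^w|, which tau^2
  absorbs.\<close>

theorem levy_Psi:
 assumes t: "\<omega> < t" "t < pi / 2" and v: "has_bochner \<mu> (%t. x - T t x) v" and ph: "clinear_bounded (ph :: 'a => complex)"
 shows "(LINT y|lborel. line_diff t (%w. (tau (exp w))^2 * levy (exp w) * ph (Q w x)) y) = 2 * of_real pi * \<i> * ph (N (N v))"
proof -
 have t0: "0 <= t" "t < pi" using t \<omega> by auto
 define \<tau> where "\<tau> w = (tau (exp w))^2" for w
 have \<tau>: "strip_decay t \<tau>" unfolding \<tau>_def by (rule tau2_decay) (fact t0)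
 define \<Phi> where "\<Phi> w = ph (Q w x)" for w
 define F where "F s y = line_diff t (%w. \<tau> w * (1 - exp (- (of_real s * exp w))) * \<Phi> w) y" for s :: real and y
 obtain K where K: "K >= 0" "!!x. norm (ph x) <= K * norm x" using clinear_bounded_bound[OF ph] by blast
 obtain C1 where C1: "C1 >= 0" "!!s p. abs p = t ==> norm (\<tau> (Complex s p) *\<^sub>C Q (Complex s p) x) <= C1 * exp (- abs s) * norm x"
  using line_bound[OF t(1) t0(2) \<tau>] by metis
 obtain C2 where C2: "C2 >= 0" "!!s p. abs p = t ==>
   norm ((exp (Complex s p) * \<tau> (Complex s p)) *\<^sub>C Q (Complex s p) x) <= C2 * exp (- abs s) * norm x"
  using line_bound[OF t(1) t0(2) exp_tau2_decay[OF t0(1) t(2)]] unfolding \<tau>_def by metis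
 define D where "D = K * (C1 + C2) * norm x"
 have D: "norm (\<tau> (Complex s p) * \<Phi> (Complex s p)) * (1 + norm (exp (Complex s p))) <= D * exp (- abs s)"
  if p: "abs p = t" for s p
 proof -
  have "norm (\<tau> (Complex s p) * \<Phi> (Complex s p)) = norm (ph (\<tau> (Complex s p) *\<^sub>C Q (Complex s p) x))"
   by (simp add: \<Phi>_def functional_scaleC[OF ph])
  also have "... <= K * (C1 * exp (- abs s) * norm x)" by (rule order_trans[OF K(2) mult_left_mono[OF C1(2)[OF p] K(1)]])
  finally have 1: "norm (\<tau> (Complex s p) * \<Phi> (Complex s p)) <= K * (C1 * exp (- abs s) * norm x)" .
  have "norm (\<tau> (Complex s p) * \<Phi> (Complex s p)) * norm (exp (Complex s p)) = norm (ph ((exp (Complex s p) * \<tau> (Complex s p)) *\<^sub>C Q (Complex s p) x))"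
   by (simp add: \<Phi>_def functional_scaleC[OF ph] norm_mult mult_ac)
  also have "... <= K * (C2 * exp (- abs s) * norm x)" by (rule order_trans[OF K(2) mult_left_mono[OF C2(2)[OF p] K(1)]])
  finally have 2: "norm (\<tau> (Complex s p) * \<Phi> (Complex s p)) * norm (exp (Complex s p)) <= K * (C2 * exp (- abs s) * norm x)" .
  have "K * (C1 * exp (- abs s) * norm x) + K * (C2 * exp (- abs s) * norm x) = D * exp (- abs s)"
   by (simp add: D_def algebra_simps)
  thus ?thesis using 1 2 unfolding distrib_left by linarith
 qed
 have Re: "0 <= Re (exp (Complex y p))" if "abs p = t" for y p
  using Re_exp_Complex_pos[of p y] that t by simp
 have Fb: "norm (F s y) <= (s / (1 + s)) * (2 * (4 * (D * exp (- abs y))))" if "s \<in> space \<mu>" for s y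
 proof -
  have s: "s > 0" using that(1) by (simp add: space_\<mu>)
  have "norm (F s y) <= 2 * ((s / (1 + s)) * (4 * (D * exp (- abs y))))"
   unfolding F_def
  proof (rule norm_line_diff[OF _ t0(1)])
   fix p assume p: "abs p = t"
   let ?w = "Complex y p"
   have "norm (\<tau> ?w * (1 - exp (- (of_real s * exp ?w))) * \<Phi> ?w) = norm (\<tau> ?w * \<Phi> ?w) * norm (1 - exp (- (of_real s * exp ?w)))"
    by (simp add: norm_mult)
   also have "... <= norm (\<tau> ?w * \<Phi> ?w) * (4 * (1 + norm (exp ?w)) * (s / (1 + s)))"
    by (intro mult_left_mono levy_integrand(1) Re p s) simp
   also have "... = (s / (1 + s)) * (4 * (norm (\<tau> ?w * \<Phi> ?w) * (1 + norm (exp ?w))))" by (simp only: mult_ac)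
   also have "... <= (s / (1 + s)) * (4 * (D * exp (- abs y)))"
    by (intro mult_left_mono D[OF p]) (use s in auto)
   finally show "norm (\<tau> ?w * (1 - exp (- (of_real s * exp ?w))) * \<Phi> ?w) <= (s / (1 + s)) * (4 * (D * exp (- abs y)))" .
  qed
  thus ?thesis by (simp only: mult_ac)
 qed
 have meas: "case_prod F \<in> borel_measurable (\<mu> \<Otimes>\<^sub>M lborel)"
 proof -
  have c: "continuous_on UNIV (%q::real \<times> real. h (Complex (snd q) p))" if "continuous_on UNIV (%s. h (Complex s p))" for p and h :: "complex => complex"
   by (rule continuous_on_compose2[OF that]) (auto intro!: continuous_intros)
  have Qc: "continuous_on UNIV (%s. \<Phi> (Complex s p))" if "abs p = t" for p
   unfolding \<Phi>_def using that t t0 \<omega> by (intro clinear_bounded_continuous_on[OF ph] Q_line_continuous) auto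
  have "continuous_on UNIV (%q. F (fst q) (snd q))"
   unfolding F_def line_diff_def
   by (intro continuous_on_mult continuous_on_diff c strip_decay_continuous[OF \<tau>] Qc)
    (use t0 in \<open>auto intro!: continuous_intros\<close>)
  hence "(%q. F (fst q) (snd q)) \<in> borel_measurable (borel \<Otimes>\<^sub>M borel)"
   unfolding borel_prod by (rule borel_measurable_continuous_onI)
  moreover have "(%q. (fst q, snd q)) \<in> measurable (\<mu> \<Otimes>\<^sub>M lborel) (borel \<Otimes>\<^sub>M borel)"
  proof (rule measurable_Pair)
   show "fst \<in> borel_measurable (\<mu> \<Otimes>\<^sub>M lborel)"
    by (rule measurable_compose[OF measurable_fst measurable_\<mu>[OF measurable_ident_sets[OF refl]]])
   show "snd \<in> borel_measurable (\<mu> \<Otimes>\<^sub>M lborel)" using measurable_snd[of \<mu> lborel] by simp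
  qed
  ultimately have "(%q. F (fst (fst q, snd q)) (snd (fst q, snd q))) \<in> borel_measurable (\<mu> \<Otimes>\<^sub>M lborel)"
   by (rule measurable_compose[rotated])
  thus ?thesis by (simp add: case_prod_beta')
 qed
 interpret sigma_finite_measure \<mu> by (rule sigma_finite_\<mu>)
 have ps: "pair_sigma_finite \<mu> (lborel :: real measure)" by unfold_locales
 have im: "integrable lborel (%y. 2 * (4 * (D * exp (- abs y))))" by (intro integrable_mult_right integrable_exp_neg_abs)
 have fub: "(\<integral>y. \<integral>s. F s y \<partial>\<mu> \<partial>lborel) = (\<integral>s. \<integral>y. F s y \<partial>lborel \<partial>\<mu>)"
  by (rule fubini_dominated(2)[OF ps meas Fb integrable_ratio im])
 have inner: "(LINT s|\<mu>. F s y) = line_diff t (%w. \<tau> w * levy (exp w) * \<Phi> w) y" for y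
 proof -
  have i: "integrable \<mu> (%s. \<tau> w * (1 - exp (- (of_real s * exp w))) * \<Phi> w)"
   "(LINT s|\<mu>. \<tau> w * (1 - exp (- (of_real s * exp w))) * \<Phi> w) = \<tau> w * levy (exp w) * \<Phi> w"
   if "w = Complex y p" "abs p = t" for w p
   unfolding levy_def using levy_integrand(3)[OF Re[OF that(2), of y]] that(1)
   by (auto intro!: integrable_mult_left integrable_mult_right)
  have ab: "abs (- t) = t" "abs t = t" using t0 by simp_all
  show ?thesis unfolding F_def line_diff_def
    Bochner_Integration.integral_diff[OF i(1)[OF refl ab(1)] i(1)[OF refl ab(2)]] i(2)[OF refl ab(1)] i(2)[OF refl ab(2)] ..
 qed
 have outer: "(LINT y|lborel. F s y) = 2 * of_real pi * \<i> * ph (N (N (x - T s x)))" if "s \<in> space \<mu>" for s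
 proof -
  have s: "0 <= s" using that by (simp add: space_\<mu>)
  have ed: "strip_decay t (%w. \<tau> w * exp (- (of_real s * exp w)))" by (rule exp_decay(1)[OF t0(1) t(2) s \<tau>])
  note 1 = Psi_functional[OF t(1) t0(2) \<tau> ph, of x] and 2 = Psi_functional[OF t(1) t0(2) ed ph, of x]
  have NT: "N (N (T s x)) = T s (N (N x))"
   by (simp add: N_def P_def T_Q[OF P_region s] clinear_boundedD(2)[OF T_clinear[OF s]])
  have "F s = (%y. line_diff t (%w. \<tau> w * ph (Q w x)) y - line_diff t (%w. (\<tau> w * exp (- (of_real s * exp w))) * ph (Q w x)) y)"
   by (auto simp: F_def line_diff_def \<Phi>_def algebra_simps)
  hence "(LINT y|lborel. F s y) = 2 * of_real pi * \<i> * ph (Psi t \<tau> x) - 2 * of_real pi * \<i> * ph (Psi t (%w. \<tau> w * exp (- (of_real s * exp w))) x)"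
   using Bochner_Integration.integral_diff[OF 1(1) 2(1)] unfolding 1(2) 2(2) by simp
  also have "... = 2 * of_real pi * \<i> * (ph (N (N x)) - ph (T s (N (N x))))"
   unfolding \<tau>_def Psi_tau2[OF t(1) t0(2)] Psi_semigroup[OF t s] by (simp add: right_diff_distrib)
  also have "... = 2 * of_real pi * \<i> * ph (N (N (x - T s x)))"
   by (simp add: clinear_boundedD(2)[OF N_clinear] clinear_boundedD(2)[OF ph] NT)
  finally show ?thesis .
 qed
 have "has_bochner_integral \<mu> (%s. ph (N (N (x - T s x)))) (ph (N (N v)))"
  by (rule has_bochner_functional[OF v]) (rule clinear_bounded_compose[OF ph clinear_bounded_compose[OF N_clinear N_clinear]])
 hence "2 * of_real pi * \<i> * ph (N (N v)) = (LINT s|\<mu>. 2 * of_real pi * \<i> * ph (N (N (x - T s x))))"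
  by (simp add: has_bochner_integral_iff)
 also have "... = (\<integral>s. \<integral>y. F s y \<partial>lborel \<partial>\<mu>)" by (rule Bochner_Integration.integral_cong[OF refl]) (simp only: outer)
 also have "... = (LINT y|lborel. line_diff t (%w. \<tau> w * levy (exp w) * \<Phi> w) y)"
  by (rule trans[OF fub[symmetric]]) (rule Bochner_Integration.integral_cong[OF refl inner])
 finally show ?thesis by (simp add: \<tau>_def \<Phi>_def)
qed

text \<open>The summands of f = \<alpha> + \<beta> l + levy are integrated against tau^2 one at a
  time. Without injectivity of A the factor N^2 can be cancelled only up to the kernel of A.\<close>

theorem G0_Psi:
 assumes t: "\<omega> < t" "t < pi / 2" and xw: "(x, w) \<in> G0"
 shows "N (N w) = Psi t (ftau f) x"
proof (rule functional_eqI)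
 fix ph :: "'a => complex" assume ph: "clinear_bounded ph"
 have t0: "0 <= t" "t < pi" using t \<omega> by auto
 obtain y v where y: "(x, y) \<in> A" and v: "has_bochner \<mu> (%t. x - T t x) v" and w: "w = \<alpha> *\<^sub>R x + \<beta> *\<^sub>R y + v"
  using xw by (auto simp: G0_def)
 note 1 = Psi_functional[OF t(1) t0(2) tau2_decay[OF t0(2)] ph, of x]
 note 2 = Psi_functional[OF t(1) t0(2) exp_tau2_decay[OF t0(1) t(2)] ph, of x]
 note 3 = Psi_functional[OF t(1) t0(2) ftau_decay[OF f t0(1) t(2)] ph, of x]
 define L1 L2 L3 where "L1 = line_diff t (%w. (tau (exp w))^2 * ph (Q w x))"
  and "L2 = line_diff t (%w. exp w * (tau (exp w))^2 * ph (Q w x))"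
  and "L3 = line_diff t (%w. ftau f w * ph (Q w x))"
 have i: "integrable lborel L1" "integrable lborel L2" "integrable lborel L3"
  unfolding L1_def L2_def L3_def by (rule 1(1) 2(1) 3(1))+
 have pt: "line_diff t (%w. (tau (exp w))^2 * levy (exp w) * ph (Q w x)) s = L3 s - (of_real \<alpha> * L1 s + of_real \<beta> * L2 s)" for s
 proof -
  have "f (exp (Complex s p)) = of_real \<alpha> + of_real \<beta> * exp (Complex s p) + levy (exp (Complex s p))" if "abs p = t" for p
   by (rule f_representation) (use Re_exp_Complex_pos[of p s] that t in simp)
  from this[of t] this[of "- t"] show ?thesis
   using t0 by (simp add: L1_def L2_def L3_def line_diff_def ftau_def algebra_simps)
 qed
 have "2 * of_real pi * \<i> * ph (N (N v)) = (LINT s|lborel. L3 s - (of_real \<alpha> * L1 s + of_real \<beta> * L2 s))"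
  unfolding levy_Psi[OF t v ph, symmetric] by (rule Bochner_Integration.integral_cong[OF refl pt])
 also have "... = (LINT s|lborel. L3 s) - (of_real \<alpha> * (LINT s|lborel. L1 s) + of_real \<beta> * (LINT s|lborel. L2 s))"
  using i by simp
 also have "... = 2 * of_real pi * \<i> * (ph (Psi t (ftau f) x) - (of_real \<alpha> * ph (N (N x)) + of_real \<beta> * ph (N (N y))))"
  unfolding L1_def L2_def L3_def 1(2) 2(2) 3(2) Psi_tau2[OF t(1) t0(2)] exp_Psi_tau2[OF t y] by (simp add: algebra_simps)
 finally have "ph (N (N v)) = ph (Psi t (ftau f) x) - (of_real \<alpha> * ph (N (N x)) + of_real \<beta> * ph (N (N y)))" by simp
 thus "ph (N (N w)) = ph (Psi t (ftau f) x)"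
  by (simp add: w scaleR_scaleC clinear_boundedD[OF N_clinear] clinear_boundedD(1)[OF ph] functional_scaleC[OF ph])
qed

end

section \<open>Recovering the part in the kernel of A, and passing to the closure\<close>

context bernstein_semigroup begin

text \<open>Dominated convergence: the orbit of X n deviates by at most a multiple of min(|Y n| s,
  D), which tends to 0 for each s and stays below a multiple of s/(1 + s).\<close>

lemma orbit_limit:
 assumes xv: "!!n. (X n, Y n) \<in> A" and X: "!!n. norm (X n) <= D" and Y: "(%n. norm (Y n)) \<longlonglongrightarrow> 0"
  and v: "!!n. has_bochner \<mu> (%s. X n - T s (X n)) (V n)"
 shows "V \<longlonglongrightarrow> 0"
proof -
 have D0: "0 <= D" using X[of 0] norm_ge_zero order_trans by blast
 have "Bseq (%n. norm (Y n))" by (rule convergent_imp_Bseq[OF convergentI[OF Y]])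
 then obtain E where E: "!!n. norm (Y n) <= E" by (auto simp: Bseq_def)
 hence E0: "0 <= E" using norm_ge_zero order_trans by blast
 define m where "m n s = min (C\<^sub>T * norm (Y n) * s) (2 * C\<^sub>T * D)" for n and s :: real
 define K where "K = 2 * C\<^sub>T * D + C\<^sub>T * E"
 have m_le: "0 <= m n s" "m n s <= 2 * K * (s / (1 + s))" if s: "s > 0" for n s
 proof -
  show m0: "0 <= m n s" using s C\<^sub>T D0 by (simp add: m_def)
  show "m n s <= 2 * K * (s / (1 + s))"
  proof (rule le_ratio[OF s m0])
   have "0 <= C\<^sub>T * E" "0 <= 2 * C\<^sub>T * D" using C\<^sub>T E0 D0 by simp_all
   thus "m n s <= K" unfolding m_def K_def by linarith
   have "C\<^sub>T * norm (Y n) * s <= K * s"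
   proof (rule mult_right_mono)
    have "C\<^sub>T * norm (Y n) <= C\<^sub>T * E" using C\<^sub>T E by (intro mult_left_mono) auto
    thus "C\<^sub>T * norm (Y n) <= K" using \<open>0 <= 2 * C\<^sub>T * D\<close> unfolding K_def by linarith
   qed (use s in simp)
   thus "m n s <= K * s" unfolding m_def by linarith
  qed
 qed
 have mm: "m n \<in> borel_measurable \<mu>" for n unfolding m_def[abs_def] by (rule measurable_\<mu>) measurable
 have le: "norm (V n) <= integral\<^sup>L \<mu> (m n)" for n
 proof (rule has_bochner_norm_bound[OF v])
  show "integrable \<mu> (m n)" by (rule integrable_\<mu>[OF mm, where K = "2 * K"]) (use m_le in auto)
  fix s assume "s \<in> space \<mu>"
  hence s: "s > 0" by (simp add: space_\<mu>)
  have 1: "norm (X n - T s (X n)) <= C\<^sub>T * norm (Y n) * s"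
   using T_Lipschitz[OF xv, of 0 s n] s by (simp add: T_0)
  have "norm (X n - T s (X n)) <= norm (X n) + C\<^sub>T * norm (X n)"
   using norm_triangle_ineq4[of "X n" "T s (X n)"] T_bound[of s "X n"] s by simp
  also have "... <= C\<^sub>T * D + C\<^sub>T * D"
   using C\<^sub>T X[of n] mult_mono[of 1 C\<^sub>T "norm (X n)" D] by (intro add_mono mult_left_mono) auto
  finally have "norm (X n - T s (X n)) <= 2 * C\<^sub>T * D" by (simp add: mult_ac)
  thus "norm (X n - T s (X n)) <= m n s" unfolding m_def by (rule min.boundedI[OF 1])
 qed
 have "(%n. integral\<^sup>L \<mu> (m n)) \<longlonglongrightarrow> (LINT s|\<mu>. 0)"
 proof (rule integral_dominated_convergence)
  show "integrable \<mu> (%s. 2 * K * (s / (1 + s)))" by (intro integrable_mult_right integrable_ratio)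
  show "AE s in \<mu>. norm (m n s) <= 2 * K * (s / (1 + s))" for n
   using m_le by (intro AE_I2) (auto simp: space_\<mu>)
  show "AE s in \<mu>. (%n. m n s) \<longlonglongrightarrow> 0"
  proof (rule AE_I2)
   fix s
   have "(%n. m n s) \<longlonglongrightarrow> min (C\<^sub>T * 0 * s) (2 * C\<^sub>T * D)"
    unfolding m_def by (intro tendsto_min tendsto_mult tendsto_const Y)
   thus "(%n. m n s) \<longlonglongrightarrow> 0" using C\<^sub>T D0 by simp
  qed
 qed (use mm in auto)
 hence "(%n. integral\<^sup>L \<mu> (m n)) \<longlonglongrightarrow> 0" by simp
 thus ?thesis by (rule Lim_null_comparison[rotated]) (rule always_eventually, rule allI, rule le)
qed

lemma Rz_commutes:
 assumes rc: "resolvent_calculus A \<omega> R q b f a \<theta> z"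
 defines "S \<equiv> resolvent_calculus.Rz R q b f a z"
 shows "clinear_bounded S" "!!x y. (x, y) \<in> A ==> (S x, S y) \<in> A" "!!s u. 0 <= s ==> S (T s u) = T s (S u)"
proof -
 interpret rc: resolvent_calculus A \<omega> R q b f a \<theta> z by (rule rc)
 show S: "clinear_bounded S" unfolding S_def by (rule rc.Rz_clinear)
 show "(S x, S y) \<in> A" if xy: "(x, y) \<in> A" for x y
 proof -
  have "P (y + x) = x" by (rule P_left[OF xy])
  hence "S x = P (S y + S x)"
   unfolding S_def using rc.Rz_P[of "y + x"] by (simp add: clinear_boundedD(1)[OF rc.Rz_clinear])
  thus ?thesis using P_graph[of "S y + S x"] by simp
 qed
 show "S (T s u) = T s (S u)" if "0 <= s" for s u
  unfolding S_def by (rule rc.Rz_commute[symmetric, OF T_clinear[OF that] T_Q[OF _ that]])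
qed

text \<open>The defect \<open>v\<close> lies in the kernel of $A$; applying $s(A+s)^{-1}$ and letting $s \<rightarrow> 0$ reduces everything to
 the value of $f$ at the origin.\<close>

theorem G0_resolvent:
 assumes rc: "resolvent_calculus A \<omega> R q b f a \<theta> z" and xw: "(x, w) \<in> G0"
 shows "resolvent_calculus.Rz R q b f a z (w + z *\<^sub>C x) = x"
proof -
 interpret rc: resolvent_calculus A \<omega> R q b f a \<theta> z by (rule rc)
 define S where "S = rc.Rz"
 note Sc = Rz_commutes[OF rc, folded S_def]
 note S = clinear_boundedD[OF Sc(1)]
 obtain t where t: "\<omega> < t" "t < pi / 2" using dense[OF \<omega>(2)] by blast
 have t0: "0 <= t" "t < pi" using t \<omega> by auto
 note Nc = clinear_boundedD[OF N_clinear]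
 \<comment> \<open>After regularisation the desired identity already holds, so the defect v
   satisfies N^2 v = 0; hence it is fixed by every \<open>Q w\<close>.\<close>
 define v where "v = S (w + z *\<^sub>C x) - x"
 have "N (N (S w)) = S (Psi t (ftau f) x)"
  using rc.Rz_N unfolding S_def G0_Psi[OF t xw, symmetric] by simp
 also have "... = N (N x) - z *\<^sub>C N (N (S x))"
  using rc.Rz_Psi[OF t(1) t0(2) ftau_decay[OF f t0(1) t(2)]] rc.Psi_ftau_Rz[OF t] unfolding S_def by simp
 finally have "N (N v) = 0" by (simp add: v_def S Nc)
 hence Qv: "Q w v = v" if "w \<in> region" for w using N_N_kernel(2) that by blast
 obtain y u where y: "(x, y) \<in> A" and u: "has_bochner \<mu> (%t. x - T t x) u" and w: "w = \<alpha> *\<^sub>R x + \<beta> *\<^sub>R y + u"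
  using xw by (auto simp: G0_def)
 \<comment> \<open>\<open>Q (c n)\<close> is s (s + A)^-1 with s = e^-n.\<close>
 define c where "c n = Complex (- real n) pi" for n
 have cr: "c n \<in> region" for n using \<omega> by (simp add: c_def region_def)
 define X Y V where "X n = Q (c n) x" and "Y n = Q (c n) y" and "V n = Q (c n) u" for n
 have "\<omega> < pi" using \<omega> by simp
 then obtain C where C: "C >= 0" "!!w u. pi <= abs (Im w) ==> abs (Im w) <= 2 * pi - pi ==> norm (Q w u) <= C * norm u"
  by (rule Q_bound) blast
 have Qb: "norm (Q (c n) u) <= C * norm u" for n u by (rule C(2)) (simp_all add: c_def)
 have XA: "(X n, Y n) \<in> A" for n unfolding X_def Y_def by (rule Q_commutes(2)[OF cr y])
 have Xb: "norm (X n) <= C * norm x" for n unfolding X_def by (rule Qb)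
 define D where "D = C * norm x + norm x"
 have D0: "0 <= D" using C by (simp add: D_def)
 have Yb: "norm (Y n) <= exp (- real n) * D" for n
 proof -
  have "norm (Y n) = exp (- real n) * norm (X n - x)"
   unfolding Y_def X_def Q_commute_A(1)[OF cr y, symmetric] norm_scaleC norm_exp_eq_Re by (simp add: c_def)
  also have "... <= exp (- real n) * D"
   unfolding D_def using norm_triangle_ineq4[of "X n" x] Xb[of n] by (intro mult_left_mono) auto
  finally show ?thesis .
 qed
 have e0: "(%n. exp (- real n)) \<longlonglongrightarrow> 0" by real_asymp
 have Y0: "Y \<longlonglongrightarrow> 0"
  by (rule tendsto_0_le[OF e0, where K = D]) (use Yb in \<open>simp add: mult.commute\<close>)
 have "V \<longlonglongrightarrow> 0"
  by (rule orbit_limit[OF XA Xb tendsto_norm_zero[OF Y0]])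
   (unfold X_def V_def, rule bochner_commute[OF Q_commutes[OF cr] y u])
 hence "(%n. \<beta> *\<^sub>R Y n + V n) \<longlonglongrightarrow> \<beta> *\<^sub>R 0 + 0" by (intro tendsto_intros Y0)
 hence "(%n. S (\<beta> *\<^sub>R Y n + V n)) \<longlonglongrightarrow> S (\<beta> *\<^sub>R 0 + 0)" by (rule clinear_bounded_tendsto[OF Sc(1)])
 hence lim1: "(%n. S (\<beta> *\<^sub>R Y n + V n)) \<longlonglongrightarrow> 0" by (simp add: S)
 \<comment> \<open>A X n = Y n tends to 0 while X n stays bounded, so for each y the operator
   \<open>psi_op y\<close> acts on X n more and more like the identity; the weight J is
   integrable.\<close>
 have lim2: "(%n. S (X n) - rc.g0 *\<^sub>C X n) \<longlonglongrightarrow> 0"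
 proof -
  obtain K where K: "K >= 0" "!!x v y. (x, v) \<in> A ==> norm (x - rc.psi_op y x) <= K * sqrt (norm x * norm v * exp (- y))"
   using rc.psi_op_defect by metis
  obtain K0 where K0: "K0 >= 0" "!!y u. norm (rc.psi_op y u) <= K0 * norm u" using rc.psi_op_bounded by metis
  define B where "B = (1 + K0) * (C * norm x)"
  have B0: "0 <= B" using K0 C by (simp add: B_def)
  define m where "m n y = min B (K * sqrt ((C * norm x) * (exp (- real n) * D) * exp (- y)))" for n and y :: real
  have m: "norm (X n - rc.psi_op y (X n)) <= m n y" for n y
  proof -
   have "norm (X n - rc.psi_op y (X n)) <= norm (X n) + K0 * norm (X n)"
    using norm_triangle_ineq4[of "X n" "rc.psi_op y (X n)"] K0(2)[of y "X n"] by linarith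
   also have "... = (1 + K0) * norm (X n)" by (simp add: distrib_right)
   also have "... <= B" unfolding B_def using K0 Xb by (intro mult_left_mono) auto
   finally have 1: "norm (X n - rc.psi_op y (X n)) <= B" .
   have "norm (X n - rc.psi_op y (X n)) <= K * sqrt (norm (X n) * norm (Y n) * exp (- y))" by (rule K(2)[OF XA])
   also have "... <= K * sqrt ((C * norm x) * (exp (- real n) * D) * exp (- y))"
    using K(1) C(1) by (intro mult_left_mono real_sqrt_le_mono mult_right_mono mult_mono Xb Yb) auto
   finally show ?thesis using 1 by (simp add: m_def)
  qed
  have m0: "0 <= m n y" "m n y <= B" for n y using order_trans[OF norm_ge_zero m] by (auto simp: m_def)
  have mm: "(%y. norm (rc.J y) * m n y) \<in> borel_measurable lborel" for n
   using borel_measurable_integrable[OF rc.J_int] unfolding m_def by measurable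
  have dom: "norm (norm (rc.J y) * m n y) <= norm (rc.J y) * B" for n y
   using m0[of n y] by (simp add: abs_mult mult_left_mono)
  have iJ: "integrable lborel (%y. norm (rc.J y) * B)" using rc.J_int by simp
  have int: "integrable lborel (%y. norm (rc.J y) * m n y)" for n
   by (rule Bochner_Integration.integrable_bound[OF iJ mm]) (use order_trans[OF dom abs_ge_self] in auto)
  have "(%n. LINT y|lborel. norm (rc.J y) * m n y) \<longlonglongrightarrow> (LINT y|(lborel::real measure). 0)"
  proof (rule integral_dominated_convergence[OF _ mm iJ])
   show "AE y in lborel. (%n. norm (rc.J y) * m n y) \<longlonglongrightarrow> 0"
   proof (rule AE_I2)
    fix y
    have "(%n. norm (rc.J y) * m n y) \<longlonglongrightarrow> norm (rc.J y) * min B (K * sqrt ((C * norm x) * (0 * D) * exp (- y)))"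
     unfolding m_def by (intro tendsto_mult tendsto_const tendsto_min tendsto_real_sqrt e0)
    thus "(%n. norm (rc.J y) * m n y) \<longlonglongrightarrow> 0" using B0 by simp
   qed
   show "AE y in lborel. norm (norm (rc.J y) * m n y) <= norm (rc.J y) * B" for n by (rule AE_I2) (rule dom)
  qed simp
  hence "(%n. q / pi * (LINT y|lborel. norm (rc.J y) * m n y)) \<longlonglongrightarrow> q / pi * 0"
   by (intro tendsto_mult tendsto_const) simp
  hence lim: "(%n. q / pi * (LINT y|lborel. norm (rc.J y) * m n y)) \<longlonglongrightarrow> 0" by simp
  have le: "norm (S (X n) - rc.g0 *\<^sub>C X n) <= q / pi * (LINT y|lborel. norm (rc.J y) * m n y)" for n
   unfolding S_def by (rule rc.Rz_near_g0[OF m int])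
  show ?thesis by (rule Lim_null_comparison[OF _ lim]) (rule always_eventually, rule allI, rule le)
 qed
 have g0: "rc.g0 * (z + of_real \<alpha>) = 1" by (rule rc.g0_eq[OF f_limit])
 \<comment> \<open>\<open>Q (c n)\<close> is applied to the formula for v, which it fixes. The terms
   stemming from \<beta> and from the Levy integral tend to 0, and on X n the operator
   \<open>Rz\<close> may be replaced by g0, whose product with z + \<alpha> is 1.\<close>
 have eq: "v = S (\<beta> *\<^sub>R Y n + V n) + (z + of_real \<alpha>) *\<^sub>C (S (X n) - rc.g0 *\<^sub>C X n)" for n
 proof -
  note Qc = clinear_boundedD[OF Q_clinear[OF cr[of n]]]
  have "v = Q (c n) v" by (rule Qv[OF cr, symmetric])
  also have "... = S (Q (c n) w + z *\<^sub>C X n) - X n"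
   by (simp add: v_def X_def Qc S_def rc.Rz_Q[OF cr, symmetric])
  also have "Q (c n) w = of_real \<alpha> *\<^sub>C X n + (\<beta> *\<^sub>R Y n + V n)"
   by (simp add: w X_def Y_def V_def Qc scaleR_scaleC add.assoc)
  also have "S (of_real \<alpha> *\<^sub>C X n + (\<beta> *\<^sub>R Y n + V n) + z *\<^sub>C X n) - X n =
    S (\<beta> *\<^sub>R Y n + V n) + (z + of_real \<alpha>) *\<^sub>C S (X n) - X n"
   by (simp add: S scaleC_add_left algebra_simps)
  finally have "v = S (\<beta> *\<^sub>R Y n + V n) + (z + of_real \<alpha>) *\<^sub>C S (X n) - X n" .
  moreover have "(z + of_real \<alpha>) *\<^sub>C rc.g0 *\<^sub>C X n = X n" using g0 by (simp add: mult.commute)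
  ultimately show ?thesis by (simp only: scaleC.diff_right add_diff_eq)
 qed
 have "(%n. S (\<beta> *\<^sub>R Y n + V n) + (z + of_real \<alpha>) *\<^sub>C (S (X n) - rc.g0 *\<^sub>C X n)) \<longlonglongrightarrow> 0 + (z + of_real \<alpha>) *\<^sub>C 0"
  by (intro tendsto_add lim1 scaleC.tendsto tendsto_const lim2)
 hence "(%n. v) \<longlonglongrightarrow> 0 + (z + of_real \<alpha>) *\<^sub>C 0" unfolding eq[symmetric] .
 hence "v = 0" by (simp add: LIMSEQ_const_iff)
 thus ?thesis by (simp add: v_def S_def)
qed

lemma G0_exists: "(x, y) \<in> A ==> EX w. (x, w) \<in> G0"
proof -
 assume xy: "(x, y) \<in> A"
 obtain u where "has_bochner \<mu> (%t. x - T t x) u" by (rule orbit_bochner[OF xy])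
 hence "(x, \<alpha> *\<^sub>R x + \<beta> *\<^sub>R y + u) \<in> G0" unfolding G0_def using xy by blast
 thus ?thesis by blast
qed

text \<open>The pairs with Rz (y + z x) = x form a closed set containing \<open>G0\<close>.
  Conversely, for x in the domain of A the pair (Rz x, x - z Rz x) is the image under
  \<open>Rz\<close> of an element of \<open>G0\<close> and hence in \<open>G0\<close>; density and
  continuity reach all vectors.\<close>

theorem closure_G0_resolvent:
 assumes rc: "resolvent_calculus A \<omega> R q b f a \<theta> z" and dense: "closure (Domain A) = UNIV"
 shows "is_resolvent_at (closure G0) z (resolvent_calculus.Rz R q b f a z)"
proof -
 interpret rc: resolvent_calculus A \<omega> R q b f a \<theta> z by (rule rc)
 define S where "S = rc.Rz"
 note Sc = Rz_commutes[OF rc, folded S_def]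
 have Scont: "continuous_on UNIV S" using clinear_bounded_continuous_on[OF Sc(1) continuous_on_id] by simp
 have left: "S (y + z *\<^sub>C x) = x" if "(x, y) \<in> closure G0" for x y
 proof -
  have "continuous_on UNIV (%p::'a \<times> 'a. S (snd p + z *\<^sub>C fst p))"
   by (rule continuous_on_compose2[OF Scont]) (auto intro!: continuous_on_add continuous_on_scaleC continuous_intros)
  hence "closed {p. S (snd p + z *\<^sub>C fst p) = fst p}"
   by (intro closed_Collect_eq continuous_intros)
  moreover have "G0 \<subseteq> {p. S (snd p + z *\<^sub>C fst p) = fst p}"
   using G0_resolvent[OF rc] unfolding S_def by auto
  ultimately have "closure G0 \<subseteq> {p. S (snd p + z *\<^sub>C fst p) = fst p}" by (rule closure_minimal[rotated])
  thus ?thesis using that by auto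
 qed
 have right: "(S u, u - z *\<^sub>C S u) \<in> closure G0" for u
 proof -
  define H where "H u = (S u, u - z *\<^sub>C S u)" for u
  have "continuous_on UNIV H" unfolding H_def
   by (intro continuous_on_Pair continuous_on_diff continuous_on_scaleC continuous_on_const continuous_on_id Scont)
  moreover have "H ` Domain A \<subseteq> closure G0"
  proof
   fix p assume "p \<in> H ` Domain A"
   then obtain x y where p: "p = H x" "(x, y) \<in> A" by blast
   obtain w where w: "(x, w) \<in> G0" using G0_exists[OF p(2)] by blast
   have "S (w + z *\<^sub>C x) = x" unfolding S_def by (rule G0_resolvent[OF rc w])
   hence "S w = x - z *\<^sub>C S x" by (simp add: clinear_boundedD[OF Sc(1)] algebra_simps)
   hence "p = (S x, S w)" by (simp add: p(1) H_def)
   hence "p \<in> G0" using G0_commute[OF Sc w] by simp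
   thus "p \<in> closure G0" using closure_subset by blast
  qed
  ultimately have "H ` closure (Domain A) \<subseteq> closure G0"
   by (intro image_closure_subset) (auto simp: dense)
  thus ?thesis using dense by (auto simp: H_def)
 qed
 show ?thesis unfolding is_resolvent_at_def S_def[symmetric]
 proof (intro conjI allI iffI)
  show "(x, y) \<in> closure G0" if e: "S (y + z *\<^sub>C x) = x" for x y using right[of "y + z *\<^sub>C x"] by (simp add: e)
 qed (fact Sc(1), rule left)
qed

text \<open>If Rz u = 0 then N^2 u = 0, so u is in the kernel of A. There every
  \<open>psi_op y\<close> is the identity, so that \<open>Rz\<close> acts as the nonzero scalar
  g0.\<close>

lemma closure_G0_injective:
 assumes rc: "resolvent_calculus A \<omega> R q b f a \<theta> z" and dense: "closure (Domain A) = UNIV" and u: "(0, u) \<in> closure G0"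
 shows "u = 0"
proof -
 interpret rc: resolvent_calculus A \<omega> R q b f a \<theta> z by (rule rc)
 have Su: "rc.Rz u = 0" using closure_G0_resolvent[OF rc dense] u by (auto simp: is_resolvent_at_def)
 define t where "t = (\<omega> + pi / 2) / 2"
 have t: "\<omega> < t" "t < pi / 2" using \<omega> by (auto simp: t_def)
 have t0: "0 <= t" "t < pi" using t \<omega> by auto
 have "N (N u) = 0"
  using rc.Psi_ftau_Rz[OF t, of u] clinear_boundedD(4)[OF Psi_clinear[OF t(1) t0(2) ftau_decay[OF f t0(1) t(2)]]]
  by (simp add: Su clinear_boundedD(4)[OF N_clinear])
 hence "(u, 0) \<in> A" by (rule N_N_kernel)
 moreover obtain K where "!!x v y. (x, v) \<in> A ==> norm (x - rc.psi_op y x) <= K * sqrt (norm x * norm v * exp (- y))"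
  using rc.psi_op_defect by metis
 ultimately have "norm (u - rc.psi_op y u) <= 0" for y by fastforce
 from rc.Rz_near_g0[OF this] have "norm (rc.Rz u - rc.g0 *\<^sub>C u) <= 0" by simp
 hence "rc.g0 *\<^sub>C u = 0" using Su by simp
 moreover have "rc.g0 ~= 0" using rc.g0_eq[OF f_limit] by auto
 ultimately show ?thesis by (metis mult_eq_0_iff norm_eq_zero norm_scaleC)
qed

end

context sect_operator begin

theorem bernstein_calculus_sectorial:
 assumes f: "f \<in> class_E" and rep: "bernstein_rep (pos_restrict f) \<alpha> \<beta> \<mu>"
  and T: "bounded_C0_semigroup T" "semigroup_generator T = op_uminus A"
 defines "B \<equiv> bernstein_calculus \<alpha> \<beta> \<mu> T A"
 shows "resolvent_calculus A \<omega> R q b f a \<theta> z ==> is_resolvent_at B z (resolvent_calculus.Rz R q b f a z)"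
  and "(0, u) \<in> B ==> u = 0" and "closure (Domain B) = UNIV"
proof -
 have fN: "f \<in> NP_plus" using f by (simp add: class_E_def)
 interpret bs: bernstein_semigroup A \<omega> R T \<mu> f \<alpha> \<beta>
  by unfold_locales (use rep T fN in \<open>auto simp: bernstein_rep_def\<close>)
 have B: "B = closure bs.G0" by (simp add: B_def bernstein_calculus_def bs.G0_def)
 have dense: "closure (Domain A) = UNIV" using A by (simp add: Sect_def)
 show "resolvent_calculus A \<omega> R q b f a \<theta> z ==> is_resolvent_at B z (resolvent_calculus.Rz R q b f a z)"
  unfolding B by (rule bs.closure_G0_resolvent[OF _ dense])
 have "\<omega> < pi" using \<omega> by simp
 then obtain q a where rc: "!!z. z ~= 0 ==> abs (Arg z) <= pi - pi ==> resolvent_calculus A \<omega> R q ((\<omega> + a) / 2) f a (pi - pi) z"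
  using resolvent_calculus_exists[OF f _ order_refl] by metis
 have "Arg 1 = 0" using Arg_of_real[of 1] by simp
 hence "resolvent_calculus A \<omega> R q ((\<omega> + a) / 2) f a (pi - pi) 1" by (intro rc) auto
 thus "(0, u) \<in> B ==> u = 0" unfolding B by (rule bs.closure_G0_injective[OF _ dense])
 have "Domain A \<subseteq> Domain B"
  unfolding B using bs.G0_exists closure_subset[of bs.G0] by blast
 thus "closure (Domain B) = UNIV" using dense closure_mono by blast
qed

end

theorem corollary4p10:
 fixes A fA :: "'a::complex_banach graph" and f :: "complex \<Rightarrow> complex" and \<omega> :: real
 assumes "0 \<le> \<omega>" and "\<omega> < pi / 2"
  and "A \<in> Sect \<omega>"
  and "f \<in> class_E"
  and "closure (Range A) = UNIV \<or> bernstein (pos_restrict f)"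
  and "is_fun_calc \<omega> f A fA"
 shows "fA \<in> Sect \<omega> \<and>
  (\<forall>\<theta> q. 0 < \<theta> \<and> \<theta> < pi - \<omega> \<and> max (pi / (pi - \<theta>)) 2 < q \<and> (\<omega> \<noteq> 0 \<longrightarrow> q < pi / \<omega>) \<longrightarrow>
   (\<forall>\<kappa> \<beta> C z. kappa_bound f (pi / q) \<kappa> \<and> \<beta> = (\<omega> + pi / q) / 2 \<and> sect_bound A \<beta> C \<and>
    z \<in> sector \<theta> \<longrightarrow>
    onorm (scaled_resolvent fA z) \<le>
     1 / sin (pi / q) +
     q * tilde_const A q \<beta> C / (pi * (cos (pi / q))\<^sup>2) *
      (\<kappa> / (cos ((pi / q + \<theta>) / 2))\<^sup>2)) \<and>
   (bernstein (pos_restrict f) \<longrightarrow> kappa_bound f (pi / q) (tan (pi / q))))"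
proof -
 interpret sect_operator A \<omega> by unfold_locales (fact assms)+
 have facts: "(ALL q b a \<theta> z. resolvent_calculus A \<omega> R q b f a \<theta> z --> is_resolvent_at fA z (resolvent_calculus.Rz R q b f a z)) \<and>
   (ALL u. (0, u) \<in> fA --> u = 0) \<and> closure (Domain fA) = UNIV"
  using assms(6) unfolding is_fun_calc_def
 proof (elim disjE conjE bexE exE)
  fix t assume inj: "injective_operator A" and t: "t \<in> {\<omega><..<pi / 2}" and fA: "fA = regularised_calculus t f A"
  have "\<omega> < t" "t < pi / 2" using t by auto
  note reg = regularised_calculus_sectorial[OF assms(4) inj assms(5) this, folded fA]
  show ?thesis by (intro conjI allI impI) (erule reg(1), erule reg(2), rule reg(3))
 next
  fix a b \<mu> T
  assume "bernstein_rep (pos_restrict f) a b \<mu>" "bounded_C0_semigroup T" "semigroup_generator T = op_uminus A"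
   and fA: "fA = bernstein_calculus a b \<mu> T A"
  note ber = bernstein_calculus_sectorial[OF assms(4) this(1-3), folded fA]
  show ?thesis by (intro conjI allI impI) (erule ber(1), erule ber(2), rule ber(3))
 qed
 have res: "is_resolvent_at fA z (resolvent_calculus.Rz R q b f a z)" if "resolvent_calculus A \<omega> R q b f a \<theta> z"
  for q b a \<theta> z using facts that by blast
 have inj: "u = 0" if "(0, u) \<in> fA" for u using facts[THEN conjunct2, THEN conjunct1] that by blast
 note main = sectorialI[OF assms(4) res inj facts[THEN conjunct2, THEN conjunct2]]
 have "kappa_bound f (pi / q) (tan (pi / q))" if "bernstein (pos_restrict f)" "2 < q" for q
 proof -
  have "f \<in> NP_plus" using assms(4) by (simp add: class_E_def)
  then interpret bf: bernstein_function f by (intro bernstein_function.intro that(1))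
  show ?thesis by (rule bf.kappa_bound_tan) (use that(2) in \<open>auto simp: field_simps\<close>)
 qed
 thus ?thesis using main by simp
qed

end
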